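(* Let $X$ be the spectrum of a noetherian (commutative) ring, let $n\in\mathbb{N}\cup\{0\}$, and let $\mathcal{M}$ be a coherent $\mathcal{O}_X$-module of rank $\leq n$. Then, for every $d\in\mathbb{N}\cup\{0\}$, there exists an open subscheme $U\subseteq X$ such that $\mathrm{codim}(X-U,X)>d$ and $\mathcal{M}|_U$ is generated by $d+n$ global sections that can be extended to all of $X$ (i.e., that are restrictions of elements of $\Gamma(X,\mathcal{M})$).
   Context: The rank of $\mathcal{M}$ is the function $x\mapsto\dim_{k(x)}\mathcal{M}(x)$, where $\mathcal{M}(x)=\mathcal{M}_x\otimes_{\mathcal{O}_{X,x}}k(x)$; "rank $\leq n$" means this function is bounded by $n$ at every point. Sections $m_1,\dots,m_t\in\Gamma(U,\mathcal{M})$ generate $\mathcal{M}|_U$ if the map $\mathcal{O}_U^t\to\mathcal{M}|_U$, $(a_i)\mapsto\sum a_im_i$, is surjective. Codimension: if $X$ is irreducible and $Y\subseteq X$ closed irreducible, $\mathrm{codim}(Y,X)$ is the supremum of the $c$ for which there is a chain of closed irreducible subsets $Y=Y_0\subsetneq\dots\subsetneq Y_c\subseteq X$. In general, for $Y$ closed in $X$, $\mathrm{codim}(Y,X)$ is the infimum of $\mathrm{codim}(Y',X')$ with $X'$ ranging over the irreducible components of $X$ and $Y'$ over the irreducible components of $Y\cap X'$; $\mathrm{codim}(\emptyset,X)=\infty$. *)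

theory Defs
  imports
    "HOL-Analysis.Abstract_Topology"
    "HOL-Library.Extended_Nat"
    "HOL-Algebra.Ring_Divisibility"
    "HOL-Algebra.Free_Abelian_Groups"
    "Jordan_Normal_Form.Missing_VectorSpace"
begin

section \<open>Codimension in a topological space\<close>

definition irreducible_space :: "'x topology \<Rightarrow> bool" where
  "irreducible_space T \<longleftrightarrow> topspace T \<noteq> {} \<and>
     (\<forall>A B. closedin T A \<and> closedin T B \<and> A \<union> B = topspace T
        \<longrightarrow> A = topspace T \<or> B = topspace T)"

definition irreducible_subset :: "'x topology \<Rightarrow> 'x set \<Rightarrow> bool" where
  "irreducible_subset T Y \<longleftrightarrow> Y \<subseteq> topspace T \<and> irreducible_space (subtopology T Y)"

definition irreducible_components :: "'x topology \<Rightarrow> 'x set set" where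
  "irreducible_components T =
     {Z. irreducible_subset T Z \<and> (\<forall>Z'. irreducible_subset T Z' \<and> Z \<subseteq> Z' \<longrightarrow> Z' = Z)}"

definition irreducible_codim :: "'x set \<Rightarrow> 'x topology \<Rightarrow> enat" where
  "irreducible_codim Y T =
     Sup {enat c | c. \<exists>C :: nat \<Rightarrow> 'x set. C 0 = Y
        \<and> (\<forall>i\<le>c. closedin T (C i) \<and> irreducible_subset T (C i))
        \<and> (\<forall>i<c. C i \<subset> C (Suc i))}"

text \<open>The infimum of the empty family is \<open>\<infinity>\<close>; in particular the empty set has
  codimension \<open>\<infinity>\<close>.\<close>

definition codim :: "'x set \<Rightarrow> 'x topology \<Rightarrow> enat" where
  "codim Y T =
     (INF X' \<in> irreducible_components T.
        INF Y' \<in> irreducible_components (subtopology T (Y \<inter> X')).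
          irreducible_codim Y' (subtopology T X'))"

lemma codim_empty: "codim {} T = \<infinity>"
proof -
  have "irreducible_components (subtopology T ({} \<inter> X')) = {}" for X'
    by (auto simp: irreducible_components_def irreducible_subset_def irreducible_space_def)
  then show ?thesis
    by (simp add: codim_def flip: top_enat_def)
qed


section \<open>Sheaves of modules on ringed spaces\<close>

text \<open>In both records below the last field takes \<open>U\<close> and \<open>V \<subseteq> U\<close> to the restriction map
  from sections over \<open>U\<close> to sections over \<open>V\<close>. Only the values at open sets matter.\<close>

record ('x, 's) ringed_space_data =
  space_of :: "'x topology"
  sec :: "'x set \<Rightarrow> 's ring"
  res :: "'x set \<Rightarrow> 'x set \<Rightarrow> 's \<Rightarrow> 's"

record ('x, 's, 'm) module_sheaf_data =
  msec :: "'x set \<Rightarrow> ('s, 'm) module"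
  mres :: "'x set \<Rightarrow> 'x set \<Rightarrow> 'm \<Rightarrow> 'm"

locale sheaf_of_sets =
  fixes T :: "'x topology" and F :: "'x set \<Rightarrow> 's set" and r :: "'x set \<Rightarrow> 'x set \<Rightarrow> 's \<Rightarrow> 's"
  assumes res_closed: "\<lbrakk>openin T U; openin T V; V \<subseteq> U; s \<in> F U\<rbrakk> \<Longrightarrow> r U V s \<in> F V"
    and res_id: "\<lbrakk>openin T U; s \<in> F U\<rbrakk> \<Longrightarrow> r U U s = s"
    and res_comp: "\<lbrakk>openin T U; openin T V; openin T W; V \<subseteq> U; W \<subseteq> V; s \<in> F U\<rbrakk>
        \<Longrightarrow> r V W (r U V s) = r U W s"
    and locality: "\<lbrakk>\<And>V. V \<in> \<V> \<Longrightarrow> openin T V; s \<in> F (\<Union>\<V>); t \<in> F (\<Union>\<V>);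
        \<And>V. V \<in> \<V> \<Longrightarrow> r (\<Union>\<V>) V s = r (\<Union>\<V>) V t\<rbrakk> \<Longrightarrow> s = t"
    and gluing: "\<lbrakk>\<And>V. V \<in> \<V> \<Longrightarrow> openin T V; \<And>V. V \<in> \<V> \<Longrightarrow> \<sigma> V \<in> F V;
        \<And>V W. \<lbrakk>V \<in> \<V>; W \<in> \<V>\<rbrakk> \<Longrightarrow> r V (V \<inter> W) (\<sigma> V) = r W (V \<inter> W) (\<sigma> W)\<rbrakk>
        \<Longrightarrow> \<exists>s\<in>F (\<Union>\<V>). \<forall>V\<in>\<V>. r (\<Union>\<V>) V s = \<sigma> V"

locale ringed_space =
  sheaf_of_sets "space_of X" "\<lambda>U. carrier (sec X U)" "res X"
  for X :: "('x, 's) ringed_space_data" +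
  assumes sec_cring: "openin (space_of X) U \<Longrightarrow> cring (sec X U)"
    and res_hom: "\<lbrakk>openin (space_of X) U; openin (space_of X) V; V \<subseteq> U\<rbrakk>
        \<Longrightarrow> res X U V \<in> ring_hom (sec X U) (sec X V)"

locale module_sheaf =
  ringed_space X + M: sheaf_of_sets "space_of X" "\<lambda>U. carrier (msec M U)" "mres M"
  for X :: "('x, 's) ringed_space_data" and M :: "('x, 's, 'm) module_sheaf_data" +
  assumes msec_module: "openin (space_of X) U \<Longrightarrow> module (sec X U) (msec M U)"
    and mres_add: "\<lbrakk>openin (space_of X) U; openin (space_of X) V; V \<subseteq> U;
        s \<in> carrier (msec M U); t \<in> carrier (msec M U)\<rbrakk>
        \<Longrightarrow> mres M U V (s \<oplus>\<^bsub>msec M U\<^esub> t) = mres M U V s \<oplus>\<^bsub>msec M V\<^esub> mres M U V t"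
    and mres_smult: "\<lbrakk>openin (space_of X) U; openin (space_of X) V; V \<subseteq> U;
        a \<in> carrier (sec X U); s \<in> carrier (msec M U)\<rbrakk>
        \<Longrightarrow> mres M U V (a \<odot>\<^bsub>msec M U\<^esub> s) = res X U V a \<odot>\<^bsub>msec M V\<^esub> mres M U V s"


subsection \<open>Generation by sections, finite type and coherence\<close>

text \<open>A map \<open>f\<close> from the sheaf \<open>E\<close> to the sheaf \<open>F\<close> (with restriction maps \<open>r\<close>), both
  considered on the open subspace \<open>U\<close>, is surjective as a map of sheaves if every section of
  \<open>F\<close> locally lifts to \<open>E\<close>. The maps on sections need not be surjective.\<close>

definition surjective_sheaf_map ::
  "'x topology \<Rightarrow> 'x set \<Rightarrow> ('x set \<Rightarrow> 'e set) \<Rightarrow> ('x set \<Rightarrow> 'e \<Rightarrow> 's) \<Rightarrow>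
    ('x set \<Rightarrow> 's set) \<Rightarrow> ('x set \<Rightarrow> 'x set \<Rightarrow> 's \<Rightarrow> 's) \<Rightarrow> bool" where
  "surjective_sheaf_map T U E f F r \<longleftrightarrow>
     (\<forall>V. openin T V \<and> V \<subseteq> U \<longrightarrow> (\<forall>s\<in>F V. \<forall>x\<in>V.
        \<exists>W. openin T W \<and> x \<in> W \<and> W \<subseteq> V \<and> r V W s \<in> f W ` E W))"

definition free_sheaf ::
  "('x, 's) ringed_space_data \<Rightarrow> nat \<Rightarrow> ('x, 's, nat \<Rightarrow> 's) module_sheaf_data" where
  "free_sheaf X t =
     \<lparr>msec = (\<lambda>W. ring.func_space (sec X W) {..<t}),
      mres = (\<lambda>V W a. \<lambda>i\<in>{..<t}. res X V W (a i))\<rparr>"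

definition sections_map ::
  "('x, 's, 'm) module_sheaf_data \<Rightarrow> 'x set \<Rightarrow> nat \<Rightarrow> (nat \<Rightarrow> 'm) \<Rightarrow> 'x set \<Rightarrow> (nat \<Rightarrow> 's) \<Rightarrow> 'm"
  where
  "sections_map M U t m W a = (\<Oplus>\<^bsub>msec M W\<^esub> i\<in>{..<t}. a i \<odot>\<^bsub>msec M W\<^esub> mres M U W (m i))"

definition generates ::
  "('x, 's) ringed_space_data \<Rightarrow> ('x, 's, 'm) module_sheaf_data \<Rightarrow> 'x set \<Rightarrow> nat \<Rightarrow> (nat \<Rightarrow> 'm)
    \<Rightarrow> bool" where
  "generates X M U t m \<longleftrightarrow>
     surjective_sheaf_map (space_of X) U
       (\<lambda>W. carrier (msec (free_sheaf X t) W)) (sections_map M U t m)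
       (\<lambda>W. carrier (msec M W)) (mres M)"

text \<open>The kernel of the map from the free sheaf of rank \<open>t\<close> on \<open>U\<close> given by the sections
  \<open>m i\<close>; it is meaningful only over open subsets of \<open>U\<close>.\<close>

definition relation_sheaf ::
  "('x, 's) ringed_space_data \<Rightarrow> ('x, 's, 'm) module_sheaf_data \<Rightarrow> 'x set \<Rightarrow> nat \<Rightarrow> (nat \<Rightarrow> 'm)
    \<Rightarrow> ('x, 's, nat \<Rightarrow> 's) module_sheaf_data" where
  "relation_sheaf X M U t m =
     \<lparr>msec = (\<lambda>W. (msec (free_sheaf X t) W)
          \<lparr>carrier := {a \<in> carrier (msec (free_sheaf X t) W).
                         sections_map M U t m W a = \<zero>\<^bsub>msec M W\<^esub>}\<rparr>),
      mres = mres (free_sheaf X t)\<rparr>"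

definition finite_type_on ::
  "('x, 's) ringed_space_data \<Rightarrow> ('x, 's, 'm) module_sheaf_data \<Rightarrow> 'x set \<Rightarrow> bool" where
  "finite_type_on X M U \<longleftrightarrow>
     (\<forall>x\<in>U. \<exists>V. openin (space_of X) V \<and> x \<in> V \<and> V \<subseteq> U \<and>
        (\<exists>t m. (\<forall>i<t. m i \<in> carrier (msec M V)) \<and> generates X M V t m))"

text \<open>Coherence in the sense of arbitrary ringed spaces: finite type, and finitely many sections
  over an open set always have a relation sheaf of finite type. On a noetherian scheme the coherent
  modules are the quasi-coherent modules of finite type.\<close>

definition coherent_module ::
  "('x, 's) ringed_space_data \<Rightarrow> ('x, 's, 'm) module_sheaf_data \<Rightarrow> bool" where
  "coherent_module X M \<longleftrightarrow>
     module_sheaf X M \<and> finite_type_on X M (topspace (space_of X)) \<and>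
     (\<forall>U t m. openin (space_of X) U \<and> (\<forall>i<t. m i \<in> carrier (msec M U))
        \<longrightarrow> finite_type_on X (relation_sheaf X M U t m) U)"


subsection \<open>Stalks\<close>

definition germ ::
  "'x topology \<Rightarrow> ('x set \<Rightarrow> 's set) \<Rightarrow> ('x set \<Rightarrow> 'x set \<Rightarrow> 's \<Rightarrow> 's) \<Rightarrow> 'x \<Rightarrow> 'x set \<Rightarrow> 's
    \<Rightarrow> ('x set \<times> 's) set" where
  "germ T F r x U s =
     {(V, t). openin T V \<and> x \<in> V \<and> t \<in> F V \<and>
        (\<exists>W. openin T W \<and> x \<in> W \<and> W \<subseteq> U \<inter> V \<and> r U W s = r V W t)}"

definition germs ::
  "'x topology \<Rightarrow> ('x set \<Rightarrow> 's set) \<Rightarrow> ('x set \<Rightarrow> 'x set \<Rightarrow> 's \<Rightarrow> 's) \<Rightarrow> 'x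
    \<Rightarrow> ('x set \<times> 's) set set" where
  "germs T F r x = {germ T F r x U s | U s. openin T U \<and> x \<in> U \<and> s \<in> F U}"

text \<open>The unions in the operations on germs below range over representatives; all the
  germs that are united are equal. The same applies to cosets and to fractions later.\<close>

definition stalk ::
  "('x, 's) ringed_space_data \<Rightarrow> 'x \<Rightarrow> ('x set \<times> 's) set ring" where
  "stalk X x =
    (let g = germ (space_of X) (\<lambda>U. carrier (sec X U)) (res X) x in
     \<lparr>carrier = germs (space_of X) (\<lambda>U. carrier (sec X U)) (res X) x,
      monoid.mult = (\<lambda>G H. \<Union>(U, s)\<in>G. \<Union>(V, t)\<in>H.
        g (U \<inter> V) (res X U (U \<inter> V) s \<otimes>\<^bsub>sec X (U \<inter> V)\<^esub> res X V (U \<inter> V) t)),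
      one = g (topspace (space_of X)) \<one>\<^bsub>sec X (topspace (space_of X))\<^esub>,
      ring.zero = g (topspace (space_of X)) \<zero>\<^bsub>sec X (topspace (space_of X))\<^esub>,
      add = (\<lambda>G H. \<Union>(U, s)\<in>G. \<Union>(V, t)\<in>H.
        g (U \<inter> V) (res X U (U \<inter> V) s \<oplus>\<^bsub>sec X (U \<inter> V)\<^esub> res X V (U \<inter> V) t))\<rparr>)"

definition mstalk ::
  "('x, 's) ringed_space_data \<Rightarrow> ('x, 's, 'm) module_sheaf_data \<Rightarrow> 'x
    \<Rightarrow> (('x set \<times> 's) set, ('x set \<times> 'm) set) module" where
  "mstalk X M x =
    (let g = germ (space_of X) (\<lambda>U. carrier (msec M U)) (mres M) x in
     \<lparr>carrier = germs (space_of X) (\<lambda>U. carrier (msec M U)) (mres M) x,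
      monoid.mult = undefined,
      one = undefined,
      ring.zero = g (topspace (space_of X)) \<zero>\<^bsub>msec M (topspace (space_of X))\<^esub>,
      add = (\<lambda>G H. \<Union>(U, s)\<in>G. \<Union>(V, t)\<in>H.
        g (U \<inter> V) (mres M U (U \<inter> V) s \<oplus>\<^bsub>msec M (U \<inter> V)\<^esub> mres M V (U \<inter> V) t)),
      smult = (\<lambda>A G. \<Union>(U, a)\<in>A. \<Union>(V, s)\<in>G.
        g (U \<inter> V) (res X U (U \<inter> V) a \<odot>\<^bsub>msec M (U \<inter> V)\<^esub> mres M V (U \<inter> V) s))\<rparr>)"


subsection \<open>Tensor products, fibres and rank\<close>

text \<open>For an \<open>A\<close>-module \<open>M\<close> and a ring homomorphism \<open>\<phi>\<close> from \<open>A\<close> to \<open>B\<close>, the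
  \<open>B\<close>-module obtained by tensoring \<open>M\<close> with \<open>B\<close> over \<open>A\<close>: the free abelian group on the
  pairs \<open>(x, b)\<close> modulo the usual relations, with \<open>B\<close> acting on the second component.\<close>

definition tensor_relations ::
  "('a, 'i) ring_scheme \<Rightarrow> ('a, 'm, 'j) module_scheme \<Rightarrow> ('b, 'k) ring_scheme \<Rightarrow> ('a \<Rightarrow> 'b)
    \<Rightarrow> ('m \<times> 'b \<Rightarrow>\<^sub>0 int) set" where
  "tensor_relations A M B \<phi> =
     {frag_of (x \<oplus>\<^bsub>M\<^esub> y, b) - frag_of (x, b) - frag_of (y, b) | x y b.
        x \<in> carrier M \<and> y \<in> carrier M \<and> b \<in> carrier B}
   \<union> {frag_of (x, b \<oplus>\<^bsub>B\<^esub> c) - frag_of (x, b) - frag_of (x, c) | x b c.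
        x \<in> carrier M \<and> b \<in> carrier B \<and> c \<in> carrier B}
   \<union> {frag_of (a \<odot>\<^bsub>M\<^esub> x, b) - frag_of (x, \<phi> a \<otimes>\<^bsub>B\<^esub> b) | a x b.
        a \<in> carrier A \<and> x \<in> carrier M \<and> b \<in> carrier B}"

definition base_change ::
  "('a, 'i) ring_scheme \<Rightarrow> ('a, 'm, 'j) module_scheme \<Rightarrow> ('b, 'k) ring_scheme \<Rightarrow> ('a \<Rightarrow> 'b)
    \<Rightarrow> ('b, ('m \<times> 'b \<Rightarrow>\<^sub>0 int) set) module" where
  "base_change A M B \<phi> =
    (let F = free_Abelian_group (carrier M \<times> carrier B);
         N = generate F (tensor_relations A M B \<phi>)
     in \<lparr>carrier = carrier (F Mod N),
         monoid.mult = undefined,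
         one = undefined,
         ring.zero = \<one>\<^bsub>F Mod N\<^esub>,
         add = monoid.mult (F Mod N),
         smult = (\<lambda>c C. \<Union>z\<in>C. N #>\<^bsub>F\<^esub> frag_extend (\<lambda>(x, b). frag_of (x, c \<otimes>\<^bsub>B\<^esub> b)) z)\<rparr>)"

definition stalk_max_ideal ::
  "('x, 's) ringed_space_data \<Rightarrow> 'x \<Rightarrow> ('x set \<times> 's) set set" where
  "stalk_max_ideal X x = carrier (stalk X x) - Units (stalk X x)"

definition residue_field ::
  "('x, 's) ringed_space_data \<Rightarrow> 'x \<Rightarrow> ('x set \<times> 's) set set ring" where
  "residue_field X x = stalk X x Quot stalk_max_ideal X x"

definition fibre ::
  "('x, 's) ringed_space_data \<Rightarrow> ('x, 's, 'm) module_sheaf_data \<Rightarrow> 'x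
    \<Rightarrow> (('x set \<times> 's) set set, (('x set \<times> 'm) set \<times> ('x set \<times> 's) set set \<Rightarrow>\<^sub>0 int) set) module"
  where
  "fibre X M x =
     base_change (stalk X x) (mstalk X M x) (residue_field X x)
       (\<lambda>a. stalk_max_ideal X x +>\<^bsub>stalk X x\<^esub> a)"

definition sheaf_rank ::
  "('x, 's) ringed_space_data \<Rightarrow> ('x, 's, 'm) module_sheaf_data \<Rightarrow> 'x \<Rightarrow> enat" where
  "sheaf_rank X M x =
     (if vectorspace.fin_dim (residue_field X x) (fibre X M x)
      then enat (vectorspace.dim (residue_field X x) (fibre X M x)) else \<infinity>)"


section \<open>The spectrum of a commutative ring\<close>

definition zariski :: "('a, 'b) ring_scheme \<Rightarrow> 'a set topology" where
  "zariski R =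
     topology (\<lambda>U. \<exists>S. S \<subseteq> carrier R \<and> U = {p. primeideal p R \<and> \<not> S \<subseteq> p})"

lemma istopology_zariski:
  "istopology (\<lambda>U. \<exists>S. S \<subseteq> carrier R \<and> U = {p. primeideal p R \<and> \<not> S \<subseteq> p})"
  (is "istopology ?P")
proof -
  have "?P (A \<inter> B)" if A: "?P A" and B: "?P B" for A B
  proof -
    obtain S T where S: "S \<subseteq> carrier R" "A = {p. primeideal p R \<and> \<not> S \<subseteq> p}"
      and T: "T \<subseteq> carrier R" "B = {p. primeideal p R \<and> \<not> T \<subseteq> p}"
      using A B by blast
    let ?ST = "{s \<otimes>\<^bsub>R\<^esub> t | s t. s \<in> S \<and> t \<in> T}"
    have "?ST \<subseteq> p \<longleftrightarrow> S \<subseteq> p \<or> T \<subseteq> p" if p: "primeideal p R" for p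
    proof -
      interpret primeideal p R by (fact p)
      show ?thesis
      proof
        assume ST: "?ST \<subseteq> p"
        show "S \<subseteq> p \<or> T \<subseteq> p"
        proof (rule ccontr)
          assume "\<not> (S \<subseteq> p \<or> T \<subseteq> p)"
          then obtain s t where st: "s \<in> S" "s \<notin> p" "t \<in> T" "t \<notin> p" by blast
          then have "s \<otimes>\<^bsub>R\<^esub> t \<in> p" using ST by blast
          then show False using I_prime[of s t] st S(1) T(1) by auto
        qed
      next
        assume "S \<subseteq> p \<or> T \<subseteq> p"
        then show "?ST \<subseteq> p"
        proof
          assume "S \<subseteq> p"
          then show ?thesis using T(1) by (auto intro: I_r_closed)
        next
          assume "T \<subseteq> p"
          then show ?thesis using S(1) by (auto intro: I_l_closed)
        qed
      qed
    qed
    then have "A \<inter> B = {p. primeideal p R \<and> \<not> ?ST \<subseteq> p}"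
      using S T by blast
    moreover have "?ST \<subseteq> carrier R" if "p \<in> A" for p
    proof -
      interpret primeideal p R using that S by blast
      show ?thesis using S(1) T(1) by blast
    qed
    ultimately show ?thesis
    proof (cases "A = {}")
      case True
      have "A \<inter> B = {p. primeideal p R \<and> \<not> {} \<subseteq> p}" using True by simp
      then show ?thesis by (intro exI[of _ "{}"] conjI empty_subsetI)
    next
      case False
      then obtain p where "p \<in> A" by blast
      with \<open>A \<inter> B = {p. primeideal p R \<and> \<not> ?ST \<subseteq> p}\<close> \<open>\<And>p. p \<in> A \<Longrightarrow> ?ST \<subseteq> carrier R\<close>
      show ?thesis by (intro exI[of _ ?ST] conjI)
    qed
  qed
  moreover have "?P (\<Union>\<K>)" if K: "\<forall>U\<in>\<K>. ?P U" for \<K>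
  proof -
    obtain S where S: "\<And>U. U \<in> \<K> \<Longrightarrow> S U \<subseteq> carrier R \<and> U = {p. primeideal p R \<and> \<not> S U \<subseteq> p}"
      using K by metis
    have "\<Union>\<K> = {p. primeideal p R \<and> \<not> \<Union>(S ` \<K>) \<subseteq> p}"
    proof (rule Set.set_eqI)
      fix p
      show "p \<in> \<Union>\<K> \<longleftrightarrow> p \<in> {p. primeideal p R \<and> \<not> \<Union>(S ` \<K>) \<subseteq> p}"
        using S by blast
    qed
    moreover have "\<Union>(S ` \<K>) \<subseteq> carrier R" using S by blast
    ultimately show ?thesis by blast
  qed
  ultimately show ?thesis
    by (simp add: istopology_def)
qed

lemma openin_zariski:
  "openin (zariski R) U \<longleftrightarrow> (\<exists>S. S \<subseteq> carrier R \<and> U = {p. primeideal p R \<and> \<not> S \<subseteq> p})"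
  unfolding zariski_def by (simp add: topology_inverse'[OF istopology_zariski])

lemma topspace_zariski: "topspace (zariski R) = {p. primeideal p R}"
proof
  show "topspace (zariski R) \<subseteq> {p. primeideal p R}"
    by (auto simp: topspace_def openin_zariski)
  have "openin (zariski R) {p. primeideal p R}"
    unfolding openin_zariski
  proof (intro exI[of _ "carrier R"] conjI)
    have "\<not> carrier R \<subseteq> p" if "primeideal p R" for p
    proof -
      interpret primeideal p R by (fact that)
      show ?thesis using a_subset I_notcarr by blast
    qed
    then show "{p. primeideal p R} = {p. primeideal p R \<and> \<not> carrier R \<subseteq> p}"
      by blast
  qed simp
  then show "{p. primeideal p R} \<subseteq> topspace (zariski R)"
    by (rule openin_subset)
qed

definition fraction :: "('a, 'b) ring_scheme \<Rightarrow> 'a set \<Rightarrow> 'a \<Rightarrow> 'a \<Rightarrow> ('a \<times> 'a) set" where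
  "fraction R p a f =
     {(b, g). b \<in> carrier R \<and> g \<in> carrier R - p \<and>
        (\<exists>h \<in> carrier R - p. h \<otimes>\<^bsub>R\<^esub> (g \<otimes>\<^bsub>R\<^esub> a) = h \<otimes>\<^bsub>R\<^esub> (f \<otimes>\<^bsub>R\<^esub> b))}"

definition localization :: "('a, 'b) ring_scheme \<Rightarrow> 'a set \<Rightarrow> ('a \<times> 'a) set ring" where
  "localization R p =
     \<lparr>carrier = {fraction R p a f | a f. a \<in> carrier R \<and> f \<in> carrier R - p},
      monoid.mult = (\<lambda>x y. \<Union>(a, f)\<in>x. \<Union>(b, g)\<in>y. fraction R p (a \<otimes>\<^bsub>R\<^esub> b) (f \<otimes>\<^bsub>R\<^esub> g)),
      one = fraction R p \<one>\<^bsub>R\<^esub> \<one>\<^bsub>R\<^esub>,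
      ring.zero = fraction R p \<zero>\<^bsub>R\<^esub> \<one>\<^bsub>R\<^esub>,
      add = (\<lambda>x y. \<Union>(a, f)\<in>x. \<Union>(b, g)\<in>y.
        fraction R p (g \<otimes>\<^bsub>R\<^esub> a \<oplus>\<^bsub>R\<^esub> f \<otimes>\<^bsub>R\<^esub> b) (f \<otimes>\<^bsub>R\<^esub> g))\<rparr>"

text \<open>Sections of the structure sheaf over \<open>U\<close> are families of elements of the local rings
  at the points of \<open>U\<close> that are locally given by fractions.\<close>

definition structure_sections ::
  "('a, 'b) ring_scheme \<Rightarrow> 'a set set \<Rightarrow> ('a set \<Rightarrow> ('a \<times> 'a) set) ring" where
  "structure_sections R U =
     \<lparr>carrier = {s \<in> (\<Pi>\<^sub>E p\<in>U. carrier (localization R p)).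
        \<forall>p\<in>U. \<exists>V a f. openin (zariski R) V \<and> p \<in> V \<and> V \<subseteq> U \<and> a \<in> carrier R \<and> f \<in> carrier R
          \<and> (\<forall>q\<in>V. f \<notin> q \<and> s q = fraction R q a f)},
      monoid.mult = (\<lambda>s t. \<lambda>p\<in>U. s p \<otimes>\<^bsub>localization R p\<^esub> t p),
      one = (\<lambda>p\<in>U. \<one>\<^bsub>localization R p\<^esub>),
      ring.zero = (\<lambda>p\<in>U. \<zero>\<^bsub>localization R p\<^esub>),
      add = (\<lambda>s t. \<lambda>p\<in>U. s p \<oplus>\<^bsub>localization R p\<^esub> t p)\<rparr>"

definition Spec ::
  "('a, 'b) ring_scheme \<Rightarrow> ('a set, 'a set \<Rightarrow> ('a \<times> 'a) set) ringed_space_data" where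
  "Spec R =
     \<lparr>space_of = zariski R, sec = structure_sections R, res = (\<lambda>U V s. restrict s V)\<rparr>"


subsection \<open>The structure sheaf is a sheaf of commutative rings\<close>

context primeideal
begin

lemma compl_closed: "f \<in> carrier R - I \<Longrightarrow> g \<in> carrier R - I \<Longrightarrow> f \<otimes> g \<in> carrier R - I"
  using I_prime by blast

lemma one_compl: "\<one> \<in> carrier R - I"
  using I_notcarr one_imp_carrier by blast

lemma fraction_eqI:
  assumes "a \<in> carrier R" "f \<in> carrier R - I" "b \<in> carrier R" "g \<in> carrier R - I"
    and h: "h \<in> carrier R - I" "h \<otimes> (g \<otimes> a) = h \<otimes> (f \<otimes> b)"
  shows "fraction R I a f = fraction R I b g"
proof -
  have *: "fraction R I b g \<subseteq> fraction R I a f"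
    if c: "a \<in> carrier R" "f \<in> carrier R - I" "b \<in> carrier R" "g \<in> carrier R - I"
      "h \<in> carrier R - I" and h: "h \<otimes> (g \<otimes> a) = h \<otimes> (f \<otimes> b)" for a f b g h
  proof
    fix z assume "z \<in> fraction R I b g"
    then obtain d e k where z: "z = (d, e)" "d \<in> carrier R" "e \<in> carrier R - I" "k \<in> carrier R - I"
      and k: "k \<otimes> (e \<otimes> b) = k \<otimes> (g \<otimes> d)"
      by (auto simp: fraction_def)
    have cc: "a \<in> carrier R" "f \<in> carrier R" "b \<in> carrier R" "g \<in> carrier R" "h \<in> carrier R"
      "d \<in> carrier R" "e \<in> carrier R" "k \<in> carrier R"
      using c z by auto
    have "(h \<otimes> k \<otimes> g) \<otimes> (e \<otimes> a) = k \<otimes> e \<otimes> (h \<otimes> (g \<otimes> a))"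
      using cc by algebra
    also have "\<dots> = h \<otimes> f \<otimes> (k \<otimes> (e \<otimes> b))" unfolding h using cc by algebra
    also have "\<dots> = (h \<otimes> k \<otimes> g) \<otimes> (f \<otimes> d)" unfolding k using cc by algebra
    finally show "z \<in> fraction R I a f"
      using z c compl_closed by (auto simp: fraction_def)
  qed
  show ?thesis
    using *[OF assms] *[OF assms(3,4,1,2) h(1) h(2)[symmetric]] by blast
qed

lemma fraction_refl: "a \<in> carrier R \<Longrightarrow> f \<in> carrier R - I \<Longrightarrow> (a, f) \<in> fraction R I a f"
  unfolding fraction_def using one_compl by (auto intro!: bexI[of _ \<one>] simp: m_comm)

lemma fraction_memD:
  assumes "(b, g) \<in> fraction R I a f"
  shows "b \<in> carrier R" "g \<in> carrier R - I"
    "\<exists>h\<in>carrier R - I. h \<otimes> (g \<otimes> a) = h \<otimes> (f \<otimes> b)"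
  using assms by (auto simp: fraction_def)

lemma localization_mult:
  assumes "a \<in> carrier R" "f \<in> carrier R - I" "b \<in> carrier R" "g \<in> carrier R - I"
  shows "fraction R I a f \<otimes>\<^bsub>localization R I\<^esub> fraction R I b g = fraction R I (a \<otimes> b) (f \<otimes> g)"
proof -
  have "fraction R I (a' \<otimes> b') (f' \<otimes> g') = fraction R I (a \<otimes> b) (f \<otimes> g)"
    if m: "(a', f') \<in> fraction R I a f" "(b', g') \<in> fraction R I b g" for a' f' b' g'
  proof -
    obtain h k where h: "h \<in> carrier R - I" "h \<otimes> (f' \<otimes> a) = h \<otimes> (f \<otimes> a')"
      and k: "k \<in> carrier R - I" "k \<otimes> (g' \<otimes> b) = k \<otimes> (g \<otimes> b')"
      using fraction_memD(3)[OF m(1)] fraction_memD(3)[OF m(2)] by blast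
    note m1 = fraction_memD(1,2)[OF m(1)] fraction_memD(1,2)[OF m(2)]
    have cc: "a \<in> carrier R" "f \<in> carrier R" "b \<in> carrier R" "g \<in> carrier R"
      "a' \<in> carrier R" "f' \<in> carrier R" "b' \<in> carrier R" "g' \<in> carrier R"
      "h \<in> carrier R" "k \<in> carrier R"
      using assms m1 h k by auto
    have "(h \<otimes> k) \<otimes> ((f \<otimes> g) \<otimes> (a' \<otimes> b')) = (h \<otimes> (f \<otimes> a')) \<otimes> (k \<otimes> (g \<otimes> b'))"
      using cc by algebra
    also have "\<dots> = (h \<otimes> k) \<otimes> ((f' \<otimes> g') \<otimes> (a \<otimes> b))"
      unfolding h(2)[symmetric] k(2)[symmetric] using cc by algebra
    finally show ?thesis
      by (intro fraction_eqI[where h = "h \<otimes> k"] compl_closed m_closed h k m1 assms)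
  qed
  then have "(\<Union>(a', f')\<in>fraction R I a f. \<Union>(b', g')\<in>fraction R I b g. fraction R I (a' \<otimes> b') (f' \<otimes> g'))
      = fraction R I (a \<otimes> b) (f \<otimes> g)"
    using fraction_refl[OF assms(1,2)] fraction_refl[OF assms(3,4)] by fast
  then show ?thesis by (simp add: localization_def)
qed

lemma localization_add:
  assumes "a \<in> carrier R" "f \<in> carrier R - I" "b \<in> carrier R" "g \<in> carrier R - I"
  shows "fraction R I a f \<oplus>\<^bsub>localization R I\<^esub> fraction R I b g
    = fraction R I (g \<otimes> a \<oplus> f \<otimes> b) (f \<otimes> g)"
proof -
  have "fraction R I (g' \<otimes> a' \<oplus> f' \<otimes> b') (f' \<otimes> g') = fraction R I (g \<otimes> a \<oplus> f \<otimes> b) (f \<otimes> g)"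
    if m: "(a', f') \<in> fraction R I a f" "(b', g') \<in> fraction R I b g" for a' f' b' g'
  proof -
    obtain h k where h: "h \<in> carrier R - I" "h \<otimes> (f' \<otimes> a) = h \<otimes> (f \<otimes> a')"
      and k: "k \<in> carrier R - I" "k \<otimes> (g' \<otimes> b) = k \<otimes> (g \<otimes> b')"
      using fraction_memD(3)[OF m(1)] fraction_memD(3)[OF m(2)] by blast
    note m1 = fraction_memD(1,2)[OF m(1)] fraction_memD(1,2)[OF m(2)]
    have cc: "a \<in> carrier R" "f \<in> carrier R" "b \<in> carrier R" "g \<in> carrier R"
      "a' \<in> carrier R" "f' \<in> carrier R" "b' \<in> carrier R" "g' \<in> carrier R"
      "h \<in> carrier R" "k \<in> carrier R"
      using assms m1 h k by auto
    have "(h \<otimes> k) \<otimes> ((f \<otimes> g) \<otimes> (g' \<otimes> a' \<oplus> f' \<otimes> b'))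
        = k \<otimes> g \<otimes> g' \<otimes> (h \<otimes> (f \<otimes> a')) \<oplus> h \<otimes> f \<otimes> f' \<otimes> (k \<otimes> (g \<otimes> b'))"
      using cc by algebra
    also have "\<dots> = (h \<otimes> k) \<otimes> ((f' \<otimes> g') \<otimes> (g \<otimes> a \<oplus> f \<otimes> b))"
      unfolding h(2)[symmetric] k(2)[symmetric] using cc by algebra
    finally show ?thesis
      by (intro fraction_eqI[where h = "h \<otimes> k"] compl_closed m_closed a_closed h k m1 assms cc)
  qed
  then have "(\<Union>(a', f')\<in>fraction R I a f. \<Union>(b', g')\<in>fraction R I b g.
        fraction R I (g' \<otimes> a' \<oplus> f' \<otimes> b') (f' \<otimes> g')) = fraction R I (g \<otimes> a \<oplus> f \<otimes> b) (f \<otimes> g)"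
    using fraction_refl[OF assms(1,2)] fraction_refl[OF assms(3,4)] by fast
  then show ?thesis by (simp add: localization_def)
qed

lemma localization_carrierE:
  assumes "x \<in> carrier (localization R I)"
  obtains a f where "a \<in> carrier R" "f \<in> carrier R" "f \<in> carrier R - I" "x = fraction R I a f"
  using assms by (auto simp: localization_def)

lemma fraction_in: "a \<in> carrier R \<Longrightarrow> f \<in> carrier R - I \<Longrightarrow> fraction R I a f \<in> carrier (localization R I)"
  by (auto simp: localization_def)

lemma fraction_eqI':
  assumes "a \<in> carrier R" "f \<in> carrier R - I" "b \<in> carrier R" "g \<in> carrier R - I"
    and "g \<otimes> a = f \<otimes> b"
  shows "fraction R I a f = fraction R I b g"
  using fraction_eqI[OF assms(1-4) one_compl] assms by simp

lemma localization_one: "\<one>\<^bsub>localization R I\<^esub> = fraction R I \<one> \<one>"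
  and localization_zero: "\<zero>\<^bsub>localization R I\<^esub> = fraction R I \<zero> \<one>"
  by (simp_all add: localization_def)

lemmas loc_simps = localization_mult localization_add localization_one localization_zero
  fraction_in one_compl compl_closed

lemma localization_cring: "cring (localization R I)"
proof (rule cringI)
  show "abelian_group (localization R I)"
  proof (rule abelian_groupI)
    fix x y assume "x \<in> carrier (localization R I)" "y \<in> carrier (localization R I)"
    then obtain a f b g where 1: "a \<in> carrier R" "f \<in> carrier R" "f \<in> carrier R - I"
      "x = fraction R I a f" "b \<in> carrier R" "g \<in> carrier R" "g \<in> carrier R - I" "y = fraction R I b g"
      by (meson localization_carrierE)
    note c = 1(1,3,5,7)
    show "x \<oplus>\<^bsub>localization R I\<^esub> y \<in> carrier (localization R I)"
      unfolding 1 localization_add[OF c]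
      by (intro fraction_in a_closed m_closed compl_closed) (use 1 in auto)
    show "x \<oplus>\<^bsub>localization R I\<^esub> y = y \<oplus>\<^bsub>localization R I\<^esub> x"
      unfolding 1 localization_add[OF c] localization_add[OF c(3,4,1,2)]
      using 1 by (simp add: m_comm a_comm)
    fix z assume "z \<in> carrier (localization R I)"
    then obtain d e where 2: "d \<in> carrier R" "e \<in> carrier R" "e \<in> carrier R - I"
      "z = fraction R I d e" by (meson localization_carrierE)
    have cc: "a \<in> carrier R" "f \<in> carrier R" "b \<in> carrier R" "g \<in> carrier R"
      "d \<in> carrier R" "e \<in> carrier R" using 1 2 by auto
    have "x \<oplus>\<^bsub>localization R I\<^esub> y \<oplus>\<^bsub>localization R I\<^esub> z
        = fraction R I (e \<otimes> (g \<otimes> a \<oplus> f \<otimes> b) \<oplus> (f \<otimes> g) \<otimes> d) (f \<otimes> g \<otimes> e)"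
      unfolding 1 2 localization_add[OF c]
      by (rule localization_add) (intro a_closed m_closed compl_closed 1 2)+
    also have "e \<otimes> (g \<otimes> a \<oplus> f \<otimes> b) \<oplus> (f \<otimes> g) \<otimes> d = (g \<otimes> e) \<otimes> a \<oplus> f \<otimes> (e \<otimes> b \<oplus> g \<otimes> d)"
      using cc by algebra
    also have "f \<otimes> g \<otimes> e = f \<otimes> (g \<otimes> e)" using cc by algebra
    also have "fraction R I ((g \<otimes> e) \<otimes> a \<oplus> f \<otimes> (e \<otimes> b \<oplus> g \<otimes> d)) (f \<otimes> (g \<otimes> e))
        = x \<oplus>\<^bsub>localization R I\<^esub> (y \<oplus>\<^bsub>localization R I\<^esub> z)"
      unfolding 1 2 localization_add[OF c(3,4) 2(1,3)]
      by (rule localization_add[symmetric]) (intro a_closed m_closed compl_closed 1 2)+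
    finally show "x \<oplus>\<^bsub>localization R I\<^esub> y \<oplus>\<^bsub>localization R I\<^esub> z
        = x \<oplus>\<^bsub>localization R I\<^esub> (y \<oplus>\<^bsub>localization R I\<^esub> z)" .
  next
    show "\<zero>\<^bsub>localization R I\<^esub> \<in> carrier (localization R I)"
      unfolding localization_zero by (intro fraction_in zero_closed one_compl)
    fix x assume "x \<in> carrier (localization R I)"
    then obtain a f where 1: "a \<in> carrier R" "f \<in> carrier R" "f \<in> carrier R - I" "x = fraction R I a f"
      by (meson localization_carrierE)
    show "\<zero>\<^bsub>localization R I\<^esub> \<oplus>\<^bsub>localization R I\<^esub> x = x"
      using 1(1,2) unfolding localization_zero 1(4) localization_add[OF zero_closed one_compl 1(1,3)]
      by simp
    have "fraction R I (\<ominus> a) f \<oplus>\<^bsub>localization R I\<^esub> x = fraction R I (f \<otimes> (\<ominus> a) \<oplus> f \<otimes> a) (f \<otimes> f)"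
      unfolding 1(4) by (rule localization_add) (use 1 in auto)
    also have "\<dots> = \<zero>\<^bsub>localization R I\<^esub>"
      unfolding localization_zero
    proof (rule fraction_eqI')
      show "\<one> \<otimes> (f \<otimes> (\<ominus> a) \<oplus> f \<otimes> a) = f \<otimes> f \<otimes> \<zero>" using 1(1,2) by algebra
    qed (use 1 compl_closed one_compl in auto)
    finally show "\<exists>y\<in>carrier (localization R I). y \<oplus>\<^bsub>localization R I\<^esub> x = \<zero>\<^bsub>localization R I\<^esub>"
      using fraction_in[of "\<ominus> a" f] 1 by blast
  qed
  show "comm_monoid (localization R I)"
  proof (rule comm_monoidI)
    fix x y assume "x \<in> carrier (localization R I)" "y \<in> carrier (localization R I)"
    then obtain a f b g where 1: "a \<in> carrier R" "f \<in> carrier R" "f \<in> carrier R - I"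
      "x = fraction R I a f" "b \<in> carrier R" "g \<in> carrier R" "g \<in> carrier R - I" "y = fraction R I b g"
      by (meson localization_carrierE)
    note c = 1(1,3,5,7)
    show "x \<otimes>\<^bsub>localization R I\<^esub> y \<in> carrier (localization R I)"
      unfolding 1 localization_mult[OF c]
      by (intro fraction_in m_closed compl_closed) (use 1 in auto)
    show "x \<otimes>\<^bsub>localization R I\<^esub> y = y \<otimes>\<^bsub>localization R I\<^esub> x"
      unfolding 1 localization_mult[OF c] localization_mult[OF c(3,4,1,2)]
      using 1 by (simp add: m_comm)
    fix z assume "z \<in> carrier (localization R I)"
    then obtain d e where 2: "d \<in> carrier R" "e \<in> carrier R" "e \<in> carrier R - I"
      "z = fraction R I d e" by (meson localization_carrierE)
    have "x \<otimes>\<^bsub>localization R I\<^esub> y \<otimes>\<^bsub>localization R I\<^esub> z = fraction R I (a \<otimes> b \<otimes> d) (f \<otimes> g \<otimes> e)"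
      unfolding 1 2 localization_mult[OF c]
      by (rule localization_mult) (intro m_closed compl_closed 1 2)+
    also have "\<dots> = fraction R I (a \<otimes> (b \<otimes> d)) (f \<otimes> (g \<otimes> e))"
      using 1 2 by (simp add: m_assoc)
    also have "\<dots> = x \<otimes>\<^bsub>localization R I\<^esub> (y \<otimes>\<^bsub>localization R I\<^esub> z)"
      unfolding 1 2 localization_mult[OF c(3,4) 2(1,3)]
      by (rule localization_mult[symmetric]) (intro m_closed compl_closed 1 2)+
    finally show "x \<otimes>\<^bsub>localization R I\<^esub> y \<otimes>\<^bsub>localization R I\<^esub> z
        = x \<otimes>\<^bsub>localization R I\<^esub> (y \<otimes>\<^bsub>localization R I\<^esub> z)" .
  next
    show "\<one>\<^bsub>localization R I\<^esub> \<in> carrier (localization R I)"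
      unfolding localization_one by (intro fraction_in one_closed one_compl)
    fix x assume "x \<in> carrier (localization R I)"
    then obtain a f where 1: "a \<in> carrier R" "f \<in> carrier R" "f \<in> carrier R - I" "x = fraction R I a f"
      by (meson localization_carrierE)
    show "\<one>\<^bsub>localization R I\<^esub> \<otimes>\<^bsub>localization R I\<^esub> x = x"
      using 1(1,2) unfolding localization_one 1(4) localization_mult[OF one_closed one_compl 1(1,3)]
      by simp
  qed
  fix x y z assume "x \<in> carrier (localization R I)" "y \<in> carrier (localization R I)"
    "z \<in> carrier (localization R I)"
  then obtain a f b g d e where 1: "a \<in> carrier R" "f \<in> carrier R" "f \<in> carrier R - I"
      "x = fraction R I a f" "b \<in> carrier R" "g \<in> carrier R" "g \<in> carrier R - I" "y = fraction R I b g"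
      "d \<in> carrier R" "e \<in> carrier R" "e \<in> carrier R - I" "z = fraction R I d e"
    by (meson localization_carrierE)
  have l: "(x \<oplus>\<^bsub>localization R I\<^esub> y) \<otimes>\<^bsub>localization R I\<^esub> z
      = fraction R I ((g \<otimes> a \<oplus> f \<otimes> b) \<otimes> d) (f \<otimes> g \<otimes> e)"
    unfolding 1(4,8,12) localization_add[OF 1(1,3,5,7)]
    by (rule localization_mult) (intro a_closed m_closed compl_closed 1)+
  have r: "x \<otimes>\<^bsub>localization R I\<^esub> z \<oplus>\<^bsub>localization R I\<^esub> y \<otimes>\<^bsub>localization R I\<^esub> z
      = fraction R I ((g \<otimes> e) \<otimes> (a \<otimes> d) \<oplus> (f \<otimes> e) \<otimes> (b \<otimes> d)) ((f \<otimes> e) \<otimes> (g \<otimes> e))"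
    unfolding 1(4,8,12) localization_mult[OF 1(1,3,9,11)] localization_mult[OF 1(5,7,9,11)]
    by (rule localization_add) (intro a_closed m_closed compl_closed 1)+
  show "(x \<oplus>\<^bsub>localization R I\<^esub> y) \<otimes>\<^bsub>localization R I\<^esub> z
      = x \<otimes>\<^bsub>localization R I\<^esub> z \<oplus>\<^bsub>localization R I\<^esub> y \<otimes>\<^bsub>localization R I\<^esub> z"
    unfolding l r
  proof (rule fraction_eqI')
    show "((f \<otimes> e) \<otimes> (g \<otimes> e)) \<otimes> ((g \<otimes> a \<oplus> f \<otimes> b) \<otimes> d)
        = (f \<otimes> g \<otimes> e) \<otimes> ((g \<otimes> e) \<otimes> (a \<otimes> d) \<oplus> (f \<otimes> e) \<otimes> (b \<otimes> d))"
      using 1(1,2,5,6,9,10) by algebra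
  qed (intro a_closed m_closed compl_closed 1)+
qed

lemma localization_minus:
  assumes "a \<in> carrier R" "f \<in> carrier R - I"
  shows "\<ominus>\<^bsub>localization R I\<^esub> fraction R I a f = fraction R I (\<ominus> a) f"
proof -
  interpret L: cring "localization R I" by (rule localization_cring)
  have "fraction R I (\<ominus> a) f \<oplus>\<^bsub>localization R I\<^esub> fraction R I a f
      = fraction R I (f \<otimes> (\<ominus> a) \<oplus> f \<otimes> a) (f \<otimes> f)"
    by (rule localization_add) (use assms in auto)
  also have "\<dots> = \<zero>\<^bsub>localization R I\<^esub>"
    unfolding localization_zero
  proof (rule fraction_eqI')
    have "a \<in> carrier R" "f \<in> carrier R" using assms by auto
    then show "\<one> \<otimes> (f \<otimes> (\<ominus> a) \<oplus> f \<otimes> a) = f \<otimes> f \<otimes> \<zero>" by algebra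
  qed (use assms compl_closed one_compl in auto)
  finally show ?thesis
    using assms L.minus_equality fraction_in a_inv_closed by metis
qed

end

context
  fixes R :: "('a, 'b) ring_scheme"
  assumes R: "cring R"
begin

interpretation cring R by (rule R)

lemma pointP: "openin (zariski R) U \<Longrightarrow> p \<in> U \<Longrightarrow> primeideal p R"
  using openin_subset topspace_zariski by blast

abbreviation "locfrac U s p \<equiv> (\<exists>V a f. openin (zariski R) V \<and> p \<in> V \<and> V \<subseteq> U \<and>
  a \<in> carrier R \<and> f \<in> carrier R \<and> (\<forall>q\<in>V. f \<notin> q \<and> s q = fraction R q a f))"

lemma sections_carrier:
  "s \<in> carrier (structure_sections R U) \<longleftrightarrow>
     s \<in> (\<Pi>\<^sub>E p\<in>U. carrier (localization R p)) \<and> (\<forall>p\<in>U. locfrac U s p)"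
  by (simp add: structure_sections_def)

lemma sections_const:
  assumes "openin (zariski R) U" "a \<in> carrier R"
  shows "(\<lambda>p\<in>U. fraction R p a \<one>\<^bsub>R\<^esub>) \<in> carrier (structure_sections R U)"
  unfolding sections_carrier
proof (intro conjI ballI)
  show "(\<lambda>p\<in>U. fraction R p a \<one>\<^bsub>R\<^esub>) \<in> (\<Pi>\<^sub>E p\<in>U. carrier (localization R p))"
    using pointP[OF assms(1)] assms(2) by (auto intro!: primeideal.fraction_in primeideal.one_compl)
  fix p assume p: "p \<in> U"
  have "\<forall>q\<in>U. \<one>\<^bsub>R\<^esub> \<notin> q \<and> (\<lambda>p\<in>U. fraction R p a \<one>\<^bsub>R\<^esub>) q = fraction R q a \<one>\<^bsub>R\<^esub>"
    using pointP[OF assms(1)] primeideal.one_compl by fastforce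
  then show "locfrac U (\<lambda>p\<in>U. fraction R p a \<one>\<^bsub>R\<^esub>) p"
    using p assms by blast
qed

lemma sections_binop:
  assumes U: "openin (zariski R) U"
    and s: "s \<in> carrier (structure_sections R U)" and t: "t \<in> carrier (structure_sections R U)"
    and opr: "\<And>p x y. primeideal p R \<Longrightarrow> x \<in> carrier (localization R p) \<Longrightarrow>
      y \<in> carrier (localization R p) \<Longrightarrow> opr p x y \<in> carrier (localization R p)"
    and N: "\<And>a f b g. a \<in> carrier R \<Longrightarrow> f \<in> carrier R \<Longrightarrow> b \<in> carrier R \<Longrightarrow> g \<in> carrier R \<Longrightarrow>
      N a f b g \<in> carrier R"
    and opf: "\<And>p a f b g. primeideal p R \<Longrightarrow> a \<in> carrier R \<Longrightarrow> f \<in> carrier R - p \<Longrightarrow>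
      b \<in> carrier R \<Longrightarrow> g \<in> carrier R - p \<Longrightarrow>
      opr p (fraction R p a f) (fraction R p b g) = fraction R p (N a f b g) (f \<otimes>\<^bsub>R\<^esub> g)"
  shows "(\<lambda>p\<in>U. opr p (s p) (t p)) \<in> carrier (structure_sections R U)"
  unfolding sections_carrier
proof (intro conjI ballI)
  show "(\<lambda>p\<in>U. opr p (s p) (t p)) \<in> (\<Pi>\<^sub>E p\<in>U. carrier (localization R p))"
    using pointP[OF U] s t opr by (auto simp: sections_carrier PiE_iff)
  fix p assume p: "p \<in> U"
  obtain V a f where V: "openin (zariski R) V" "p \<in> V" "V \<subseteq> U" "a \<in> carrier R" "f \<in> carrier R"
    "\<forall>q\<in>V. f \<notin> q \<and> s q = fraction R q a f" using s p unfolding sections_carrier by blast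
  obtain W b g where W: "openin (zariski R) W" "p \<in> W" "W \<subseteq> U" "b \<in> carrier R" "g \<in> carrier R"
    "\<forall>q\<in>W. g \<notin> q \<and> t q = fraction R q b g" using t p unfolding sections_carrier by blast
  have "f \<otimes>\<^bsub>R\<^esub> g \<notin> q \<and> (\<lambda>p\<in>U. opr p (s p) (t p)) q = fraction R q (N a f b g) (f \<otimes>\<^bsub>R\<^esub> g)"
    if q: "q \<in> V \<inter> W" for q
  proof -
    have q': "q \<in> V" "q \<in> W" using q by auto
    have pq: "primeideal q R" "q \<in> U" using pointP[OF V(1) q'(1)] q'(1) V(3) by blast+
    have "f \<otimes>\<^bsub>R\<^esub> g \<in> carrier R - q"
      by (rule primeideal.compl_closed[OF pq(1)]) (use V(5,6) W(5,6) q' in auto)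
    moreover have "opr q (s q) (t q) = fraction R q (N a f b g) (f \<otimes>\<^bsub>R\<^esub> g)"
      using V(4-6) W(4-6) q' opf[OF pq(1), of a f b g] by simp
    ultimately show ?thesis using pq by simp
  qed
  then show "locfrac U (\<lambda>p\<in>U. opr p (s p) (t p)) p"
    using V(1-5) W(1-5) N
    by (intro exI[of _ "V \<inter> W"] exI[of _ "N a f b g"] exI[of _ "f \<otimes>\<^bsub>R\<^esub> g"] conjI ballI)
      (simp_all add: openin_Int le_infI1)
qed

lemma sections_ops:
  assumes U: "openin (zariski R) U"
  shows sections_mult: "\<lbrakk>s \<in> carrier (structure_sections R U); t \<in> carrier (structure_sections R U)\<rbrakk>
      \<Longrightarrow> (\<lambda>p\<in>U. s p \<otimes>\<^bsub>localization R p\<^esub> t p) \<in> carrier (structure_sections R U)"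
    and sections_add: "\<lbrakk>s \<in> carrier (structure_sections R U); t \<in> carrier (structure_sections R U)\<rbrakk>
      \<Longrightarrow> (\<lambda>p\<in>U. s p \<oplus>\<^bsub>localization R p\<^esub> t p) \<in> carrier (structure_sections R U)"
    and sections_minus: "s \<in> carrier (structure_sections R U)
      \<Longrightarrow> (\<lambda>p\<in>U. \<ominus>\<^bsub>localization R p\<^esub> s p) \<in> carrier (structure_sections R U)"
proof -
  have L: "cring (localization R p)" if "primeideal p R" for p
    by (rule primeideal.localization_cring[OF that])
  show mult: "(\<lambda>p\<in>U. s p \<otimes>\<^bsub>localization R p\<^esub> t p) \<in> carrier (structure_sections R U)"
    if st: "s \<in> carrier (structure_sections R U)" "t \<in> carrier (structure_sections R U)" for s t
    by (rule sections_binop[OF U st, where opr = "\<lambda>p x y. x \<otimes>\<^bsub>localization R p\<^esub> y" and N = "\<lambda>a f b g. a \<otimes>\<^bsub>R\<^esub> b"])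
      (use L in \<open>auto simp: primeideal.localization_mult
         intro: monoid.m_closed[OF ring.is_monoid[OF cring.axioms(1)]]\<close>)
  show "(\<lambda>p\<in>U. s p \<oplus>\<^bsub>localization R p\<^esub> t p) \<in> carrier (structure_sections R U)"
    if st: "s \<in> carrier (structure_sections R U)" "t \<in> carrier (structure_sections R U)" for s t
    by (rule sections_binop[OF U st, where opr = "\<lambda>p x y. x \<oplus>\<^bsub>localization R p\<^esub> y" and N = "\<lambda>a f b g. g \<otimes>\<^bsub>R\<^esub> a \<oplus>\<^bsub>R\<^esub> f \<otimes>\<^bsub>R\<^esub> b"])
      (use L in \<open>auto simp: primeideal.localization_add
         intro: abelian_monoid.a_closed[OF abelian_group.axioms(1)[OF ring.is_abelian_group[OF cring.axioms(1)]]]\<close>)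
  show "(\<lambda>p\<in>U. \<ominus>\<^bsub>localization R p\<^esub> s p) \<in> carrier (structure_sections R U)"
    if s: "s \<in> carrier (structure_sections R U)" for s
  proof -
    have "(\<lambda>p\<in>U. \<ominus>\<^bsub>localization R p\<^esub> s p)
        = (\<lambda>p\<in>U. (\<lambda>p\<in>U. fraction R p (\<ominus>\<^bsub>R\<^esub> \<one>\<^bsub>R\<^esub>) \<one>\<^bsub>R\<^esub>) p \<otimes>\<^bsub>localization R p\<^esub> s p)"
    proof (rule restrict_ext)
      fix p assume p: "p \<in> U"
      have pp: "primeideal p R" using pointP U p by blast
      interpret P: primeideal p R by (rule pp)
      interpret L: cring "localization R p" by (rule L[OF pp])
      have "s p \<in> carrier (localization R p)"
        using s p by (auto simp: sections_carrier)
      moreover have "fraction R p (\<ominus>\<^bsub>R\<^esub> \<one>\<^bsub>R\<^esub>) \<one>\<^bsub>R\<^esub> = \<ominus>\<^bsub>localization R p\<^esub> \<one>\<^bsub>localization R p\<^esub>"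
        using P.localization_minus[of "\<one>\<^bsub>R\<^esub>" "\<one>\<^bsub>R\<^esub>"] P.one_compl by (simp add: P.localization_one)
      ultimately show "\<ominus>\<^bsub>localization R p\<^esub> s p
          = (\<lambda>p\<in>U. fraction R p (\<ominus>\<^bsub>R\<^esub> \<one>\<^bsub>R\<^esub>) \<one>\<^bsub>R\<^esub>) p \<otimes>\<^bsub>localization R p\<^esub> s p"
        using p by (simp add: L.l_minus)
    qed
    then show ?thesis using mult[OF sections_const[OF U] s] by simp
  qed
qed

lemma sections_simps:
  "carrier (structure_sections R U) = {s \<in> (\<Pi>\<^sub>E p\<in>U. carrier (localization R p)). \<forall>p\<in>U. locfrac U s p}"
  "s \<otimes>\<^bsub>structure_sections R U\<^esub> t = (\<lambda>p\<in>U. s p \<otimes>\<^bsub>localization R p\<^esub> t p)"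
  "s \<oplus>\<^bsub>structure_sections R U\<^esub> t = (\<lambda>p\<in>U. s p \<oplus>\<^bsub>localization R p\<^esub> t p)"
  "\<one>\<^bsub>structure_sections R U\<^esub> = (\<lambda>p\<in>U. fraction R p \<one>\<^bsub>R\<^esub> \<one>\<^bsub>R\<^esub>)"
  "\<zero>\<^bsub>structure_sections R U\<^esub> = (\<lambda>p\<in>U. fraction R p \<zero>\<^bsub>R\<^esub> \<one>\<^bsub>R\<^esub>)"
  by (simp_all add: structure_sections_def localization_def)

lemma sections_cring:
  assumes U: "openin (zariski R) U"
  shows "cring (structure_sections R U)"
proof -
  have pp: "primeideal p R" if "p \<in> U" for p using pointP U that by blast
  have L: "cring (localization R p)" if "p \<in> U" for p
    by (rule primeideal.localization_cring[OF pp[OF that]])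
  have LM: "comm_monoid (localization R p)" "abelian_monoid (localization R p)" "ring (localization R p)"
     "abelian_group (localization R p)"
    if "p \<in> U" for p
    using L[OF that] by (auto simp: cring_def ring_def abelian_group_def)
  have m: "s p \<in> carrier (localization R p)"
    if "s \<in> carrier (structure_sections R U)" "p \<in> U" for s p
    using that by (auto simp: sections_carrier)
  have ext: "s = t"
    if "s \<in> carrier (structure_sections R U)" "t \<in> carrier (structure_sections R U)"
      "\<And>p. p \<in> U \<Longrightarrow> s p = t p" for s t
    by (rule PiE_ext[of s U "\<lambda>p. carrier (localization R p)" t]) (use that in \<open>auto simp: sections_carrier\<close>)
  have one: "fraction R p \<one>\<^bsub>R\<^esub> \<one>\<^bsub>R\<^esub> = \<one>\<^bsub>localization R p\<^esub>" and
    zero: "fraction R p \<zero>\<^bsub>R\<^esub> \<one>\<^bsub>R\<^esub> = \<zero>\<^bsub>localization R p\<^esub>" for p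
    by (simp_all add: localization_def)
  have LD: "(x \<oplus>\<^bsub>localization R p\<^esub> y) \<otimes>\<^bsub>localization R p\<^esub> z
      = x \<otimes>\<^bsub>localization R p\<^esub> z \<oplus>\<^bsub>localization R p\<^esub> y \<otimes>\<^bsub>localization R p\<^esub> z"
    if "p \<in> U" "x \<in> carrier (localization R p)" "y \<in> carrier (localization R p)"
      "z \<in> carrier (localization R p)" for p x y z
  proof -
    interpret L: cring "localization R p" by (rule L[OF that(1)])
    show ?thesis using that by (intro L.l_distr)
  qed
  note ops = sections_mult[OF U] sections_add[OF U] sections_const[OF U one_closed]
    sections_const[OF U zero_closed]
  have ops': "\<And>s t. \<lbrakk>s \<in> carrier (structure_sections R U); t \<in> carrier (structure_sections R U)\<rbrakk>
      \<Longrightarrow> s \<otimes>\<^bsub>structure_sections R U\<^esub> t \<in> carrier (structure_sections R U)"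
    "\<And>s t. \<lbrakk>s \<in> carrier (structure_sections R U); t \<in> carrier (structure_sections R U)\<rbrakk>
      \<Longrightarrow> s \<oplus>\<^bsub>structure_sections R U\<^esub> t \<in> carrier (structure_sections R U)"
    "\<one>\<^bsub>structure_sections R U\<^esub> \<in> carrier (structure_sections R U)"
    "\<zero>\<^bsub>structure_sections R U\<^esub> \<in> carrier (structure_sections R U)"
    unfolding sections_simps(2-5) by (intro ops; assumption)+
  have app: "\<And>s t p. p \<in> U \<Longrightarrow> (s \<otimes>\<^bsub>structure_sections R U\<^esub> t) p = s p \<otimes>\<^bsub>localization R p\<^esub> t p"
    "\<And>s t p. p \<in> U \<Longrightarrow> (s \<oplus>\<^bsub>structure_sections R U\<^esub> t) p = s p \<oplus>\<^bsub>localization R p\<^esub> t p"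
    "\<And>p. p \<in> U \<Longrightarrow> \<one>\<^bsub>structure_sections R U\<^esub> p = \<one>\<^bsub>localization R p\<^esub>"
    "\<And>p. p \<in> U \<Longrightarrow> \<zero>\<^bsub>structure_sections R U\<^esub> p = \<zero>\<^bsub>localization R p\<^esub>"
    by (simp_all add: structure_sections_def)
  show ?thesis
  proof (rule cringI)
    show "abelian_group (structure_sections R U)"
    proof (rule abelian_groupI)
      fix s assume s: "s \<in> carrier (structure_sections R U)"
      let ?t = "\<lambda>p\<in>U. \<ominus>\<^bsub>localization R p\<^esub> s p"
      have "?t \<in> carrier (structure_sections R U)" by (rule sections_minus[OF U s])
      moreover from this have "?t \<oplus>\<^bsub>structure_sections R U\<^esub> s = \<zero>\<^bsub>structure_sections R U\<^esub>"
        by (intro ext ops' s) (simp_all add: app abelian_group.l_neg[OF LM(4)] m[OF s])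
      ultimately show "\<exists>t\<in>carrier (structure_sections R U).
          t \<oplus>\<^bsub>structure_sections R U\<^esub> s = \<zero>\<^bsub>structure_sections R U\<^esub>" by blast
    next
      fix s t u assume st: "s \<in> carrier (structure_sections R U)" "t \<in> carrier (structure_sections R U)"
      show "s \<oplus>\<^bsub>structure_sections R U\<^esub> t \<in> carrier (structure_sections R U)"
        by (intro ops' st)
      show "s \<oplus>\<^bsub>structure_sections R U\<^esub> t = t \<oplus>\<^bsub>structure_sections R U\<^esub> s"
        by (intro ext ops' st) (simp add: app m[OF st(1)] m[OF st(2)] abelian_monoid.a_comm[OF LM(2)])
      assume u: "u \<in> carrier (structure_sections R U)"
      show "s \<oplus>\<^bsub>structure_sections R U\<^esub> t \<oplus>\<^bsub>structure_sections R U\<^esub> u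
          = s \<oplus>\<^bsub>structure_sections R U\<^esub> (t \<oplus>\<^bsub>structure_sections R U\<^esub> u)"
        by (intro ext ops' st u)
          (simp add: app m[OF st(1)] m[OF st(2)] m[OF u] abelian_monoid.a_assoc[OF LM(2)])
    next
      show "\<zero>\<^bsub>structure_sections R U\<^esub> \<in> carrier (structure_sections R U)" by (rule ops')
      fix s assume s: "s \<in> carrier (structure_sections R U)"
      show "\<zero>\<^bsub>structure_sections R U\<^esub> \<oplus>\<^bsub>structure_sections R U\<^esub> s = s"
        by (intro ext ops' s) (simp add: app m[OF s] abelian_monoid.l_zero[OF LM(2)])
    qed
    show "comm_monoid (structure_sections R U)"
    proof (rule comm_monoidI)
      fix s t u assume st: "s \<in> carrier (structure_sections R U)" "t \<in> carrier (structure_sections R U)"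
      show "s \<otimes>\<^bsub>structure_sections R U\<^esub> t \<in> carrier (structure_sections R U)"
        by (intro ops' st)
      show "s \<otimes>\<^bsub>structure_sections R U\<^esub> t = t \<otimes>\<^bsub>structure_sections R U\<^esub> s"
        by (intro ext ops' st) (simp add: app m[OF st(1)] m[OF st(2)] comm_monoid.m_comm[OF LM(1)])
      assume u: "u \<in> carrier (structure_sections R U)"
      show "s \<otimes>\<^bsub>structure_sections R U\<^esub> t \<otimes>\<^bsub>structure_sections R U\<^esub> u
          = s \<otimes>\<^bsub>structure_sections R U\<^esub> (t \<otimes>\<^bsub>structure_sections R U\<^esub> u)"
        by (intro ext ops' st u) (simp add: app m[OF st(1)] m[OF st(2)] m[OF u]
            monoid.m_assoc[OF comm_monoid.axioms(1)[OF LM(1)]])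
    next
      show "\<one>\<^bsub>structure_sections R U\<^esub> \<in> carrier (structure_sections R U)" by (rule ops')
      fix s assume s: "s \<in> carrier (structure_sections R U)"
      show "\<one>\<^bsub>structure_sections R U\<^esub> \<otimes>\<^bsub>structure_sections R U\<^esub> s = s"
        by (intro ext ops' s) (simp add: app m[OF s] monoid.l_one[OF comm_monoid.axioms(1)[OF LM(1)]])
    qed
    fix s t u assume st: "s \<in> carrier (structure_sections R U)" "t \<in> carrier (structure_sections R U)"
      "u \<in> carrier (structure_sections R U)"
    show "(s \<oplus>\<^bsub>structure_sections R U\<^esub> t) \<otimes>\<^bsub>structure_sections R U\<^esub> u
        = s \<otimes>\<^bsub>structure_sections R U\<^esub> u \<oplus>\<^bsub>structure_sections R U\<^esub> t \<otimes>\<^bsub>structure_sections R U\<^esub> u"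
      by (intro ext ops' st)
        (simp add: app m[OF st(1)] m[OF st(2)] m[OF st(3)] LD)
  qed
qed

lemma sections_restrict:
  assumes UV: "openin (zariski R) U" "openin (zariski R) V" "V \<subseteq> U"
    and s: "s \<in> carrier (structure_sections R U)"
  shows "restrict s V \<in> carrier (structure_sections R V)"
  unfolding sections_carrier
proof (intro conjI ballI)
  show "restrict s V \<in> (\<Pi>\<^sub>E p\<in>V. carrier (localization R p))"
    using s UV(3) by (auto simp: sections_carrier PiE_iff)
  fix p assume p: "p \<in> V"
  then obtain W a f where W: "openin (zariski R) W" "p \<in> W" "a \<in> carrier R" "f \<in> carrier R"
    "\<forall>q\<in>W. f \<notin> q \<and> s q = fraction R q a f" using s UV(3) unfolding sections_carrier by blast
  show "locfrac V (restrict s V) p"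
    by (rule exI[of _ "V \<inter> W"], rule exI[of _ a], rule exI[of _ f], intro conjI ballI)
      (use p UV(2) W in \<open>simp_all add: openin_Int\<close>)
qed

theorem ringed_space_Spec: "ringed_space (Spec R)"
proof (intro ringed_space.intro sheaf_of_sets.intro ringed_space_axioms.intro,
       unfold Spec_def ringed_space_data.simps)
  fix U V :: "'a set set" and s
  assume UV: "openin (zariski R) U" "openin (zariski R) V" "V \<subseteq> U"
    and s: "s \<in> carrier (structure_sections R U)"
  show "restrict s V \<in> carrier (structure_sections R V)"
    by (rule sections_restrict[OF UV s])
next
  fix U s assume "s \<in> carrier (structure_sections R U)"
  then show "restrict s U = s"
    by (auto simp: sections_carrier intro: PiE_restrict)
next
  fix U V W :: "'a set set" and s :: "'a set \<Rightarrow> ('a \<times> 'a) set" assume "W \<subseteq> V"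
  then show "restrict (restrict s V) W = restrict s W"
    by (auto simp: restrict_def fun_eq_iff)
next
  fix \<V> s t
  assume s: "s \<in> carrier (structure_sections R (\<Union>\<V>))" and t: "t \<in> carrier (structure_sections R (\<Union>\<V>))"
    and eq: "\<And>V. V \<in> \<V> \<Longrightarrow> restrict s V = restrict t V"
  show "s = t"
  proof (rule PiE_ext)
    show "s \<in> (\<Pi>\<^sub>E p\<in>\<Union>\<V>. carrier (localization R p))" "t \<in> (\<Pi>\<^sub>E p\<in>\<Union>\<V>. carrier (localization R p))"
      using s t by (auto simp: sections_carrier)
    show "s p = t p" if "p \<in> \<Union>\<V>" for p using that eq by (metis UnionE restrict_apply')
  qed
next
  fix \<V> \<sigma>
  assume op: "\<And>V. V \<in> \<V> \<Longrightarrow> openin (zariski R) V"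
    and \<sigma>: "\<And>V. V \<in> \<V> \<Longrightarrow> \<sigma> V \<in> carrier (structure_sections R V)"
    and eq: "\<And>V W. V \<in> \<V> \<Longrightarrow> W \<in> \<V> \<Longrightarrow> restrict (\<sigma> V) (V \<inter> W) = restrict (\<sigma> W) (V \<inter> W)"
  define c where "c p = (SOME V. V \<in> \<V> \<and> p \<in> V)" for p
  have c: "c p \<in> \<V>" "p \<in> c p" if "p \<in> \<Union>\<V>" for p
    using someI_ex[of "\<lambda>V. V \<in> \<V> \<and> p \<in> V"] that unfolding c_def by blast+
  define s where "s = (\<lambda>p\<in>\<Union>\<V>. \<sigma> (c p) p)"
  have sV: "s p = \<sigma> V p" if "V \<in> \<V>" "p \<in> V" for V p
  proof -
    have "p \<in> \<Union>\<V>" using that by blast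
    moreover have "restrict (\<sigma> (c p)) (c p \<inter> V) p = restrict (\<sigma> V) (c p \<inter> V) p"
      using eq[OF c(1) that(1)] calculation by metis
    ultimately show ?thesis using c that by (simp add: s_def)
  qed
  have "s \<in> carrier (structure_sections R (\<Union>\<V>))"
    unfolding sections_carrier
  proof (intro conjI ballI)
    show "s \<in> (\<Pi>\<^sub>E p\<in>\<Union>\<V>. carrier (localization R p))"
    proof (rule PiE_I)
      fix p assume "p \<in> \<Union>\<V>"
      then show "s p \<in> carrier (localization R p)"
        using \<sigma>[OF c(1)[of p]] c[of p] by (auto simp: s_def sections_carrier simp del: UN_iff Union_iff)
    qed (simp add: s_def)
    fix p assume "p \<in> \<Union>\<V>"
    then obtain V where V: "V \<in> \<V>" "p \<in> V" by blast
    then obtain W a f where W: "openin (zariski R) W" "p \<in> W" "W \<subseteq> V" "a \<in> carrier R" "f \<in> carrier R"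
      "\<forall>q\<in>W. f \<notin> q \<and> \<sigma> V q = fraction R q a f" using \<sigma>[OF V(1)] unfolding sections_carrier by blast
    then have "\<forall>q\<in>W. f \<notin> q \<and> s q = fraction R q a f" using sV V by auto
    then show "locfrac (\<Union>\<V>) s p" using W V by blast
  qed
  moreover have "restrict s V = \<sigma> V" if V: "V \<in> \<V>" for V
  proof -
    have "restrict s V = restrict (\<sigma> V) V" using sV[OF V] by (intro restrict_ext)
    also have "\<dots> = \<sigma> V" using \<sigma>[OF V] by (auto simp: sections_carrier intro: PiE_restrict)
    finally show ?thesis .
  qed
  ultimately show "\<exists>s\<in>carrier (structure_sections R (\<Union>\<V>)). \<forall>V\<in>\<V>. restrict s V = \<sigma> V" by blast
next
  fix U assume "openin (zariski R) U"
  then show "cring (structure_sections R U)" by (rule sections_cring)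
next
  fix U V :: "'a set set"
  assume UV: "openin (zariski R) U" "openin (zariski R) V" "V \<subseteq> U"
  show "(\<lambda>s. restrict s V) \<in> ring_hom (structure_sections R U) (structure_sections R V)"
  proof (rule ring_hom_memI)
    fix s assume s: "s \<in> carrier (structure_sections R U)"
    show "restrict s V \<in> carrier (structure_sections R V)"
      by (rule sections_restrict[OF UV s])
  qed (use UV in \<open>auto simp: sections_simps(2-5) restrict_def fun_eq_iff\<close>)
qed

end
end

theory Submission
  imports Defs
begin

text \<open>Given finitely many global sections \<open>m\<close>, call \<^emph>\<open>defect\<close> at a prime \<open>p\<close> the least number of further
  elements that, together with \<open>m\<close>, generate the stalk of \<open>M\<close> at \<open>p\<close>; it is the dimension of the fibre of
  \<open>M / (m)\<close>. The sections are chosen one at a time. Initially the defect is at most \<open>n\<close> everywhere, by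
  the assumption on the rank. A new section lowers the defect at \<open>p\<close> as soon as its image in the
  fibre of \<open>M / (m)\<close> is nonzero, and by a variant of prime avoidance one section can do so at
  finitely many given primes (\<open>exchange\<close>, \<open>avoid_submodules\<close>). These are taken to be the generic points of the
  closed loci where the defect exceeds a number \<open>k\<close>. It follows by induction that after \<open>j\<close> steps the
  locus of defect greater than \<open>k\<close> has codimension at least \<open>j + k + 1 - n\<close>
  (\<open>elements_of_bounded_defect\<close>). For \<open>j = d + n\<close> and \<open>k = 0\<close> this is the theorem.

  This argument is about a finitely generated \<open>R\<close>-module \<open>G\<close>, the module of global sections, and its
  localizations. That \<open>G\<close> determines \<open>M\<close> is where coherence enters. Coherence is a condition on ringed
  spaces: locally there are finitely many generators, and the relations between finitely many
  sections are locally generated by finitely many of them (\<open>local_generators\<close>, \<open>local_relations\<close>). From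
  this it follows that a section that vanishes where \<open>g\<close> is invertible is killed by a power of \<open>g\<close>, and that a section given
  only there extends after multiplication with a power of \<open>g\<close> (\<open>killed_by_power\<close>,
  \<open>extension_up_to_power\<close>). Hence the stalk at \<open>p\<close> is the localization of \<open>G\<close> at \<open>p\<close>, and \<open>G\<close> is finitely
  generated. In each of these proofs the denominators that make a statement true form an ideal; if
  the ideal lies in no prime of a basic open set, it contains a power of the equation of that set
  (\<open>power_mem_ideal\<close>).

  The rank is defined by the tensor product of the stalk with the residue field. Generators of this
  vector space lift to the stalk, and then to \<open>G\<close>, and Nakayama's lemma shows that they generate
  near \<open>p\<close> (\<open>lift_generators_of_quotient\<close>, \<open>completed_by_rank\<close>).\<close>

section \<open>Noetherian commutative rings\<close>

locale noetherian_cring = noetherian_ring R + cring R for R (structure)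
begin

lemma maximal_ideal_in:
  assumes "A \<noteq> {}" and "\<And>I. I \<in> A \<Longrightarrow> ideal I R"
  obtains M where "M \<in> A" "\<And>I. I \<in> A \<Longrightarrow> M \<subseteq> I \<Longrightarrow> I = M"
proof -
  have "\<Union>C \<in> A" if "C \<noteq> {}" "subset.chain A C" for C
  proof -
    have "subset.chain {I. ideal I R} C"
      using that(2) assms(2) by (auto simp: subset.chain_def)
    from ideal_chain_is_trivial[OF that(1) this] show ?thesis
      using that(2) by (auto simp: subset.chain_def)
  qed
  with subset_Zorn_nonempty[OF assms(1)] that show ?thesis by metis
qed

lemma ideal_add_cgenideal:
  assumes "ideal I R" "a \<in> carrier R"
  shows "ideal (I <+>\<^bsub>R\<^esub> PIdl a) R" "I \<subseteq> I <+>\<^bsub>R\<^esub> PIdl a" "a \<in> I <+>\<^bsub>R\<^esub> PIdl a"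
    "x \<in> I <+>\<^bsub>R\<^esub> PIdl a \<longleftrightarrow> (\<exists>i\<in>I. \<exists>r\<in>carrier R. x = i \<oplus> r \<otimes> a)"
proof -
  interpret I: ideal I R by (rule assms(1))
  show "ideal (I <+>\<^bsub>R\<^esub> PIdl a) R"
    by (intro add_ideals assms cgenideal_ideal)
  show mem: "x \<in> I <+>\<^bsub>R\<^esub> PIdl a \<longleftrightarrow> (\<exists>i\<in>I. \<exists>r\<in>carrier R. x = i \<oplus> r \<otimes> a)" for x
    by (auto simp: set_add_def' cgenideal_def)
  have "i = i \<oplus> \<zero> \<otimes> a" if "i \<in> I" for i using that assms(2) I.a_Hcarr by simp
  then show "I \<subseteq> I <+>\<^bsub>R\<^esub> PIdl a" unfolding subset_iff mem by blast
  have "a = \<zero> \<oplus> \<one> \<otimes> a" using assms(2) by simp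
  then show "a \<in> I <+>\<^bsub>R\<^esub> PIdl a" unfolding mem using I.zero_closed by blast
qed

text \<open>A maximal counterexample would be a proper ideal that is not prime, so it would contain a product
  of two elements outside of it, while the two ideals obtained by adding one of them are no
  counterexamples.\<close>

lemma prime_split_induct [consumes 1, case_names carrier prime split]:
  assumes "ideal I R"
    and carr: "P (carrier R)"
    and prime: "\<And>I. primeideal I R \<Longrightarrow> P I"
    and split: "\<And>I a b. \<lbrakk>ideal I R; a \<in> carrier R; b \<in> carrier R; a \<otimes> b \<in> I;
        P (I <+>\<^bsub>R\<^esub> PIdl a); P (I <+>\<^bsub>R\<^esub> PIdl b)\<rbrakk> \<Longrightarrow> P I"
  shows "P I"
proof (rule ccontr)
  assume "\<not> P I"
  then have ne: "{I. ideal I R \<and> \<not> P I} \<noteq> {}" using assms(1) by auto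
  have id: "ideal I R" if "I \<in> {I. ideal I R \<and> \<not> P I}" for I using that by simp
  obtain M where M': "M \<in> {I. ideal I R \<and> \<not> P I}"
    and max': "\<And>J. J \<in> {I. ideal I R \<and> \<not> P I} \<Longrightarrow> M \<subseteq> J \<Longrightarrow> J = M"
    by (rule maximal_ideal_in[OF ne id], assumption, rule that)
  have M: "ideal M R" "\<not> P M" using M' by simp_all
  have max: "J = M" if "ideal J R" "\<not> P J" "M \<subseteq> J" for J using max' that by simp
  have "\<not> primeideal M R" "carrier R \<noteq> M" using M(2) prime carr by auto
  then obtain a b where ab: "a \<in> carrier R" "b \<in> carrier R" "a \<otimes> b \<in> M" "a \<notin> M" "b \<notin> M"
    using primeidealI[OF M(1) is_cring] by blast
  have "P (M <+>\<^bsub>R\<^esub> PIdl c)" if c: "c \<in> carrier R" "c \<notin> M" for c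
  proof (rule ccontr)
    assume "\<not> P (M <+>\<^bsub>R\<^esub> PIdl c)"
    from max[OF ideal_add_cgenideal(1)[OF M(1) c(1)] this ideal_add_cgenideal(2)[OF M(1) c(1)]]
    show False using ideal_add_cgenideal(3)[OF M(1) c(1)] c(2) by simp
  qed
  then show False using split[OF M(1) ab(1-3)] ab M(2) by simp
qed

text \<open>The set contains all minimal primes over \<open>J\<close>, but its members need not be minimal; this suffices
  below and spares a discussion of minimality.\<close>

lemma finitely_many_primes_over:
  assumes "ideal J R"
  obtains F where "finite F" "\<And>q. q \<in> F \<Longrightarrow> primeideal q R" "\<And>q. q \<in> F \<Longrightarrow> J \<subseteq> q"
    "\<And>p. primeideal p R \<Longrightarrow> J \<subseteq> p \<Longrightarrow> \<exists>q\<in>F. q \<subseteq> p"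
proof -
  from assms have "\<exists>F. finite F \<and> (\<forall>q\<in>F. primeideal q R \<and> J \<subseteq> q) \<and>
      (\<forall>p. primeideal p R \<and> J \<subseteq> p \<longrightarrow> (\<exists>q\<in>F. q \<subseteq> p))"
  proof (induction rule: prime_split_induct)
    case carrier
    have "\<not> carrier R \<subseteq> p" if "primeideal p R" for p
    proof -
      interpret primeideal p R by (rule that)
      show ?thesis using I_notcarr a_subset by blast
    qed
    then show ?case by (intro exI[of _ "{}"]) auto
  next
    case (prime I)
    then show ?case by (intro exI[of _ "{I}"]) auto
  next
    case (split I a b)
    from split(5) obtain F where F: "finite F" "\<forall>q\<in>F. primeideal q R \<and> I <+>\<^bsub>R\<^esub> PIdl a \<subseteq> q"
        "\<forall>p. primeideal p R \<and> I <+>\<^bsub>R\<^esub> PIdl a \<subseteq> p \<longrightarrow> (\<exists>q\<in>F. q \<subseteq> p)" by (elim exE conjE)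
    from split(6) obtain G where G: "finite G" "\<forall>q\<in>G. primeideal q R \<and> I <+>\<^bsub>R\<^esub> PIdl b \<subseteq> q"
        "\<forall>p. primeideal p R \<and> I <+>\<^bsub>R\<^esub> PIdl b \<subseteq> p \<longrightarrow> (\<exists>q\<in>G. q \<subseteq> p)" by (elim exE conjE)
    have "\<exists>q\<in>F \<union> G. q \<subseteq> p" if p: "primeideal p R" "I \<subseteq> p" for p
    proof -
      interpret primeideal p R by (rule p(1))
      have *: "I <+>\<^bsub>R\<^esub> PIdl c \<subseteq> p" if c: "c \<in> carrier R" "c \<in> p" for c
      proof
        fix x assume "x \<in> I <+>\<^bsub>R\<^esub> PIdl c"
        then obtain i r where x: "i \<in> I" "r \<in> carrier R" "x = i \<oplus> r \<otimes> c"
          using ideal_add_cgenideal(4)[OF split(1) c(1)] by auto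
        have "i \<in> p" "r \<otimes> c \<in> p" using x p(2) I_l_closed[OF c(2) x(2)] by auto
        then show "x \<in> p" unfolding x(3) by (rule additive_subgroup.a_closed[OF additive_subgroup_axioms])
      qed
      have "a \<in> p \<or> b \<in> p" using I_prime[OF split(2,3)] split(4) p(2) by blast
      then show ?thesis
      proof
        assume "a \<in> p"
        then have "\<exists>q\<in>F. q \<subseteq> p" using F(3) p(1) *[OF split(2)] by simp
        then show ?thesis by auto
      next
        assume "b \<in> p"
        then have "\<exists>q\<in>G. q \<subseteq> p" using G(3) p(1) *[OF split(3)] by simp
        then show ?thesis by auto
      qed
    qed
    moreover have "I \<subseteq> q" if "q \<in> F \<union> G" for q
      using that F(2) G(2) ideal_add_cgenideal(2)[OF split(1)] split(2,3) by blast
    moreover have "primeideal q R" if "q \<in> F \<union> G" for q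
      using that F(2) G(2) by auto
    ultimately have "finite (F \<union> G) \<and> (\<forall>q\<in>F \<union> G. primeideal q R \<and> I \<subseteq> q) \<and>
        (\<forall>p. primeideal p R \<and> I \<subseteq> p \<longrightarrow> (\<exists>q\<in>F \<union> G. q \<subseteq> p))"
      using F(1) G(1) by simp
    then show ?case by (rule exI)
  qed
  then obtain F where F: "finite F" "\<forall>q\<in>F. primeideal q R \<and> J \<subseteq> q"
    "\<forall>p. primeideal p R \<and> J \<subseteq> p \<longrightarrow> (\<exists>q\<in>F. q \<subseteq> p)" by (elim exE conjE)
  show ?thesis by (rule that[OF F(1)]) (use F(2,3) in simp_all)
qed

text \<open>Every ideal contains a product of primes over it, so an element of all these primes is
  nilpotent modulo the ideal. Below the ideal will consist of the denominators that make some
  local statement true; that the statement holds at each point of a basic open set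
  then says that the ideal contains a power of the equation of that set.\<close>

lemma power_mem_ideal:
  assumes "ideal J R" "u \<in> carrier R" "\<And>p. primeideal p R \<Longrightarrow> J \<subseteq> p \<Longrightarrow> u \<in> p"
  obtains N :: nat where "u [^] N \<in> J"
proof -
  from assms(1,3) have "\<exists>N::nat. u [^] N \<in> J"
  proof (induction rule: prime_split_induct)
    case carrier
    then show ?case using assms(2) by auto
  next
    case (prime I)
    then have "u [^] (1::nat) \<in> I" using assms(2) by simp
    then show ?case by blast
  next
    case (split I a b)
    have *: "\<exists>N::nat. \<exists>i\<in>I. \<exists>r\<in>carrier R. u [^] N = i \<oplus> r \<otimes> c"
      if c: "c \<in> carrier R"
        and IH: "(\<And>p. primeideal p R \<Longrightarrow> I <+>\<^bsub>R\<^esub> PIdl c \<subseteq> p \<Longrightarrow> u \<in> p) \<Longrightarrow> \<exists>N::nat. u [^] N \<in> I <+>\<^bsub>R\<^esub> PIdl c"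
      for c
      using IH split.prems ideal_add_cgenideal(2,4)[OF split(1) c] by blast
    obtain N K :: nat and i r j s where
      i: "i \<in> I" "r \<in> carrier R" "u [^] N = i \<oplus> r \<otimes> a" and
      j: "j \<in> I" "s \<in> carrier R" "u [^] K = j \<oplus> s \<otimes> b"
      using *[OF split(2,5)] *[OF split(3,6)] by blast
    interpret I: ideal I R by (rule split(1))
    have c: "i \<in> carrier R" "j \<in> carrier R" using i j I.a_subset by auto
    have "u [^] (N + K) = (i \<oplus> r \<otimes> a) \<otimes> (j \<oplus> s \<otimes> b)"
      unfolding i(3)[symmetric] j(3)[symmetric] using assms(2) by (simp add: nat_pow_mult)
    also have "\<dots> = (j \<oplus> s \<otimes> b) \<otimes> i \<oplus> ((r \<otimes> a) \<otimes> j \<oplus> (r \<otimes> s) \<otimes> (a \<otimes> b))"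
      using c i(2) j(2) split(2,3) by algebra
    also have "\<dots> \<in> I"
      using c i j split(2,3) by (intro I.a_closed I.I_l_closed[OF split(4)] I.I_l_closed[OF i(1)] I.I_l_closed[OF j(1)]) auto
    finally show ?case by blast
  qed
  then show ?thesis using that by blast
qed

lemma one_mem_ideal_avoiding_primes:
  assumes "ideal J R" "\<And>p. primeideal p R \<Longrightarrow> \<not> J \<subseteq> p"
  shows "\<one> \<in> J"
  using power_mem_ideal[OF assms(1) one_closed] assms(2) by (metis nat_pow_one)

lemma open_iff_ideal:
  "openin (zariski R) U \<longleftrightarrow> (\<exists>I. ideal I R \<and> U = {p. primeideal p R \<and> \<not> I \<subseteq> p})"
proof
  assume "openin (zariski R) U"
  then obtain S where S: "S \<subseteq> carrier R" "U = {p. primeideal p R \<and> \<not> S \<subseteq> p}"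
    by (auto simp: openin_zariski)
  have "Idl S \<subseteq> p \<longleftrightarrow> S \<subseteq> p" if "primeideal p R" for p
    using Idl_subset_ideal[OF primeideal.axioms(1)[OF that] S(1)] by blast
  then show "\<exists>I. ideal I R \<and> U = {p. primeideal p R \<and> \<not> I \<subseteq> p}"
    using S genideal_ideal[OF S(1)] by blast
qed (auto simp: openin_zariski dest: ideal.Icarr)

text \<open>A property of open sets that passes to finite unions holds on all of an open set if it holds
  locally: an ideal that is maximal among those whose complement has the property
  already gives the whole open set. This replaces quasi-compactness arguments with finite covers.\<close>

lemma zariski_patching:
  assumes W: "openin (zariski R) W"
    and empty: "P {}"
    and un: "\<And>A B. \<lbrakk>openin (zariski R) A; openin (zariski R) B; A \<subseteq> W; B \<subseteq> W; P A; P B\<rbrakk> \<Longrightarrow> P (A \<union> B)"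
    and loc: "\<And>x. x \<in> W \<Longrightarrow> \<exists>V. openin (zariski R) V \<and> x \<in> V \<and> V \<subseteq> W \<and> P V"
  shows "P W"
proof -
  define D where "D I = {p. primeideal p R \<and> \<not> I \<subseteq> p}" for I
  have open_D: "openin (zariski R) V \<longleftrightarrow> (\<exists>I. ideal I R \<and> V = D I)" for V
    unfolding D_def by (rule open_iff_ideal)
  then have Dopen: "openin (zariski R) (D I)" if "ideal I R" for I
    using that by auto
  define A where "A = {I. ideal I R \<and> D I \<subseteq> W \<and> P (D I)}"
  have "D {\<zero>} = {}" unfolding D_def
    using additive_subgroup.zero_closed ideal.axioms(1) primeideal.axioms(1) by fastforce
  then have "{\<zero>} \<in> A" unfolding A_def using zeroideal empty by simp
  then have ne: "A \<noteq> {}" by auto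
  have id: "ideal I R" if "I \<in> A" for I using that by (simp add: A_def)
  obtain M where M: "M \<in> A" and max: "\<And>I. I \<in> A \<Longrightarrow> M \<subseteq> I \<Longrightarrow> I = M"
    by (rule maximal_ideal_in[OF ne id], assumption, rule that)
  have Mi: "ideal M R" "D M \<subseteq> W" "P (D M)" using M by (auto simp: A_def)
  have "W \<subseteq> D M"
  proof
    fix x assume x: "x \<in> W"
    show "x \<in> D M"
    proof (rule ccontr)
      assume nx: "x \<notin> D M"
      obtain V where V: "openin (zariski R) V" "x \<in> V" "V \<subseteq> W" "P V" using loc[OF x] by blast
      then obtain I where I: "ideal I R" "V = D I" unfolding open_D by auto
      have sub: "M \<subseteq> M <+>\<^bsub>R\<^esub> I" "I \<subseteq> M <+>\<^bsub>R\<^esub> I"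
      proof -
        have "m = m \<oplus> \<zero>" if "m \<in> M" for m using that ideal.Icarr[OF Mi(1)] by simp
        then show "M \<subseteq> M <+>\<^bsub>R\<^esub> I" unfolding set_add_def'
          using additive_subgroup.zero_closed[OF ideal.axioms(1)[OF I(1)]] by blast
        have "m = \<zero> \<oplus> m" if "m \<in> I" for m using that ideal.Icarr[OF I(1)] by simp
        then show "I \<subseteq> M <+>\<^bsub>R\<^esub> I" unfolding set_add_def'
          using additive_subgroup.zero_closed[OF ideal.axioms(1)[OF Mi(1)]] by blast
      qed
      have "M <+>\<^bsub>R\<^esub> I \<subseteq> p \<longleftrightarrow> M \<subseteq> p \<and> I \<subseteq> p" if "primeideal p R" for p
      proof
        interpret primeideal p R by (rule that)
        show "M <+>\<^bsub>R\<^esub> I \<subseteq> p" if "M \<subseteq> p \<and> I \<subseteq> p" using that unfolding set_add_def' by auto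
      qed (use sub in blast)
      then have "D (M <+>\<^bsub>R\<^esub> I) = D M \<union> D I" unfolding D_def by blast
      then have "M <+>\<^bsub>R\<^esub> I \<in> A"
        using un[OF Dopen[OF Mi(1)] V(1) Mi(2) V(3) Mi(3) V(4)] Mi(2) V(3) I add_ideals[OF Mi(1) I(1)]
        by (auto simp: A_def)
      then have "I \<subseteq> M" using max sub by blast
      then have "x \<in> D M" using V(2) I(2) by (auto simp: D_def)
      then show False using nx by simp
    qed
  qed
  then show ?thesis using Mi(2,3) by (simp add: subset_antisym)
qed

end

section \<open>Generating a module near a prime\<close>

context module
begin

abbreviation submod :: "'c set \<Rightarrow> bool" where
  "submod N \<equiv> LinearCombinations.submodule R N M"

lemma submodI:
  assumes "N \<subseteq> carrier M" "\<zero>\<^bsub>M\<^esub> \<in> N"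
    "\<And>x y. x \<in> N \<Longrightarrow> y \<in> N \<Longrightarrow> x \<oplus>\<^bsub>M\<^esub> y \<in> N"
    "\<And>a x. a \<in> carrier R \<Longrightarrow> x \<in> N \<Longrightarrow> a \<odot>\<^bsub>M\<^esub> x \<in> N"
  shows "submod N"
  by (intro LinearCombinations.submodule.intro module_axioms assms)

lemma submodD:
  assumes "submod N"
  shows "N \<subseteq> carrier M" "\<zero>\<^bsub>M\<^esub> \<in> N"
    "\<And>x y. x \<in> N \<Longrightarrow> y \<in> N \<Longrightarrow> x \<oplus>\<^bsub>M\<^esub> y \<in> N"
    "\<And>a x. a \<in> carrier R \<Longrightarrow> x \<in> N \<Longrightarrow> a \<odot>\<^bsub>M\<^esub> x \<in> N"
    "\<And>x. x \<in> N \<Longrightarrow> x \<in> carrier M"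
  using LinearCombinations.submodule.subset[OF assms]
    LinearCombinations.submodule.zero_closed[OF assms]
    LinearCombinations.submodule.m_closed[OF assms]
    LinearCombinations.submodule.smult_closed[OF assms] by auto

lemma submod_minus:
  assumes "submod N" "x \<in> N" "y \<in> N"
  shows "x \<ominus>\<^bsub>M\<^esub> y \<in> N"
proof -
  note D = submodD[OF assms(1)]
  have "y \<in> carrier M" using D(5) assms(3) .
  then have "\<ominus>\<^bsub>M\<^esub> y = (\<ominus> \<one>) \<odot>\<^bsub>M\<^esub> y" by (simp add: smult_l_minus)
  then show ?thesis using D(3,4) assms(2,3) by (simp add: a_minus_def)
qed

text \<open>The elements that fall into \<open>N\<close> after localization at the prime \<open>p\<close>: the preimage of the
  localization of \<open>N\<close>.\<close>

definition sat :: "'a set \<Rightarrow> 'c set \<Rightarrow> 'c set" where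
  "sat p N = {y \<in> carrier M. \<exists>c\<in>carrier R - p. c \<odot>\<^bsub>M\<^esub> y \<in> N}"

lemma satI: "y \<in> carrier M \<Longrightarrow> c \<in> carrier R \<Longrightarrow> c \<notin> p \<Longrightarrow> c \<odot>\<^bsub>M\<^esub> y \<in> N \<Longrightarrow> y \<in> sat p N"
  unfolding sat_def by auto

lemma satE:
  assumes "y \<in> sat p N"
  obtains c where "y \<in> carrier M" "c \<in> carrier R" "c \<notin> p" "c \<in> carrier R - p" "c \<odot>\<^bsub>M\<^esub> y \<in> N"
  using assms unfolding sat_def by auto

lemma sat_mono: "N \<subseteq> N' \<Longrightarrow> sat p N \<subseteq> sat p N'"
  unfolding sat_def by auto

lemma sat_carrier: "sat p N \<subseteq> carrier M"
  unfolding sat_def by auto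

lemma sat_submod:
  assumes p: "primeideal p R" and N: "submod N"
  shows "submod (sat p N)"
proof (rule submodI)
  note D = submodD[OF N]
  interpret p: primeideal p R by (rule p)
  show "sat p N \<subseteq> carrier M" by (rule sat_carrier)
  show "\<zero>\<^bsub>M\<^esub> \<in> sat p N"
    by (rule satI[of _ \<one>]) (use p.one_compl D(2) in auto)
  fix x assume "x \<in> sat p N"
  then obtain c where c: "x \<in> carrier M" "c \<in> carrier R" "c \<in> carrier R - p" "c \<odot>\<^bsub>M\<^esub> x \<in> N" by (rule satE)
  show "a \<odot>\<^bsub>M\<^esub> x \<in> sat p N" if a: "a \<in> carrier R" for a
  proof (rule satI[of _ c])
    have "c \<odot>\<^bsub>M\<^esub> (a \<odot>\<^bsub>M\<^esub> x) = a \<odot>\<^bsub>M\<^esub> (c \<odot>\<^bsub>M\<^esub> x)"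
      using a c(1,2) by (simp flip: smult_assoc1 add: R.m_comm)
    then show "c \<odot>\<^bsub>M\<^esub> (a \<odot>\<^bsub>M\<^esub> x) \<in> N" using D(4)[OF a c(4)] by simp
  qed (use a c in auto)
  fix y assume "y \<in> sat p N"
  then obtain e where e: "y \<in> carrier M" "e \<in> carrier R" "e \<in> carrier R - p" "e \<odot>\<^bsub>M\<^esub> y \<in> N" by (rule satE)
  show "x \<oplus>\<^bsub>M\<^esub> y \<in> sat p N"
  proof (rule satI[of _ "c \<otimes> e"])
    have "(c \<otimes> e) \<odot>\<^bsub>M\<^esub> (x \<oplus>\<^bsub>M\<^esub> y) = e \<odot>\<^bsub>M\<^esub> (c \<odot>\<^bsub>M\<^esub> x) \<oplus>\<^bsub>M\<^esub> c \<odot>\<^bsub>M\<^esub> (e \<odot>\<^bsub>M\<^esub> y)"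
      using c(1,2) e(1,2) by (simp add: smult_r_distr R.m_comm[of e c] flip: smult_assoc1)
    then show "(c \<otimes> e) \<odot>\<^bsub>M\<^esub> (x \<oplus>\<^bsub>M\<^esub> y) \<in> N" using D(3)[OF D(4)[OF e(2) c(4)] D(4)[OF c(2) e(4)]] by simp
    show "c \<otimes> e \<in> carrier R" "c \<otimes> e \<notin> p" using p.compl_closed[OF c(3) e(3)] by auto
  qed (use c e in auto)
qed

lemma subset_sat:
  assumes "primeideal p R" "N \<subseteq> carrier M"
  shows "N \<subseteq> sat p N"
proof
  fix x assume x: "x \<in> N"
  show "x \<in> sat p N"
    by (rule satI[of _ \<one>]) (use primeideal.one_compl[OF assms(1)] x assms(2) in auto)
qed

lemma sat_sat:
  assumes p: "primeideal p R"
  shows "sat p (sat p N) \<subseteq> sat p N"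
proof
  interpret p: primeideal p R by (rule p)
  fix x assume "x \<in> sat p (sat p N)"
  then obtain c where c: "x \<in> carrier M" "c \<in> carrier R" "c \<in> carrier R - p" "c \<odot>\<^bsub>M\<^esub> x \<in> sat p N" by (rule satE)
  from c(4) obtain e where e: "e \<in> carrier R" "e \<in> carrier R - p" "e \<odot>\<^bsub>M\<^esub> (c \<odot>\<^bsub>M\<^esub> x) \<in> N" by (rule satE)
  show "x \<in> sat p N"
  proof (rule satI[of _ "e \<otimes> c"])
    show "e \<otimes> c \<in> carrier R" "e \<otimes> c \<notin> p" using p.compl_closed[OF e(2) c(3)] by auto
  qed (use c e in \<open>simp_all add: smult_assoc1\<close>)
qed

text \<open>To generate the localization at \<open>p\<close> it suffices to reach a set of generators up to denominators.\<close>

lemma sat_span_least: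
  assumes "primeideal p R" "T \<subseteq> carrier M" "S \<subseteq> sat p (span T)"
  shows "sat p (span S) \<subseteq> sat p (span T)"
  using sat_mono[OF span_is_subset[OF assms(3) sat_submod[OF assms(1) span_is_submodule[OF assms(2)]]], of p]
    sat_sat[OF assms(1)] by (rule subset_trans)

lemma span_insert:
  assumes x: "x \<in> carrier M" and S: "S \<subseteq> carrier M"
  shows "y \<in> span (insert x S) \<longleftrightarrow> (\<exists>a\<in>carrier R. \<exists>s\<in>span S. y = a \<odot>\<^bsub>M\<^esub> x \<oplus>\<^bsub>M\<^esub> s)"
proof
  have xS: "insert x S \<subseteq> carrier M" using x S by simp
  note D = submodD[OF span_is_submodule[OF S]] and E = submodD[OF span_is_submodule[OF xS]]
  show "y \<in> span (insert x S)" if "\<exists>a\<in>carrier R. \<exists>s\<in>span S. y = a \<odot>\<^bsub>M\<^esub> x \<oplus>\<^bsub>M\<^esub> s"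
  proof -
    from that obtain a s where a: "a \<in> carrier R" "s \<in> span S" "y = a \<odot>\<^bsub>M\<^esub> x \<oplus>\<^bsub>M\<^esub> s" by auto
    have "x \<in> span (insert x S)" "s \<in> span (insert x S)"
      using in_own_span[OF xS] span_is_monotone[of S "insert x S"] a(2) by auto
    then show ?thesis unfolding a(3) using E(3,4) a(1) by simp
  qed
  let ?N = "{a \<odot>\<^bsub>M\<^esub> x \<oplus>\<^bsub>M\<^esub> s | a s. a \<in> carrier R \<and> s \<in> span S}"
  have "submod ?N"
  proof (rule submodI)
    show "?N \<subseteq> carrier M" using x D(5) by auto
    have "\<zero>\<^bsub>M\<^esub> = \<zero> \<odot>\<^bsub>M\<^esub> x \<oplus>\<^bsub>M\<^esub> \<zero>\<^bsub>M\<^esub>" using x by simp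
    then show "\<zero>\<^bsub>M\<^esub> \<in> ?N" using D(2) R.zero_closed by blast
  next
    fix u v assume "u \<in> ?N" "v \<in> ?N"
    then obtain a s b t where *: "a \<in> carrier R" "s \<in> span S" "u = a \<odot>\<^bsub>M\<^esub> x \<oplus>\<^bsub>M\<^esub> s"
      "b \<in> carrier R" "t \<in> span S" "v = b \<odot>\<^bsub>M\<^esub> x \<oplus>\<^bsub>M\<^esub> t" by auto
    have "u \<oplus>\<^bsub>M\<^esub> v = (a \<oplus> b) \<odot>\<^bsub>M\<^esub> x \<oplus>\<^bsub>M\<^esub> (s \<oplus>\<^bsub>M\<^esub> t)"
      using * x D(5) by (simp add: smult_l_distr M.a_ac)
    then show "u \<oplus>\<^bsub>M\<^esub> v \<in> ?N" using *(1,2,4,5) D(3) by auto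
  next
    fix b u assume b: "b \<in> carrier R" and "u \<in> ?N"
    then obtain a s where *: "a \<in> carrier R" "s \<in> span S" "u = a \<odot>\<^bsub>M\<^esub> x \<oplus>\<^bsub>M\<^esub> s" by auto
    have "b \<odot>\<^bsub>M\<^esub> u = (b \<otimes> a) \<odot>\<^bsub>M\<^esub> x \<oplus>\<^bsub>M\<^esub> b \<odot>\<^bsub>M\<^esub> s"
      using * x D(5) b by (simp add: smult_r_distr smult_assoc1)
    then show "b \<odot>\<^bsub>M\<^esub> u \<in> ?N" using *(1,2) b D(4) by auto
  qed
  moreover have "insert x S \<subseteq> ?N"
  proof
    fix z assume "z \<in> insert x S"
    then have "z = \<one> \<odot>\<^bsub>M\<^esub> x \<oplus>\<^bsub>M\<^esub> \<zero>\<^bsub>M\<^esub> \<or> (z = \<zero> \<odot>\<^bsub>M\<^esub> x \<oplus>\<^bsub>M\<^esub> z \<and> z \<in> span S)"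
      using x S in_own_span[OF S] by auto
    then show "z \<in> ?N" using D(2) R.zero_closed R.one_closed by blast
  qed
  ultimately have "span (insert x S) \<subseteq> ?N" by (intro span_is_subset)
  then show "\<exists>a\<in>carrier R. \<exists>s\<in>span S. y = a \<odot>\<^bsub>M\<^esub> x \<oplus>\<^bsub>M\<^esub> s" if "y \<in> span (insert x S)"
    using subsetD[OF _ that, of ?N] by blast
qed

text \<open>\<open>m\<close> together with \<open>k\<close> further elements generates the localization at \<open>p\<close>. The least such \<open>k\<close>
  is the dimension of the fibre at \<open>p\<close> of the quotient by \<open>m\<close>.\<close>

definition completed_by :: "'a set \<Rightarrow> 'c set \<Rightarrow> nat \<Rightarrow> bool" where
  "completed_by p m k \<longleftrightarrow>
     (\<exists>X. X \<subseteq> carrier M \<and> finite X \<and> card X \<le> k \<and> sat p (span (m \<union> X)) = carrier M)"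

lemma completed_byI:
  assumes "X \<subseteq> carrier M" "finite X" "card X \<le> k" "carrier M \<subseteq> sat p (span (m \<union> X))"
  shows "completed_by p m k"
  unfolding completed_by_def using assms sat_carrier[of p "span (m \<union> X)"] by (intro exI[of _ X]) simp

lemma completed_by_mono:
  assumes "completed_by p m k" "m \<subseteq> m'" "k \<le> k'"
  shows "completed_by p m' k'"
proof -
  obtain X where X: "X \<subseteq> carrier M" "finite X" "card X \<le> k" "sat p (span (m \<union> X)) = carrier M"
    using assms(1) unfolding completed_by_def by auto
  show ?thesis
    by (rule completed_byI[OF X(1,2)])
      (use X(3,4) assms(2,3) sat_mono[OF span_is_monotone[of "m \<union> X" "m' \<union> X"], of p] in auto)
qed

text \<open>If \<open>Suc k\<close> is the least number of elements that complete \<open>m\<close>, fix \<open>Suc k\<close> such elements and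
  one of them, \<open>x\<close>. The elements whose coefficient at \<open>x\<close> lies in \<open>p\<close> form a proper submodule, by
  minimality: otherwise \<open>x\<close> could be expressed by the others. Any element outside of it has a
  unit as coefficient at \<open>x\<close>, so it can take the place of \<open>x\<close>.\<close>

lemma exchange:
  assumes p: "primeideal p R" and m: "m \<subseteq> carrier M"
    and k: "completed_by p m (Suc k)" "\<not> completed_by p m k"
  obtains N where "submod N" "sat p N \<subseteq> N" "\<And>b y. b \<in> p \<Longrightarrow> y \<in> carrier M \<Longrightarrow> b \<odot>\<^bsub>M\<^esub> y \<in> N"
    "m \<subseteq> N" "N \<noteq> carrier M" "\<And>y. y \<in> carrier M \<Longrightarrow> y \<notin> N \<Longrightarrow> completed_by p (insert y m) k"
proof -
  interpret p: primeideal p R by (rule p)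
  obtain X where X: "X \<subseteq> carrier M" "finite X" "card X \<le> Suc k" "sat p (span (m \<union> X)) = carrier M"
    using k(1) unfolding completed_by_def by auto
  have "\<not> card X \<le> k" using completed_byI[OF X(1,2)] X(4) k(2) by auto
  then have cX: "card X = Suc k" using X(3) by simp
  then obtain x where x: "x \<in> X" by fastforce
  define T where "T = m \<union> (X - {x})"
  have xM: "x \<in> carrier M" and T: "T \<subseteq> carrier M" using x X(1) m by (auto simp: T_def)
  have mX: "m \<union> X = insert x T" using x by (auto simp: T_def)
  have cX': "finite (X - {x})" "card (X - {x}) = k" "X - {x} \<subseteq> carrier M"
    using cX x X(1,2) by auto
  note D = submodD[OF span_is_submodule[OF T]]
  \<comment> \<open>The combinations whose coefficient at \<open>x\<close> lies in \<open>p\<close>; the submodule sought is its saturation.\<close>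
  define N0 where "N0 = {a \<odot>\<^bsub>M\<^esub> x \<oplus>\<^bsub>M\<^esub> s | a s. a \<in> p \<and> s \<in> span T}"
  have sub0: "submod N0"
  proof (rule submodI)
    show "N0 \<subseteq> carrier M" unfolding N0_def using xM D(5) by auto
    have "\<zero>\<^bsub>M\<^esub> = \<zero> \<odot>\<^bsub>M\<^esub> x \<oplus>\<^bsub>M\<^esub> \<zero>\<^bsub>M\<^esub>" using xM by simp
    then show "\<zero>\<^bsub>M\<^esub> \<in> N0" unfolding N0_def using D(2) p.zero_closed by blast
  next
    fix u v assume "u \<in> N0" "v \<in> N0"
    then obtain a s b t where *: "a \<in> p" "s \<in> span T" "u = a \<odot>\<^bsub>M\<^esub> x \<oplus>\<^bsub>M\<^esub> s"
      "b \<in> p" "t \<in> span T" "v = b \<odot>\<^bsub>M\<^esub> x \<oplus>\<^bsub>M\<^esub> t" unfolding N0_def by auto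
    have "u \<oplus>\<^bsub>M\<^esub> v = (a \<oplus> b) \<odot>\<^bsub>M\<^esub> x \<oplus>\<^bsub>M\<^esub> (s \<oplus>\<^bsub>M\<^esub> t)"
      using * xM D(5) p.Icarr by (simp add: smult_l_distr M.a_ac)
    then show "u \<oplus>\<^bsub>M\<^esub> v \<in> N0" unfolding N0_def using *(2,5) p.a_closed[OF *(1,4)] D(3) by auto
  next
    fix b u assume b: "b \<in> carrier R" and "u \<in> N0"
    then obtain a s where *: "a \<in> p" "s \<in> span T" "u = a \<odot>\<^bsub>M\<^esub> x \<oplus>\<^bsub>M\<^esub> s" unfolding N0_def by auto
    have "b \<odot>\<^bsub>M\<^esub> u = (b \<otimes> a) \<odot>\<^bsub>M\<^esub> x \<oplus>\<^bsub>M\<^esub> b \<odot>\<^bsub>M\<^esub> s"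
      using * xM D(5) b p.Icarr by (simp add: smult_r_distr smult_assoc1)
    then show "b \<odot>\<^bsub>M\<^esub> u \<in> N0" unfolding N0_def using *(2) p.I_l_closed[OF *(1) b] b D(4) by auto
  qed
  have T0: "span T \<subseteq> N0"
  proof
    fix s assume s: "s \<in> span T"
    have "s = \<zero> \<odot>\<^bsub>M\<^esub> x \<oplus>\<^bsub>M\<^esub> s" using xM D(5)[OF s] by simp
    then show "s \<in> N0" unfolding N0_def using s p.zero_closed by blast
  qed
  have all: "\<exists>c\<in>carrier R - p. \<exists>a\<in>carrier R. \<exists>s\<in>span T. c \<odot>\<^bsub>M\<^esub> y = a \<odot>\<^bsub>M\<^esub> x \<oplus>\<^bsub>M\<^esub> s"
    if "y \<in> carrier M" for y
  proof -
    have "y \<in> sat p (span (insert x T))" using that X(4) mX by simp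
    then obtain c where "c \<in> carrier R - p" "c \<odot>\<^bsub>M\<^esub> y \<in> span (insert x T)" by (rule satE)
    then show ?thesis unfolding span_insert[OF xM T] by (rule bexI[rotated])
  qed
  show thesis
  proof
    show "submod (sat p N0)" by (rule sat_submod[OF p sub0])
    show "sat p (sat p N0) \<subseteq> sat p N0" by (rule sat_sat[OF p])
    have sub: "N0 \<subseteq> sat p N0" by (rule subset_sat[OF p submodD(1)[OF sub0]])
    show "m \<subseteq> sat p N0" using sub T0 in_own_span[OF T] by (auto simp: T_def)
    show "b \<odot>\<^bsub>M\<^esub> y \<in> sat p N0" if b: "b \<in> p" and y: "y \<in> carrier M" for b y
    proof -
      obtain c a s where c: "c \<in> carrier R - p" "a \<in> carrier R" "s \<in> span T" "c \<odot>\<^bsub>M\<^esub> y = a \<odot>\<^bsub>M\<^esub> x \<oplus>\<^bsub>M\<^esub> s"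
        using all[OF y] by auto
      have bR: "b \<in> carrier R" using b by (rule p.Icarr)
      have "c \<odot>\<^bsub>M\<^esub> (b \<odot>\<^bsub>M\<^esub> y) = b \<odot>\<^bsub>M\<^esub> (c \<odot>\<^bsub>M\<^esub> y)"
        using bR c(1) y by (simp flip: smult_assoc1 add: R.m_comm)
      also have "\<dots> = (b \<otimes> a) \<odot>\<^bsub>M\<^esub> x \<oplus>\<^bsub>M\<^esub> b \<odot>\<^bsub>M\<^esub> s"
        unfolding c(4) using bR c(2) D(5)[OF c(3)] xM by (simp add: smult_r_distr smult_assoc1)
      also have "\<dots> \<in> N0" unfolding N0_def using p.I_r_closed[OF b c(2)] D(4)[OF bR c(3)] by auto
      finally show ?thesis using c(1) bR y by (intro satI[of _ c]) auto
    qed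
    show "sat p N0 \<noteq> carrier M"
    proof
      assume "sat p N0 = carrier M"
      then have "x \<in> sat p N0" using xM by simp
      then obtain c where c: "c \<in> carrier R" "c \<notin> p" "c \<odot>\<^bsub>M\<^esub> x \<in> N0" by (rule satE)
      then obtain a s where as: "a \<in> p" "s \<in> span T" "c \<odot>\<^bsub>M\<^esub> x = a \<odot>\<^bsub>M\<^esub> x \<oplus>\<^bsub>M\<^esub> s"
        unfolding N0_def by auto
      have a: "a \<in> carrier R" using as(1) by (rule p.Icarr)
      have s: "s \<in> carrier M" by (rule D(5)[OF as(2)])
      \<comment> \<open>Since \<open>c - a\<close> is a unit at \<open>p\<close>, the others would generate \<open>x\<close>, against the minimality of \<open>Suc k\<close>.\<close>
      have "c \<ominus> a \<notin> p"
      proof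
        assume "c \<ominus> a \<in> p"
        then have "c \<ominus> a \<oplus> a \<in> p" using as(1) by (rule p.a_closed)
        moreover have "c \<ominus> a \<oplus> a = c" using c(1) a by algebra
        ultimately show False using c(2) by simp
      qed
      moreover have "(c \<ominus> a) \<odot>\<^bsub>M\<^esub> x = s"
      proof -
        have "(c \<ominus> a) \<odot>\<^bsub>M\<^esub> x = c \<odot>\<^bsub>M\<^esub> x \<oplus>\<^bsub>M\<^esub> \<ominus>\<^bsub>M\<^esub> (a \<odot>\<^bsub>M\<^esub> x)"
          unfolding R.minus_eq using c(1) a xM by (simp add: smult_l_distr smult_l_minus)
        also have "\<dots> = s" unfolding as(3) using a xM s
          by (simp add: M.a_comm[of "a \<odot>\<^bsub>M\<^esub> x" s] M.a_assoc M.r_neg)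
        finally show ?thesis .
      qed
      ultimately have "x \<in> sat p (span T)"
        using as(2) c(1) a xM by (intro satI[of _ "c \<ominus> a"]) auto
      then have "insert x T \<subseteq> sat p (span T)"
        using subset_sat[OF p D(1)] in_own_span[OF T] by auto
      then have "carrier M \<subseteq> sat p (span T)"
        using sat_span_least[OF p T, of "insert x T"] X(4) mX by simp
      then have "completed_by p m k"
        using completed_byI[OF cX'(3,1), of k p m] cX'(2) by (simp add: T_def)
      then show False using k(2) by simp
    qed
    fix y assume y: "y \<in> carrier M" "y \<notin> sat p N0"
    obtain c a s where c: "c \<in> carrier R - p" "a \<in> carrier R" "s \<in> span T" "c \<odot>\<^bsub>M\<^esub> y = a \<odot>\<^bsub>M\<^esub> x \<oplus>\<^bsub>M\<^esub> s"
      using all[OF y(1)] by auto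
    have s: "s \<in> carrier M" by (rule D(5)[OF c(3)])
    have "a \<notin> p"
    proof
      assume "a \<in> p"
      then have "c \<odot>\<^bsub>M\<^esub> y \<in> N0" unfolding N0_def using c(3,4) by auto
      then show False using y c(1) satI[of y c p N0] by auto
    qed
    have yT: "insert y T \<subseteq> carrier M" using y T by simp
    note E = submodD[OF span_is_submodule[OF yT]]
    have "y \<in> span (insert y T)" "s \<in> span (insert y T)"
      using in_own_span[OF yT] span_is_monotone[of T "insert y T"] c(3) by auto
    then have "c \<odot>\<^bsub>M\<^esub> y \<ominus>\<^bsub>M\<^esub> s \<in> span (insert y T)"
      using E(4) c(1) by (intro submod_minus span_is_submodule yT) auto
    moreover have "c \<odot>\<^bsub>M\<^esub> y \<ominus>\<^bsub>M\<^esub> s = a \<odot>\<^bsub>M\<^esub> x"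
      unfolding c(4) using c(2) xM s by (simp add: a_minus_def M.a_assoc M.r_neg)
    ultimately have "x \<in> sat p (span (insert y T))"
      using xM c(2) \<open>a \<notin> p\<close> by (intro satI[of _ a]) auto
    then have "insert x T \<subseteq> sat p (span (insert y T))"
      using subset_sat[OF p E(1)] in_own_span[OF yT] by auto
    then have "carrier M \<subseteq> sat p (span (insert y T))"
      using sat_span_least[OF p yT, of "insert x T"] X(4) mX by simp
    moreover have "insert y T = insert y m \<union> (X - {x})" by (auto simp: T_def)
    ultimately show "completed_by p (insert y m) k"
      using completed_byI[OF cX'(3,1), of k p "insert y m"] cX'(2) by simp
  qed
qed

lemma exact_completion:
  assumes "completed_by p m n" "\<not> completed_by p m 0"
  obtains k where "completed_by p m (Suc k)" "\<not> completed_by p m k"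
proof -
  define k where "k = (LEAST k. completed_by p m k)"
  have 1: "completed_by p m k" unfolding k_def using assms(1) by (rule LeastI)
  then have "k \<noteq> 0" using assms(2) by (metis)
  then obtain l where l: "k = Suc l" using not0_implies_Suc by auto
  have "\<not> completed_by p m l"
    using not_less_Least[of l "\<lambda>k. completed_by p m k"] l unfolding k_def by simp
  then show thesis using that[of l] 1 l by simp
qed

text \<open>Nakayama's lemma. If \<open>X\<close> did not generate the localization at \<open>p\<close>, then exchanging would give a
  proper saturated submodule that contains \<open>X\<close> and \<open>p M\<close>. Finite generation makes the least number of
  elements that complete \<open>X\<close> exist.\<close>

lemma nakayama:
  assumes p: "primeideal p R" and X: "X \<subseteq> carrier M" "finite X"
    and Z: "finite Z" "Z \<subseteq> carrier M" "sat p (span Z) = carrier M"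
    and gen: "\<And>N. \<lbrakk>submod N; sat p N \<subseteq> N; \<And>b y. b \<in> p \<Longrightarrow> y \<in> carrier M \<Longrightarrow> b \<odot>\<^bsub>M\<^esub> y \<in> N; X \<subseteq> N\<rbrakk>
      \<Longrightarrow> N = carrier M"
  shows "completed_by p {} (card X)"
proof -
  have c: "completed_by p {} (card Z)"
    by (rule completed_byI[OF Z(2,1)]) (use Z(3) in auto)
  have "completed_by p X 0"
  proof (rule ccontr)
    assume n: "\<not> completed_by p X 0"
    have c': "completed_by p X (card Z)" by (rule completed_by_mono[OF c]) auto
    obtain k where k: "completed_by p X (Suc k)" "\<not> completed_by p X k"
      by (rule exact_completion[OF c' n])
    from exchange[OF p X(1) k] gen show False by metis
  qed
  then have "sat p (span X) = carrier M" unfolding completed_by_def by auto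
  then show ?thesis using completed_byI[OF X, of "card X" p "{}"] by simp
qed

lemma element_of_primes_avoiding_prime:
  assumes p: "primeideal p R" and "finite B" "\<And>q. q \<in> B \<Longrightarrow> ideal q R \<and> \<not> q \<subseteq> p"
  shows "\<exists>a\<in>carrier R - p. \<forall>q\<in>B. a \<in> q"
  using assms(2,3)
proof (induction B rule: finite_induct)
  case empty
  then show ?case using primeideal.one_compl[OF p] by auto
next
  case (insert q B)
  from insert.IH insert.prems obtain a where a: "a \<in> carrier R - p" "\<forall>q\<in>B. a \<in> q" by auto
  from insert.prems[of q] obtain b where b: "b \<in> q" "b \<notin> p" and q: "ideal q R" by auto
  have bR: "b \<in> carrier R" by (rule ideal.Icarr[OF q b(1)])
  have "a \<otimes> b \<in> carrier R - p" using primeideal.compl_closed[OF p a(1)] b(2) bR by simp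
  moreover have "a \<otimes> b \<in> q" using ideal.I_l_closed[OF q b(1)] a(1) by simp
  moreover have "a \<otimes> b \<in> q'" if "q' \<in> B" for q'
    using ideal.I_r_closed[of q' R a b] insert.prems[of q'] that a(2) bR by simp
  ultimately show ?case by auto
qed

text \<open>Correct a solution for the other primes at a minimal prime \<open>p\<close> of the finite set: add a multiple
  of an element good at \<open>p\<close>, with a coefficient that lies in all the other primes but not in \<open>p\<close>.\<close>

lemma avoid_submodules:
  assumes "finite B"
    and "\<And>p. p \<in> B \<Longrightarrow> primeideal p R \<and> submod (N p) \<and> sat p (N p) \<subseteq> N p \<and> N p \<noteq> carrier M \<and>
      (\<forall>b\<in>p. \<forall>y\<in>carrier M. b \<odot>\<^bsub>M\<^esub> y \<in> N p)"
  shows "\<exists>y\<in>carrier M. \<forall>p\<in>B. y \<notin> N p"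
  using assms
proof (induction "card B" arbitrary: B)
  case 0
  then show ?case using M.zero_closed by auto
next
  case (Suc n)
  have "B \<noteq> {}" using Suc.hyps(2) by auto
  from finite_has_minimal[OF Suc.prems(1) this] obtain p where
    p: "p \<in> B" and min: "\<And>q. q \<in> B \<Longrightarrow> q \<subseteq> p \<Longrightarrow> q = p" by metis
  define B' where "B' = B - {p}"
  have B': "n = card B'" "finite B'" "\<And>q. q \<in> B' \<Longrightarrow> q \<in> B" "B = insert p B'" "p \<notin> B'"
    using Suc.hyps(2) Suc.prems(1) p by (auto simp: B'_def)
  have P: "primeideal p R" "submod (N p)" "sat p (N p) \<subseteq> N p" "N p \<noteq> carrier M"
    "\<And>b y. b \<in> p \<Longrightarrow> y \<in> carrier M \<Longrightarrow> b \<odot>\<^bsub>M\<^esub> y \<in> N p"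
    using Suc.prems(2)[OF p] by auto
  obtain y where y: "y \<in> carrier M" "\<And>q. q \<in> B' \<Longrightarrow> y \<notin> N q"
    using Suc.hyps(1)[OF B'(1,2)] Suc.prems(2) B'(3) by meson
  show ?case
  proof (cases "y \<in> N p")
    case False
    then show ?thesis using y B'(4) by auto
  next
    case True
    obtain y' where y': "y' \<in> carrier M" "y' \<notin> N p"
      using P(4) submodD(1)[OF P(2)] by auto
    have "\<exists>a\<in>carrier R - p. \<forall>q\<in>B'. a \<in> q"
    proof (rule element_of_primes_avoiding_prime[OF P(1) B'(2)])
      fix q assume q: "q \<in> B'"
      then have "q \<noteq> p" "q \<in> B" using B'(3,5) by auto
      then show "ideal q R \<and> \<not> q \<subseteq> p" using min Suc.prems(2) primeideal.axioms(1) by metis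
    qed
    then obtain a where a: "a \<in> carrier R" "a \<notin> p" "\<And>q. q \<in> B' \<Longrightarrow> a \<in> q" by auto
    let ?z = "y \<oplus>\<^bsub>M\<^esub> a \<odot>\<^bsub>M\<^esub> y'"
    have ay: "a \<odot>\<^bsub>M\<^esub> y' \<in> carrier M" using a y' by simp
    have cancel: "?z \<ominus>\<^bsub>M\<^esub> y = a \<odot>\<^bsub>M\<^esub> y'" "?z \<ominus>\<^bsub>M\<^esub> a \<odot>\<^bsub>M\<^esub> y' = y"
      subgoal using y(1) ay by (subst M.a_comm) (simp_all add: a_minus_def M.a_assoc M.r_neg)
      subgoal using y(1) ay by (simp add: a_minus_def M.a_assoc M.r_neg)
      done
    have "?z \<notin> N p"
    proof
      assume "?z \<in> N p"
      then have "a \<odot>\<^bsub>M\<^esub> y' \<in> N p" using submod_minus[OF P(2) _ True] cancel(1) by metis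
      then have "y' \<in> sat p (N p)" using a y' by (intro satI[of _ a]) auto
      then show False using P(3) y'(2) by auto
    qed
    moreover have "?z \<notin> N q" if q: "q \<in> B'" for q
    proof
      assume z: "?z \<in> N q"
      have Q: "submod (N q)" "a \<odot>\<^bsub>M\<^esub> y' \<in> N q"
        using Suc.prems(2)[OF B'(3)[OF q]] a(3)[OF q] y'(1) by auto
      then show False using submod_minus[OF Q(1) z Q(2)] cancel(2) y(2)[OF q] by simp
    qed
    ultimately show ?thesis using y(1) ay B'(4) by (intro bexI[of _ ?z]) auto
  qed
qed

text \<open>The finitely many generators of the module have a common denominator with respect to a set that
  generates at \<open>p\<close>.\<close>

lemma completion_open:
  assumes Z: "finite Z" "Z \<subseteq> carrier M" "span Z = carrier M"
    and m: "m \<subseteq> carrier M" and p: "primeideal p R" and k: "completed_by p m k"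
  shows "\<exists>c\<in>carrier R - p. \<forall>q. primeideal q R \<and> c \<notin> q \<longrightarrow> completed_by q m k"
proof -
  obtain X where X: "X \<subseteq> carrier M" "finite X" "card X \<le> k" "sat p (span (m \<union> X)) = carrier M"
    using k unfolding completed_by_def by auto
  have mX: "m \<union> X \<subseteq> carrier M" using m X(1) by auto
  note D = submodD[OF span_is_submodule[OF mX]]
  have "\<exists>c\<in>carrier R - p. \<forall>z\<in>Z. c \<odot>\<^bsub>M\<^esub> z \<in> span (m \<union> X)" using Z(1,2)
  proof (induction Z rule: finite_induct)
    case empty
    then show ?case using primeideal.one_compl[OF p] by auto
  next
    case (insert z Z)
    then obtain c where c: "c \<in> carrier R - p" "\<forall>z\<in>Z. c \<odot>\<^bsub>M\<^esub> z \<in> span (m \<union> X)" by auto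
    have zM: "z \<in> carrier M" "Z \<subseteq> carrier M" using insert.prems by auto
    then have "z \<in> sat p (span (m \<union> X))" using X(4) by simp
    then obtain e where e: "e \<in> carrier R - p" "e \<odot>\<^bsub>M\<^esub> z \<in> span (m \<union> X)" by (rule satE)
    have "(c \<otimes> e) \<odot>\<^bsub>M\<^esub> w = c \<odot>\<^bsub>M\<^esub> (e \<odot>\<^bsub>M\<^esub> w)" "(c \<otimes> e) \<odot>\<^bsub>M\<^esub> w = e \<odot>\<^bsub>M\<^esub> (c \<odot>\<^bsub>M\<^esub> w)"
      if "w \<in> carrier M" for w
      using that c(1) e(1) by (simp_all add: smult_assoc1[symmetric] R.m_comm[of e c])
    then have "\<forall>w\<in>insert z Z. (c \<otimes> e) \<odot>\<^bsub>M\<^esub> w \<in> span (m \<union> X)"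
      using D(4) c e zM by (metis DiffD1 insert_iff subsetD)
    then show ?case using primeideal.compl_closed[OF p c(1) e(1)] by (rule bexI)
  qed
  then obtain c where c: "c \<in> carrier R - p" "\<forall>z\<in>Z. c \<odot>\<^bsub>M\<^esub> z \<in> span (m \<union> X)" by auto
  have "completed_by q m k" if q: "primeideal q R" "c \<notin> q" for q
  proof (rule completed_byI[OF X(1-3)])
    have "Z \<subseteq> sat q (span (m \<union> X))"
      using Z(2) c q(2) by (auto intro!: satI[of _ c])
    then have "sat q (span Z) \<subseteq> sat q (span (m \<union> X))" by (rule sat_span_least[OF q(1) mX])
    then show "carrier M \<subseteq> sat q (span (m \<union> X))" using subset_sat[OF q(1), of "carrier M"] Z(3) by auto
  qed
  then show ?thesis using c(1) by auto
qed

end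

section \<open>Elements generating a module up to a given codimension\<close>

text \<open>The chain is indexed downwards from \<open>q\<close>. Its existence says that \<open>q\<close> has height at least \<open>c\<close> in the
  quotient by \<open>P\<close>.\<close>

definition prime_chain :: "('a, 'b) ring_scheme \<Rightarrow> 'a set \<Rightarrow> 'a set \<Rightarrow> nat \<Rightarrow> bool" where
  "prime_chain R P q c \<longleftrightarrow>
     (\<exists>C. C 0 = q \<and> (\<forall>i\<le>c. primeideal (C i) R \<and> P \<subseteq> C i) \<and> (\<forall>i<c. C (Suc i) \<subset> C i))"

lemma prime_chain_0: "primeideal q R \<Longrightarrow> P \<subseteq> q \<Longrightarrow> prime_chain R P q 0"
  unfolding prime_chain_def by (rule exI[of _ "\<lambda>i. q"]) simp

lemma prime_chain_Suc:
  assumes "prime_chain R P q' c" "primeideal q R" "q' \<subset> q"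
  shows "prime_chain R P q (Suc c)"
proof -
  obtain C where C: "C 0 = q'" "\<And>i. i \<le> c \<Longrightarrow> primeideal (C i) R \<and> P \<subseteq> C i"
    "\<And>i. i < c \<Longrightarrow> C (Suc i) \<subset> C i"
    using assms(1) unfolding prime_chain_def by auto
  have "P \<subseteq> q" using C(1) C(2)[of 0] assms(3) by auto
  then show ?thesis unfolding prime_chain_def using C assms(2,3)
    by (intro exI[of _ "\<lambda>i. case i of 0 \<Rightarrow> q | Suc i \<Rightarrow> C i"]) (auto split: nat.split)
qed

locale noetherian_module = noetherian_cring R + module R M
  for R :: "('a, 'b) ring_scheme" (structure) and M :: "('a, 'c, 'd) module_scheme" (structure)
begin

lemma incomplete_locus_closed:
  assumes Z: "finite Z" "Z \<subseteq> carrier M" "span Z = carrier M" and m: "m \<subseteq> carrier M"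
  obtains J where "ideal J R" "\<And>q. primeideal q R \<Longrightarrow> J \<subseteq> q \<longleftrightarrow> \<not> completed_by q m k"
proof -
  define S where "S = {c \<in> carrier R. \<forall>q. primeideal q R \<and> c \<notin> q \<longrightarrow> completed_by q m k}"
  have S: "S \<subseteq> carrier R" by (auto simp: S_def)
  have "S \<subseteq> q \<longleftrightarrow> \<not> completed_by q m k" if q: "primeideal q R" for q
  proof
    assume "S \<subseteq> q"
    show "\<not> completed_by q m k"
    proof
      assume "completed_by q m k"
      from completion_open[OF Z m q this] obtain c where "c \<in> S" "c \<notin> q" unfolding S_def by auto
      then show False using \<open>S \<subseteq> q\<close> by auto
    qed
  next
    assume "\<not> completed_by q m k"
    then show "S \<subseteq> q" using q unfolding S_def by auto
  qed
  then have "Idl S \<subseteq> q \<longleftrightarrow> \<not> completed_by q m k" if "primeideal q R" for q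
    using Idl_subset_ideal[OF primeideal.axioms(1)[OF that] S] that by simp
  then show thesis using that[of "Idl S"] genideal_ideal[OF S] by simp
qed

text \<open>The induction behind the theorem. Call the least \<open>k\<close> for which \<open>m\<close> is completed by \<open>k\<close>
  elements the defect at \<open>q\<close>. With \<open>j\<close> elements chosen, the locus where the defect
  exceeds \<open>k\<close> has codimension at least \<open>j + k + 1 - n\<close>. There are finitely many minimal primes
  of these loci, and an element outside finitely many proper submodules lowers the defect at
  all of them. A prime where the new defect still exceeds \<open>k\<close> then either lies strictly above a
  minimal prime of the old locus, or it is such a prime, and then its old defect exceeded
  \<open>k + 1\<close>; both ways the bound improves by one.\<close>

lemma elements_of_bounded_defect:
  assumes Z: "finite Z" "Z \<subseteq> carrier M" "span Z = carrier M"
    and rank: "\<And>p. primeideal p R \<Longrightarrow> completed_by p {} n"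
    and F: "finite F" "\<And>P. P \<in> F \<Longrightarrow> primeideal P R"
  shows "\<exists>m. m \<subseteq> carrier M \<and> finite m \<and> card m \<le> j \<and>
    (\<forall>k. \<forall>P\<in>F. \<forall>q. primeideal q R \<and> P \<subseteq> q \<and> \<not> completed_by q m k \<longrightarrow>
       (\<forall>c. c + n \<le> j + k + 1 \<longrightarrow> prime_chain R P q c))"
proof (induction j)
  case 0
  have "prime_chain R P q c"
    if "primeideal q R" "P \<subseteq> q" "\<not> completed_by q {} k" "c + n \<le> 0 + k + 1" for k P q c
  proof -
    have "k < n"
      using completed_by_mono[OF rank[OF that(1)] subset_refl, of k] that(3) by (cases "n \<le> k") auto
    then have "c = 0" using that(4) by simp
    then show ?thesis using prime_chain_0 that(1,2) by metis
  qed
  then show ?case by (intro exI[of _ "{}"]) auto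
next
  case (Suc j)
  then obtain m where m: "m \<subseteq> carrier M" "finite m" "card m \<le> j"
    and IH: "\<And>k P q c. \<lbrakk>P \<in> F; primeideal q R; P \<subseteq> q; \<not> completed_by q m k; c + n \<le> j + k + 1\<rbrakk>
      \<Longrightarrow> prime_chain R P q c" by metis
  have rank': "completed_by p m n" if "primeideal p R" for p
    by (rule completed_by_mono[OF rank[OF that]]) auto
  have "\<exists>G. finite G \<and> (\<forall>q\<in>G. primeideal q R \<and> \<not> completed_by q m k \<and> P \<subseteq> q) \<and>
      (\<forall>q. primeideal q R \<and> P \<subseteq> q \<and> \<not> completed_by q m k \<longrightarrow> (\<exists>q'\<in>G. q' \<subseteq> q))"
    if P: "P \<in> F" for P k
  proof -
    obtain J where J: "ideal J R" "\<And>q. primeideal q R \<Longrightarrow> J \<subseteq> q \<longleftrightarrow> \<not> completed_by q m k"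
      by (rule incomplete_locus_closed[OF Z m(1), of k], rule that)
    have JP: "J \<union> P \<subseteq> carrier R"
      using ideal.Icarr[OF J(1)] ideal.Icarr[OF primeideal.axioms(1)[OF F(2)[OF P]]] by auto
    have iff: "Idl (J \<union> P) \<subseteq> q \<longleftrightarrow> P \<subseteq> q \<and> \<not> completed_by q m k" if "primeideal q R" for q
      using Idl_subset_ideal[OF primeideal.axioms(1)[OF that] JP] J(2)[OF that] by auto
    obtain G where G: "finite G" "\<And>q. q \<in> G \<Longrightarrow> primeideal q R" "\<And>q. q \<in> G \<Longrightarrow> Idl (J \<union> P) \<subseteq> q"
      "\<And>q. primeideal q R \<Longrightarrow> Idl (J \<union> P) \<subseteq> q \<Longrightarrow> \<exists>q'\<in>G. q' \<subseteq> q"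
      by (rule finitely_many_primes_over[OF genideal_ideal[OF JP]], rule that)
    then show ?thesis using iff by (intro exI[of _ G]) simp
  qed
  then obtain G where G: "\<And>P k. P \<in> F \<Longrightarrow> finite (G P k)"
    "\<And>P k q. P \<in> F \<Longrightarrow> q \<in> G P k \<Longrightarrow> primeideal q R \<and> \<not> completed_by q m k \<and> P \<subseteq> q"
    "\<And>P k q. P \<in> F \<Longrightarrow> primeideal q R \<Longrightarrow> P \<subseteq> q \<Longrightarrow> \<not> completed_by q m k \<Longrightarrow> \<exists>q'\<in>G P k. q' \<subseteq> q"
    by metis
  \<comment> \<open>Beyond \<open>n\<close> the loci are empty, so finitely many primes have to be treated.\<close>
  define B where "B = (\<Union>P\<in>F. \<Union>k<n. G P k)"
  have finB: "finite B" unfolding B_def using F(1) G(1) by auto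
  have B: "primeideal q R \<and> \<not> completed_by q m 0" if "q \<in> B" for q
    using that G(2) completed_by_mono[OF _ subset_refl, of q m 0] unfolding B_def by fastforce
  have "\<exists>Nk. case Nk of (N, k) \<Rightarrow> submod N \<and> sat q N \<subseteq> N \<and> (\<forall>b\<in>q. \<forall>y\<in>carrier M. b \<odot>\<^bsub>M\<^esub> y \<in> N) \<and> N \<noteq> carrier M \<and>
      \<not> completed_by q m k \<and> (\<forall>y\<in>carrier M. y \<notin> N \<longrightarrow> completed_by q (insert y m) k)"
    if "q \<in> B" for q
  proof -
    have q: "primeideal q R" "\<not> completed_by q m 0" using B[OF that] by auto
    obtain k where k: "completed_by q m (Suc k)" "\<not> completed_by q m k"
      by (rule exact_completion[OF rank'[OF q(1)] q(2)])
    obtain N where "submod N" "sat q N \<subseteq> N" "\<And>b y. b \<in> q \<Longrightarrow> y \<in> carrier M \<Longrightarrow> b \<odot>\<^bsub>M\<^esub> y \<in> N"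
      "m \<subseteq> N" "N \<noteq> carrier M" "\<And>y. y \<in> carrier M \<Longrightarrow> y \<notin> N \<Longrightarrow> completed_by q (insert y m) k"
      by (rule exchange[OF q(1) m(1) k], rule that)
    then show ?thesis using k(2) by (intro exI[of _ "(N, k)"]) simp
  qed
  then have "\<exists>f. \<forall>q\<in>B. case f q of (N, k) \<Rightarrow> submod N \<and> sat q N \<subseteq> N \<and>
      (\<forall>b\<in>q. \<forall>y\<in>carrier M. b \<odot>\<^bsub>M\<^esub> y \<in> N) \<and> N \<noteq> carrier M \<and>
      \<not> completed_by q m k \<and> (\<forall>y\<in>carrier M. y \<notin> N \<longrightarrow> completed_by q (insert y m) k)"
    by (intro bchoice ballI)
  then obtain f where f: "\<forall>q\<in>B. case f q of (N, k) \<Rightarrow> submod N \<and> sat q N \<subseteq> N \<and>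
      (\<forall>b\<in>q. \<forall>y\<in>carrier M. b \<odot>\<^bsub>M\<^esub> y \<in> N) \<and> N \<noteq> carrier M \<and>
      \<not> completed_by q m k \<and> (\<forall>y\<in>carrier M. y \<notin> N \<longrightarrow> completed_by q (insert y m) k)"
    by (elim exE)
  define N where "N q = fst (f q)" for q
  define \<kappa> where "\<kappa> q = snd (f q)" for q
  have N: "\<And>q. q \<in> B \<Longrightarrow> submod (N q)" "\<And>q. q \<in> B \<Longrightarrow> sat q (N q) \<subseteq> N q"
      "\<And>q. q \<in> B \<Longrightarrow> \<forall>b\<in>q. \<forall>y\<in>carrier M. b \<odot>\<^bsub>M\<^esub> y \<in> N q" "\<And>q. q \<in> B \<Longrightarrow> N q \<noteq> carrier M"
    and \<kappa>: "\<And>q. q \<in> B \<Longrightarrow> \<not> completed_by q m (\<kappa> q)"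
      "\<And>q y. q \<in> B \<Longrightarrow> y \<in> carrier M \<Longrightarrow> y \<notin> N q \<Longrightarrow> completed_by q (insert y m) (\<kappa> q)"
    using f unfolding N_def \<kappa>_def case_prod_beta by simp_all
  have "\<exists>y\<in>carrier M. \<forall>q\<in>B. y \<notin> N q"
    by (rule avoid_submodules[OF finB]) (simp add: N B)
  then obtain y where y: "y \<in> carrier M" "\<And>q. q \<in> B \<Longrightarrow> y \<notin> N q" by auto
  have "prime_chain R P q c"
    if *: "P \<in> F" "primeideal q R" "P \<subseteq> q" "\<not> completed_by q (insert y m) k" "c + n \<le> Suc j + k + 1"
    for k P q c
  proof (cases c)
    case 0
    then show ?thesis using prime_chain_0[OF *(2,3)] by simp
  next
    case (Suc c')
    have nm: "\<not> completed_by q m k" using *(4) completed_by_mono[of q m k "insert y m" k] by auto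
    then have "k < n"
      using completed_by_mono[OF rank'[OF *(2)] subset_refl, of k] by (cases "n \<le> k") auto
    obtain q' where q': "q' \<in> G P k" "q' \<subseteq> q" using G(3)[OF *(1-3) nm] by auto
    show ?thesis
    proof (cases "q' = q")
      case False
      have "prime_chain R P q' c'"
        by (rule IH[of P q' k]) (use G(2)[OF *(1) q'(1)] *(1,5) Suc in auto)
      from prime_chain_Suc[OF this *(2)] show ?thesis using False q'(2) Suc by auto
    next
      case True
      then have qB: "q \<in> B" using q'(1) *(1) \<open>k < n\<close> by (auto simp: B_def)
      have "k < \<kappa> q"
        using completed_by_mono[OF \<kappa>(2)[OF qB y(1) y(2)[OF qB]] subset_refl, of k] *(4)
        by (cases "\<kappa> q \<le> k") auto
      then have "\<not> completed_by q m (Suc k)"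
        using completed_by_mono[of q m "Suc k" m "\<kappa> q"] \<kappa>(1)[OF qB] by auto
      then show ?thesis using IH[OF *(1-3), of "Suc k" c] *(5) by simp
    qed
  qed
  moreover have "insert y m \<subseteq> carrier M" "finite (insert y m)" "card (insert y m) \<le> Suc j"
    using m y(1) card_insert_le_m1[of "Suc j" m y] by auto
  ultimately show ?case by (intro exI[of _ "insert y m"]) auto
qed

end

section \<open>Codimension and chains of primes\<close>

definition prime_locus :: "('a, 'b) ring_scheme \<Rightarrow> 'a set \<Rightarrow> 'a set set" where
  "prime_locus R J = {p. primeideal p R \<and> J \<subseteq> p}"

lemma closedin_zariski:
  "closedin (zariski R) K \<longleftrightarrow> (\<exists>S. S \<subseteq> carrier R \<and> K = prime_locus R S)"
proof
  assume "closedin (zariski R) K"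
  then have K: "K \<subseteq> {p. primeideal p R}" "openin (zariski R) ({p. primeideal p R} - K)"
    by (auto simp: closedin_def topspace_zariski)
  then obtain S where S: "S \<subseteq> carrier R" "{p. primeideal p R} - K = {p. primeideal p R \<and> \<not> S \<subseteq> p}"
    unfolding openin_zariski by auto
  have "K = {p. primeideal p R} - ({p. primeideal p R} - K)" using K(1) by auto
  also have "\<dots> = prime_locus R S" unfolding S(2) prime_locus_def by auto
  finally show "\<exists>S. S \<subseteq> carrier R \<and> K = prime_locus R S" using S(1) by auto
next
  assume "\<exists>S. S \<subseteq> carrier R \<and> K = prime_locus R S"
  then obtain S where S: "S \<subseteq> carrier R" "K = prime_locus R S" by auto
  have "{p. primeideal p R} - K = {p. primeideal p R \<and> \<not> S \<subseteq> p}"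
    unfolding S(2) prime_locus_def by auto
  then show "closedin (zariski R) K"
    using S unfolding closedin_def topspace_zariski openin_zariski by (auto simp: prime_locus_def)
qed

lemma irreducible_prime_locus:
  assumes "primeideal q R"
  shows "irreducible_subset (zariski R) (prime_locus R q)"
proof -
  have sub: "prime_locus R q \<subseteq> topspace (zariski R)"
    by (auto simp: prime_locus_def topspace_zariski)
  then have top: "topspace (subtopology (zariski R) (prime_locus R q)) = prime_locus R q"
    by auto
  have q: "q \<in> prime_locus R q" using assms by (simp add: prime_locus_def)
  have all: "A = prime_locus R q"
    if A: "closedin (subtopology (zariski R) (prime_locus R q)) A" "q \<in> A" for A
  proof -
    obtain K where K: "closedin (zariski R) K" "A = K \<inter> prime_locus R q"
      using A(1) unfolding closedin_subtopology by auto
    then obtain S where "K = prime_locus R S" unfolding closedin_zariski by auto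
    then have "prime_locus R q \<subseteq> K" using A(2) K(2) unfolding prime_locus_def by auto
    then show ?thesis using K(2) by auto
  qed
  show ?thesis unfolding irreducible_subset_def irreducible_space_def top
  proof (intro conjI allI impI sub)
    show "prime_locus R q \<noteq> {}" using q by auto
    fix A B assume *: "closedin (subtopology (zariski R) (prime_locus R q)) A \<and>
      closedin (subtopology (zariski R) (prime_locus R q)) B \<and> A \<union> B = prime_locus R q"
    then have "q \<in> A \<or> q \<in> B" using q by blast
    then show "A = prime_locus R q \<or> B = prime_locus R q" using all * by blast
  qed
qed

lemma irreducible_space_finite_cover:
  assumes "irreducible_space T" "finite I" "\<And>i. i \<in> I \<Longrightarrow> closedin T (C i)" "topspace T = (\<Union>i\<in>I. C i)"
  shows "\<exists>i\<in>I. C i = topspace T"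
  using assms(2-4)
proof (induction I rule: finite_induct)
  case empty
  then show ?case using assms(1) by (simp add: irreducible_space_def)
next
  case (insert i I)
  have c: "closedin T (C i)" "closedin T (\<Union>i\<in>I. C i)"
    using insert.prems(1) insert.hyps(1) by (auto intro!: closedin_Union)
  have "C i \<union> (\<Union>i\<in>I. C i) = topspace T" using insert.prems(2) by auto
  then have "C i = topspace T \<or> (\<Union>i\<in>I. C i) = topspace T"
    using assms(1) c unfolding irreducible_space_def by metis
  then show ?case
  proof
    assume "(\<Union>i\<in>I. C i) = topspace T"
    then show ?thesis using insert.IH insert.prems(1) by auto
  qed auto
qed

context noetherian_cring
begin

text \<open>An irreducible set covered by finitely many closed sets lies in one of them; a component is then
  equal to it by maximality.\<close>

lemma irreducible_component_of_prime_locus: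
  assumes J: "ideal J R"
    and G: "finite G" "\<And>q. q \<in> G \<Longrightarrow> primeideal q R" "\<And>q. q \<in> G \<Longrightarrow> J \<subseteq> q"
      "\<And>p. primeideal p R \<Longrightarrow> J \<subseteq> p \<Longrightarrow> \<exists>q\<in>G. q \<subseteq> p"
    and Z: "Z \<in> irreducible_components (subtopology (zariski R) (prime_locus R J))"
  shows "\<exists>q\<in>G. Z = prime_locus R q"
proof -
  let ?S = "subtopology (zariski R) (prime_locus R J)"
  have JR: "J \<subseteq> carrier R" using ideal.Icarr[OF J] by auto
  have topS: "topspace ?S = prime_locus R J"
    by (auto simp: prime_locus_def topspace_zariski)
  have Zirr: "irreducible_subset ?S Z" and max: "\<And>Z'. irreducible_subset ?S Z' \<Longrightarrow> Z \<subseteq> Z' \<Longrightarrow> Z' = Z"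
    using Z unfolding irreducible_components_def by auto
  have ZJ: "Z \<subseteq> prime_locus R J" and Zsp: "irreducible_space (subtopology ?S Z)"
    using Zirr topS unfolding irreducible_subset_def by auto
  have topZ: "topspace (subtopology ?S Z) = Z" using ZJ topS by auto
  have sub: "subtopology ?S A = subtopology (zariski R) A" if "A \<subseteq> prime_locus R J" for A
    using that by (simp add: subtopology_subtopology inf_absorb2)
  have "\<exists>q\<in>G. Z \<inter> prime_locus R q = topspace (subtopology ?S Z)"
  proof (rule irreducible_space_finite_cover[OF Zsp G(1)])
    fix q assume q: "q \<in> G"
    have "q \<subseteq> carrier R" using ideal.Icarr[OF primeideal.axioms(1)[OF G(2)[OF q]]] by auto
    then have "closedin (zariski R) (prime_locus R q)" unfolding closedin_zariski by auto
    then show "closedin (subtopology ?S Z) (Z \<inter> prime_locus R q)"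
      unfolding sub[OF ZJ] closedin_subtopology by auto
  next
    have "Z \<subseteq> (\<Union>q\<in>G. prime_locus R q)"
    proof
      fix p assume "p \<in> Z"
      then have p: "primeideal p R" "J \<subseteq> p" using ZJ unfolding prime_locus_def by auto
      from G(4)[OF this] obtain q where "q \<in> G" "q \<subseteq> p" by (elim bexE)
      then show "p \<in> (\<Union>q\<in>G. prime_locus R q)" using p(1) unfolding prime_locus_def by auto
    qed
    then show "topspace (subtopology ?S Z) = (\<Union>q\<in>G. Z \<inter> prime_locus R q)" unfolding topZ by auto
  qed
  then obtain q where q: "q \<in> G" "Z \<inter> prime_locus R q = Z" unfolding topZ by (elim bexE)
  then have q: "q \<in> G" "Z \<subseteq> prime_locus R q" by auto
  have qJ: "prime_locus R q \<subseteq> prime_locus R J" using G(3)[OF q(1)] unfolding prime_locus_def by auto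
  have "irreducible_subset ?S (prime_locus R q)"
    using irreducible_prime_locus[OF G(2)[OF q(1)]] qJ
    unfolding irreducible_subset_def sub[OF qJ] topS by simp
  from max[OF this q(2)] show ?thesis using q(1) by auto
qed

text \<open>The irreducible components of the spectrum and of its closed subsets are loci of primes, so
  chains of primes give the chains of irreducible sets that bound the codimension below.\<close>

lemma codim_greaterI:
  assumes Y: "closedin (zariski R) Y"
    and F: "finite F" "\<And>P. P \<in> F \<Longrightarrow> primeideal P R" "\<And>p. primeideal p R \<Longrightarrow> \<exists>P\<in>F. P \<subseteq> p"
    and chains: "\<And>P q. P \<in> F \<Longrightarrow> q \<in> Y \<Longrightarrow> P \<subseteq> q \<Longrightarrow> prime_chain R P q (Suc d)"
  shows "codim Y (zariski R) > enat d"
proof -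
  obtain S where S: "S \<subseteq> carrier R" "Y = prime_locus R S" using Y unfolding closedin_zariski by auto
  have "enat (Suc d) \<le> irreducible_codim Y' (subtopology (zariski R) X')"
    if X': "X' \<in> irreducible_components (zariski R)"
      and Y': "Y' \<in> irreducible_components (subtopology (zariski R) (Y \<inter> X'))" for X' Y'
  proof -
    have zero: "{\<zero>} \<subseteq> p" if "primeideal p R" for p
      using additive_subgroup.zero_closed[OF ideal.axioms(1)[OF primeideal.axioms(1)[OF that]]] by simp
    have "prime_locus R {\<zero>} = topspace (zariski R)"
      using zero by (auto simp: prime_locus_def topspace_zariski)
    then have "subtopology (zariski R) (prime_locus R {\<zero>}) = zariski R" by simp
    then have "\<exists>q\<in>F. X' = prime_locus R q"
      using irreducible_component_of_prime_locus[OF zeroideal F(1,2) zero[OF F(2)] F(3)] X' by simp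
    then obtain P where P: "P \<in> F" "X' = prime_locus R P" by auto
    have SP: "S \<union> P \<subseteq> carrier R"
      using S(1) ideal.Icarr[OF primeideal.axioms(1)[OF F(2)[OF P(1)]]] by auto
    have iff: "Idl (S \<union> P) \<subseteq> q \<longleftrightarrow> S \<subseteq> q \<and> P \<subseteq> q" if "primeideal q R" for q
      using Idl_subset_ideal[OF primeideal.axioms(1)[OF that] SP] by simp
    have YX: "Y \<inter> X' = prime_locus R (Idl (S \<union> P))"
      unfolding S(2) P(2) prime_locus_def using iff by auto
    obtain G where G: "finite G" "\<And>q. q \<in> G \<Longrightarrow> primeideal q R" "\<And>q. q \<in> G \<Longrightarrow> Idl (S \<union> P) \<subseteq> q"
      "\<And>q. primeideal q R \<Longrightarrow> Idl (S \<union> P) \<subseteq> q \<Longrightarrow> \<exists>q'\<in>G. q' \<subseteq> q"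
      by (rule finitely_many_primes_over[OF genideal_ideal[OF SP]], rule that)
    obtain q where q: "q \<in> G" "Y' = prime_locus R q"
      using irreducible_component_of_prime_locus[OF genideal_ideal[OF SP] G] Y' unfolding YX by auto
    have "q \<in> Y" "P \<subseteq> q"
      using G(2,3)[OF q(1)] iff[OF G(2)[OF q(1)]] unfolding S(2) prime_locus_def by auto
    from chains[OF P(1) this] obtain C where C: "C 0 = q"
      "\<And>i. i \<le> Suc d \<Longrightarrow> primeideal (C i) R" "\<And>i. i \<le> Suc d \<Longrightarrow> P \<subseteq> C i"
      "\<And>i. i < Suc d \<Longrightarrow> C (Suc i) \<subset> C i"
      unfolding prime_chain_def by auto
    have "closedin (subtopology (zariski R) X') (prime_locus R (C i)) \<and>
        irreducible_subset (subtopology (zariski R) X') (prime_locus R (C i))" if i: "i \<le> Suc d" for i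
    proof
      have sub: "prime_locus R (C i) \<subseteq> X'" using C(3)[OF i] unfolding P(2) prime_locus_def by auto
      have "C i \<subseteq> carrier R" using ideal.Icarr[OF primeideal.axioms(1)[OF C(2)[OF i]]] by auto
      then have "closedin (zariski R) (prime_locus R (C i))" unfolding closedin_zariski by auto
      then show "closedin (subtopology (zariski R) X') (prime_locus R (C i))"
        unfolding closedin_subtopology using sub by auto
      show "irreducible_subset (subtopology (zariski R) X') (prime_locus R (C i))"
        using irreducible_prime_locus[OF C(2)[OF i]] sub
        by (simp add: irreducible_subset_def subtopology_subtopology inf_absorb2)
    qed
    moreover have "prime_locus R (C i) \<subset> prime_locus R (C (Suc i))" if i: "i < Suc d" for i
    proof -
      have "C (Suc i) \<in> prime_locus R (C (Suc i))" "C (Suc i) \<notin> prime_locus R (C i)"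
        using C(2)[of "Suc i"] C(4)[OF i] i unfolding prime_locus_def by auto
      then show ?thesis using C(4)[OF i] unfolding prime_locus_def by auto
    qed
    ultimately show ?thesis
      unfolding irreducible_codim_def q(2) using C(1)
      by (intro Sup_upper CollectI exI[of _ "Suc d"] conjI exI[of _ "\<lambda>i. prime_locus R (C i)"]) auto
  qed
  then have "enat (Suc d) \<le> codim Y (zariski R)"
    unfolding codim_def by (intro INF_greatest)
  then show ?thesis using less_le_trans[of "enat d" "enat (Suc d)"] by simp
qed

end

section \<open>Sections of a coherent sheaf on a noetherian spectrum\<close>

lemma (in abelian_monoid) finsum_mem:
  assumes "L \<subseteq> carrier G" "\<zero> \<in> L" "\<And>x y. x \<in> L \<Longrightarrow> y \<in> L \<Longrightarrow> x \<oplus> y \<in> L" "f \<in> A \<rightarrow> L"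
  shows "finsum G f A \<in> L"
proof (cases "finite A")
  case True
  then show ?thesis using assms(4)
  proof (induction A rule: finite_induct)
    case (insert i A)
    have "f \<in> A \<rightarrow> carrier G" "f i \<in> carrier G" using insert.prems assms(1) by auto
    then have "finsum G f (insert i A) = f i \<oplus> finsum G f A"
      using insert.hyps by (simp add: finsum_insert)
    then show ?case using insert assms(3) by auto
  qed (simp add: assms(2))
next
  case False
  then show ?thesis using assms(2) by (simp add: finsum_infinite)
qed

lemma (in module) span_image_lessThan:
  fixes z :: "nat \<Rightarrow> 'c"
  assumes "\<And>i. i < t \<Longrightarrow> z i \<in> carrier M" "y \<in> span (z ` {..<t})"
  shows "\<exists>\<alpha>. (\<forall>i<t. \<alpha> i \<in> carrier R) \<and> y = (\<Oplus>\<^bsub>M\<^esub>i\<in>{..<t}. \<alpha> i \<odot>\<^bsub>M\<^esub> z i)"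
  using assms
proof (induction t arbitrary: y)
  case 0
  then show ?case by (auto simp: span_def lincomb_def)
next
  case (Suc t)
  have z: "z t \<in> carrier M" "z ` {..<t} \<subseteq> carrier M" using Suc.prems(1) by auto
  have "y \<in> span (insert (z t) (z ` {..<t}))" using Suc.prems(2) by (simp add: lessThan_Suc)
  then obtain a s where a: "a \<in> carrier R" "s \<in> span (z ` {..<t})" "y = a \<odot>\<^bsub>M\<^esub> z t \<oplus>\<^bsub>M\<^esub> s"
    unfolding span_insert[OF z] by auto
  have "\<And>i. i < t \<Longrightarrow> z i \<in> carrier M" using Suc.prems(1) by simp
  from Suc.IH[OF this a(2)] obtain \<alpha> where \<alpha>: "\<And>i. i < t \<Longrightarrow> \<alpha> i \<in> carrier R"
    "s = (\<Oplus>\<^bsub>M\<^esub>i\<in>{..<t}. \<alpha> i \<odot>\<^bsub>M\<^esub> z i)" by auto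
  have "(\<Oplus>\<^bsub>M\<^esub>i\<in>{..<Suc t}. (\<alpha>(t := a)) i \<odot>\<^bsub>M\<^esub> z i)
      = a \<odot>\<^bsub>M\<^esub> z t \<oplus>\<^bsub>M\<^esub> (\<Oplus>\<^bsub>M\<^esub>i\<in>{..<t}. (\<alpha>(t := a)) i \<odot>\<^bsub>M\<^esub> z i)"
    unfolding lessThan_Suc using \<alpha>(1) a(1) Suc.prems(1)
    by (subst M.finsum_insert) auto
  also have "(\<Oplus>\<^bsub>M\<^esub>i\<in>{..<t}. (\<alpha>(t := a)) i \<odot>\<^bsub>M\<^esub> z i) = s"
    unfolding \<alpha>(2) using \<alpha>(1) Suc.prems(1) by (intro M.finsum_cong') auto
  finally show ?case using \<alpha>(1) a(1,3) by (intro exI[of _ "\<alpha>(t := a)"]) auto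
qed

text \<open>The ideal of the denominators that bring \<open>y\<close> into \<open>N\<close>, to which \<open>power_mem_ideal\<close> is applied.\<close>

lemma (in module) colon_ideal:
  assumes N: "submod N" and y: "y \<in> carrier M"
  shows "ideal {c \<in> carrier R. c \<odot>\<^bsub>M\<^esub> y \<in> N} R"
proof (rule idealI)
  note D = submodD[OF N]
  show "ring R" by (rule R.ring_axioms)
  show "subgroup {c \<in> carrier R. c \<odot>\<^bsub>M\<^esub> y \<in> N} (add_monoid R)"
  proof (rule R.add.subgroupI)
    have "\<zero> \<in> {c \<in> carrier R. c \<odot>\<^bsub>M\<^esub> y \<in> N}" using y D(2) by simp
    then show "{c \<in> carrier R. c \<odot>\<^bsub>M\<^esub> y \<in> N} \<noteq> {}" by auto
    fix c assume c: "c \<in> {c \<in> carrier R. c \<odot>\<^bsub>M\<^esub> y \<in> N}"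
    have "(\<ominus> \<one> \<otimes> c) \<odot>\<^bsub>M\<^esub> y \<in> N" using c y D(4)[of "\<ominus> \<one>" "c \<odot>\<^bsub>M\<^esub> y"] smult_assoc1[of "\<ominus> \<one>" c y] by simp
    then show "\<ominus> c \<in> {c \<in> carrier R. c \<odot>\<^bsub>M\<^esub> y \<in> N}" using c by (simp add: R.l_minus)
    fix e assume "e \<in> {c \<in> carrier R. c \<odot>\<^bsub>M\<^esub> y \<in> N}"
    then show "c \<oplus> e \<in> {c \<in> carrier R. c \<odot>\<^bsub>M\<^esub> y \<in> N}" using c y D(3) by (simp add: smult_l_distr)
  qed auto
  fix c x assume c: "c \<in> {c \<in> carrier R. c \<odot>\<^bsub>M\<^esub> y \<in> N}" and x: "x \<in> carrier R"
  have "(x \<otimes> c) \<odot>\<^bsub>M\<^esub> y \<in> N" using c x y D(4)[of x "c \<odot>\<^bsub>M\<^esub> y"] by (simp add: smult_assoc1)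
  then show "x \<otimes> c \<in> {c \<in> carrier R. c \<odot>\<^bsub>M\<^esub> y \<in> N}" "c \<otimes> x \<in> {c \<in> carrier R. c \<odot>\<^bsub>M\<^esub> y \<in> N}"
    using c x by (auto simp: R.m_comm)
qed

lemma (in module) submod_zero: "submod {\<zero>\<^bsub>M\<^esub>}"
  by (rule submodI) auto

definition const_section :: "('a, 'b) ring_scheme \<Rightarrow> 'a set set \<Rightarrow> 'a \<Rightarrow> 'a set \<Rightarrow> ('a \<times> 'a) set" where
  "const_section R U a = (\<lambda>p\<in>U. fraction R p a \<one>\<^bsub>R\<^esub>)"

definition basic_open :: "('a, 'b) ring_scheme \<Rightarrow> 'a \<Rightarrow> 'a set set" where
  "basic_open R g = {p. primeideal p R \<and> g \<notin> p}"

lemma primeideal_pow: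
  assumes "primeideal p R" "g \<in> carrier R" "g \<notin> p"
  shows "g [^]\<^bsub>R\<^esub> (N::nat) \<in> carrier R - p"
proof -
  interpret p: primeideal p R by (rule assms(1))
  show ?thesis
  proof (induction N)
    case 0
    then show ?case using p.one_compl by simp
  next
    case (Suc N)
    then show ?case using p.compl_closed[of "g [^]\<^bsub>R\<^esub> N" g] assms(2,3) by simp
  qed
qed

lemma primeideal_mult:
  assumes "primeideal p R" "f \<in> carrier R" "g \<in> carrier R" "f \<notin> p" "g \<notin> p"
  shows "f \<otimes>\<^bsub>R\<^esub> g \<notin> p"
  using primeideal.compl_closed[OF assms(1), of f g] assms(2-) by auto

context cring
begin

lemma open_basic: "g \<in> carrier R \<Longrightarrow> openin (zariski R) (basic_open R g)"
  unfolding openin_zariski basic_open_def by (intro exI[of _ "{g}"]) auto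

lemma basic_nbhd:
  assumes "openin (zariski R) U" "x \<in> U"
  obtains g where "g \<in> carrier R" "g \<notin> x" "x \<in> basic_open R g" "basic_open R g \<subseteq> U"
proof -
  obtain S where S: "S \<subseteq> carrier R" "U = {p. primeideal p R \<and> \<not> S \<subseteq> p}"
    using assms(1) unfolding openin_zariski by auto
  then obtain g where g: "g \<in> S" "g \<notin> x" "primeideal x R" using assms(2) by auto
  show thesis by (rule that[of g]) (use g S in \<open>auto simp: basic_open_def\<close>)
qed

lemma open_prime: "openin (zariski R) U \<Longrightarrow> p \<in> U \<Longrightarrow> primeideal p R"
  by (rule pointP[OF is_cring])

lemma const_section_closed:
  "openin (zariski R) U \<Longrightarrow> a \<in> carrier R \<Longrightarrow> const_section R U a \<in> carrier (structure_sections R U)"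
  unfolding const_section_def by (rule sections_const[OF is_cring])

lemma const_section_hom:
  assumes U: "openin (zariski R) U"
  shows "const_section R U \<in> ring_hom R (structure_sections R U)"
proof (rule ring_hom_memI)
  fix a b assume ab: "a \<in> carrier R" "b \<in> carrier R"
  show "const_section R U a \<in> carrier (structure_sections R U)" by (rule const_section_closed[OF U ab(1)])
  have "fraction R p (a \<otimes> b) \<one> = fraction R p a \<one> \<otimes>\<^bsub>localization R p\<^esub> fraction R p b \<one>"
    "fraction R p (a \<oplus> b) \<one> = fraction R p a \<one> \<oplus>\<^bsub>localization R p\<^esub> fraction R p b \<one>"
    if "p \<in> U" for p
  proof -
    interpret p: primeideal p R by (rule open_prime[OF U that])
    show "fraction R p (a \<otimes> b) \<one> = fraction R p a \<one> \<otimes>\<^bsub>localization R p\<^esub> fraction R p b \<one>"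
      using ab p.one_compl by (simp add: p.localization_mult)
    show "fraction R p (a \<oplus> b) \<one> = fraction R p a \<one> \<oplus>\<^bsub>localization R p\<^esub> fraction R p b \<one>"
      using ab p.one_compl by (simp add: p.localization_add)
  qed
  then show "const_section R U (a \<otimes> b) = const_section R U a \<otimes>\<^bsub>structure_sections R U\<^esub> const_section R U b"
    "const_section R U (a \<oplus> b) = const_section R U a \<oplus>\<^bsub>structure_sections R U\<^esub> const_section R U b"
    unfolding sections_simps[OF is_cring] const_section_def by (auto intro!: restrict_ext)
next
  show "const_section R U \<one> = \<one>\<^bsub>structure_sections R U\<^esub>"
    unfolding sections_simps[OF is_cring] const_section_def by simp
qed

lemma const_section_unit:
  assumes U: "openin (zariski R) U" and h: "h \<in> carrier R" "\<And>q. q \<in> U \<Longrightarrow> h \<notin> q"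
  obtains b where "b \<in> carrier (structure_sections R U)"
    "b \<otimes>\<^bsub>structure_sections R U\<^esub> const_section R U h = \<one>\<^bsub>structure_sections R U\<^esub>"
proof -
  let ?b = "\<lambda>p\<in>U. fraction R p \<one> h"
  have "?b \<in> carrier (structure_sections R U)"
    unfolding sections_carrier[OF is_cring]
  proof (intro conjI ballI)
    show "?b \<in> (\<Pi>\<^sub>E p\<in>U. carrier (localization R p))"
      using open_prime[OF U] h by (auto intro!: primeideal.fraction_in)
    show "\<exists>V a f. openin (zariski R) V \<and> p \<in> V \<and> V \<subseteq> U \<and> a \<in> carrier R \<and> f \<in> carrier R \<and>
        (\<forall>q\<in>V. f \<notin> q \<and> ?b q = fraction R q a f)" if "p \<in> U" for p
      using that U h by (intro exI[of _ U] exI[of _ \<one>] exI[of _ h]) auto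
  qed
  moreover have "?b \<otimes>\<^bsub>structure_sections R U\<^esub> const_section R U h = \<one>\<^bsub>structure_sections R U\<^esub>"
    unfolding sections_simps[OF is_cring] const_section_def
  proof (rule restrict_ext)
    fix p assume p: "p \<in> U"
    interpret p: primeideal p R by (rule open_prime[OF U p])
    have "fraction R p \<one> h \<otimes>\<^bsub>localization R p\<^esub> fraction R p h \<one> = fraction R p (\<one> \<otimes> h) (h \<otimes> \<one>)"
      by (rule p.localization_mult) (use h(1) h(2)[OF p] p.one_compl in auto)
    also have "\<dots> = fraction R p \<one> \<one>"
      by (rule p.fraction_eqI') (use h(1) h(2)[OF p] p.one_compl in auto)
    finally have "fraction R p \<one> h \<otimes>\<^bsub>localization R p\<^esub> fraction R p h \<one> = fraction R p \<one> \<one>" .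
    then show "(\<lambda>p\<in>U. fraction R p \<one> h) p \<otimes>\<^bsub>localization R p\<^esub> (\<lambda>p\<in>U. fraction R p h \<one>) p
        = fraction R p \<one> \<one>" using p by simp
  qed
  ultimately show thesis by (rule that)
qed

lemma section_locally_fraction:
  assumes b: "b \<in> carrier (structure_sections R U)" and x: "x \<in> U"
  obtains W c \<alpha> where "openin (zariski R) W" "x \<in> W" "W \<subseteq> U" "c \<in> carrier R" "\<And>q. q \<in> W \<Longrightarrow> c \<notin> q"
    "\<alpha> \<in> carrier R" "\<And>q. q \<in> W \<Longrightarrow> b q = fraction R q \<alpha> c"
proof -
  obtain W \<alpha> c where "openin (zariski R) W" "x \<in> W" "W \<subseteq> U" "\<alpha> \<in> carrier R" "c \<in> carrier R"
    "\<forall>q\<in>W. c \<notin> q \<and> b q = fraction R q \<alpha> c"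
    using b x unfolding sections_carrier[OF is_cring] by blast
  then show thesis by (intro that[of W c \<alpha>]) auto
qed

lemma const_mult_fraction:
  assumes W: "openin (zariski R) W" and b: "b \<in> carrier (structure_sections R W)"
    and c: "c \<in> carrier R" "\<And>q. q \<in> W \<Longrightarrow> c \<notin> q" and \<alpha>: "\<alpha> \<in> carrier R"
    and eq: "\<And>q. q \<in> W \<Longrightarrow> b q = fraction R q \<alpha> c"
  shows "const_section R W c \<otimes>\<^bsub>structure_sections R W\<^esub> b = const_section R W \<alpha>"
  unfolding sections_simps[OF is_cring]
proof (subst (2) const_section_def, rule restrict_ext)
  fix p assume p: "p \<in> W"
  interpret p: primeideal p R by (rule open_prime[OF W p])
  have "fraction R p c \<one> \<otimes>\<^bsub>localization R p\<^esub> fraction R p \<alpha> c = fraction R p (c \<otimes> \<alpha>) (\<one> \<otimes> c)"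
    by (rule p.localization_mult) (use c(1) c(2)[OF p] p.one_compl \<alpha> in auto)
  also have "\<dots> = fraction R p \<alpha> \<one>"
    by (rule p.fraction_eqI') (use c(1) c(2)[OF p] p.one_compl \<alpha> in auto)
  finally have "fraction R p c \<one> \<otimes>\<^bsub>localization R p\<^esub> fraction R p \<alpha> c = fraction R p \<alpha> \<one>" .
  then show "const_section R W c p \<otimes>\<^bsub>localization R p\<^esub> b p = fraction R p \<alpha> \<one>"
    using p eq[OF p] by (simp add: const_section_def)
qed

lemma sections_common_denominator:
  assumes U: "openin (zariski R) U" "x \<in> U" and I: "finite I"
    and b: "\<And>i. i \<in> I \<Longrightarrow> b i \<in> carrier (structure_sections R U)"
  shows "\<exists>W c \<alpha>. openin (zariski R) W \<and> x \<in> W \<and> W \<subseteq> U \<and> c \<in> carrier R \<and> (\<forall>q\<in>W. c \<notin> q) \<and>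
    (\<forall>i\<in>I. \<alpha> i \<in> carrier R \<and> (\<forall>q\<in>W. b i q = fraction R q (\<alpha> i) c))"
  using I b
proof (induction I rule: finite_induct)
  case empty
  have "\<forall>q\<in>U. \<one> \<notin> q" using open_prime[OF U(1)] primeideal.one_compl by fastforce
  then show ?case using U by (intro exI[of _ U] exI[of _ \<one>]) auto
next
  case (insert i I)
  then obtain W c \<alpha> where W: "openin (zariski R) W" "x \<in> W" "W \<subseteq> U" "c \<in> carrier R" "\<forall>q\<in>W. c \<notin> q"
    "\<forall>i\<in>I. \<alpha> i \<in> carrier R \<and> (\<forall>q\<in>W. b i q = fraction R q (\<alpha> i) c)" by auto
  have "b i \<in> carrier (structure_sections R U)" using insert.prems by simp
  from section_locally_fraction[OF this U(2)] obtain V e \<beta> where V: "openin (zariski R) V" "x \<in> V" "V \<subseteq> U"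
    "e \<in> carrier R" "\<And>q. q \<in> V \<Longrightarrow> e \<notin> q" "\<beta> \<in> carrier R" "\<And>q. q \<in> V \<Longrightarrow> b i q = fraction R q \<beta> e"
    by metis
  define \<gamma> where "\<gamma> = (\<lambda>j. if j = i then c \<otimes> \<beta> else e \<otimes> \<alpha> j)"
  have ce: "c \<otimes> e \<notin> q" if "q \<in> W \<inter> V" for q
    using primeideal_mult[OF open_prime[OF W(1)], of q c e] that W(4,5) V(4,5) by auto
  have "\<gamma> j \<in> carrier R \<and> (\<forall>q\<in>W \<inter> V. b j q = fraction R q (\<gamma> j) (c \<otimes> e))" if j: "j \<in> insert i I" for j
  proof (cases "j = i")
    case True
    have "b j q = fraction R q (\<gamma> j) (c \<otimes> e)" if q: "q \<in> W \<inter> V" for q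
    proof -
      interpret q: primeideal q R by (rule open_prime[OF W(1)]) (use q in auto)
      have "fraction R q \<beta> e = fraction R q (c \<otimes> \<beta>) (c \<otimes> e)"
        using W(4) V(4-6) q ce[OF q] by (intro q.fraction_eqI') (auto simp: m_ac)
      then show ?thesis using True V(7) q by (simp add: \<gamma>_def)
    qed
    then show ?thesis using True W(4) V(6) by (simp add: \<gamma>_def)
  next
    case False
    then have jI: "j \<in> I" using j by simp
    have "b j q = fraction R q (\<gamma> j) (c \<otimes> e)" if q: "q \<in> W \<inter> V" for q
    proof -
      interpret q: primeideal q R by (rule open_prime[OF W(1)]) (use q in auto)
      have "fraction R q (\<alpha> j) c = fraction R q (e \<otimes> \<alpha> j) (c \<otimes> e)"
        using W(4-6) V(4) q ce[OF q] jI by (intro q.fraction_eqI') (auto simp: m_ac)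
      then show ?thesis using False W(6) jI q by (simp add: \<gamma>_def)
    qed
    then show ?thesis using False W(6) jI V(4) by (simp add: \<gamma>_def)
  qed
  moreover have "openin (zariski R) (W \<inter> V)" using W(1) V(1) by (rule openin_Int)
  ultimately show ?case using W V ce
    by (intro exI[of _ "W \<inter> V"] exI[of _ "c \<otimes> e"] exI[of _ \<gamma>]) auto
qed

lemma fraction_eqs_common_multiplier:
  fixes \<alpha> \<beta> :: "nat \<Rightarrow> 'a"
  assumes q: "primeideal q R" and h: "h \<in> carrier R - q"
    and ab: "\<And>i. i < t \<Longrightarrow> \<alpha> i \<in> carrier R \<and> \<beta> i \<in> carrier R \<and> fraction R q (\<alpha> i) \<one> = fraction R q (\<beta> i) h"
  shows "\<exists>k\<in>carrier R - q. \<forall>i<t. k \<otimes> (h \<otimes> \<alpha> i) = k \<otimes> \<beta> i"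
proof -
  interpret q: primeideal q R by (rule q)
  show ?thesis using ab
  proof (induction t)
    case 0
    then show ?case using q.one_compl by auto
  next
    case (Suc t)
    then obtain k where k: "k \<in> carrier R - q" "\<forall>i<t. k \<otimes> (h \<otimes> \<alpha> i) = k \<otimes> \<beta> i" by auto
    have ab: "\<alpha> t \<in> carrier R" "\<beta> t \<in> carrier R" "fraction R q (\<alpha> t) \<one> = fraction R q (\<beta> t) h"
      using Suc.prems[of t] by auto
    have "(\<beta> t, h) \<in> fraction R q (\<alpha> t) \<one>" unfolding ab(3) by (rule q.fraction_refl[OF ab(2) h])
    from q.fraction_memD(3)[OF this] obtain l where
      l: "l \<in> carrier R - q" "l \<otimes> (h \<otimes> \<alpha> t) = l \<otimes> (\<one> \<otimes> \<beta> t)" by auto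
    have "(k \<otimes> l) \<otimes> (h \<otimes> \<alpha> i) = (k \<otimes> l) \<otimes> \<beta> i" if i: "i < Suc t" for i
    proof -
      have c: "\<alpha> i \<in> carrier R" "\<beta> i \<in> carrier R" "k \<in> carrier R" "l \<in> carrier R" "h \<in> carrier R"
        using Suc.prems[OF i] k(1) l(1) h by auto
      show ?thesis
      proof (cases "i = t")
        case True
        have "(k \<otimes> l) \<otimes> (h \<otimes> \<alpha> i) = k \<otimes> (l \<otimes> (h \<otimes> \<alpha> i))" using c by (simp add: m_assoc)
        also have "\<dots> = (k \<otimes> l) \<otimes> \<beta> i" using l(2) c True by (simp add: m_assoc)
        finally show ?thesis .
      next
        case False
        have "(k \<otimes> l) \<otimes> (h \<otimes> \<alpha> i) = l \<otimes> (k \<otimes> (h \<otimes> \<alpha> i))" using c by (simp add: m_ac)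
        also have "k \<otimes> (h \<otimes> \<alpha> i) = k \<otimes> \<beta> i" using k(2) False i by simp
        also have "l \<otimes> (k \<otimes> \<beta> i) = (k \<otimes> l) \<otimes> \<beta> i" using c by (simp add: m_ac)
        finally show ?thesis .
      qed
    qed
    then show ?case using q.compl_closed[OF k(1) l(1)] by (intro bexI[of _ "k \<otimes> l"]) auto
  qed
qed

end

lemma Spec_simps [simp]: "space_of (Spec R) = zariski R" "sec (Spec R) = structure_sections R"
  "res (Spec R) = (\<lambda>U V s. restrict s V)"
  by (simp_all add: Spec_def)

lemma (in module) finsum_smult_zero:
  assumes "finite A" "\<And>i. i \<in> A \<Longrightarrow> z i \<in> carrier M" "\<And>i. i \<in> A \<Longrightarrow> \<beta> i \<in> carrier R" "b \<in> carrier R"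
    and "\<And>i. i \<in> A \<Longrightarrow> \<gamma> i = b \<otimes> \<beta> i"
  shows "(\<Oplus>\<^bsub>M\<^esub>i\<in>A. \<gamma> i \<odot>\<^bsub>M\<^esub> z i) = b \<odot>\<^bsub>M\<^esub> (\<Oplus>\<^bsub>M\<^esub>i\<in>A. \<beta> i \<odot>\<^bsub>M\<^esub> z i)"
proof -
  have "(\<Oplus>\<^bsub>M\<^esub>i\<in>A. \<gamma> i \<odot>\<^bsub>M\<^esub> z i) = (\<Oplus>\<^bsub>M\<^esub>i\<in>A. b \<odot>\<^bsub>M\<^esub> (\<beta> i \<odot>\<^bsub>M\<^esub> z i))"
    using assms by (intro M.finsum_cong') (auto simp: smult_assoc1)
  also have "\<dots> = b \<odot>\<^bsub>M\<^esub> (\<Oplus>\<^bsub>M\<^esub>i\<in>A. \<beta> i \<odot>\<^bsub>M\<^esub> z i)"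
    using assms by (intro finsum_smult_ldistr[symmetric]) auto
  finally show ?thesis .
qed

lemma (in module) finsum_smult_add:
  assumes "\<And>i. i \<in> A \<Longrightarrow> z i \<in> carrier M" "\<And>i. i \<in> A \<Longrightarrow> \<beta> i \<in> carrier R" "\<And>i. i \<in> A \<Longrightarrow> \<gamma> i \<in> carrier R"
    and "\<And>i. i \<in> A \<Longrightarrow> \<delta> i = \<beta> i \<oplus> \<gamma> i"
  shows "(\<Oplus>\<^bsub>M\<^esub>i\<in>A. \<delta> i \<odot>\<^bsub>M\<^esub> z i)
    = (\<Oplus>\<^bsub>M\<^esub>i\<in>A. \<beta> i \<odot>\<^bsub>M\<^esub> z i) \<oplus>\<^bsub>M\<^esub> (\<Oplus>\<^bsub>M\<^esub>i\<in>A. \<gamma> i \<odot>\<^bsub>M\<^esub> z i)"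
proof -
  have "(\<Oplus>\<^bsub>M\<^esub>i\<in>A. \<delta> i \<odot>\<^bsub>M\<^esub> z i) = (\<Oplus>\<^bsub>M\<^esub>i\<in>A. \<beta> i \<odot>\<^bsub>M\<^esub> z i \<oplus>\<^bsub>M\<^esub> \<gamma> i \<odot>\<^bsub>M\<^esub> z i)"
    using assms by (intro M.finsum_cong') (auto simp: smult_l_distr)
  also have "\<dots> = (\<Oplus>\<^bsub>M\<^esub>i\<in>A. \<beta> i \<odot>\<^bsub>M\<^esub> z i) \<oplus>\<^bsub>M\<^esub> (\<Oplus>\<^bsub>M\<^esub>i\<in>A. \<gamma> i \<odot>\<^bsub>M\<^esub> z i)"
    using assms by (intro M.finsum_addf) auto
  finally show ?thesis .
qed

lemma (in module) finsum_smult_0: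
  assumes "\<And>i. i \<in> A \<Longrightarrow> z i \<in> carrier M" "\<And>i. i \<in> A \<Longrightarrow> \<gamma> i = \<zero>"
  shows "(\<Oplus>\<^bsub>M\<^esub>i\<in>A. \<gamma> i \<odot>\<^bsub>M\<^esub> z i) = \<zero>\<^bsub>M\<^esub>"
proof -
  have "(\<Oplus>\<^bsub>M\<^esub>i\<in>A. \<gamma> i \<odot>\<^bsub>M\<^esub> z i) = (\<Oplus>\<^bsub>M\<^esub>i\<in>A. \<zero>\<^bsub>M\<^esub>)"
    using assms by (intro M.finsum_cong') auto
  then show ?thesis by (simp add: M.finsum_zero)
qed

locale coherent_spec = noetherian_cring R
  for R :: "('a, 'b) ring_scheme" (structure) +
  fixes M :: "('a set, 'a set \<Rightarrow> ('a \<times> 'a) set, 'm) module_sheaf_data"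
  assumes coherent: "coherent_module (Spec R) M"
begin

abbreviation opn :: "'a set set \<Rightarrow> bool" where "opn \<equiv> openin (zariski R)"

abbreviation whole :: "'a set set" where "whole \<equiv> topspace (zariski R)"

abbreviation rs :: "'a set set \<Rightarrow> 'a set set \<Rightarrow> 'm \<Rightarrow> 'm" where "rs \<equiv> mres M"

text \<open>Sections over \<open>U\<close> are regarded as a module over \<open>R\<close> and not over the sections of the structure
  sheaf, so that modules over different open sets share their ring. Elements of \<open>R\<close> that are units
  on the open set in question take over the role of denominators.\<close>

definition sect :: "'a set set \<Rightarrow> ('a, 'm) module" where
  "sect U = \<lparr>carrier = carrier (msec M U), monoid.mult = undefined, one = undefined,
     ring.zero = \<zero>\<^bsub>msec M U\<^esub>, add = add (msec M U),
     smult = (\<lambda>a s. const_section R U a \<odot>\<^bsub>msec M U\<^esub> s)\<rparr>"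

abbreviation sp :: "'a set set \<Rightarrow> 'm set \<Rightarrow> 'm set" where
  "sp U S \<equiv> LinearCombinations.module.span R (sect U) S"

definition unit_on :: "'a set set \<Rightarrow> 'a \<Rightarrow> bool" where
  "unit_on W c \<longleftrightarrow> c \<in> carrier R \<and> (\<forall>q\<in>W. c \<notin> q)"

lemma opn_whole: "opn whole" by simp

lemma opn_sub_whole: "opn U \<Longrightarrow> U \<subseteq> whole" by (rule openin_subset)

lemma sheaf: "module_sheaf (Spec R) M"
  using coherent by (simp add: coherent_module_def)

lemma msec_mod: "opn U \<Longrightarrow> module (structure_sections R U) (msec M U)"
  using module_sheaf.msec_module[OF sheaf] by simp

lemma unit_onD: "unit_on W c \<Longrightarrow> c \<in> carrier R" "unit_on W c \<Longrightarrow> q \<in> W \<Longrightarrow> c \<notin> q"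
  by (auto simp: unit_on_def)

lemma unit_on_mono: "unit_on W c \<Longrightarrow> V \<subseteq> W \<Longrightarrow> unit_on V c"
  by (auto simp: unit_on_def)

lemma unit_on_mult:
  assumes "opn W" "unit_on W c" "unit_on W e"
  shows "unit_on W (c \<otimes> e)"
  using primeideal_mult[OF open_prime[OF assms(1)]] assms(2,3) by (simp add: unit_on_def)

lemma unit_on_pow: "opn W \<Longrightarrow> unit_on W c \<Longrightarrow> unit_on W (c [^] (N::nat))"
  using primeideal_pow[OF open_prime] by (simp add: unit_on_def)

lemma unit_on_basic: "c \<in> carrier R \<Longrightarrow> W \<subseteq> basic_open R c \<Longrightarrow> unit_on W c"
  by (auto simp: unit_on_def basic_open_def)

lemma unit_on_one: "opn W \<Longrightarrow> unit_on W \<one>"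
  using primeideal.one_compl[OF open_prime] by (auto simp: unit_on_def)

lemma sect_carrier: "carrier (sect U) = carrier (msec M U)"
  and sect_add: "add (sect U) = add (msec M U)"
  and sect_zero: "ring.zero (sect U) = ring.zero (msec M U)"
  and sect_smult: "a \<odot>\<^bsub>sect U\<^esub> s = const_section R U a \<odot>\<^bsub>msec M U\<^esub> s"
  by (simp_all add: sect_def)

lemma finsum_sect: "finsum (sect U) = finsum (msec M U)"
  by (intro ext) (simp add: finsum_def finprod_def sect_def)

lemma sect_module:
  assumes U: "opn U"
  shows "module R (sect U)"
proof -
  interpret N: module "structure_sections R U" "msec M U" by (rule msec_mod[OF U])
  note h = const_section_hom[OF U]
  note hs = ring_hom_mult[OF h] ring_hom_add[OF h] ring_hom_one[OF h] ring_hom_closed[OF h]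
  show ?thesis
  proof (rule moduleI)
    show "cring R" by (rule is_cring)
    show "abelian_group (sect U)"
    proof (rule abelian_groupI)
      show "\<exists>y\<in>carrier (sect U). y \<oplus>\<^bsub>sect U\<^esub> x = \<zero>\<^bsub>sect U\<^esub>" if "x \<in> carrier (sect U)" for x
        using that unfolding sect_carrier sect_add sect_zero
        by (intro bexI[of _ "\<ominus>\<^bsub>msec M U\<^esub> x"]) (auto simp: N.M.l_neg)
    qed (auto simp: sect_carrier sect_add sect_zero N.M.a_ac)
  qed (auto simp: sect_carrier sect_add sect_smult hs N.smult_l_distr N.smult_r_distr N.smult_assoc1)
qed

lemma rs_closed: "\<lbrakk>opn U; opn V; V \<subseteq> U; s \<in> carrier (sect U)\<rbrakk> \<Longrightarrow> rs U V s \<in> carrier (sect V)"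
proof -
  interpret S: module_sheaf "Spec R" M by (rule sheaf)
  show "\<lbrakk>opn U; opn V; V \<subseteq> U; s \<in> carrier (sect U)\<rbrakk> \<Longrightarrow> rs U V s \<in> carrier (sect V)"
    using S.M.res_closed by (simp add: sect_carrier)
qed

lemma rs_id: "\<lbrakk>opn U; s \<in> carrier (sect U)\<rbrakk> \<Longrightarrow> rs U U s = s"
proof -
  interpret S: module_sheaf "Spec R" M by (rule sheaf)
  show "\<lbrakk>opn U; s \<in> carrier (sect U)\<rbrakk> \<Longrightarrow> rs U U s = s"
    using S.M.res_id by (simp add: sect_carrier)
qed

lemma rs_comp: "\<lbrakk>opn U; opn V; opn W; V \<subseteq> U; W \<subseteq> V; s \<in> carrier (sect U)\<rbrakk> \<Longrightarrow> rs V W (rs U V s) = rs U W s"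
proof -
  interpret S: module_sheaf "Spec R" M by (rule sheaf)
  show "\<lbrakk>opn U; opn V; opn W; V \<subseteq> U; W \<subseteq> V; s \<in> carrier (sect U)\<rbrakk> \<Longrightarrow> rs V W (rs U V s) = rs U W s"
    using S.M.res_comp by (simp add: sect_carrier)
qed

lemma rs_add: "\<lbrakk>opn U; opn V; V \<subseteq> U; s \<in> carrier (sect U); t \<in> carrier (sect U)\<rbrakk>
    \<Longrightarrow> rs U V (s \<oplus>\<^bsub>sect U\<^esub> t) = rs U V s \<oplus>\<^bsub>sect V\<^esub> rs U V t"
  using module_sheaf.mres_add[OF sheaf] by (simp add: sect_carrier sect_add)

lemma rs_smult_msec: "\<lbrakk>opn U; opn V; V \<subseteq> U; b \<in> carrier (structure_sections R U); s \<in> carrier (sect U)\<rbrakk>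
    \<Longrightarrow> rs U V (b \<odot>\<^bsub>msec M U\<^esub> s) = restrict b V \<odot>\<^bsub>msec M V\<^esub> rs U V s"
  using module_sheaf.mres_smult[OF sheaf] by (simp add: sect_carrier)

lemma rs_smult: "\<lbrakk>opn U; opn V; V \<subseteq> U; a \<in> carrier R; s \<in> carrier (sect U)\<rbrakk>
    \<Longrightarrow> rs U V (a \<odot>\<^bsub>sect U\<^esub> s) = a \<odot>\<^bsub>sect V\<^esub> rs U V s"
proof -
  assume a: "opn U" "opn V" "V \<subseteq> U" "a \<in> carrier R" "s \<in> carrier (sect U)"
  have "restrict (const_section R U a) V = const_section R V a"
    using a(3) by (auto simp: const_section_def restrict_def fun_eq_iff)
  then show ?thesis
    using rs_smult_msec[OF a(1-3) const_section_closed[OF a(1,4)] a(5)] by (simp add: sect_smult)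
qed

lemma rs_zero:
  assumes "opn U" "opn V" "V \<subseteq> U"
  shows "rs U V \<zero>\<^bsub>sect U\<^esub> = \<zero>\<^bsub>sect V\<^esub>"
proof -
  interpret U: module R "sect U" by (rule sect_module[OF assms(1)])
  interpret V: module R "sect V" by (rule sect_module[OF assms(2)])
  have "rs U V (\<zero> \<odot>\<^bsub>sect U\<^esub> \<zero>\<^bsub>sect U\<^esub>) = \<zero> \<odot>\<^bsub>sect V\<^esub> rs U V \<zero>\<^bsub>sect U\<^esub>"
    by (rule rs_smult[OF assms]) auto
  then show ?thesis using rs_closed[OF assms, of "\<zero>\<^bsub>sect U\<^esub>"] by simp
qed

lemma rs_minus:
  assumes "opn U" "opn V" "V \<subseteq> U" "s \<in> carrier (sect U)" "t \<in> carrier (sect U)"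
  shows "rs U V (s \<ominus>\<^bsub>sect U\<^esub> t) = rs U V s \<ominus>\<^bsub>sect V\<^esub> rs U V t"
proof -
  interpret U: module R "sect U" by (rule sect_module[OF assms(1)])
  interpret V: module R "sect V" by (rule sect_module[OF assms(2)])
  have "rs U V ((\<ominus> \<one>) \<odot>\<^bsub>sect U\<^esub> t) = (\<ominus> \<one>) \<odot>\<^bsub>sect V\<^esub> rs U V t"
    by (rule rs_smult[OF assms(1-3) _ assms(5)]) auto
  then have "rs U V (\<ominus>\<^bsub>sect U\<^esub> t) = \<ominus>\<^bsub>sect V\<^esub> rs U V t"
    using assms(5) rs_closed[OF assms(1-3,5)] by (simp add: U.smult_l_minus V.smult_l_minus)
  then show ?thesis using assms(4,5) by (simp add: a_minus_def rs_add[OF assms(1-3)])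
qed

lemma rs_finsum:
  assumes "opn U" "opn V" "V \<subseteq> U" "finite A" "\<And>i. i \<in> A \<Longrightarrow> f i \<in> carrier (sect U)"
  shows "rs U V (finsum (sect U) f A) = finsum (sect V) (\<lambda>i. rs U V (f i)) A"
  using assms(4,5)
proof (induction A rule: finite_induct)
  case empty
  interpret U: module R "sect U" by (rule sect_module[OF assms(1)])
  interpret V: module R "sect V" by (rule sect_module[OF assms(2)])
  show ?case by (simp add: rs_zero[OF assms(1-3)])
next
  case (insert i A)
  interpret U: module R "sect U" by (rule sect_module[OF assms(1)])
  interpret V: module R "sect V" by (rule sect_module[OF assms(2)])
  have f: "f \<in> A \<rightarrow> carrier (sect U)" "f i \<in> carrier (sect U)"
    "(\<lambda>i. rs U V (f i)) \<in> A \<rightarrow> carrier (sect V)" "rs U V (f i) \<in> carrier (sect V)"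
    using insert.prems rs_closed[OF assms(1-3)] by auto
  have IH: "rs U V (finsum (sect U) f A) = finsum (sect V) (\<lambda>i. rs U V (f i)) A"
    using insert by simp
  show ?case
    by (simp add: U.M.finsum_insert[OF insert.hyps f(1,2)] V.M.finsum_insert[OF insert.hyps f(3,4)]
        rs_add[OF assms(1-3) f(2) U.M.finsum_closed[OF f(1)]] IH)
qed

lemma rs_span:
  assumes UV: "opn U" "opn V" "V \<subseteq> U" and S: "S \<subseteq> carrier (sect U)"
  shows "sp V (rs U V ` S) = rs U V ` sp U S"
proof -
  interpret U: module R "sect U" by (rule sect_module[OF UV(1)])
  interpret V: module R "sect V" by (rule sect_module[OF UV(2)])
  note D = U.submodD[OF U.span_is_submodule[OF S]]
  have rS: "rs U V ` S \<subseteq> carrier (sect V)" using S rs_closed[OF UV] by auto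
  note E = V.submodD[OF V.span_is_submodule[OF rS]]
  show ?thesis
  proof
    have "V.submod (rs U V ` sp U S)"
    proof (rule V.submodI)
      show "rs U V ` sp U S \<subseteq> carrier (sect V)" using D(5) rs_closed[OF UV] by auto
      show "\<zero>\<^bsub>sect V\<^esub> \<in> rs U V ` sp U S" using rs_zero[OF UV] D(2) by (metis imageI)
      fix x assume "x \<in> rs U V ` sp U S"
      then obtain u where u: "x = rs U V u" "u \<in> sp U S" by auto
      show "a \<odot>\<^bsub>sect V\<^esub> x \<in> rs U V ` sp U S" if "a \<in> carrier R" for a
        unfolding u(1) rs_smult[OF UV that D(5)[OF u(2)], symmetric] using D(4)[OF that u(2)] by auto
      fix y assume "y \<in> rs U V ` sp U S"
      then obtain v where v: "y = rs U V v" "v \<in> sp U S" by auto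
      show "x \<oplus>\<^bsub>sect V\<^esub> y \<in> rs U V ` sp U S"
        unfolding u(1) v(1) rs_add[OF UV D(5)[OF u(2)] D(5)[OF v(2)], symmetric]
        using D(3)[OF u(2) v(2)] by auto
    qed
    moreover have "rs U V ` S \<subseteq> rs U V ` sp U S" using U.in_own_span[OF S] by auto
    ultimately show "sp V (rs U V ` S) \<subseteq> rs U V ` sp U S" by (intro V.span_is_subset)
    let ?N = "{u \<in> carrier (sect U). rs U V u \<in> sp V (rs U V ` S)}"
    have "U.submod ?N"
      by (rule U.submodI) (auto simp: rs_zero[OF UV] rs_add[OF UV] rs_smult[OF UV] E(2,3,4))
    moreover have "S \<subseteq> ?N" using S V.in_own_span[OF rS] by auto
    ultimately have "sp U S \<subseteq> ?N" by (intro U.span_is_subset)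
    then show "rs U V ` sp U S \<subseteq> sp V (rs U V ` S)" by auto
  qed
qed

lemma rs_image_comp:
  assumes "opn U" "opn V" "opn W" "V \<subseteq> U" "W \<subseteq> V" "S \<subseteq> carrier (sect U)"
  shows "rs V W ` rs U V ` S = rs U W ` S"
  unfolding image_image using rs_comp[OF assms(1-5)] assms(6) by (intro image_cong) auto

lemma rs_span_comp:
  assumes "opn U" "opn V" "opn W" "V \<subseteq> U" "W \<subseteq> V" "S \<subseteq> carrier (sect U)" "u \<in> sp V (rs U V ` S)"
  shows "rs V W u \<in> sp W (rs U W ` S)"
proof -
  have "rs U V ` S \<subseteq> carrier (sect V)" using rs_closed[OF assms(1,2,4)] assms(6) by auto
  from rs_span[OF assms(2,3,5) this] assms(7) have "rs V W u \<in> sp W (rs V W ` rs U V ` S)" by auto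
  then show ?thesis unfolding rs_image_comp[OF assms(1-6)] .
qed

lemma sections_equal:
  assumes "opn A" "opn B" "s \<in> carrier (sect (A \<union> B))" "t \<in> carrier (sect (A \<union> B))"
    "rs (A \<union> B) A s = rs (A \<union> B) A t" "rs (A \<union> B) B s = rs (A \<union> B) B t"
  shows "s = t"
proof -
  interpret S: module_sheaf "Spec R" M by (rule sheaf)
  show ?thesis
    by (rule S.M.locality[of "{A, B}"]) (use assms in \<open>auto simp: sect_carrier\<close>)
qed

lemma sections_over_empty:
  assumes "s \<in> carrier (sect {})" "t \<in> carrier (sect {})"
  shows "s = t"
proof -
  interpret S: module_sheaf "Spec R" M by (rule sheaf)
  show ?thesis
    by (rule S.M.locality[of "{}"]) (use assms in \<open>auto simp: sect_carrier\<close>)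
qed

lemma glue:
  assumes AB: "opn A" "opn B" and s: "s \<in> carrier (sect A)" "t \<in> carrier (sect B)"
    and eq: "rs A (A \<inter> B) s = rs B (A \<inter> B) t"
  obtains u where "u \<in> carrier (sect (A \<union> B))" "rs (A \<union> B) A u = s" "rs (A \<union> B) B u = t"
proof (cases "A = B")
  case True
  have "s = t" using eq s rs_id[OF AB(2)] unfolding True by simp
  then show ?thesis using that[of s] s rs_id[OF AB(1)] True by simp
next
  case False
  interpret S: module_sheaf "Spec R" M by (rule sheaf)
  define \<sigma> where "\<sigma> = (\<lambda>V. if V = A then s else t)"
  have "\<exists>u\<in>carrier (msec M (\<Union>{A, B})). \<forall>V\<in>{A, B}. rs (\<Union>{A, B}) V u = \<sigma> V"
    by (rule S.M.gluing)
      (use AB s eq False in \<open>auto simp: \<sigma>_def sect_carrier Int_commute\<close>)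
  then obtain u where "u \<in> carrier (msec M (A \<union> B))" "rs (A \<union> B) A u = \<sigma> A" "rs (A \<union> B) B u = \<sigma> B"
    by auto
  then show ?thesis using that[of u] False by (auto simp: \<sigma>_def sect_carrier)
qed

lemma unit_inverse:
  assumes U: "opn U" and h: "unit_on U h"
  obtains b where "b \<in> carrier (structure_sections R U)"
    "\<And>s. s \<in> carrier (sect U) \<Longrightarrow> b \<odot>\<^bsub>msec M U\<^esub> (h \<odot>\<^bsub>sect U\<^esub> s) = s"
    "\<And>s. s \<in> carrier (sect U) \<Longrightarrow> h \<odot>\<^bsub>sect U\<^esub> (b \<odot>\<^bsub>msec M U\<^esub> s) = s"
proof -
  interpret N: module "structure_sections R U" "msec M U" by (rule msec_mod[OF U])
  obtain b where b: "b \<in> carrier (structure_sections R U)"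
    "b \<otimes>\<^bsub>structure_sections R U\<^esub> const_section R U h = \<one>\<^bsub>structure_sections R U\<^esub>"
    using const_section_unit[OF U] unit_onD[OF h] by metis
  have hc: "const_section R U h \<in> carrier (structure_sections R U)"
    using const_section_closed[OF U] unit_onD(1)[OF h] by simp
  show thesis
  proof (rule that[OF b(1)])
    fix s assume s: "s \<in> carrier (sect U)"
    then show "b \<odot>\<^bsub>msec M U\<^esub> (h \<odot>\<^bsub>sect U\<^esub> s) = s"
      using b hc by (simp add: sect_carrier sect_smult N.smult_assoc1[symmetric])
    have "const_section R U h \<otimes>\<^bsub>structure_sections R U\<^esub> b = \<one>\<^bsub>structure_sections R U\<^esub>"
      using b hc by (simp add: N.R.m_comm)
    then show "h \<odot>\<^bsub>sect U\<^esub> (b \<odot>\<^bsub>msec M U\<^esub> s) = s"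
      using s b(1) hc by (simp add: sect_carrier sect_smult N.smult_assoc1[symmetric])
  qed
qed

lemma unit_cancel:
  assumes "opn U" "unit_on U h" "s \<in> carrier (sect U)" "t \<in> carrier (sect U)"
    "h \<odot>\<^bsub>sect U\<^esub> s = h \<odot>\<^bsub>sect U\<^esub> t"
  shows "s = t"
  using unit_inverse[OF assms(1,2)] assms(3-5) by metis

lemma unit_divide:
  assumes "opn U" "unit_on U h" "s \<in> carrier (sect U)"
  obtains t where "t \<in> carrier (sect U)" "h \<odot>\<^bsub>sect U\<^esub> t = s"
proof -
  interpret N: module "structure_sections R U" "msec M U" by (rule msec_mod[OF assms(1)])
  obtain b where "b \<in> carrier (structure_sections R U)" "h \<odot>\<^bsub>sect U\<^esub> (b \<odot>\<^bsub>msec M U\<^esub> s) = s"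
    using unit_inverse[OF assms(1,2)] assms(3) by metis
  then show thesis using that[of "b \<odot>\<^bsub>msec M U\<^esub> s"] assms(3) by (simp add: sect_carrier)
qed

subsection \<open>Generators near a point\<close>

text \<open>The sections over \<open>W\<close> whose germ at \<open>y\<close> lies in the module generated by the germs of \<open>Z\<close>. The
  denominators of the coefficients are collected in \<open>c\<close>, which leaves coefficients in \<open>R\<close>.\<close>

definition near_span :: "'a set set \<Rightarrow> 'm set \<Rightarrow> 'a set set \<Rightarrow> 'a set \<Rightarrow> 'm set" where
  "near_span V Z W y = {s \<in> carrier (sect W). \<exists>W' c. opn W' \<and> y \<in> W' \<and> W' \<subseteq> W \<and> unit_on W' c \<and>
     c \<odot>\<^bsub>sect W'\<^esub> rs W W' s \<in> sp W' (rs V W' ` Z)}"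

lemma near_spanE:
  assumes "s \<in> near_span V Z W y"
  obtains W' c where "opn W'" "y \<in> W'" "W' \<subseteq> W" "unit_on W' c"
    "c \<odot>\<^bsub>sect W'\<^esub> rs W W' s \<in> sp W' (rs V W' ` Z)"
  using assms unfolding near_span_def by auto

lemma near_spanI:
  assumes "s \<in> carrier (sect W)" "opn W'" "y \<in> W'" "W' \<subseteq> W" "unit_on W' c"
    "c \<odot>\<^bsub>sect W'\<^esub> rs W W' s \<in> sp W' (rs V W' ` Z)"
  shows "s \<in> near_span V Z W y"
  using assms unfolding near_span_def by auto

lemma near_span_shrink:
  assumes "opn V" "opn W" "W \<subseteq> V" "Z \<subseteq> carrier (sect V)" "s \<in> carrier (sect W)"
    and "opn W1" "W1 \<subseteq> W" "c \<in> carrier R" "c \<odot>\<^bsub>sect W1\<^esub> rs W W1 s \<in> sp W1 (rs V W1 ` Z)"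
    and "opn W2" "W2 \<subseteq> W1"
  shows "c \<odot>\<^bsub>sect W2\<^esub> rs W W2 s \<in> sp W2 (rs V W2 ` Z)"
proof -
  have "rs W1 W2 (c \<odot>\<^bsub>sect W1\<^esub> rs W W1 s) \<in> sp W2 (rs V W2 ` Z)"
    by (rule rs_span_comp[OF assms(1,6,10) _ assms(11,4,9)]) (use assms in auto)
  then show ?thesis
    using rs_smult[OF assms(6,10,11,8) rs_closed[OF assms(2,6,7,5)]]
      rs_comp[OF assms(2,6,10,7,11,5)] by simp
qed

text \<open>Closure under the structure sheaf, although the spans have coefficients in \<open>R\<close>, comes from
  writing its sections locally as fractions.\<close>

lemma near_span_submodule:
  assumes V: "opn V" "opn W" "W \<subseteq> V" "Z \<subseteq> carrier (sect V)" and y: "y \<in> W"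
  shows "\<zero>\<^bsub>sect W\<^esub> \<in> near_span V Z W y"
    and "\<And>s t. \<lbrakk>s \<in> near_span V Z W y; t \<in> near_span V Z W y\<rbrakk> \<Longrightarrow> s \<oplus>\<^bsub>sect W\<^esub> t \<in> near_span V Z W y"
    and "\<And>b s. \<lbrakk>b \<in> carrier (structure_sections R W); s \<in> near_span V Z W y\<rbrakk>
      \<Longrightarrow> b \<odot>\<^bsub>msec M W\<^esub> s \<in> near_span V Z W y"
    and "\<And>z. z \<in> Z \<Longrightarrow> rs V W z \<in> near_span V Z W y"
proof -
  interpret W: module R "sect W" by (rule sect_module[OF V(2)])
  interpret N: module "structure_sections R W" "msec M W" by (rule msec_mod[OF V(2)])
  have ZW: "rs V W' ` Z \<subseteq> carrier (sect W')" if "opn W'" "W' \<subseteq> W" for W'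
    using rs_closed[OF V(1) that(1)] that(2) V(3,4) by auto
  have D: "\<zero>\<^bsub>sect W'\<^esub> \<in> sp W' (rs V W' ` Z)"
    "\<And>x y. x \<in> sp W' (rs V W' ` Z) \<Longrightarrow> y \<in> sp W' (rs V W' ` Z) \<Longrightarrow> x \<oplus>\<^bsub>sect W'\<^esub> y \<in> sp W' (rs V W' ` Z)"
    "\<And>a x. a \<in> carrier R \<Longrightarrow> x \<in> sp W' (rs V W' ` Z) \<Longrightarrow> a \<odot>\<^bsub>sect W'\<^esub> x \<in> sp W' (rs V W' ` Z)"
    "rs V W' ` Z \<subseteq> sp W' (rs V W' ` Z)"
    if W': "opn W'" "W' \<subseteq> W" for W'
    using module.submodD(2-4)[OF sect_module[OF W'(1)]
        module.span_is_submodule[OF sect_module[OF W'(1)] ZW[OF W']]]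
      module.in_own_span[OF sect_module[OF W'(1)] ZW[OF W']] by blast+
  have one: "\<one> \<odot>\<^bsub>sect W\<^esub> rs W W s = s" if "s \<in> carrier (sect W)" for s
    using that rs_id[OF V(2)] by simp
  show "\<zero>\<^bsub>sect W\<^esub> \<in> near_span V Z W y"
    by (rule near_spanI[OF _ V(2) y subset_refl unit_on_one[OF V(2)]])
      (simp_all add: one D(1)[OF V(2) subset_refl])
  show "rs V W z \<in> near_span V Z W y" if "z \<in> Z" for z
  proof (rule near_spanI[OF _ V(2) y subset_refl unit_on_one[OF V(2)]])
    show z: "rs V W z \<in> carrier (sect W)" using that V(4) rs_closed[OF V(1-3)] by auto
    show "\<one> \<odot>\<^bsub>sect W\<^esub> rs W W (rs V W z) \<in> sp W (rs V W ` Z)"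
      unfolding one[OF z] using that D(4)[OF V(2) subset_refl] by auto
  qed
  fix s assume s: "s \<in> near_span V Z W y"
  then have sW: "s \<in> carrier (sect W)" by (simp add: near_span_def)
  from s obtain W1 c where W1: "opn W1" "y \<in> W1" "W1 \<subseteq> W" "unit_on W1 c"
    "c \<odot>\<^bsub>sect W1\<^esub> rs W W1 s \<in> sp W1 (rs V W1 ` Z)" by (rule near_spanE)
  note c = unit_onD(1)[OF W1(4)]
  {
    fix t assume t: "t \<in> near_span V Z W y"
    then have tW: "t \<in> carrier (sect W)" by (simp add: near_span_def)
    from t obtain W2 e where W2: "opn W2" "y \<in> W2" "W2 \<subseteq> W" "unit_on W2 e"
      "e \<odot>\<^bsub>sect W2\<^esub> rs W W2 t \<in> sp W2 (rs V W2 ` Z)" by (rule near_spanE)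
    note e = unit_onD(1)[OF W2(4)]
    let ?W = "W1 \<inter> W2"
    have W': "opn ?W" "y \<in> ?W" "?W \<subseteq> W" using W1 W2 by auto
    interpret W': module R "sect ?W" by (rule sect_module[OF W'(1)])
    have s': "c \<odot>\<^bsub>sect ?W\<^esub> rs W ?W s \<in> sp ?W (rs V ?W ` Z)"
      by (rule near_span_shrink[OF V sW W1(1,3) c W1(5) W'(1)]) auto
    have t': "e \<odot>\<^bsub>sect ?W\<^esub> rs W ?W t \<in> sp ?W (rs V ?W ` Z)"
      by (rule near_span_shrink[OF V tW W2(1,3) e W2(5) W'(1)]) auto
    have r: "rs W ?W s \<in> carrier (sect ?W)" "rs W ?W t \<in> carrier (sect ?W)"
      using rs_closed[OF V(2) W'(1,3)] sW tW by auto
    have "(c \<otimes> e) \<odot>\<^bsub>sect ?W\<^esub> rs W ?W (s \<oplus>\<^bsub>sect W\<^esub> t)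
        = e \<odot>\<^bsub>sect ?W\<^esub> (c \<odot>\<^bsub>sect ?W\<^esub> rs W ?W s) \<oplus>\<^bsub>sect ?W\<^esub> c \<odot>\<^bsub>sect ?W\<^esub> (e \<odot>\<^bsub>sect ?W\<^esub> rs W ?W t)"
      using c e r by (simp add: rs_add[OF V(2) W'(1,3) sW tW] W'.smult_r_distr m_comm[of e c] flip: W'.smult_assoc1)
    also have "\<dots> \<in> sp ?W (rs V ?W ` Z)"
      using D(2,3)[OF W'(1,3)] s' t' c e by simp
    finally show "s \<oplus>\<^bsub>sect W\<^esub> t \<in> near_span V Z W y"
      by (intro near_spanI[OF _ W' unit_on_mult[OF W'(1)]])
        (use sW tW unit_on_mono W1(4) W2(4) in auto)
  next
    fix b assume b: "b \<in> carrier (structure_sections R W)"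
    obtain W2 e \<beta> where W2: "opn W2" "y \<in> W2" "W2 \<subseteq> W" "e \<in> carrier R" "\<And>q. q \<in> W2 \<Longrightarrow> e \<notin> q"
      "\<beta> \<in> carrier R" "\<And>q. q \<in> W2 \<Longrightarrow> b q = fraction R q \<beta> e"
      by (rule section_locally_fraction[OF b y], rule that)
    let ?W = "W1 \<inter> W2"
    have W': "opn ?W" "y \<in> ?W" "?W \<subseteq> W" using W1 W2 by auto
    interpret W': module R "sect ?W" by (rule sect_module[OF W'(1)])
    interpret N': module "structure_sections R ?W" "msec M ?W" by (rule msec_mod[OF W'(1)])
    have s': "c \<odot>\<^bsub>sect ?W\<^esub> rs W ?W s \<in> sp ?W (rs V ?W ` Z)"
      by (rule near_span_shrink[OF V sW W1(1,3) c W1(5) W'(1)]) auto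
    have r: "rs W ?W s \<in> carrier (sect ?W)" using rs_closed[OF V(2) W'(1,3)] sW by auto
    have b': "restrict b ?W \<in> carrier (structure_sections R ?W)"
      by (rule sections_restrict[OF is_cring V(2) W'(1,3) b])
    have "const_section R ?W e \<otimes>\<^bsub>structure_sections R ?W\<^esub> restrict b ?W = const_section R ?W \<beta>"
      by (rule const_mult_fraction[OF W'(1) b' W2(4)]) (use W2(5-7) in auto)
    then have eb: "e \<odot>\<^bsub>sect ?W\<^esub> rs W ?W (b \<odot>\<^bsub>msec M W\<^esub> s) = \<beta> \<odot>\<^bsub>sect ?W\<^esub> rs W ?W s"
      using r b' const_section_closed[OF W'(1)] W2(4)
      by (simp add: rs_smult_msec[OF V(2) W'(1,3) b sW] sect_smult sect_carrier flip: N'.smult_assoc1)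
    have bs: "b \<odot>\<^bsub>msec M W\<^esub> s \<in> carrier (sect W)" using b sW by (simp add: sect_carrier)
    note rbs = rs_closed[OF V(2) W'(1,3) bs]
    have "(c \<otimes> e) \<odot>\<^bsub>sect ?W\<^esub> rs W ?W (b \<odot>\<^bsub>msec M W\<^esub> s) = \<beta> \<odot>\<^bsub>sect ?W\<^esub> (c \<odot>\<^bsub>sect ?W\<^esub> rs W ?W s)"
      using c W2(4,6) r rbs by (simp add: W'.smult_assoc1 eb) (simp add: m_comm[of c \<beta>] flip: W'.smult_assoc1)
    also have "\<dots> \<in> sp ?W (rs V ?W ` Z)" by (rule D(3)[OF W'(1,3) W2(6) s'])
    finally show "b \<odot>\<^bsub>msec M W\<^esub> s \<in> near_span V Z W y"
      by (intro near_spanI[OF bs W' unit_on_mult[OF W'(1)]])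
        (use unit_on_mono[OF W1(4)] W2(4,5) in \<open>auto simp: unit_on_def\<close>)
  }
qed

text \<open>This is finite type with coefficients from \<open>R\<close> in place of sections of the structure sheaf.\<close>

lemma local_generators:
  assumes x: "x \<in> whole"
  obtains V Z where "opn V" "x \<in> V" "finite Z" "Z \<subseteq> carrier (sect V)"
    "\<And>W s y. \<lbrakk>opn W; W \<subseteq> V; s \<in> carrier (sect W); y \<in> W\<rbrakk> \<Longrightarrow> s \<in> near_span V Z W y"
proof -
  have "finite_type_on (Spec R) M whole" using coherent by (simp add: coherent_module_def)
  then have "\<exists>V. opn V \<and> x \<in> V \<and> V \<subseteq> whole \<and>
      (\<exists>t m. (\<forall>i<t. m i \<in> carrier (sect V)) \<and> generates (Spec R) M V t m)"
    using x unfolding finite_type_on_def by (simp add: sect_carrier)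
  then obtain V t m where V: "opn V" "x \<in> V" and m': "\<forall>i<t. m i \<in> carrier (sect V)"
    and gen: "generates (Spec R) M V t m" by (elim exE conjE)
  have m: "\<And>i. i < t \<Longrightarrow> m i \<in> carrier (sect V)" using m' by simp
  have Z: "m ` {..<t} \<subseteq> carrier (sect V)" using m by auto
  show thesis
  proof (rule that[OF V, of "m ` {..<t}"])
    fix W s y assume W: "opn W" "W \<subseteq> V" and s: "s \<in> carrier (sect W)" and y: "y \<in> W"
    have "s \<in> carrier (msec M W)" using s by (simp add: sect_carrier)
    from gen[unfolded generates_def surjective_sheaf_map_def Spec_simps, rule_format, OF conjI[OF W] this y]
    obtain W' where W': "opn W'" "y \<in> W'" "W' \<subseteq> W"
      and im: "rs W W' s \<in> sections_map M V t m W' ` carrier (msec (free_sheaf (Spec R) t) W')"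
      by (elim exE conjE)
    have W'V: "W' \<subseteq> V" using W' W by auto
    interpret W': module R "sect W'" by (rule sect_module[OF W'(1)])
    interpret O: cring "structure_sections R W'" by (rule sections_cring[OF is_cring W'(1)])
    obtain a where a: "a \<in> {..<t} \<rightarrow>\<^sub>E carrier (structure_sections R W')"
      "rs W W' s = sections_map M V t m W' a"
      using im by (auto simp: free_sheaf_def O.func_space_def)
    note N = near_span_submodule[OF V(1) W'(1) W'V Z W'(2)]
    have "rs W W' s = (\<Oplus>\<^bsub>sect W'\<^esub>i\<in>{..<t}. a i \<odot>\<^bsub>msec M W'\<^esub> rs V W' (m i))"
      unfolding a(2) sections_map_def finsum_sect ..
    also have "\<dots> \<in> near_span V (m ` {..<t}) W' y"
    proof (rule W'.M.finsum_mem[OF _ N(1,2)])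
      show "near_span V (m ` {..<t}) W' y \<subseteq> carrier (sect W')" by (auto simp: near_span_def)
      show "(\<lambda>i. a i \<odot>\<^bsub>msec M W'\<^esub> rs V W' (m i)) \<in> {..<t} \<rightarrow> near_span V (m ` {..<t}) W' y"
      proof
        fix i assume i: "i \<in> {..<t}"
        show "a i \<odot>\<^bsub>msec M W'\<^esub> rs V W' (m i) \<in> near_span V (m ` {..<t}) W' y"
          by (rule N(3)[OF _ N(4)]) (use i a(1) in auto)
      qed
    qed
    finally obtain W2 c where W2: "opn W2" "y \<in> W2" "W2 \<subseteq> W'" "unit_on W2 c"
      "c \<odot>\<^bsub>sect W2\<^esub> rs W' W2 (rs W W' s) \<in> sp W2 (rs V W2 ` m ` {..<t})" by (rule near_spanE)
    show "s \<in> near_span V (m ` {..<t}) W y"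
      by (rule near_spanI[OF s W2(1,2) _ W2(4)])
        (use W2(3,5) W'(3) rs_comp[OF W(1) W'(1) W2(1) W'(3) W2(3) s] in auto)
  qed (use Z in auto)
qed


subsection \<open>Relations near a point\<close>

text \<open>The finitely many relations that generate the relation sheaf near \<open>x\<close> are relations on one
  common neighbourhood \<open>V\<close>. A combination that vanishes near some other point \<open>q\<close> of \<open>V\<close> therefore
  vanishes on all of \<open>V\<close> after multiplication with an element outside \<open>q\<close>.\<close>

lemma local_relations:
  assumes U: "opn U" "x \<in> U" and Z: "finite Z" "Z \<subseteq> carrier (sect U)"
  obtains V where "opn V" "x \<in> V" "V \<subseteq> U"
    "\<And>s q W. \<lbrakk>s \<in> sp U Z; opn W; W \<subseteq> V; q \<in> W; rs U W s = \<zero>\<^bsub>sect W\<^esub>\<rbrakk>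
      \<Longrightarrow> \<exists>c\<in>carrier R - q. c \<odot>\<^bsub>sect V\<^esub> rs U V s = \<zero>\<^bsub>sect V\<^esub>"
proof -
  obtain t m where Zm: "Z = m ` {..<t::nat}"
    using finite_imp_nat_seg_image_inj_on[OF Z(1)] by (auto simp: lessThan_def)
  have m: "m i \<in> carrier (sect U)" if "i < t" for i using Z(2) that Zm by auto
  interpret U: module R "sect U" by (rule sect_module[OF U(1)])
  let ?Q = "relation_sheaf (Spec R) M U t m"
  have "\<forall>i<t. m i \<in> carrier (msec M U)" using m by (simp add: sect_carrier)
  then have "finite_type_on (Spec R) ?Q U"
    using coherent U(1) unfolding coherent_module_def Spec_simps by blast
  then have "\<exists>V. opn V \<and> x \<in> V \<and> V \<subseteq> U \<and>
      (\<exists>k \<rho>. (\<forall>j<k. \<rho> j \<in> carrier (msec ?Q V)) \<and> generates (Spec R) ?Q V k \<rho>)"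
    using U(2) unfolding finite_type_on_def by simp
  then obtain V0 k \<rho> where V0: "opn V0" "x \<in> V0" "V0 \<subseteq> U"
    and \<rho>': "\<forall>j<k. \<rho> j \<in> carrier (msec ?Q V0)" and gen: "generates (Spec R) ?Q V0 k \<rho>"
    by (elim exE conjE)
  have Qcar: "a \<in> carrier (msec ?Q W) \<longleftrightarrow> a \<in> {..<t} \<rightarrow>\<^sub>E carrier (structure_sections R W) \<and>
      (\<Oplus>\<^bsub>msec M W\<^esub>i\<in>{..<t}. a i \<odot>\<^bsub>msec M W\<^esub> rs U W (m i)) = \<zero>\<^bsub>msec M W\<^esub>" if "opn W" for W a
    by (simp add: relation_sheaf_def free_sheaf_def sections_map_def
        ring.func_space_def[OF cring.axioms(1)[OF sections_cring[OF is_cring that]]])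
  have \<rho>: "\<rho> j \<in> {..<t} \<rightarrow>\<^sub>E carrier (structure_sections R V0)"
    "(\<Oplus>\<^bsub>msec M V0\<^esub>i\<in>{..<t}. \<rho> j i \<odot>\<^bsub>msec M V0\<^esub> rs U V0 (m i)) = \<zero>\<^bsub>msec M V0\<^esub>" if "j < k" for j
    using \<rho>' that Qcar[OF V0(1)] by auto
  have \<rho>c: "\<rho> j i \<in> carrier (structure_sections R V0)" if "j < k" "i < t" for j i
    using PiE_mem[OF \<rho>(1)[OF that(1)]] that(2) by simp
  have \<rho>_restrict: "(\<Oplus>\<^bsub>msec M W\<^esub>i\<in>{..<t}. restrict (\<rho> j i) W \<odot>\<^bsub>msec M W\<^esub> rs U W (m i)) = \<zero>\<^bsub>msec M W\<^esub>"
    if j: "j < k" and W: "opn W" "W \<subseteq> V0" for j W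
  proof -
    interpret W: module "structure_sections R W" "msec M W" by (rule msec_mod[OF W(1)])
    have mV0: "rs U V0 (m i) \<in> carrier (sect V0)" if "i < t" for i
      using rs_closed[OF U(1) V0(1,3)] m that by simp
    have \<rho>m: "\<rho> j i \<odot>\<^bsub>msec M V0\<^esub> rs U V0 (m i) \<in> carrier (sect V0)" if "i < t" for i
      using module.smult_closed[OF msec_mod[OF V0(1)] \<rho>c[OF j that]] mV0[OF that] by (simp add: sect_carrier)
    have "restrict (\<rho> j i) W \<odot>\<^bsub>msec M W\<^esub> rs U W (m i) = rs V0 W (\<rho> j i \<odot>\<^bsub>msec M V0\<^esub> rs U V0 (m i))"
      if i: "i < t" for i
      using rs_smult_msec[OF V0(1) W \<rho>c[OF j i] mV0[OF i]] rs_comp[OF U(1) V0(1) W(1) V0(3) W(2) m[OF i]] by simp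
    then have "(\<Oplus>\<^bsub>msec M W\<^esub>i\<in>{..<t}. restrict (\<rho> j i) W \<odot>\<^bsub>msec M W\<^esub> rs U W (m i))
        = (\<Oplus>\<^bsub>msec M W\<^esub>i\<in>{..<t}. rs V0 W (\<rho> j i \<odot>\<^bsub>msec M V0\<^esub> rs U V0 (m i)))"
      using rs_closed[OF V0(1) W \<rho>m] by (intro W.M.finsum_cong') (auto simp: sect_carrier)
    also have "\<dots> = rs V0 W (\<Oplus>\<^bsub>sect V0\<^esub>i\<in>{..<t}. \<rho> j i \<odot>\<^bsub>msec M V0\<^esub> rs U V0 (m i))"
      unfolding finsum_sect[symmetric] using \<rho>m by (intro rs_finsum[OF V0(1) W, symmetric]) auto
    also have "\<dots> = \<zero>\<^bsub>msec M W\<^esub>"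
      unfolding finsum_sect \<rho>(2)[OF j] using rs_zero[OF V0(1) W] by (simp add: sect_zero)
    finally show ?thesis .
  qed
  have "\<exists>V e r. opn V \<and> x \<in> V \<and> V \<subseteq> V0 \<and> e \<in> carrier R \<and> (\<forall>q\<in>V. e \<notin> q) \<and>
      (\<forall>ji\<in>{..<k} \<times> {..<t}. r ji \<in> carrier R \<and> (\<forall>q\<in>V. (\<lambda>ji. \<rho> (fst ji) (snd ji)) ji q = fraction R q (r ji) e))"
    by (rule sections_common_denominator[OF V0(1,2)]) (auto intro!: PiE_mem[OF \<rho>(1)])
  then obtain V e r' where V: "opn V" "x \<in> V" "V \<subseteq> V0" and e': "e \<in> carrier R" "\<forall>q\<in>V. e \<notin> q"
    and r': "\<forall>ji\<in>{..<k} \<times> {..<t}. r' ji \<in> carrier R \<and>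
      (\<forall>q\<in>V. (\<lambda>ji. \<rho> (fst ji) (snd ji)) ji q = fraction R q (r' ji) e)"
    by (elim exE conjE)
  have e: "e \<in> carrier R" "\<And>q. q \<in> V \<Longrightarrow> e \<notin> q" using e' by auto
  define r where "r j i = r' (j, i)" for j i
  have r: "r j i \<in> carrier R" "\<And>q. q \<in> V \<Longrightarrow> \<rho> j i q = fraction R q (r j i) e" if "j < k" "i < t" for j i
    using r' that unfolding r_def by auto
  have VU: "V \<subseteq> U" using V(3) V0(3) by auto
  interpret V: module R "sect V" by (rule sect_module[OF V(1)])
  define comb where "comb \<beta> = (\<Oplus>\<^bsub>sect V\<^esub>i\<in>{..<t}. \<beta> i \<odot>\<^bsub>sect V\<^esub> rs U V (m i))" for \<beta>
  have mV: "rs U V (m i) \<in> carrier (sect V)" if "i < t" for i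
    using rs_closed[OF U(1) V(1) VU] m that by simp
  have comb_smult: "comb \<gamma> = b \<odot>\<^bsub>sect V\<^esub> comb \<beta>"
    if "b \<in> carrier R" "\<And>i. i < t \<Longrightarrow> \<beta> i \<in> carrier R" "\<And>i. i < t \<Longrightarrow> \<gamma> i = b \<otimes> \<beta> i" for b \<beta> \<gamma>
    unfolding comb_def using that mV by (intro V.finsum_smult_zero) auto
  have comb_add: "comb \<delta> = comb \<beta> \<oplus>\<^bsub>sect V\<^esub> comb \<gamma>"
    if "\<And>i. i < t \<Longrightarrow> \<beta> i \<in> carrier R" "\<And>i. i < t \<Longrightarrow> \<gamma> i \<in> carrier R"
      "\<And>i. i < t \<Longrightarrow> \<delta> i = \<beta> i \<oplus> \<gamma> i" for \<beta> \<gamma> \<delta>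
    unfolding comb_def using that mV by (intro V.finsum_smult_add) auto
  have comb_r: "comb (r j) = \<zero>\<^bsub>sect V\<^esub>" if j: "j < k" for j
  proof -
    interpret N: module "structure_sections R V" "msec M V" by (rule msec_mod[OF V(1)])
    have \<rho>V: "restrict (\<rho> j i) V \<in> carrier (structure_sections R V)" if "i < t" for i
      by (rule sections_restrict[OF is_cring V0(1) V(1,3) \<rho>c[OF j that]])
    have "const_section R V (r j i) = const_section R V e \<otimes>\<^bsub>structure_sections R V\<^esub> restrict (\<rho> j i) V"
      if i: "i < t" for i
      by (rule const_mult_fraction[OF V(1) \<rho>V[OF i] e r(1)[OF j i], symmetric]) (use r(2)[OF j i] in auto)
    then have "comb (r j) = const_section R V e \<odot>\<^bsub>msec M V\<^esub>
        (\<Oplus>\<^bsub>msec M V\<^esub>i\<in>{..<t}. restrict (\<rho> j i) V \<odot>\<^bsub>msec M V\<^esub> rs U V (m i))"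
      unfolding comb_def finsum_sect sect_smult
      using mV \<rho>V const_section_closed[OF V(1) e(1)] by (intro N.finsum_smult_zero) (auto simp: sect_carrier)
    then show ?thesis
      using \<rho>_restrict[OF j V(1,3)] const_section_closed[OF V(1) e(1)] by (simp add: sect_zero)
  qed
  show thesis
  proof (rule that[OF V(1,2) VU])
    fix s q W assume s: "s \<in> sp U Z" and W: "opn W" "W \<subseteq> V" "q \<in> W" and s0: "rs U W s = \<zero>\<^bsub>sect W\<^esub>"
    obtain \<alpha> where \<alpha>: "\<And>i. i < t \<Longrightarrow> \<alpha> i \<in> carrier R" "s = (\<Oplus>\<^bsub>sect U\<^esub>i\<in>{..<t}. \<alpha> i \<odot>\<^bsub>sect U\<^esub> m i)"
      using U.span_image_lessThan[of t m s] m s unfolding Zm by auto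
    have rs_s: "rs U W' s = (\<Oplus>\<^bsub>sect W'\<^esub>i\<in>{..<t}. \<alpha> i \<odot>\<^bsub>sect W'\<^esub> rs U W' (m i))"
      if W': "opn W'" "W' \<subseteq> U" for W'
    proof -
      interpret W': module R "sect W'" by (rule sect_module[OF W'(1)])
      have "rs U W' s = (\<Oplus>\<^bsub>sect W'\<^esub>i\<in>{..<t}. rs U W' (\<alpha> i \<odot>\<^bsub>sect U\<^esub> m i))"
        unfolding \<alpha>(2) using \<alpha>(1) m by (intro rs_finsum[OF U(1) W']) auto
      also have "\<dots> = (\<Oplus>\<^bsub>sect W'\<^esub>i\<in>{..<t}. \<alpha> i \<odot>\<^bsub>sect W'\<^esub> rs U W' (m i))"
        using \<alpha>(1) m rs_smult[OF U(1) W'] rs_closed[OF U(1) W'] by (intro W'.M.finsum_cong') auto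
      finally show ?thesis .
    qed
    have WU: "W \<subseteq> U" and WV0: "W \<subseteq> V0" using W(2) V(3) VU by auto
    define a where "a = (\<lambda>i\<in>{..<t}. const_section R W (\<alpha> i))"
    have "(\<Oplus>\<^bsub>msec M W\<^esub>i\<in>{..<t}. a i \<odot>\<^bsub>msec M W\<^esub> rs U W (m i)) = rs U W s"
    proof -
      interpret W: module R "sect W" by (rule sect_module[OF W(1)])
      have "rs U W s = (\<Oplus>\<^bsub>sect W\<^esub>i\<in>{..<t}. a i \<odot>\<^bsub>msec M W\<^esub> rs U W (m i))"
        unfolding rs_s[OF W(1) WU]
        using \<alpha>(1) m rs_closed[OF U(1) W(1) WU]
        by (intro W.M.finsum_cong') (auto simp: a_def sect_smult[symmetric])
      then show ?thesis by (simp add: finsum_sect)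
    qed
    then have aQ: "a \<in> carrier (msec ?Q W)"
      unfolding Qcar[OF W(1)] using s0 \<alpha>(1) const_section_closed[OF W(1)]
      by (auto simp: a_def sect_zero)
    from gen[unfolded generates_def surjective_sheaf_map_def Spec_simps, rule_format,
        OF conjI[OF W(1) WV0] aQ W(3)]
    obtain W' where W': "opn W'" "q \<in> W'" "W' \<subseteq> W"
      and im: "mres ?Q W W' a \<in> sections_map ?Q V0 k \<rho> W' ` carrier (msec (free_sheaf (Spec R) k) W')"
      by (elim exE conjE)
    interpret O: cring "structure_sections R W'" by (rule sections_cring[OF is_cring W'(1)])
    interpret F: module "structure_sections R W'" "O.func_space {..<t}" by (rule O.func_space_is_module)
    interpret N: module "structure_sections R W'" "msec M W'" by (rule msec_mod[OF W'(1)])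
    interpret q: primeideal q R by (rule open_prime[OF W'(1,2)])
    have W'U: "W' \<subseteq> U" and W'V0: "W' \<subseteq> V0" and qV: "q \<in> V" using W'(2,3) WU WV0 W(2) by auto
    have mW': "rs U W' (m i) \<in> carrier (msec M W')" if "i < t" for i
      using rs_closed[OF U(1) W'(1) W'U m[OF that]] by (simp add: sect_carrier)
    obtain b where b: "b \<in> {..<k} \<rightarrow>\<^sub>E carrier (structure_sections R W')"
      "mres ?Q W W' a = sections_map ?Q V0 k \<rho> W' b"
      using im by (auto simp: free_sheaf_def O.func_space_def)
    let ?K = "msec ?Q W'"
    have K: "ring.zero ?K = (\<lambda>i\<in>{..<t}. \<zero>\<^bsub>structure_sections R W'\<^esub>)"
      "a' \<oplus>\<^bsub>?K\<^esub> a'' = (\<lambda>i\<in>{..<t}. a' i \<oplus>\<^bsub>structure_sections R W'\<^esub> a'' i)"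
      "b' \<odot>\<^bsub>?K\<^esub> a' = (\<lambda>i\<in>{..<t}. b' \<otimes>\<^bsub>structure_sections R W'\<^esub> a' i)" for a' a'' b'
      by (simp_all add: relation_sheaf_def free_sheaf_def O.func_space_def)
    note KC = Qcar[OF W'(1)]
    have Kclosed: "a' \<oplus>\<^bsub>?K\<^esub> a'' \<in> carrier ?K" if "a' \<in> carrier ?K" "a'' \<in> carrier ?K" for a' a''
    proof -
      have c: "a' i \<in> carrier (structure_sections R W')" "a'' i \<in> carrier (structure_sections R W')" if "i < t" for i
        using \<open>a' \<in> carrier ?K\<close> \<open>a'' \<in> carrier ?K\<close> that unfolding KC by auto
      have "(\<Oplus>\<^bsub>msec M W'\<^esub>i\<in>{..<t}. (a' \<oplus>\<^bsub>?K\<^esub> a'') i \<odot>\<^bsub>msec M W'\<^esub> rs U W' (m i)) =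
         (\<Oplus>\<^bsub>msec M W'\<^esub>i\<in>{..<t}. a' i \<odot>\<^bsub>msec M W'\<^esub> rs U W' (m i)) \<oplus>\<^bsub>msec M W'\<^esub>
         (\<Oplus>\<^bsub>msec M W'\<^esub>i\<in>{..<t}. a'' i \<odot>\<^bsub>msec M W'\<^esub> rs U W' (m i))"
        by (rule N.finsum_smult_add) (use mW' c in \<open>auto simp: K(2)\<close>)
      then show ?thesis using that c unfolding KC by (auto simp: K(2))
    qed
    have Kzero: "ring.zero ?K \<in> carrier ?K"
      unfolding KC K(1) by (auto intro!: N.finsum_smult_0 mW')
    have "abelian_monoid ?K"
    proof (rule abelian_monoidI)
      fix u v w assume "u \<in> carrier ?K" "v \<in> carrier ?K" "w \<in> carrier ?K"
      then have "u \<in> carrier (O.func_space {..<t})" "v \<in> carrier (O.func_space {..<t})" "w \<in> carrier (O.func_space {..<t})"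
        unfolding KC by (auto simp: O.func_space_def)
      note c = this
      show "u \<oplus>\<^bsub>?K\<^esub> v \<oplus>\<^bsub>?K\<^esub> w = u \<oplus>\<^bsub>?K\<^esub> (v \<oplus>\<^bsub>?K\<^esub> w)"
        using F.M.a_assoc[OF c] by (simp add: K O.func_space_def)
    next
      fix u v assume "u \<in> carrier ?K" "v \<in> carrier ?K"
      then have c: "u \<in> carrier (O.func_space {..<t})" "v \<in> carrier (O.func_space {..<t})"
        unfolding KC by (auto simp: O.func_space_def)
      show "u \<oplus>\<^bsub>?K\<^esub> v = v \<oplus>\<^bsub>?K\<^esub> u"
        using F.M.a_comm[OF c] by (simp add: K O.func_space_def)
    next
      fix u assume "u \<in> carrier ?K"
      then have c: "u \<in> carrier (O.func_space {..<t})"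
        unfolding KC by (auto simp: O.func_space_def)
      show "ring.zero ?K \<oplus>\<^bsub>?K\<^esub> u = u"
        using F.M.l_zero[OF c] by (simp add: K O.func_space_def)
    qed (use Kclosed Kzero in auto)
    then interpret K: abelian_monoid ?K .
    \<comment> \<open>The relations over \<open>W'\<close> whose germs at \<open>q\<close> are fractions of relations over \<open>R\<close> that hold on all of \<open>V\<close>.
      The generators \<open>\<rho> j\<close> have this property by the choice of \<open>V\<close>, hence so do their combinations.\<close>
    define L where "L = {a' \<in> carrier ?K. \<exists>h\<in>carrier R - q. \<exists>\<beta>. (\<forall>i<t. \<beta> i \<in> carrier R \<and>
        a' i q = fraction R q (\<beta> i) h) \<and> comb \<beta> = \<zero>\<^bsub>sect V\<^esub>}"
    have L_E: thesis
      if "u \<in> L" and *: "\<And>h \<beta>. \<lbrakk>u \<in> carrier ?K; h \<in> carrier R - q; \<And>i. i < t \<Longrightarrow> \<beta> i \<in> carrier R;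
        \<And>i. i < t \<Longrightarrow> u i q = fraction R q (\<beta> i) h; comb \<beta> = \<zero>\<^bsub>sect V\<^esub>\<rbrakk> \<Longrightarrow> thesis" for u thesis
    proof -
      from \<open>u \<in> L\<close> obtain h \<beta> where "u \<in> carrier ?K" "h \<in> carrier R - q"
        "\<forall>i<t. \<beta> i \<in> carrier R \<and> u i q = fraction R q (\<beta> i) h" "comb \<beta> = \<zero>\<^bsub>sect V\<^esub>"
        unfolding L_def mem_Collect_eq by (elim bexE exE conjE)
      then show thesis by (intro *[of h \<beta>]) simp_all
    qed
    have O_ops: "(\<zero>\<^bsub>structure_sections R W'\<^esub>) q = fraction R q \<zero> \<one>"
      "(f \<oplus>\<^bsub>structure_sections R W'\<^esub> g) q = f q \<oplus>\<^bsub>localization R q\<^esub> g q"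
      "(f \<otimes>\<^bsub>structure_sections R W'\<^esub> g) q = f q \<otimes>\<^bsub>localization R q\<^esub> g q" for f g
      using W'(2) by (simp_all add: sections_simps[OF is_cring])
    have "finsum ?K (\<lambda>j. b j \<odot>\<^bsub>?K\<^esub> mres ?Q V0 W' (\<rho> j)) {..<k} \<in> L"
    proof (rule K.finsum_mem)
      show "L \<subseteq> carrier ?K" by (auto simp: L_def)
      have "comb (\<lambda>i. \<zero>) = \<zero>\<^bsub>sect V\<^esub>" unfolding comb_def using mV by (intro V.finsum_smult_0) auto
      then show "ring.zero ?K \<in> L" unfolding L_def using Kzero q.one_compl
        by (intro CollectI conjI bexI[of _ \<one>] exI[of _ "\<lambda>i. \<zero>"]) (auto simp: K O_ops)
    next
      fix u v assume "u \<in> L" "v \<in> L"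
      then have uL: "u \<in> L" and vL: "v \<in> L" by auto
      obtain h \<beta> where u: "u \<in> carrier ?K" "h \<in> carrier R - q"
        "\<And>i. i < t \<Longrightarrow> \<beta> i \<in> carrier R" "\<And>i. i < t \<Longrightarrow> u i q = fraction R q (\<beta> i) h" "comb \<beta> = \<zero>\<^bsub>sect V\<^esub>"
        by (rule L_E[OF uL], rule that)
      obtain g \<gamma> where v: "v \<in> carrier ?K" "g \<in> carrier R - q"
        "\<And>i. i < t \<Longrightarrow> \<gamma> i \<in> carrier R" "\<And>i. i < t \<Longrightarrow> v i q = fraction R q (\<gamma> i) g" "comb \<gamma> = \<zero>\<^bsub>sect V\<^esub>"
        by (rule L_E[OF vL], rule that)
      let ?\<delta> = "\<lambda>i. g \<otimes> \<beta> i \<oplus> h \<otimes> \<gamma> i"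
      have "comb ?\<delta> = comb (\<lambda>i. g \<otimes> \<beta> i) \<oplus>\<^bsub>sect V\<^esub> comb (\<lambda>i. h \<otimes> \<gamma> i)"
        by (rule comb_add) (use u v in auto)
      also have "comb (\<lambda>i. g \<otimes> \<beta> i) = g \<odot>\<^bsub>sect V\<^esub> comb \<beta>" by (rule comb_smult) (use u v in auto)
      also have "comb (\<lambda>i. h \<otimes> \<gamma> i) = h \<odot>\<^bsub>sect V\<^esub> comb \<gamma>" by (rule comb_smult) (use u v in auto)
      finally have "comb ?\<delta> = \<zero>\<^bsub>sect V\<^esub>" using u(2,5) v(2,5) by simp
      moreover have "(u \<oplus>\<^bsub>?K\<^esub> v) i q = fraction R q (?\<delta> i) (h \<otimes> g)" if i: "i < t" for i
        using i by (simp add: K O_ops u(4) v(4) q.localization_add[OF u(3)[OF i] u(2) v(3)[OF i] v(2)])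
      ultimately show "u \<oplus>\<^bsub>?K\<^esub> v \<in> L" unfolding L_def
        using Kclosed[OF u(1) v(1)] q.compl_closed[OF u(2) v(2)] u(2,3) v(2,3)
        by (intro CollectI conjI bexI[of _ "h \<otimes> g"] exI[of _ ?\<delta>]) auto
    next
      show "(\<lambda>j. b j \<odot>\<^bsub>?K\<^esub> mres ?Q V0 W' (\<rho> j)) \<in> {..<k} \<rightarrow> L"
      proof
        fix j assume "j \<in> {..<k}"
        then have j: "j < k" by simp
        have bj: "b j \<in> carrier (structure_sections R W')" using b(1) j by auto
        define \<rho>' where "\<rho>' = (\<lambda>i\<in>{..<t}. restrict (\<rho> j i) W')"
        have mr: "mres ?Q V0 W' (\<rho> j) = \<rho>'"
          by (simp add: relation_sheaf_def free_sheaf_def \<rho>'_def)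
        have \<rho>'c: "\<rho>' i \<in> carrier (structure_sections R W')" if "i < t" for i
          using sections_restrict[OF is_cring V0(1) W'(1) W'V0 \<rho>c[OF j that]] that by (simp add: \<rho>'_def)
        have sum0: "(\<Oplus>\<^bsub>msec M W'\<^esub>i\<in>{..<t}. \<rho>' i \<odot>\<^bsub>msec M W'\<^esub> rs U W' (m i)) = \<zero>\<^bsub>msec M W'\<^esub>"
          unfolding \<rho>_restrict[OF j W'(1) W'V0, symmetric]
          using mW' \<rho>'c by (intro N.M.finsum_cong') (auto simp: \<rho>'_def)
        have "(\<Oplus>\<^bsub>msec M W'\<^esub>i\<in>{..<t}. (b j \<odot>\<^bsub>?K\<^esub> \<rho>') i \<odot>\<^bsub>msec M W'\<^esub> rs U W' (m i))
            = b j \<odot>\<^bsub>msec M W'\<^esub> (\<Oplus>\<^bsub>msec M W'\<^esub>i\<in>{..<t}. \<rho>' i \<odot>\<^bsub>msec M W'\<^esub> rs U W' (m i))"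
          by (rule N.finsum_smult_zero) (use mW' \<rho>'c bj in \<open>auto simp: K\<close>)
        then have inK: "b j \<odot>\<^bsub>?K\<^esub> \<rho>' \<in> carrier ?K"
          unfolding KC using bj \<rho>'c sum0 by (auto simp: K)
        obtain \<beta> e' where be: "\<beta> \<in> carrier R" "e' \<in> carrier R - q" "b j q = fraction R q \<beta> e'"
          using section_locally_fraction[OF bj W'(2)] W'(2) by (metis DiffI)
        have "comb (\<lambda>i. \<beta> \<otimes> r j i) = \<beta> \<odot>\<^bsub>sect V\<^esub> comb (r j)"
          by (rule comb_smult) (use be(1) r(1)[OF j] in auto)
        then have "comb (\<lambda>i. \<beta> \<otimes> r j i) = \<zero>\<^bsub>sect V\<^esub>" using comb_r[OF j] be(1) by simp
        moreover have "(b j \<odot>\<^bsub>?K\<^esub> \<rho>') i q = fraction R q (\<beta> \<otimes> r j i) (e' \<otimes> e)" if i: "i < t" for i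
        proof -
          have "e \<in> carrier R - q" using e qV by auto
          from q.localization_mult[OF be(1,2) r(1)[OF j i] this]
          show ?thesis using i W'(2) by (simp add: K O_ops be(3) \<rho>'_def r(2)[OF j i qV])
        qed
        moreover have "e' \<otimes> e \<in> carrier R - q" using q.compl_closed[OF be(2)] e qV by auto
        ultimately show "b j \<odot>\<^bsub>?K\<^esub> mres ?Q V0 W' (\<rho> j) \<in> L" unfolding mr L_def
          using inK be(1) r(1)[OF j]
          by (intro CollectI conjI bexI[of _ "e' \<otimes> e"] exI[of _ "\<lambda>i. \<beta> \<otimes> r j i"]) auto
      qed
    qed
    then have aL: "mres ?Q W W' a \<in> L" unfolding b(2) sections_map_def .
    obtain h \<beta> where h: "mres ?Q W W' a \<in> carrier ?K" "h \<in> carrier R - q" "\<And>i. i < t \<Longrightarrow> \<beta> i \<in> carrier R"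
      "\<And>i. i < t \<Longrightarrow> mres ?Q W W' a i q = fraction R q (\<beta> i) h" "comb \<beta> = \<zero>\<^bsub>sect V\<^esub>"
      by (rule L_E[OF aL], rule that)
    note h = h(2-5)
    have "mres ?Q W W' a i q = fraction R q (\<alpha> i) \<one>" if "i < t" for i
      using that W'(2,3) by (auto simp: relation_sheaf_def free_sheaf_def a_def const_section_def)
    then have "\<exists>l\<in>carrier R - q. \<forall>i<t. l \<otimes> (h \<otimes> \<alpha> i) = l \<otimes> \<beta> i"
      using h(2,3) \<alpha>(1) by (intro fraction_eqs_common_multiplier[OF open_prime[OF W'(1,2)] h(1)]) auto
    then obtain l where l: "l \<in> carrier R - q" "\<And>i. i < t \<Longrightarrow> l \<otimes> (h \<otimes> \<alpha> i) = l \<otimes> \<beta> i" by auto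
    have "(l \<otimes> h) \<odot>\<^bsub>sect V\<^esub> rs U V s = comb (\<lambda>i. (l \<otimes> h) \<otimes> \<alpha> i)"
      unfolding rs_s[OF V(1) VU] comb_def[symmetric]
      by (rule comb_smult[symmetric]) (use l h \<alpha>(1) in auto)
    also have "\<dots> = l \<odot>\<^bsub>sect V\<^esub> comb \<beta>"
    proof (rule comb_smult)
      show "(l \<otimes> h) \<otimes> \<alpha> i = l \<otimes> \<beta> i" if "i < t" for i
        using l(1) h(1) \<alpha>(1)[OF that] by (simp add: m_assoc flip: l(2)[OF that])
    qed (use l h in auto)
    also have "\<dots> = \<zero>\<^bsub>sect V\<^esub>" using h(4) l(1) by simp
    finally show "\<exists>c\<in>carrier R - q. c \<odot>\<^bsub>sect V\<^esub> rs U V s = \<zero>\<^bsub>sect V\<^esub>"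
      using q.compl_closed[OF l(1) h(1)] by auto
  qed
qed


subsection \<open>Vanishing and extension of sections\<close>

lemma pow_kill:
  assumes "opn W" "s \<in> carrier (sect W)" "g \<in> carrier R" "g [^] (N::nat) \<odot>\<^bsub>sect W\<^esub> s = \<zero>\<^bsub>sect W\<^esub>" "N \<le> K"
  shows "g [^] K \<odot>\<^bsub>sect W\<^esub> s = \<zero>\<^bsub>sect W\<^esub>"
proof -
  interpret W: module R "sect W" by (rule sect_module[OF assms(1)])
  have "g [^] K = g [^] (K - N) \<otimes> g [^] N" using assms(3,5) by (simp add: nat_pow_mult)
  then show ?thesis using assms(2-4) by (simp add: W.smult_assoc1)
qed

lemma mult_notin_prime:
  assumes "primeideal p R" "g \<in> carrier R" "h \<in> carrier R" "g \<otimes> h \<notin> p"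
  shows "g \<notin> p" "h \<notin> p"
  using ideal.I_r_closed[OF primeideal.axioms(1)[OF assms(1)], of g h]
    ideal.I_l_closed[OF primeideal.axioms(1)[OF assms(1)], of h g] assms(2-4) by auto

text \<open>By patching, only a neighbourhood of a point is concerned. There the section is, up to a unit \<open>c\<close>, a
  combination of local generators. On a basic open set given by \<open>h\<close>, by the lemma on relations, the elements that kill
  this combination do not all lie in any one prime at which \<open>g\<close> and \<open>h\<close> are units, so a power
  of \<open>g h\<close> kills it; and \<open>h\<close> and \<open>c\<close> are units there.\<close>

lemma killed_by_power:
  assumes W: "opn W" and s: "s \<in> carrier (sect W)" and g: "g \<in> carrier R"
    and zero: "rs W (W \<inter> basic_open R g) s = \<zero>\<^bsub>sect (W \<inter> basic_open R g)\<^esub>"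
  obtains N :: nat where "g [^] N \<odot>\<^bsub>sect W\<^esub> s = \<zero>\<^bsub>sect W\<^esub>"
proof -
  define P where "P A \<longleftrightarrow> (\<exists>N::nat. g [^] N \<odot>\<^bsub>sect A\<^esub> rs W A s = \<zero>\<^bsub>sect A\<^esub>)" for A
  have "P W"
  proof (rule zariski_patching[OF W, of P])
    interpret E: module R "sect {}" by (rule sect_module) simp
    have "rs W {} s \<in> carrier (sect {})" by (rule rs_closed[OF W _ _ s]) auto
    then show "P {}" unfolding P_def using sections_over_empty g by (intro exI[of _ 0]) auto
  next
    fix A B assume AB: "opn A" "opn B" "A \<subseteq> W" "B \<subseteq> W" "P A" "P B"
    then obtain N K :: nat where NK: "g [^] N \<odot>\<^bsub>sect A\<^esub> rs W A s = \<zero>\<^bsub>sect A\<^esub>"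
      "g [^] K \<odot>\<^bsub>sect B\<^esub> rs W B s = \<zero>\<^bsub>sect B\<^esub>" unfolding P_def by auto
    have C: "opn (A \<union> B)" "A \<union> B \<subseteq> W" using AB by auto
    interpret C: module R "sect (A \<union> B)" by (rule sect_module[OF C(1)])
    let ?N = "N + K"
    have r: "rs W (A \<union> B) s \<in> carrier (sect (A \<union> B))" by (rule rs_closed[OF W C s])
    have e: "rs (A \<union> B) D (g [^] ?N \<odot>\<^bsub>sect (A \<union> B)\<^esub> rs W (A \<union> B) s) = rs (A \<union> B) D \<zero>\<^bsub>sect (A \<union> B)\<^esub>"
      if D: "opn D" "D \<subseteq> A \<union> B" "g [^] ?N \<odot>\<^bsub>sect D\<^esub> rs W D s = \<zero>\<^bsub>sect D\<^esub>" for D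
      using g r rs_comp[OF W C(1) D(1) C(2) D(2) s] D(3)
      by (simp add: rs_smult[OF C(1) D(1,2)] rs_zero[OF C(1) D(1,2)])
    have "g [^] ?N \<odot>\<^bsub>sect (A \<union> B)\<^esub> rs W (A \<union> B) s = \<zero>\<^bsub>sect (A \<union> B)\<^esub>"
    proof (rule sections_equal[OF AB(1,2)])
      show "rs (A \<union> B) A (g [^] ?N \<odot>\<^bsub>sect (A \<union> B)\<^esub> rs W (A \<union> B) s) = rs (A \<union> B) A \<zero>\<^bsub>sect (A \<union> B)\<^esub>"
        by (rule e[OF AB(1)]) (use pow_kill[OF AB(1) rs_closed[OF W AB(1,3) s] g NK(1), of ?N] in auto)
      show "rs (A \<union> B) B (g [^] ?N \<odot>\<^bsub>sect (A \<union> B)\<^esub> rs W (A \<union> B) s) = rs (A \<union> B) B \<zero>\<^bsub>sect (A \<union> B)\<^esub>"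
        by (rule e[OF AB(2)]) (use pow_kill[OF AB(2) rs_closed[OF W AB(2,4) s] g NK(2), of ?N] in auto)
    qed (use g r in auto)
    then show "P (A \<union> B)" unfolding P_def by auto
  next
    fix x assume x: "x \<in> W"
    then have xw: "x \<in> whole" using opn_sub_whole[OF W] by auto
    obtain V0 Z where V0: "opn V0" "x \<in> V0" "finite Z" "Z \<subseteq> carrier (sect V0)"
      and gen: "\<And>W s y. \<lbrakk>opn W; W \<subseteq> V0; s \<in> carrier (sect W); y \<in> W\<rbrakk> \<Longrightarrow> s \<in> near_span V0 Z W y"
      by (rule local_generators[OF xw], rule that)
    let ?W = "W \<inter> V0"
    have W': "opn ?W" "?W \<subseteq> W" "?W \<subseteq> V0" "x \<in> ?W" using W V0 x by auto
    have "rs W ?W s \<in> near_span V0 Z ?W x"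
      by (rule gen[OF W'(1,3) rs_closed[OF W W'(1,2) s] W'(4)])
    then obtain W1 c where W1: "opn W1" "x \<in> W1" "W1 \<subseteq> ?W" "unit_on W1 c"
      "c \<odot>\<^bsub>sect W1\<^esub> rs ?W W1 (rs W ?W s) \<in> sp W1 (rs V0 W1 ` Z)" by (rule near_spanE)
    have W1W: "W1 \<subseteq> W" and W1V0: "W1 \<subseteq> V0" using W1(3) by auto
    define s1 where "s1 = c \<odot>\<^bsub>sect W1\<^esub> rs W W1 s"
    have s1: "s1 \<in> sp W1 (rs V0 W1 ` Z)"
      using W1(5) rs_comp[OF W W'(1) W1(1) W'(2) W1(3) s] unfolding s1_def by simp
    note c = unit_onD(1)[OF W1(4)]
    have ZW1: "rs V0 W1 ` Z \<subseteq> carrier (sect W1)" using rs_closed[OF V0(1) W1(1) W1V0] V0(4) by auto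
    obtain V where V: "opn V" "x \<in> V" "V \<subseteq> W1"
      and rel: "\<And>s q W. \<lbrakk>s \<in> sp W1 (rs V0 W1 ` Z); opn W; W \<subseteq> V; q \<in> W; rs W1 W s = \<zero>\<^bsub>sect W\<^esub>\<rbrakk>
        \<Longrightarrow> \<exists>c\<in>carrier R - q. c \<odot>\<^bsub>sect V\<^esub> rs W1 V s = \<zero>\<^bsub>sect V\<^esub>"
      by (rule local_relations[OF W1(1,2) finite_imageI[OF V0(3)] ZW1], rule that)
    obtain h where h: "h \<in> carrier R" "x \<in> basic_open R h" "basic_open R h \<subseteq> V"
      by (rule basic_nbhd[OF V(1,2)], rule that)
    let ?H = "basic_open R h"
    have H: "opn ?H" "?H \<subseteq> W1" "?H \<subseteq> W" using open_basic[OF h(1)] h(3) V(3) W1W by auto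
    interpret H: module R "sect ?H" by (rule sect_module[OF H(1)])
    interpret V: module R "sect V" by (rule sect_module[OF V(1)])
    have rH: "rs W ?H s \<in> carrier (sect ?H)" by (rule rs_closed[OF W H(1,3) s])
    have s1c: "s1 \<in> carrier (sect W1)"
      unfolding s1_def using module.smult_closed[OF sect_module[OF W1(1)] c rs_closed[OF W W1(1) W1W s]] .
    have s1H: "rs W1 D s1 = c \<odot>\<^bsub>sect D\<^esub> rs W D s" if "opn D" "D \<subseteq> W1" for D
      unfolding s1_def using rs_smult[OF W1(1) that c rs_closed[OF W W1(1) W1W s]]
        rs_comp[OF W W1(1) that(1) W1W that(2) s] by simp
    define J where "J = {l \<in> carrier R. l \<odot>\<^bsub>sect ?H\<^esub> rs W1 ?H s1 \<in> {\<zero>\<^bsub>sect ?H\<^esub>}}"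
    have Jid: "ideal J R"
      unfolding J_def by (rule H.colon_ideal[OF H.submod_zero rs_closed[OF W1(1) H(1,2) s1c]])
    obtain N :: nat where N: "(g \<otimes> h) [^] N \<in> J"
    proof (rule power_mem_ideal[OF Jid m_closed[OF g h(1)]])
      fix p assume p: "primeideal p R" "J \<subseteq> p"
      show "g \<otimes> h \<in> p"
      proof (rule ccontr)
        assume "g \<otimes> h \<notin> p"
        note gh = mult_notin_prime[OF p(1) g h(1) this]
        let ?D = "?H \<inter> basic_open R g"
        have D: "opn ?D" "?D \<subseteq> V" "p \<in> ?D" "?D \<subseteq> W1" "?D \<subseteq> W" "?D \<subseteq> W \<inter> basic_open R g"
          using H open_basic[OF g] h(3) gh p(1) by (auto simp: basic_open_def)
        have Wg: "opn (W \<inter> basic_open R g)" "W \<inter> basic_open R g \<subseteq> W" using W open_basic[OF g] by auto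
        interpret D: module R "sect ?D" by (rule sect_module[OF D(1)])
        have "rs W ?D s = \<zero>\<^bsub>sect ?D\<^esub>"
          using rs_comp[OF W Wg(1) D(1) Wg(2) D(6) s] zero rs_zero[OF Wg(1) D(1,6)] by simp
        then have "rs W1 ?D s1 = \<zero>\<^bsub>sect ?D\<^esub>" using s1H[OF D(1,4)] c by simp
        from rel[OF s1 D(1-3) this] obtain l where
          l: "l \<in> carrier R" "l \<notin> p" "l \<odot>\<^bsub>sect V\<^esub> rs W1 V s1 = \<zero>\<^bsub>sect V\<^esub>" by auto
        have "rs V ?H (l \<odot>\<^bsub>sect V\<^esub> rs W1 V s1) = l \<odot>\<^bsub>sect ?H\<^esub> rs W1 ?H s1"
          using rs_smult[OF V(1) H(1) h(3) l(1) rs_closed[OF W1(1) V(1,3) s1c]]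
            rs_comp[OF W1(1) V(1) H(1) V(3) h(3) s1c] by simp
        then have "l \<in> J" using l(1,3) rs_zero[OF V(1) H(1) h(3)] by (simp add: J_def)
        then show False using p(2) l(2) by auto
      qed
    qed
    have uH: "unit_on ?H h" "unit_on ?H c"
      using unit_on_basic[OF h(1) subset_refl] unit_on_mono[OF W1(4) H(2)] by auto
    have u: "unit_on ?H (h [^] N \<otimes> c)" by (rule unit_on_mult[OF H(1) unit_on_pow[OF H(1) uH(1)] uH(2)])
    have "(h [^] N \<otimes> c) \<odot>\<^bsub>sect ?H\<^esub> (g [^] N \<odot>\<^bsub>sect ?H\<^esub> rs W ?H s)
        = (g \<otimes> h) [^] N \<odot>\<^bsub>sect ?H\<^esub> rs W1 ?H s1"
      using g h(1) c rH by (simp add: s1H[OF H(1,2)] nat_pow_distrib m_ac flip: H.smult_assoc1)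
    also have "\<dots> = (h [^] N \<otimes> c) \<odot>\<^bsub>sect ?H\<^esub> \<zero>\<^bsub>sect ?H\<^esub>" using N h(1) c by (simp add: J_def)
    finally have "g [^] N \<odot>\<^bsub>sect ?H\<^esub> rs W ?H s = \<zero>\<^bsub>sect ?H\<^esub>"
      by (rule unit_cancel[OF H(1) u, rotated 2]) (use g rH in auto)
    then have "P ?H" unfolding P_def by auto
    then show "\<exists>V. opn V \<and> x \<in> V \<and> V \<subseteq> W \<and> P V" using H h(2) by auto
  qed
  then show thesis using that rs_id[OF W s] unfolding P_def by auto
qed

lemma killed_near:
  assumes W: "opn W" "s \<in> carrier (sect W)" and W': "opn W'" "W' \<subseteq> W" "q \<in> W'"
    and zero: "rs W W' s = \<zero>\<^bsub>sect W'\<^esub>"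
  shows "\<exists>c\<in>carrier R - q. c \<odot>\<^bsub>sect W\<^esub> s = \<zero>\<^bsub>sect W\<^esub>"
proof -
  obtain g where g: "g \<in> carrier R" "g \<notin> q" "q \<in> basic_open R g" "basic_open R g \<subseteq> W'"
    by (rule basic_nbhd[OF W'(1,3)], rule that)
  let ?G = "W \<inter> basic_open R g"
  have G: "opn ?G" "?G \<subseteq> W'" using W(1) open_basic[OF g(1)] g(4) by auto
  have "rs W ?G s = \<zero>\<^bsub>sect ?G\<^esub>"
    using rs_comp[OF W(1) W'(1) G(1) W'(2) G(2) W(2)] zero rs_zero[OF W'(1) G] by simp
  then obtain N :: nat where "g [^] N \<odot>\<^bsub>sect W\<^esub> s = \<zero>\<^bsub>sect W\<^esub>" by (rule killed_by_power[OF W g(1)])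
  then show ?thesis using primeideal_pow[OF open_prime[OF W'(1,3)] g(1,2)] by auto
qed

lemma agree_near:
  assumes W: "opn W" "s \<in> carrier (sect W)" "t \<in> carrier (sect W)" and W': "opn W'" "W' \<subseteq> W" "q \<in> W'"
    and eq: "rs W W' s = rs W W' t"
  shows "\<exists>c\<in>carrier R - q. c \<odot>\<^bsub>sect W\<^esub> s = c \<odot>\<^bsub>sect W\<^esub> t"
proof -
  interpret W: module R "sect W" by (rule sect_module[OF W(1)])
  interpret W': module R "sect W'" by (rule sect_module[OF W'(1)])
  have "rs W W' (s \<ominus>\<^bsub>sect W\<^esub> t) = \<zero>\<^bsub>sect W'\<^esub>"
    unfolding rs_minus[OF W(1) W'(1,2) W(2,3)] eq
    using rs_closed[OF W(1) W'(1,2) W(3)] by (simp add: W'.M.r_neg a_minus_def)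
  from killed_near[OF W(1) W.M.minus_closed[OF W(2,3)] W' this]
  obtain c where c: "c \<in> carrier R - q" "c \<odot>\<^bsub>sect W\<^esub> (s \<ominus>\<^bsub>sect W\<^esub> t) = \<zero>\<^bsub>sect W\<^esub>" by auto
  have "c \<odot>\<^bsub>sect W\<^esub> s \<ominus>\<^bsub>sect W\<^esub> c \<odot>\<^bsub>sect W\<^esub> t = \<zero>\<^bsub>sect W\<^esub>"
    using c W(2,3) by (simp add: a_minus_def W.smult_r_distr W.smult_r_minus)
  then have "c \<odot>\<^bsub>sect W\<^esub> s = c \<odot>\<^bsub>sect W\<^esub> t"
    using c(1) W(2,3) by simp
  then show ?thesis using c(1) by auto
qed

text \<open>Near a point with generators defined on a basic open set given by \<open>h\<close>, the elements that turn the section into a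
  combination of the generators form an ideal. It contains a power of \<open>g h\<close>, and the
  combination, divided by the power of the unit \<open>h\<close>, is an extension. Extensions over two open sets agree
  on the intersection up to a power of \<open>g\<close> and then glue.\<close>

lemma extension_up_to_power:
  assumes g: "g \<in> carrier R" and s: "s \<in> carrier (sect (basic_open R g))"
  obtains N :: nat and t where "t \<in> carrier (sect whole)"
    "rs whole (basic_open R g) t = g [^] N \<odot>\<^bsub>sect (basic_open R g)\<^esub> s"
proof -
  let ?G = "basic_open R g"
  have G: "opn ?G" by (rule open_basic[OF g])
  have rG: "rs ?G D s \<in> carrier (sect D)" if "opn D" "D \<subseteq> ?G" for D by (rule rs_closed[OF G that s])
  define extends where "extends N A t \<longleftrightarrow> t \<in> carrier (sect A) \<and>
    (\<forall>D. opn D \<and> D \<subseteq> A \<and> D \<subseteq> ?G \<longrightarrow> rs A D t = g [^] N \<odot>\<^bsub>sect D\<^esub> rs ?G D s)" for N :: nat and A t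
  have extendsD: "t \<in> carrier (sect A)"
      "\<lbrakk>opn D; D \<subseteq> A; D \<subseteq> ?G\<rbrakk> \<Longrightarrow> rs A D t = g [^] N \<odot>\<^bsub>sect D\<^esub> rs ?G D s"
    if "extends N A t" for N A t D using that unfolding extends_def by auto
  have scale: "extends (K + N) A (g [^] K \<odot>\<^bsub>sect A\<^esub> t)" if A: "opn A" and t: "extends N A t" for K N A t
    unfolding extends_def
  proof (intro conjI allI impI)
    interpret A: module R "sect A" by (rule sect_module[OF A])
    show "g [^] K \<odot>\<^bsub>sect A\<^esub> t \<in> carrier (sect A)" using extendsD(1)[OF t] g by simp
    fix D assume "opn D \<and> D \<subseteq> A \<and> D \<subseteq> ?G"
    then have D: "opn D" "D \<subseteq> A" "D \<subseteq> ?G" by auto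
    interpret D: module R "sect D" by (rule sect_module[OF D(1)])
    show "rs A D (g [^] K \<odot>\<^bsub>sect A\<^esub> t) = g [^] (K + N) \<odot>\<^bsub>sect D\<^esub> rs ?G D s"
      using rs_smult[OF A D(1,2) _ extendsD(1)[OF t], of "g [^] K"] extendsD(2)[OF t D] g rG[OF D(1,3)]
      by (simp add: nat_pow_mult[symmetric] D.smult_assoc1)
  qed
  define P where "P A \<longleftrightarrow> (\<exists>N t. extends N A t)" for A
  have "P whole"
  proof (rule zariski_patching[OF opn_whole, of P])
    interpret E: module R "sect {}" by (rule sect_module) simp
    have "extends 0 {} \<zero>\<^bsub>sect {}\<^esub>"
      unfolding extends_def
    proof (intro conjI allI impI)
      fix D assume "opn D \<and> D \<subseteq> {} \<and> D \<subseteq> ?G"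
      then have D: "D = {}" "opn {}" "{} \<subseteq> ?G" by auto
      show "rs {} D \<zero>\<^bsub>sect {}\<^esub> = g [^] (0::nat) \<odot>\<^bsub>sect D\<^esub> rs ?G D s"
        using rG[OF D(2,3)] rs_zero[OF D(2,2) subset_refl] sections_over_empty by (simp add: D(1))
    qed simp
    then show "P {}" unfolding P_def by auto
  next
    fix A B assume AB: "opn A" "opn B" "P A" "P B"
    obtain N1 t1 where t1: "extends N1 A t1" using AB(3) unfolding P_def by auto
    obtain N2 t2 where t2: "extends N2 B t2" using AB(4) unfolding P_def by auto
    define N where "N = N1 + N2"
    \<comment> \<open>Both extensions are first multiplied to the same power of \<open>g\<close>; their difference on
      the intersection is then killed by a further power.\<close>
    define u1 where "u1 = g [^] N2 \<odot>\<^bsub>sect A\<^esub> t1"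
    define u2 where "u2 = g [^] N1 \<odot>\<^bsub>sect B\<^esub> t2"
    have u1: "extends N A u1" and u2: "extends N B u2"
      using scale[OF AB(1) t1, of N2] scale[OF AB(2) t2, of N1] by (simp_all add: N_def u1_def u2_def add.commute)
    let ?I = "A \<inter> B"
    have I: "opn ?I" "?I \<subseteq> A" "?I \<subseteq> B" using AB by auto
    interpret I: module R "sect ?I" by (rule sect_module[OF I(1)])
    have rI: "rs A ?I u1 \<in> carrier (sect ?I)" "rs B ?I u2 \<in> carrier (sect ?I)"
      using rs_closed[OF AB(1) I(1,2) extendsD(1)[OF u1]] rs_closed[OF AB(2) I(1,3) extendsD(1)[OF u2]] by auto
    have IG: "opn (?I \<inter> ?G)" "?I \<inter> ?G \<subseteq> ?I" "?I \<inter> ?G \<subseteq> A" "?I \<inter> ?G \<subseteq> B" "?I \<inter> ?G \<subseteq> ?G"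
      using I(1) G by auto
    interpret IG: module R "sect (?I \<inter> ?G)" by (rule sect_module[OF IG(1)])
    have "rs ?I (?I \<inter> ?G) (rs A ?I u1 \<ominus>\<^bsub>sect ?I\<^esub> rs B ?I u2) = \<zero>\<^bsub>sect (?I \<inter> ?G)\<^esub>"
      unfolding rs_minus[OF I(1) IG(1,2) rI] rs_comp[OF AB(1) I(1) IG(1) I(2) IG(2) extendsD(1)[OF u1]]
        rs_comp[OF AB(2) I(1) IG(1) I(3) IG(2) extendsD(1)[OF u2]] extendsD(2)[OF u1 IG(1,3,5)]
        extendsD(2)[OF u2 IG(1,4,5)]
      using g rG[OF IG(1,5)] by (simp add: a_minus_def IG.M.r_neg)
    then obtain K :: nat where K: "g [^] K \<odot>\<^bsub>sect ?I\<^esub> (rs A ?I u1 \<ominus>\<^bsub>sect ?I\<^esub> rs B ?I u2) = \<zero>\<^bsub>sect ?I\<^esub>"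
      by (rule killed_by_power[OF I(1) I.M.minus_closed[OF rI] g])
    have gK: "g [^] K \<in> carrier R" using g by simp
    have "g [^] K \<odot>\<^bsub>sect ?I\<^esub> rs A ?I u1 \<ominus>\<^bsub>sect ?I\<^esub> g [^] K \<odot>\<^bsub>sect ?I\<^esub> rs B ?I u2 = \<zero>\<^bsub>sect ?I\<^esub>"
      using K gK rI by (simp add: a_minus_def I.smult_r_distr I.smult_r_minus)
    then have "g [^] K \<odot>\<^bsub>sect ?I\<^esub> rs A ?I u1 = g [^] K \<odot>\<^bsub>sect ?I\<^esub> rs B ?I u2"
      using gK rI by simp
    then have eq: "rs A ?I (g [^] K \<odot>\<^bsub>sect A\<^esub> u1) = rs B ?I (g [^] K \<odot>\<^bsub>sect B\<^esub> u2)"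
      by (simp add: rs_smult[OF AB(1) I(1,2) gK extendsD(1)[OF u1]] rs_smult[OF AB(2) I(1,3) gK extendsD(1)[OF u2]])
    note v1 = scale[OF AB(1) u1, of K] and v2 = scale[OF AB(2) u2, of K]
    obtain v where v: "v \<in> carrier (sect (A \<union> B))" "rs (A \<union> B) A v = g [^] K \<odot>\<^bsub>sect A\<^esub> u1"
      "rs (A \<union> B) B v = g [^] K \<odot>\<^bsub>sect B\<^esub> u2"
      by (rule glue[OF AB(1,2) extendsD(1)[OF v1] extendsD(1)[OF v2] eq])
    have U: "opn (A \<union> B)" using AB by auto
    have gN: "g [^] (K + N) \<in> carrier R" using g by simp
    have "extends (K + N) (A \<union> B) v"
      unfolding extends_def
    proof (intro conjI allI impI v(1))
      fix D assume "opn D \<and> D \<subseteq> A \<union> B \<and> D \<subseteq> ?G"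
      then have D: "opn D" "D \<subseteq> A \<union> B" "D \<subseteq> ?G" "(A \<inter> D) \<union> (B \<inter> D) = D" by auto
      interpret D: module R "sect D" by (rule sect_module[OF D(1)])
      have local: "rs D (E \<inter> D) (rs (A \<union> B) D v) = rs D (E \<inter> D) (g [^] (K + N) \<odot>\<^bsub>sect D\<^esub> rs ?G D s)"
        if E: "opn E" "E \<subseteq> A \<union> B" and w: "extends (K + N) E (rs (A \<union> B) E v)" for E
      proof -
        have ED: "opn (E \<inter> D)" "E \<inter> D \<subseteq> E" "E \<inter> D \<subseteq> D" "E \<inter> D \<subseteq> ?G" using E D by auto
        show ?thesis
          using rs_comp[OF U D(1) ED(1) D(2) ED(3) v(1)] rs_comp[OF U E(1) ED(1) E(2) ED(2) v(1)]
            extendsD(2)[OF w ED(1,2,4)] rs_smult[OF D(1) ED(1,3) gN rG[OF D(1,3)]]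
            rs_comp[OF G D(1) ED(1) D(3) ED(3) s] by simp
      qed
      show "rs (A \<union> B) D v = g [^] (K + N) \<odot>\<^bsub>sect D\<^esub> rs ?G D s"
        by (rule sections_equal[of "A \<inter> D" "B \<inter> D", unfolded D(4)])
          (use AB D(1) local[OF AB(1)] local[OF AB(2)] v(2,3) v1 v2 rs_closed[OF U D(1,2) v(1)]
            D.smult_closed[OF gN rG[OF D(1,3)]] in auto)
    qed
    then show "P (A \<union> B)" unfolding P_def by auto
  next
    fix x assume x: "x \<in> whole"
    obtain V0 Z where V0: "opn V0" "x \<in> V0" "finite Z" "Z \<subseteq> carrier (sect V0)"
      and gen: "\<And>W s y. \<lbrakk>opn W; W \<subseteq> V0; s \<in> carrier (sect W); y \<in> W\<rbrakk> \<Longrightarrow> s \<in> near_span V0 Z W y"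
      by (rule local_generators[OF x], rule that)
    obtain h where h: "h \<in> carrier R" "x \<in> basic_open R h" "basic_open R h \<subseteq> V0"
      by (rule basic_nbhd[OF V0(1,2)], rule that)
    let ?H = "basic_open R h" and ?D = "basic_open R h \<inter> ?G"
    have H: "opn ?H" by (rule open_basic[OF h(1)])
    have D: "opn ?D" "?D \<subseteq> ?H" "?D \<subseteq> ?G" "?D \<subseteq> V0" using H G h(3) by auto
    interpret H: module R "sect ?H" by (rule sect_module[OF H])
    interpret D: module R "sect ?D" by (rule sect_module[OF D(1)])
    have ZD: "rs V0 ?D ` Z \<subseteq> carrier (sect ?D)" using rs_closed[OF V0(1) D(1,4)] V0(4) by auto
    note sub = D.submodD[OF D.span_is_submodule[OF ZD]]
    have sD: "rs ?G ?D s \<in> carrier (sect ?D)" by (rule rs_closed[OF G D(1,3) s])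
    define J where "J = {l \<in> carrier R. l \<odot>\<^bsub>sect ?D\<^esub> rs ?G ?D s \<in> sp ?D (rs V0 ?D ` Z)}"
    have Jid: "ideal J R" unfolding J_def by (rule D.colon_ideal[OF D.span_is_submodule[OF ZD] sD])
    obtain N :: nat where N: "(g \<otimes> h) [^] N \<in> J"
    proof (rule power_mem_ideal[OF Jid m_closed[OF g h(1)]])
      fix p assume p: "primeideal p R" "J \<subseteq> p"
      show "g \<otimes> h \<in> p"
      proof (rule ccontr)
        assume "g \<otimes> h \<notin> p"
        note gh = mult_notin_prime[OF p(1) g h(1) this]
        have pD: "p \<in> ?D" using gh p(1) by (auto simp: basic_open_def)
        have "rs ?G ?D s \<in> near_span V0 Z ?D p" by (rule gen[OF D(1,4) sD pD])
        then obtain W c where W: "opn W" "p \<in> W" "W \<subseteq> ?D" "unit_on W c"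
          "c \<odot>\<^bsub>sect W\<^esub> rs ?D W (rs ?G ?D s) \<in> sp W (rs V0 W ` Z)" by (rule near_spanE)
        note c = unit_onD[OF W(4)]
        have "sp W (rs V0 W ` Z) = rs ?D W ` sp ?D (rs V0 ?D ` Z)"
          using rs_span[OF D(1) W(1,3) ZD] rs_image_comp[OF V0(1) D(1) W(1) D(4) W(3) V0(4)] by simp
        then obtain u where u: "u \<in> sp ?D (rs V0 ?D ` Z)"
          "c \<odot>\<^bsub>sect W\<^esub> rs ?D W (rs ?G ?D s) = rs ?D W u" using W(5) by auto
        have "rs ?D W (c \<odot>\<^bsub>sect ?D\<^esub> rs ?G ?D s) = rs ?D W u"
          using u(2) rs_smult[OF D(1) W(1,3) c(1) sD] by simp
        from agree_near[OF D(1) D.smult_closed[OF c(1) sD] sub(5)[OF u(1)] W(1,3,2) this]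
        obtain e where e: "e \<in> carrier R - p" "e \<odot>\<^bsub>sect ?D\<^esub> (c \<odot>\<^bsub>sect ?D\<^esub> rs ?G ?D s) = e \<odot>\<^bsub>sect ?D\<^esub> u" by auto
        have "e \<otimes> c \<in> J" unfolding J_def using e c(1) sD sub(4)[of e u] u(1) by (simp add: D.smult_assoc1)
        moreover have "e \<otimes> c \<notin> p" using primeideal_mult[OF p(1)] e(1) c(1) c(2)[OF W(2)] by auto
        ultimately show False using p(2) by auto
      qed
    qed
    have rsp: "sp ?D (rs V0 ?D ` Z) = rs ?H ?D ` sp ?H (rs V0 ?H ` Z)"
    proof -
      have "rs V0 ?H ` Z \<subseteq> carrier (sect ?H)" using rs_closed[OF V0(1) H h(3)] V0(4) by auto
      from rs_span[OF H D(1,2) this] rs_image_comp[OF V0(1) H D(1) h(3) D(2) V0(4)] show ?thesis by simp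
    qed
    have ZH: "rs V0 ?H ` Z \<subseteq> carrier (sect ?H)" using rs_closed[OF V0(1) H h(3)] V0(4) by auto
    have "(g \<otimes> h) [^] N \<odot>\<^bsub>sect ?D\<^esub> rs ?G ?D s \<in> rs ?H ?D ` sp ?H (rs V0 ?H ` Z)"
      using N rsp by (simp add: J_def)
    then obtain u where u: "u \<in> sp ?H (rs V0 ?H ` Z)" "rs ?H ?D u = (g \<otimes> h) [^] N \<odot>\<^bsub>sect ?D\<^esub> rs ?G ?D s"
      by auto
    have uc: "u \<in> carrier (sect ?H)" using H.submodD(5)[OF H.span_is_submodule[OF ZH] u(1)] .
    have uh: "unit_on ?H (h [^] N)" by (rule unit_on_pow[OF H unit_on_basic[OF h(1) subset_refl]])
    obtain t where t: "t \<in> carrier (sect ?H)" "h [^] N \<odot>\<^bsub>sect ?H\<^esub> t = u"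
      by (rule unit_divide[OF H uh uc], rule that)
    have rt: "rs ?H ?D t \<in> carrier (sect ?D)" by (rule rs_closed[OF H D(1,2) t(1)])
    have "h [^] N \<odot>\<^bsub>sect ?D\<^esub> rs ?H ?D t = (g \<otimes> h) [^] N \<odot>\<^bsub>sect ?D\<^esub> rs ?G ?D s"
      using rs_smult[OF H D(1,2) _ t(1), of "h [^] N"] h(1) t(2) u(2) by simp
    also have "\<dots> = h [^] N \<odot>\<^bsub>sect ?D\<^esub> (g [^] N \<odot>\<^bsub>sect ?D\<^esub> rs ?G ?D s)"
      using g h(1) sD by (simp add: nat_pow_distrib m_comm[of "g [^] N"] D.smult_assoc1)
    finally have "rs ?H ?D t = g [^] N \<odot>\<^bsub>sect ?D\<^esub> rs ?G ?D s"
      by (rule unit_cancel[OF D(1) unit_on_mono[OF uh D(2)] rt, rotated]) (use g sD in auto)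
    then have tD: "rs ?H ?D t = g [^] N \<odot>\<^bsub>sect ?D\<^esub> rs ?G ?D s" .
    have "extends N ?H t"
      unfolding extends_def
    proof (intro conjI allI impI t(1))
      fix E assume "opn E \<and> E \<subseteq> ?H \<and> E \<subseteq> ?G"
      then have E: "opn E" "E \<subseteq> ?D" by auto
      have "rs ?H E t = rs ?D E (rs ?H ?D t)" using rs_comp[OF H D(1) E(1) D(2) E(2) t(1)] by simp
      also have "\<dots> = g [^] N \<odot>\<^bsub>sect E\<^esub> rs ?G E s"
        unfolding tD using rs_smult[OF D(1) E _ sD, of "g [^] N"] g rs_comp[OF G D(1) E(1) D(3) E(2) s] by simp
      finally show "rs ?H E t = g [^] N \<odot>\<^bsub>sect E\<^esub> rs ?G E s" .
    qed
    then have "P ?H" unfolding P_def by auto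
    then show "\<exists>V. opn V \<and> x \<in> V \<and> V \<subseteq> whole \<and> P V" using H h(2) opn_sub_whole[OF H] by auto
  qed
  then obtain N t where "extends N whole t" unfolding P_def by auto
  then show thesis
    using that[of t N] extendsD(1)[of N whole t] extendsD(2)[of N whole t ?G] G opn_sub_whole[OF G] rs_id[OF G s] by simp
qed

subsection \<open>Global sections generate\<close>

text \<open>The power of \<open>g\<close> that is needed to extend a section from the basic open set of \<open>g\<close> to the whole spectrum
  is a unit on the former, so the global sections generate all stalks.\<close>

lemma locally_global:
  assumes V: "opn V" "s \<in> carrier (sect V)" "x \<in> V"
  obtains W h t where "opn W" "x \<in> W" "W \<subseteq> V" "unit_on W h" "t \<in> carrier (sect whole)"
    "rs whole W t = h \<odot>\<^bsub>sect W\<^esub> rs V W s"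
proof -
  obtain g where g: "g \<in> carrier R" "x \<in> basic_open R g" "basic_open R g \<subseteq> V"
    by (rule basic_nbhd[OF V(1,3)], rule that)
  have G: "opn (basic_open R g)" by (rule open_basic[OF g(1)])
  obtain N :: nat and t where t: "t \<in> carrier (sect whole)"
    "rs whole (basic_open R g) t = g [^] N \<odot>\<^bsub>sect (basic_open R g)\<^esub> rs V (basic_open R g) s"
    by (rule extension_up_to_power[OF g(1) rs_closed[OF V(1) G g(3) V(2)]], rule that)
  show thesis
    by (rule that[OF G g(2,3) unit_on_pow[OF G unit_on_basic[OF g(1) subset_refl]] t])
qed

text \<open>Near each point local generators are, up to units, finitely many global sections. Patching collects
  finitely many global sections that generate at every prime; for a given section the
  denominators with respect to them then generate the unit ideal.\<close>

lemma global_sections_finitely_generated: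
  obtains Z where "finite Z" "Z \<subseteq> carrier (sect whole)" "sp whole Z = carrier (sect whole)"
proof -
  interpret G: module R "sect whole" by (rule sect_module[OF opn_whole])
  define P where "P A \<longleftrightarrow> (\<exists>Z. finite Z \<and> Z \<subseteq> carrier (sect whole) \<and>
    (\<forall>q\<in>A. carrier (sect whole) \<subseteq> G.sat q (sp whole Z)))" for A
  have "P whole"
  proof (rule zariski_patching[OF opn_whole, of P])
    show "P {}" unfolding P_def by auto
  next
    fix A B assume "P A" "P B"
    then obtain Y Z where Y: "finite Y" "Y \<subseteq> carrier (sect whole)"
      "\<forall>q\<in>A. carrier (sect whole) \<subseteq> G.sat q (sp whole Y)"
      and Z: "finite Z" "Z \<subseteq> carrier (sect whole)"
      "\<forall>q\<in>B. carrier (sect whole) \<subseteq> G.sat q (sp whole Z)" unfolding P_def by auto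
    have "G.sat q (sp whole Y) \<subseteq> G.sat q (sp whole (Y \<union> Z))" "G.sat q (sp whole Z) \<subseteq> G.sat q (sp whole (Y \<union> Z))" for q
      by (intro G.sat_mono G.span_is_monotone Un_upper1 Un_upper2)+
    then have "\<forall>q\<in>A \<union> B. carrier (sect whole) \<subseteq> G.sat q (sp whole (Y \<union> Z))"
      using Y(3) Z(3) by (meson UnE subset_trans)
    then show "P (A \<union> B)" unfolding P_def using Y(1,2) Z(1,2) by (intro exI[of _ "Y \<union> Z"]) simp
  next
    fix x assume x: "x \<in> whole"
    obtain V0 Y where V0: "opn V0" "x \<in> V0" "finite Y" "Y \<subseteq> carrier (sect V0)"
      and gen: "\<And>W s y. \<lbrakk>opn W; W \<subseteq> V0; s \<in> carrier (sect W); y \<in> W\<rbrakk> \<Longrightarrow> s \<in> near_span V0 Y W y"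
      by (rule local_generators[OF x], rule that)
    define lifts where "lifts z W h t \<longleftrightarrow> opn W \<and> x \<in> W \<and> W \<subseteq> V0 \<and> unit_on W h \<and>
      t \<in> carrier (sect whole) \<and> rs whole W t = h \<odot>\<^bsub>sect W\<^esub> rs V0 W z" for z W h t
    have "\<exists>W h t. lifts z W h t" if z: "z \<in> Y" for z
    proof -
      have zc: "z \<in> carrier (sect V0)" using z V0(4) by auto
      obtain W h t where "opn W" "x \<in> W" "W \<subseteq> V0" "unit_on W h" "t \<in> carrier (sect whole)"
        "rs whole W t = h \<odot>\<^bsub>sect W\<^esub> rs V0 W z" by (rule locally_global[OF V0(1) zc V0(2)], rule that)
      then show ?thesis unfolding lifts_def by blast
    qed
    then obtain N h t where "\<And>z. z \<in> Y \<Longrightarrow> lifts z (N z) (h z) (t z)" by metis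
    then have N: "opn (N z)" "x \<in> N z" "N z \<subseteq> V0" "unit_on (N z) (h z)" "t z \<in> carrier (sect whole)"
      "rs whole (N z) (t z) = h z \<odot>\<^bsub>sect (N z)\<^esub> rs V0 (N z) z" if "z \<in> Y" for z
      using that unfolding lifts_def by auto
    define V where "V = V0 \<inter> (\<Inter>z\<in>Y. N z)"
    define Z where "Z = t ` Y"
    have V: "opn V" "x \<in> V" "finite Z" "Z \<subseteq> carrier (sect whole)" "V \<subseteq> V0"
      using V0(1-3) N(1,2,5) by (auto simp: V_def Z_def intro!: openin_Int_Inter)
    have VN: "V \<subseteq> N z" if "z \<in> Y" for z using that by (auto simp: V_def)
    note Vw = opn_sub_whole[OF V(1)]
    note D = G.submodD[OF G.span_is_submodule[OF V(4)]]
    have "y \<in> G.sat q (sp whole Z)" if q: "q \<in> V" and y: "y \<in> carrier (sect whole)" for q y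
    proof -
      have "rs whole V y \<in> near_span V0 Y V q"
        by (rule gen[OF V(1,5) rs_closed[OF opn_whole V(1) Vw y] q])
      then obtain W c where W: "opn W" "q \<in> W" "W \<subseteq> V" "unit_on W c"
        "c \<odot>\<^bsub>sect W\<^esub> rs V W (rs whole V y) \<in> sp W (rs V0 W ` Y)" by (rule near_spanE)
      note c = unit_onD[OF W(4)] and Ww = opn_sub_whole[OF W(1)]
      have WV0: "W \<subseteq> V0" using W(3) V(5) by auto
      interpret W: module R "sect W" by (rule sect_module[OF W(1)])
      have tW: "rs whole W ` Z \<subseteq> carrier (sect W)" using rs_closed[OF opn_whole W(1) Ww] V(4) by auto
      note near = near_span_submodule[OF opn_whole W(1) Ww V(4) W(2)]
      have "W.submod (near_span whole Z W q)"
      proof (rule W.submodI)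
        show "a \<odot>\<^bsub>sect W\<^esub> s \<in> near_span whole Z W q" if "a \<in> carrier R" "s \<in> near_span whole Z W q" for a s
          unfolding sect_smult by (rule near(3)[OF const_section_closed[OF W(1) that(1)] that(2)])
      qed (use near(1,2) in \<open>auto simp: near_span_def\<close>)
      moreover have "rs V0 W z \<in> near_span whole Z W q" if z: "z \<in> Y" for z
      proof -
        note N = N[OF z]
        have WN: "W \<subseteq> N z" using W(3) VN[OF z] by auto
        have zc: "z \<in> carrier (sect V0)" using z V0(4) by auto
        have zW: "rs V0 W z \<in> carrier (sect W)" by (rule rs_closed[OF V0(1) W(1) WV0 zc])
        have "rs whole W (t z) = rs (N z) W (rs whole (N z) (t z))"
          by (rule rs_comp[OF opn_whole N(1) W(1) opn_sub_whole[OF N(1)] WN N(5), symmetric])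
        also have "\<dots> = h z \<odot>\<^bsub>sect W\<^esub> rs V0 W z"
          unfolding N(6) using rs_smult[OF N(1) W(1) WN unit_onD(1)[OF N(4)] rs_closed[OF V0(1) N(1,3) zc]]
            rs_comp[OF V0(1) N(1) W(1) N(3) WN zc] by simp
        finally have "rs whole W (t z) = h z \<odot>\<^bsub>sect W\<^esub> rs V0 W z" .
        moreover have "rs whole W (t z) \<in> sp W (rs whole W ` Z)"
          by (rule subsetD[OF W.in_own_span[OF tW]]) (use z in \<open>simp add: Z_def\<close>)
        ultimately have "h z \<odot>\<^bsub>sect W\<^esub> rs V0 W z \<in> sp W (rs whole W ` Z)" by simp
        then show ?thesis
          by (intro near_spanI[OF zW W(1,2) subset_refl unit_on_mono[OF N(4) WN]]) (simp add: rs_id[OF W(1) zW])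
      qed
      ultimately have "sp W (rs V0 W ` Y) \<subseteq> near_span whole Z W q" by (intro W.span_is_subset) auto
      then have "c \<odot>\<^bsub>sect W\<^esub> rs whole W y \<in> near_span whole Z W q"
        using W(5) rs_comp[OF opn_whole V(1) W(1) Vw W(3) y] by auto
      then obtain W2 e where W2: "opn W2" "q \<in> W2" "W2 \<subseteq> W" "unit_on W2 e"
        "e \<odot>\<^bsub>sect W2\<^esub> rs W W2 (c \<odot>\<^bsub>sect W\<^esub> rs whole W y) \<in> sp W2 (rs whole W2 ` Z)" by (rule near_spanE)
      note e = unit_onD[OF W2(4)] and W2w = opn_sub_whole[OF W2(1)]
      obtain u where u: "u \<in> sp whole Z"
        "e \<odot>\<^bsub>sect W2\<^esub> rs W W2 (c \<odot>\<^bsub>sect W\<^esub> rs whole W y) = rs whole W2 u"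
        using W2(5) unfolding rs_span[OF opn_whole W2(1) W2w V(4)] by auto
      have ec: "e \<otimes> c \<in> carrier R" "e \<otimes> c \<notin> q"
        using e(1) c(1) primeideal_mult[OF open_prime[OF V(1) q] e(1) c(1) e(2)[OF W2(2)] c(2)[OF W(2)]] by auto
      interpret W2: module R "sect W2" by (rule sect_module[OF W2(1)])
      have "rs whole W2 ((e \<otimes> c) \<odot>\<^bsub>sect whole\<^esub> y) = rs whole W2 u"
        using u(2) rs_smult[OF opn_whole W2(1) W2w ec(1) y] rs_smult[OF W(1) W2(1,3) c(1) rs_closed[OF opn_whole W(1) Ww y]]
          rs_comp[OF opn_whole W(1) W2(1) Ww W2(3) y] rs_closed[OF opn_whole W2(1) W2w y] e(1) c(1)
        by (simp add: W2.smult_assoc1)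
      from agree_near[OF opn_whole G.smult_closed[OF ec(1) y] D(5)[OF u(1)] W2(1) W2w W2(2) this]
      obtain l where l: "l \<in> carrier R - q"
        "l \<odot>\<^bsub>sect whole\<^esub> ((e \<otimes> c) \<odot>\<^bsub>sect whole\<^esub> y) = l \<odot>\<^bsub>sect whole\<^esub> u" by auto
      show ?thesis
      proof (rule G.satI[OF y])
        show "(l \<otimes> (e \<otimes> c)) \<odot>\<^bsub>sect whole\<^esub> y \<in> sp whole Z"
          using l ec(1) y u(1) D(4) by (simp add: G.smult_assoc1)
        show "l \<otimes> (e \<otimes> c) \<notin> q" using primeideal_mult[OF open_prime[OF V(1) q]] l(1) ec by auto
      qed (use l ec in auto)
    qed
    then have "P V" unfolding P_def using V(3,4) by auto
    then show "\<exists>V. opn V \<and> x \<in> V \<and> V \<subseteq> whole \<and> P V" using V(1,2) Vw by auto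
  qed
  then obtain Z where Z: "finite Z" "Z \<subseteq> carrier (sect whole)"
    "\<And>q. q \<in> whole \<Longrightarrow> carrier (sect whole) \<subseteq> G.sat q (sp whole Z)" unfolding P_def by auto
  note sub = G.span_is_submodule[OF Z(2)]
  have "carrier (sect whole) \<subseteq> sp whole Z"
  proof
    fix y assume y: "y \<in> carrier (sect whole)"
    have "\<one> \<in> {c \<in> carrier R. c \<odot>\<^bsub>sect whole\<^esub> y \<in> sp whole Z}"
    proof (rule one_mem_ideal_avoiding_primes[OF G.colon_ideal[OF sub y]])
      fix p assume "primeideal p R"
      then have "p \<in> whole" by (simp add: topspace_zariski)
      then have "y \<in> G.sat p (sp whole Z)" using Z(3) y by auto
      then obtain c where "c \<in> carrier R" "c \<notin> p" "c \<odot>\<^bsub>sect whole\<^esub> y \<in> sp whole Z" by (rule G.satE)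
      then show "\<not> {c \<in> carrier R. c \<odot>\<^bsub>sect whole\<^esub> y \<in> sp whole Z} \<subseteq> p" by auto
    qed
    then show "y \<in> sp whole Z" using y by simp
  qed
  then show thesis using that[OF Z(1,2)] G.submodD(1)[OF sub] by auto
qed

text \<open>Near each point a section is, up to a unit, a global one, which some denominator \<open>c\<close> outside the
  point brings into the span of the \<open>m i\<close>. On the open set where \<open>c\<close> is a unit as well, division gives the coefficients.\<close>

lemma generatesI:
  fixes t :: nat
  assumes U: "opn U" and m: "\<And>i. i < t \<Longrightarrow> m i \<in> carrier (sect whole)"
    and gen: "\<And>q. q \<in> U \<Longrightarrow> module.sat R (sect whole) q (sp whole (m ` {..<t})) = carrier (sect whole)"
  shows "generates (Spec R) M U t (\<lambda>i. rs whole U (m i))"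
  unfolding generates_def surjective_sheaf_map_def Spec_simps
proof (intro allI impI ballI)
  fix V s x assume "opn V \<and> V \<subseteq> U" and "s \<in> carrier (msec M V)" and x: "x \<in> V"
  then have V: "opn V" "V \<subseteq> U" and s: "s \<in> carrier (sect V)" by (auto simp: sect_carrier)
  interpret G: module R "sect whole" by (rule sect_module[OF opn_whole])
  obtain W h y where W: "opn W" "x \<in> W" "W \<subseteq> V" "unit_on W h" "y \<in> carrier (sect whole)"
    "rs whole W y = h \<odot>\<^bsub>sect W\<^esub> rs V W s" by (rule locally_global[OF V(1) s x], rule that)
  have "y \<in> G.sat x (sp whole (m ` {..<t}))" using gen x V(2) W(5) by auto
  then obtain c where c: "c \<in> carrier R" "c \<notin> x" "c \<odot>\<^bsub>sect whole\<^esub> y \<in> sp whole (m ` {..<t})"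
    by (rule G.satE)
  obtain \<alpha> where \<alpha>: "\<And>i. i < t \<Longrightarrow> \<alpha> i \<in> carrier R"
    "c \<odot>\<^bsub>sect whole\<^esub> y = (\<Oplus>\<^bsub>sect whole\<^esub>i\<in>{..<t}. \<alpha> i \<odot>\<^bsub>sect whole\<^esub> m i)"
    using G.span_image_lessThan[of t m, OF m c(3)] by auto
  note h = unit_onD(1)[OF W(4)]
  let ?W = "W \<inter> basic_open R c"
  have W': "opn ?W" "x \<in> ?W" "?W \<subseteq> W" "?W \<subseteq> V" "?W \<subseteq> U" "?W \<subseteq> whole"
    using W V open_basic[OF c(1)] c(2) open_prime[OF W(1,2)] opn_sub_whole[OF W(1)] by (auto simp: basic_open_def)
  have u: "unit_on ?W (c \<otimes> h)"
    by (rule unit_on_mult[OF W'(1) unit_on_basic[OF c(1)] unit_on_mono[OF W(4) W'(3)]]) auto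
  interpret W': module R "sect ?W" by (rule sect_module[OF W'(1)])
  interpret O: cring "structure_sections R ?W" by (rule sections_cring[OF is_cring W'(1)])
  interpret N: module "structure_sections R ?W" "msec M ?W" by (rule msec_mod[OF W'(1)])
  obtain b where b: "b \<in> carrier (structure_sections R ?W)"
    "\<And>s. s \<in> carrier (sect ?W) \<Longrightarrow> b \<odot>\<^bsub>msec M ?W\<^esub> ((c \<otimes> h) \<odot>\<^bsub>sect ?W\<^esub> s) = s"
    by (rule unit_inverse[OF W'(1) u], rule that)
  have rm: "rs whole ?W (m i) \<in> carrier (sect ?W)" if "i < t" for i
    by (rule rs_closed[OF opn_whole W'(1,6) m[OF that]])
  have rsc: "rs V ?W s \<in> carrier (sect ?W)" by (rule rs_closed[OF V(1) W'(1,4) s])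
  have "(c \<otimes> h) \<odot>\<^bsub>sect ?W\<^esub> rs V ?W s = c \<odot>\<^bsub>sect ?W\<^esub> rs W ?W (h \<odot>\<^bsub>sect W\<^esub> rs V W s)"
    using rs_smult[OF W(1) W'(1,3) h rs_closed[OF V(1) W(1,3) s]] rs_comp[OF V(1) W(1) W'(1) W(3) W'(3) s]
      c(1) h rsc by (simp add: W'.smult_assoc1)
  also have "\<dots> = rs whole ?W (c \<odot>\<^bsub>sect whole\<^esub> y)"
    unfolding W(6)[symmetric] using rs_smult[OF opn_whole W'(1,6) c(1) W(5)]
      rs_comp[OF opn_whole W(1) W'(1) opn_sub_whole[OF W(1)] W'(3) W(5)] by simp
  also have "\<dots> = (\<Oplus>\<^bsub>sect ?W\<^esub>i\<in>{..<t}. rs whole ?W (\<alpha> i \<odot>\<^bsub>sect whole\<^esub> m i))"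
    unfolding \<alpha>(2) using \<alpha>(1) m by (intro rs_finsum[OF opn_whole W'(1,6)]) auto
  also have "\<dots> = (\<Oplus>\<^bsub>sect ?W\<^esub>i\<in>{..<t}. \<alpha> i \<odot>\<^bsub>sect ?W\<^esub> rs whole ?W (m i))"
    using \<alpha>(1) m rm rs_smult[OF opn_whole W'(1,6)] by (intro W'.M.finsum_cong') auto
  finally have key: "(c \<otimes> h) \<odot>\<^bsub>sect ?W\<^esub> rs V ?W s = (\<Oplus>\<^bsub>msec M ?W\<^esub>i\<in>{..<t}. const_section R ?W (\<alpha> i) \<odot>\<^bsub>msec M ?W\<^esub> rs whole ?W (m i))"
    by (simp add: finsum_sect sect_smult)
  define a where "a = (\<lambda>i\<in>{..<t}. b \<otimes>\<^bsub>structure_sections R ?W\<^esub> const_section R ?W (\<alpha> i))"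
  have "rs V ?W s = b \<odot>\<^bsub>msec M ?W\<^esub> (\<Oplus>\<^bsub>msec M ?W\<^esub>i\<in>{..<t}. const_section R ?W (\<alpha> i) \<odot>\<^bsub>msec M ?W\<^esub> rs whole ?W (m i))"
    using b(2)[OF rsc] unfolding key by simp
  also have "\<dots> = (\<Oplus>\<^bsub>msec M ?W\<^esub>i\<in>{..<t}. a i \<odot>\<^bsub>msec M ?W\<^esub> rs whole ?W (m i))"
    by (rule N.finsum_smult_zero[symmetric])
      (use rm b(1) const_section_closed[OF W'(1)] \<alpha>(1) in \<open>auto simp: a_def sect_carrier\<close>)
  also have "\<dots> = sections_map M U t (\<lambda>i. rs whole U (m i)) ?W a"
    unfolding sections_map_def
  proof (rule N.M.finsum_cong'[OF refl])
    show "(\<lambda>i. a i \<odot>\<^bsub>msec M ?W\<^esub> rs U ?W (rs whole U (m i))) \<in> {..<t} \<rightarrow> carrier (msec M ?W)"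
      using rs_comp[OF opn_whole U W'(1) opn_sub_whole[OF U] W'(5) m] rm b(1) const_section_closed[OF W'(1)] \<alpha>(1)
      by (auto simp: a_def sect_carrier)
    show "a i \<odot>\<^bsub>msec M ?W\<^esub> rs whole ?W (m i) = a i \<odot>\<^bsub>msec M ?W\<^esub> rs U ?W (rs whole U (m i))"
      if "i \<in> {..<t}" for i
      using rs_comp[OF opn_whole U W'(1) opn_sub_whole[OF U] W'(5) m, of i] that by simp
  qed
  finally have "rs V ?W s = sections_map M U t (\<lambda>i. rs whole U (m i)) ?W a" .
  moreover have "a \<in> carrier (msec (free_sheaf (Spec R) t) ?W)"
    using b(1) const_section_closed[OF W'(1)] \<alpha>(1) by (auto simp: free_sheaf_def O.func_space_def a_def)
  ultimately show "\<exists>W. opn W \<and> x \<in> W \<and> W \<subseteq> V \<and>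
      rs V W s \<in> sections_map M U t (\<lambda>i. rs whole U (m i)) W ` carrier (msec (free_sheaf (Spec R) t) W)"
    using W'(1,2,4) by (intro exI[of _ ?W]) blast
qed

end

section \<open>Base change of modules\<close>

locale module_base_change = M: module A M + B: cring B
  for A :: "('a, 'i) ring_scheme" and M :: "('a, 'm, 'j) module_scheme" and B :: "('b, 'k) ring_scheme" +
  fixes \<phi> :: "'a \<Rightarrow> 'b"
  assumes \<phi>: "\<phi> \<in> ring_hom A B"
begin

definition rel :: "('m \<times> 'b \<Rightarrow>\<^sub>0 int) set" where
  "rel = generate (free_Abelian_group (carrier M \<times> carrier B)) (tensor_relations A M B \<phi>)"

definition supported :: "('m \<times> 'b \<Rightarrow>\<^sub>0 int) \<Rightarrow> bool" where
  "supported z \<longleftrightarrow> Poly_Mapping.keys z \<subseteq> carrier M \<times> carrier B"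

text \<open>The class of a formal sum in the tensor product. Describing it as a translate keeps the
  calculations in the additive group of formal sums, away from the quotient group.\<close>

definition cls :: "('m \<times> 'b \<Rightarrow>\<^sub>0 int) \<Rightarrow> ('m \<times> 'b \<Rightarrow>\<^sub>0 int) set" where
  "cls z = (\<lambda>n. n + z) ` rel"

definition act :: "'b \<Rightarrow> ('m \<times> 'b \<Rightarrow>\<^sub>0 int) \<Rightarrow> ('m \<times> 'b \<Rightarrow>\<^sub>0 int)" where
  "act c = frag_extend (\<lambda>(x, b). frag_of (x, c \<otimes>\<^bsub>B\<^esub> b))"

abbreviation "V \<equiv> base_change A M B \<phi>"

lemma supported_simps:
  "supported 0" "supported z \<Longrightarrow> supported w \<Longrightarrow> supported (z + w)"
  "supported z \<Longrightarrow> supported (- z)" "supported z \<Longrightarrow> supported w \<Longrightarrow> supported (z - w)"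
  "x \<in> carrier M \<Longrightarrow> b \<in> carrier B \<Longrightarrow> supported (frag_of (x, b))"
  unfolding supported_def using keys_add[of z w] keys_diff[of z w] by auto

lemma supported_induct [consumes 1, case_names zero diff gen]:
  assumes "supported z" "P 0" "\<And>z w. \<lbrakk>supported z; supported w; P z; P w\<rbrakk> \<Longrightarrow> P (z - w)"
    "\<And>x b. \<lbrakk>x \<in> carrier M; b \<in> carrier B\<rbrakk> \<Longrightarrow> P (frag_of (x, b))"
  shows "P z"
  by (rule free_Abelian_group_induct[of z "carrier M \<times> carrier B"])
    (use assms in \<open>auto simp: supported_def\<close>)

lemma tensor_relations_cases [consumes 1, case_names add_left add_right scalar]:
  assumes "z \<in> tensor_relations A M B \<phi>"
    and "\<And>x y b. \<lbrakk>x \<in> carrier M; y \<in> carrier M; b \<in> carrier B\<rbrakk>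
      \<Longrightarrow> P (frag_of (x \<oplus>\<^bsub>M\<^esub> y, b) - frag_of (x, b) - frag_of (y, b))"
    and "\<And>x b d. \<lbrakk>x \<in> carrier M; b \<in> carrier B; d \<in> carrier B\<rbrakk>
      \<Longrightarrow> P (frag_of (x, b \<oplus>\<^bsub>B\<^esub> d) - frag_of (x, b) - frag_of (x, d))"
    and "\<And>a x b. \<lbrakk>a \<in> carrier A; x \<in> carrier M; b \<in> carrier B\<rbrakk>
      \<Longrightarrow> P (frag_of (a \<odot>\<^bsub>M\<^esub> x, b) - frag_of (x, \<phi> a \<otimes>\<^bsub>B\<^esub> b))"
  shows "P z"
  using assms(1) unfolding tensor_relations_def
  by (elim UnE CollectE exE conjE) (simp_all only: assms(2-4))

lemma tensor_relations_supported: "z \<in> tensor_relations A M B \<phi> \<Longrightarrow> supported z"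
  unfolding tensor_relations_def using ring_hom_closed[OF \<phi>]
  by (auto intro!: supported_simps B.m_closed)

lemma rel_supported: "z \<in> rel \<Longrightarrow> supported z"
  unfolding rel_def
proof (induction rule: generate.induct)
  case (inv h)
  then show ?case using tensor_relations_supported[OF inv]
    by (simp add: supported_def)
next
  case (eng h1 h2)
  then show ?case by (simp add: supported_simps)
qed (auto simp: tensor_relations_supported supported_simps)

lemma rel_zero: "0 \<in> rel"
  using generate.one[of "free_Abelian_group (carrier M \<times> carrier B)"] by (simp add: rel_def)

lemma rel_add: "x \<in> rel \<Longrightarrow> y \<in> rel \<Longrightarrow> x + y \<in> rel"
  using generate.eng[of x "free_Abelian_group (carrier M \<times> carrier B)" _ y] by (simp add: rel_def)

lemma rel_incl: "x \<in> tensor_relations A M B \<phi> \<Longrightarrow> x \<in> rel"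
  unfolding rel_def by (rule generate.incl)

lemma rel_minus: "x \<in> rel \<Longrightarrow> - x \<in> rel"
  unfolding rel_def
proof (induction rule: generate.induct)
  case one
  then show ?case using rel_zero by (simp add: rel_def)
next
  case (incl h)
  have "inv\<^bsub>free_Abelian_group (carrier M \<times> carrier B)\<^esub> h \<in> generate (free_Abelian_group (carrier M \<times> carrier B)) (tensor_relations A M B \<phi>)"
    by (rule generate.inv[OF incl])
  then show ?case using tensor_relations_supported[OF incl] by (simp add: supported_def)
next
  case (inv h)
  then show ?case using tensor_relations_supported[OF inv] generate.incl[OF inv] by (simp add: supported_def)
next
  case (eng h1 h2)
  then show ?case using rel_add[of "- h1" "- h2"] by (simp add: rel_def)
qed

lemma rel_diff: "x \<in> rel \<Longrightarrow> y \<in> rel \<Longrightarrow> x - y \<in> rel"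
  using rel_add[of x "- y"] rel_minus[of y] by simp

lemma cls_eq: "cls z = cls w \<longleftrightarrow> z - w \<in> rel"
proof
  assume "cls z = cls w"
  moreover have "z \<in> cls z" unfolding cls_def using rel_zero by (intro image_eqI[of _ _ 0]) auto
  ultimately obtain n where "n \<in> rel" "z = n + w" by (auto simp: cls_def)
  then show "z - w \<in> rel" by simp
next
  assume zw: "z - w \<in> rel"
  have "cls z \<subseteq> cls w" if "z - w \<in> rel" for z w
  proof
    fix u assume "u \<in> cls z"
    then obtain n where n: "n \<in> rel" "u = n + z" by (auto simp: cls_def)
    then show "u \<in> cls w" unfolding cls_def
      using rel_add[OF n(1) that] by (intro image_eqI[of _ _ "n + (z - w)"]) (auto simp: algebra_simps)
  qed
  from this[OF zw] this[of w z] rel_minus[OF zw] show "cls z = cls w" by (simp add: subset_antisym)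
qed

lemma r_coset_cls: "rel #>\<^bsub>free_Abelian_group (carrier M \<times> carrier B)\<^esub> z = cls z"
  by (auto simp: r_coset_def cls_def)

lemma base_change_simps:
  "carrier V = {cls z | z. supported z}" "ring.zero V = cls 0"
  "cls z \<oplus>\<^bsub>V\<^esub> cls w = cls (z + w)"
  "c \<odot>\<^bsub>V\<^esub> C = (\<Union>z\<in>C. cls (act c z))"
proof -
  show "carrier V = {cls z | z. supported z}"
    by (auto simp: base_change_def Let_def FactGroup_def RCOSETS_def supported_def r_coset_cls
        rel_def[symmetric])
  have "rel = cls 0" by (simp add: cls_def)
  then show "ring.zero V = cls 0"
    by (simp add: base_change_def Let_def FactGroup_def rel_def[symmetric])
  have "cls z \<oplus>\<^bsub>V\<^esub> cls w = cls z <#>\<^bsub>free_Abelian_group (carrier M \<times> carrier B)\<^esub> cls w"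
    by (simp add: base_change_def Let_def FactGroup_def)
  also have "\<dots> = {x + y | x y. x \<in> cls z \<and> y \<in> cls w}" by (auto simp: set_mult_def)
  also have "\<dots> = cls (z + w)"
  proof (intro Set.set_eqI iffI)
    fix u assume "u \<in> {x + y | x y. x \<in> cls z \<and> y \<in> cls w}"
    then obtain n m where "n \<in> rel" "m \<in> rel" "u = (n + z) + (m + w)" by (auto simp: cls_def)
    then show "u \<in> cls (z + w)" unfolding cls_def
      using rel_add[of n m] by (intro image_eqI[of _ _ "n + m"]) (auto simp: algebra_simps)
  next
    fix u assume "u \<in> cls (z + w)"
    then obtain n where n: "n \<in> rel" "u = n + (z + w)" by (auto simp: cls_def)
    have "n + z \<in> cls z" "0 + w \<in> cls w" using n(1) rel_zero by (auto simp: cls_def)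
    moreover have "u = (n + z) + (0 + w)" using n(2) by (simp add: algebra_simps)
    ultimately show "u \<in> {x + y | x y. x \<in> cls z \<and> y \<in> cls w}" by blast
  qed
  finally show "cls z \<oplus>\<^bsub>V\<^esub> cls w = cls (z + w)" .
  show "c \<odot>\<^bsub>V\<^esub> C = (\<Union>z\<in>C. cls (act c z))"
    by (simp add: base_change_def Let_def rel_def[symmetric] r_coset_cls act_def)
qed

lemma act_simps: "act c 0 = 0" "act c (z + w) = act c z + act c w" "act c (z - w) = act c z - act c w"
  "act c (- z) = - act c z" "act c (frag_of (x, b)) = frag_of (x, c \<otimes>\<^bsub>B\<^esub> b)"
  by (simp_all add: act_def frag_extend_add frag_extend_diff frag_extend_minus)

lemma act_supported:
  assumes "c \<in> carrier B" "supported z"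
  shows "supported (act c z)"
  using assms(2)
  by (induction rule: supported_induct) (auto simp: act_simps assms(1) intro!: supported_simps)

lemma rel_tensor:
  "\<lbrakk>x \<in> carrier M; y \<in> carrier M; b \<in> carrier B\<rbrakk> \<Longrightarrow> frag_of (x \<oplus>\<^bsub>M\<^esub> y, b) - frag_of (x, b) - frag_of (y, b) \<in> rel"
  "\<lbrakk>x \<in> carrier M; b \<in> carrier B; c \<in> carrier B\<rbrakk> \<Longrightarrow> frag_of (x, b \<oplus>\<^bsub>B\<^esub> c) - frag_of (x, b) - frag_of (x, c) \<in> rel"
  "\<lbrakk>a \<in> carrier A; x \<in> carrier M; b \<in> carrier B\<rbrakk> \<Longrightarrow> frag_of (a \<odot>\<^bsub>M\<^esub> x, b) - frag_of (x, \<phi> a \<otimes>\<^bsub>B\<^esub> b) \<in> rel"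
proof -
  show "frag_of (x \<oplus>\<^bsub>M\<^esub> y, b) - frag_of (x, b) - frag_of (y, b) \<in> rel"
    if "x \<in> carrier M" "y \<in> carrier M" "b \<in> carrier B"
    by (rule rel_incl, unfold tensor_relations_def, rule UnI1, rule UnI1) (use that in blast)
  show "frag_of (x, b \<oplus>\<^bsub>B\<^esub> c) - frag_of (x, b) - frag_of (x, c) \<in> rel"
    if "x \<in> carrier M" "b \<in> carrier B" "c \<in> carrier B"
    by (rule rel_incl, unfold tensor_relations_def, rule UnI1, rule UnI2) (use that in blast)
  show "frag_of (a \<odot>\<^bsub>M\<^esub> x, b) - frag_of (x, \<phi> a \<otimes>\<^bsub>B\<^esub> b) \<in> rel"
    if "a \<in> carrier A" "x \<in> carrier M" "b \<in> carrier B"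
    by (rule rel_incl, unfold tensor_relations_def, rule UnI2) (use that in blast)
qed

lemma act_rel:
  assumes c: "c \<in> carrier B" and z: "z \<in> rel"
  shows "act c z \<in> rel"
proof -
  have gen: "act c h \<in> rel" if "h \<in> tensor_relations A M B \<phi>" for h
  proof -
    from \<open>h \<in> tensor_relations A M B \<phi>\<close> show ?thesis
    proof (induction rule: tensor_relations_cases)
      case (add_left x y b)
      then show ?case using rel_tensor(1)[of x y "c \<otimes>\<^bsub>B\<^esub> b"] c by (simp add: act_simps)
    next
      case (add_right x b d)
      then show ?case using rel_tensor(2)[of x "c \<otimes>\<^bsub>B\<^esub> b" "c \<otimes>\<^bsub>B\<^esub> d"] c by (simp add: act_simps B.r_distr)
    next
      case (scalar a x b)
      have "\<phi> a \<otimes>\<^bsub>B\<^esub> (c \<otimes>\<^bsub>B\<^esub> b) = c \<otimes>\<^bsub>B\<^esub> (\<phi> a \<otimes>\<^bsub>B\<^esub> b)"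
        using c scalar(3) ring_hom_closed[OF \<phi> scalar(1)] by (simp add: B.m_lcomm)
      then show ?case using scalar rel_tensor(3)[of a x "c \<otimes>\<^bsub>B\<^esub> b"] c by (simp add: act_simps)
    qed
  qed
  from z show ?thesis unfolding rel_def
  proof (induction rule: generate.induct)
    case (inv h)
    have "- act c h \<in> rel" using rel_minus[OF gen[OF inv]] .
    then show ?case using tensor_relations_supported[OF inv] by (simp add: supported_def act_simps rel_def)
  next
    case (eng h1 h2)
    then show ?case using rel_add by (simp add: act_simps rel_def)
  qed (use gen rel_zero in \<open>auto simp: act_simps rel_def\<close>)
qed

lemma smult_cls:
  assumes "c \<in> carrier B"
  shows "c \<odot>\<^bsub>V\<^esub> cls z = cls (act c z)"
proof -
  have "cls (act c w) = cls (act c z)" if w: "w \<in> cls z" for w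
  proof -
    obtain n where n: "n \<in> rel" "w = n + z" using w by (auto simp: cls_def)
    then show ?thesis unfolding cls_eq using act_rel[OF assms n(1)] by (simp add: act_simps)
  qed
  then have "(\<Union>w\<in>cls z. cls (act c w)) = (\<Union>w\<in>cls z. cls (act c z))" by (intro SUP_cong refl)
  moreover have "cls z \<noteq> {}" unfolding cls_def using rel_zero by auto
  ultimately show ?thesis unfolding base_change_simps(4) by simp
qed

lemma base_change_module: "module B V"
proof (rule moduleI)
  show "cring B" by (rule B.is_cring)
  show "abelian_group V"
  proof (rule abelian_groupI)
    fix x assume "x \<in> carrier V"
    then obtain z where z: "supported z" "x = cls z" by (auto simp: base_change_simps)
    show "\<exists>y\<in>carrier V. y \<oplus>\<^bsub>V\<^esub> x = \<zero>\<^bsub>V\<^esub>"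
      by (rule bexI[of _ "cls (- z)"]) (use z in \<open>auto simp: base_change_simps intro!: supported_simps\<close>)
  qed (auto simp: base_change_simps add_ac intro: supported_simps)
next
  fix c x assume c: "c \<in> carrier B" and "x \<in> carrier V"
  then obtain z where z: "supported z" "x = cls z" by (auto simp: base_change_simps)
  show "c \<odot>\<^bsub>V\<^esub> x \<in> carrier V" using act_supported[OF c z(1)] by (auto simp: z(2) smult_cls[OF c] base_change_simps(1))
next
  fix c d x assume c: "c \<in> carrier B" "d \<in> carrier B" and "x \<in> carrier V"
  then obtain z where z: "supported z" "x = cls z" by (auto simp: base_change_simps)
  have cd: "c \<oplus>\<^bsub>B\<^esub> d \<in> carrier B" "c \<otimes>\<^bsub>B\<^esub> d \<in> carrier B" using c by auto
  have "act (c \<oplus>\<^bsub>B\<^esub> d) z - (act c z + act d z) \<in> rel"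
    using z(1)
  proof (induction rule: supported_induct)
    case zero
    then show ?case by (simp add: act_simps rel_zero)
  next
    case (diff z w)
    then show ?case using rel_diff[OF diff(3,4)] by (simp add: act_simps algebra_simps)
  next
    case (gen x b)
    then show ?case using rel_tensor(2)[of x "c \<otimes>\<^bsub>B\<^esub> b" "d \<otimes>\<^bsub>B\<^esub> b"] c
      by (simp add: act_simps B.l_distr diff_diff_eq)
  qed
  then show "(c \<oplus>\<^bsub>B\<^esub> d) \<odot>\<^bsub>V\<^esub> x = c \<odot>\<^bsub>V\<^esub> x \<oplus>\<^bsub>V\<^esub> d \<odot>\<^bsub>V\<^esub> x"
    unfolding z(2) smult_cls[OF c(1)] smult_cls[OF c(2)] smult_cls[OF cd(1)] base_change_simps(3) cls_eq .
  have "act (c \<otimes>\<^bsub>B\<^esub> d) z = act c (act d z)"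
    using z(1) by (induction rule: supported_induct) (auto simp: act_simps c B.m_assoc)
  then show "(c \<otimes>\<^bsub>B\<^esub> d) \<odot>\<^bsub>V\<^esub> x = c \<odot>\<^bsub>V\<^esub> (d \<odot>\<^bsub>V\<^esub> x)"
    unfolding z(2) smult_cls[OF c(1)] smult_cls[OF c(2)] smult_cls[OF cd(2)] by simp
next
  fix c x y assume c: "c \<in> carrier B" and "x \<in> carrier V" "y \<in> carrier V"
  then obtain z w where "x = cls z" "y = cls w" by (auto simp: base_change_simps)
  then show "c \<odot>\<^bsub>V\<^esub> (x \<oplus>\<^bsub>V\<^esub> y) = c \<odot>\<^bsub>V\<^esub> x \<oplus>\<^bsub>V\<^esub> c \<odot>\<^bsub>V\<^esub> y"
    by (simp add: base_change_simps(3) smult_cls[OF c] act_simps)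
next
  fix x assume "x \<in> carrier V"
  then obtain z where z: "supported z" "x = cls z" by (auto simp: base_change_simps)
  have "act \<one>\<^bsub>B\<^esub> z = z"
    using z(1) by (induction rule: supported_induct) (auto simp: act_simps)
  then show "\<one>\<^bsub>B\<^esub> \<odot>\<^bsub>V\<^esub> x = x" unfolding z(2) smult_cls[OF B.one_closed] by simp
qed

end

text \<open>Over a quotient ring every tensor has the form \<open>x \<otimes> 1\<close>, so generators of the fibre lift to
  elements of the module. They generate modulo the ideal, which is
  seen from the map \<open>(x, a + I) \<mapsto> a x + S\<close> for a submodule \<open>S\<close> that contains \<open>I M\<close> and the lifts.\<close>

lemma lift_generators_of_quotient:
  fixes A :: "('a, 'i) ring_scheme" and M :: "('a, 'm, 'j) module_scheme"
  assumes M: "module A M" and I: "ideal I A"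
    and X: "finite X" "X \<subseteq> carrier (base_change A M (A Quot I) (\<lambda>a. I +>\<^bsub>A\<^esub> a))"
      "LinearCombinations.module.span (A Quot I) (base_change A M (A Quot I) (\<lambda>a. I +>\<^bsub>A\<^esub> a)) X
       = carrier (base_change A M (A Quot I) (\<lambda>a. I +>\<^bsub>A\<^esub> a))"
  obtains Y where "Y \<subseteq> carrier M" "finite Y" "card Y \<le> card X"
    "\<And>S. \<lbrakk>LinearCombinations.submodule A S M; Y \<subseteq> S; \<And>a y. \<lbrakk>a \<in> I; y \<in> carrier M\<rbrakk> \<Longrightarrow> a \<odot>\<^bsub>M\<^esub> y \<in> S\<rbrakk>
      \<Longrightarrow> S = carrier M"
proof -
  interpret M: module A M by (rule M)
  interpret I: ideal I A by (rule I)
  let ?B = "A Quot I" and ?\<phi> = "\<lambda>a. I +>\<^bsub>A\<^esub> a"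
  interpret B: cring ?B by (rule I.quotient_is_cring) (rule M.R.is_cring)
  interpret T: module_base_change A M ?B ?\<phi>
    by unfold_locales (rule I.rcos_ring_hom)
  interpret V: module ?B "base_change A M ?B ?\<phi>" by (rule T.base_change_module)
  have \<phi>c: "?\<phi> a \<in> carrier ?B" if "a \<in> carrier A" for a using ring_hom_closed[OF T.\<phi> that] .
  have rep: "\<exists>a\<in>carrier A. b = ?\<phi> a" if "b \<in> carrier ?B" for b
    using that by (auto simp: FactRing_simps)
  have one: "\<one>\<^bsub>?B\<^esub> = ?\<phi> \<one>\<^bsub>A\<^esub>" by (simp add: FactRing_def)
  let ?e = "\<lambda>x. frag_of (x, \<one>\<^bsub>?B\<^esub>)"
  have e_add: "T.cls (?e (x \<oplus>\<^bsub>M\<^esub> y)) = T.cls (?e x + ?e y)" if "x \<in> carrier M" "y \<in> carrier M" for x y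
    unfolding T.cls_eq using T.rel_tensor(1)[OF that B.one_closed] by (simp add: diff_diff_eq)
  have e_smult: "T.cls (frag_of (x, ?\<phi> a)) = T.cls (?e (a \<odot>\<^bsub>M\<^esub> x))" if "a \<in> carrier A" "x \<in> carrier M" for a x
    unfolding T.cls_eq using T.rel_minus[OF T.rel_tensor(3)[OF that B.one_closed]] \<phi>c[OF that(1)]
    by simp
  have e_zero: "T.cls (?e \<zero>\<^bsub>M\<^esub>) = T.cls 0"
    unfolding T.cls_eq using T.rel_minus[OF T.rel_tensor(1)[OF M.M.zero_closed M.M.zero_closed B.one_closed]]
    by simp
  have pure: "\<exists>x\<in>carrier M. T.cls z = T.cls (?e x)" if "T.supported z" for z
    using that
  proof (induction rule: T.supported_induct)
    case zero
    then show ?case using e_zero M.M.zero_closed by metis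
  next
    case (gen x b)
    obtain a where a: "a \<in> carrier A" "b = ?\<phi> a" using rep[OF gen(2)] by auto
    show ?case unfolding a(2) e_smult[OF a(1) gen(1)] using a(1) gen(1) by auto
  next
    case (diff z w)
    then obtain x y where x: "x \<in> carrier M" "T.cls z = T.cls (?e x)"
      and y: "y \<in> carrier M" "T.cls w = T.cls (?e y)" by auto
    have xy: "x \<ominus>\<^bsub>M\<^esub> y \<in> carrier M" using x y by simp
    have xe: "(x \<ominus>\<^bsub>M\<^esub> y) \<oplus>\<^bsub>M\<^esub> y = x" using x(1) y(1) by (simp add: a_minus_def M.M.a_assoc M.M.l_neg)
    have 1: "?e x - (?e (x \<ominus>\<^bsub>M\<^esub> y) + ?e y) \<in> T.rel"
      using e_add[OF xy y(1)] unfolding xe T.cls_eq .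
    have 2: "z - ?e x \<in> T.rel" "w - ?e y \<in> T.rel" using x(2) y(2) unfolding T.cls_eq by auto
    have "(z - w) - ?e (x \<ominus>\<^bsub>M\<^esub> y) = (z - ?e x) - (w - ?e y) + (?e x - (?e (x \<ominus>\<^bsub>M\<^esub> y) + ?e y))"
      by simp
    then have "T.cls (z - w) = T.cls (?e (x \<ominus>\<^bsub>M\<^esub> y))"
      unfolding T.cls_eq using T.rel_add[OF T.rel_diff[OF 2] 1] by simp
    then show ?case using xy by auto
  qed
  have "\<exists>x\<in>carrier M. C = T.cls (?e x)" if "C \<in> X" for C
    using X(2) that pure by (fastforce simp: T.base_change_simps)
  then obtain f where f: "\<And>C. C \<in> X \<Longrightarrow> f C \<in> carrier M" "\<And>C. C \<in> X \<Longrightarrow> C = T.cls (?e (f C))"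
    by metis
  show thesis
  proof (rule that[of "f ` X"])
    show "f ` X \<subseteq> carrier M" "finite (f ` X)" "card (f ` X) \<le> card X"
      using f(1) X(1) card_image_le by auto
    fix S assume S: "LinearCombinations.submodule A S M" and fS: "f ` X \<subseteq> S"
      and IS: "\<And>a y. \<lbrakk>a \<in> I; y \<in> carrier M\<rbrakk> \<Longrightarrow> a \<odot>\<^bsub>M\<^esub> y \<in> S"
    note D = M.submodD[OF S]
    \<comment> \<open>The image of \<open>S\<close> in the fibre is a subspace that contains the generators, so it is everything.\<close>
    define W where "W = {T.cls (?e x) | x. x \<in> S}"
    have "V.submod W"
    proof (rule V.submodI)
      show "W \<subseteq> carrier (base_change A M ?B ?\<phi>)"
        unfolding W_def T.base_change_simps(1) using D(5) by (auto intro: T.supported_simps)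
      show "\<zero>\<^bsub>base_change A M ?B ?\<phi>\<^esub> \<in> W" unfolding W_def T.base_change_simps(2) using e_zero D(2) by auto
    next
      fix u v assume "u \<in> W" "v \<in> W"
      then obtain x y where "x \<in> S" "y \<in> S" "u = T.cls (?e x)" "v = T.cls (?e y)" by (auto simp: W_def)
      then show "u \<oplus>\<^bsub>base_change A M ?B ?\<phi>\<^esub> v \<in> W"
        unfolding W_def using e_add[OF D(5) D(5), of x y] D(3)[of x y] by (auto simp: T.base_change_simps(3))
    next
      fix c u assume c: "c \<in> carrier ?B" and "u \<in> W"
      then obtain x where x: "x \<in> S" "u = T.cls (?e x)" by (auto simp: W_def)
      obtain a where a: "a \<in> carrier A" "c = ?\<phi> a" using rep[OF c] by auto
      have "c \<odot>\<^bsub>base_change A M ?B ?\<phi>\<^esub> u = T.cls (frag_of (x, ?\<phi> a))"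
        using c by (simp add: x(2) T.smult_cls T.act_simps a(2))
      then show "c \<odot>\<^bsub>base_change A M ?B ?\<phi>\<^esub> u \<in> W"
        unfolding W_def e_smult[OF a(1) D(5)[OF x(1)]] using D(4)[OF a(1) x(1)] by auto
    qed
    moreover have "X \<subseteq> W" unfolding W_def using f(2) fS by blast
    ultimately have "carrier (base_change A M ?B ?\<phi>) \<subseteq> W"
      using V.span_is_subset X(3) by metis
    then have cover: "\<exists>x\<in>S. ?e y - ?e x \<in> T.rel" if "y \<in> carrier M" for y
    proof -
      have "T.cls (?e y) \<in> W"
        using \<open>carrier (base_change A M ?B ?\<phi>) \<subseteq> W\<close> T.supported_simps(5)[OF that B.one_closed]
        unfolding T.base_change_simps(1) by blast
      then show ?thesis unfolding W_def by (auto simp: T.cls_eq)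
    qed
    have "subgroup S (add_monoid M)"
      by (rule M.M.add.subgroupI)
        (use D M.submod_minus[OF S D(2)] in \<open>auto simp: a_minus_def\<close>)
    then have add_sub: "additive_subgroup S M" by (rule additive_subgroupI)
    interpret S: abelian_subgroup S M
      by (rule abelian_subgroupI3[OF add_sub M.M.abelian_group_axioms])
    interpret Q: comm_group "M A_Mod S" by (rule S.a_factorgroup_is_comm_group)
    have Qc: "S +>\<^bsub>M\<^esub> u \<in> carrier (M A_Mod S)" if "u \<in> carrier M" for u
      using that by (auto simp: A_FactGroup_def' A_RCOSETS_def')
    have Qm: "(S +>\<^bsub>M\<^esub> u) \<otimes>\<^bsub>M A_Mod S\<^esub> (S +>\<^bsub>M\<^esub> v) = S +>\<^bsub>M\<^esub> (u \<oplus>\<^bsub>M\<^esub> v)"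
      if "u \<in> carrier M" "v \<in> carrier M" for u v
      using S.a_rcos_sum[OF that] by simp
    have Q1: "\<one>\<^bsub>M A_Mod S\<^esub> = S" by (simp add: A_FactGroup_def')
    have Qeq: "S +>\<^bsub>M\<^esub> u = S +>\<^bsub>M\<^esub> v" if "u \<in> carrier M" "v \<in> carrier M" "u \<ominus>\<^bsub>M\<^esub> v \<in> S" for u v
    proof -
      have "u = (u \<ominus>\<^bsub>M\<^esub> v) \<oplus>\<^bsub>M\<^esub> v" using that(1,2) by (simp add: a_minus_def M.M.a_assoc M.M.l_neg)
      then have "u \<in> S +>\<^bsub>M\<^esub> v" unfolding a_r_coset_def' using that(3) by blast
      then show ?thesis using S.a_repr_independence' that(2) by metis
    qed
    define r where "r b = (SOME a. a \<in> carrier A \<and> b = ?\<phi> a)" for b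
    have r: "r b \<in> carrier A" "b = ?\<phi> (r b)" if "b \<in> carrier ?B" for b
      using someI_ex[of "\<lambda>a. a \<in> carrier A \<and> b = ?\<phi> a"] rep[OF that] unfolding r_def by auto
    define g where "g = (\<lambda>(x, b). S +>\<^bsub>M\<^esub> (r b \<odot>\<^bsub>M\<^esub> x))"
    have g: "g (x, ?\<phi> a) = S +>\<^bsub>M\<^esub> (a \<odot>\<^bsub>M\<^esub> x)" if x: "x \<in> carrier M" and a: "a \<in> carrier A" for x a
    proof -
      note rr = r[OF \<phi>c[OF a]]
      have "r (?\<phi> a) \<ominus>\<^bsub>A\<^esub> a \<in> I"
        using M.R.quotient_eq_iff_same_a_r_cos[OF I rr(1) a] rr(2) by simp
      from IS[OF this x] have "r (?\<phi> a) \<odot>\<^bsub>M\<^esub> x \<ominus>\<^bsub>M\<^esub> a \<odot>\<^bsub>M\<^esub> x \<in> S"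
        using rr(1) a x by (simp add: a_minus_def M.smult_l_distr M.smult_l_minus)
      then show ?thesis unfolding g_def using Qeq rr(1) a x by simp
    qed
    have "g ` (carrier M \<times> carrier ?B) \<subseteq> carrier (M A_Mod S)"
      using r Qc by (auto simp: g_def)
    then obtain h where h: "h \<in> hom (free_Abelian_group (carrier M \<times> carrier ?B)) (M A_Mod S)"
      "\<And>z. z \<in> carrier M \<times> carrier ?B \<Longrightarrow> h (frag_of z) = g z"
      by (rule Q.free_Abelian_group_universal) auto
    have hc: "h z \<in> carrier (M A_Mod S)" if "T.supported z" for z
      using hom_in_carrier[OF h(1)] that by (simp add: T.supported_def)
    have hadd: "h (z + w) = h z \<otimes>\<^bsub>M A_Mod S\<^esub> h w" if "T.supported z" "T.supported w" for z w
      using hom_mult[OF h(1), of z w] that by (simp add: T.supported_def)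
    have hdiff: "h z = h (z - w) \<otimes>\<^bsub>M A_Mod S\<^esub> h w" if "T.supported z" "T.supported w" for z w
      using hadd[OF T.supported_simps(4)[OF that] that(2)] by simp
    have hdiff1: "h (z - w) = \<one>\<^bsub>M A_Mod S\<^esub>" if "T.supported z" "T.supported w" "h z = h w" for z w
      using hdiff[OF that(1,2)] hc[OF T.supported_simps(4)[OF that(1,2)]] hc[OF that(2)] that(3)
      by (metis Q.r_cancel_one)
    have hzero: "h 0 = \<one>\<^bsub>M A_Mod S\<^esub>" using hdiff1[OF T.supported_simps(1) T.supported_simps(1) refl] by simp
    have hgen: "h (frag_of (x, ?\<phi> a)) = S +>\<^bsub>M\<^esub> (a \<odot>\<^bsub>M\<^esub> x)" if "x \<in> carrier M" "a \<in> carrier A" for x a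
      using h(2)[of "(x, ?\<phi> a)"] g[OF that] that \<phi>c by simp
    have trel: "h z = \<one>\<^bsub>M A_Mod S\<^esub>" if "z \<in> tensor_relations A M ?B ?\<phi>" for z
      using that
    proof (induction rule: T.tensor_relations_cases)
      case (add_left x y b)
      obtain a where a: "a \<in> carrier A" "b = ?\<phi> a" using rep[OF add_left(3)] by auto
      have "h (frag_of (x \<oplus>\<^bsub>M\<^esub> y, b)) = h (frag_of (x, b) + frag_of (y, b))"
        using add_left(1,2) a(1) \<phi>c[OF a(1)]
        by (simp add: a(2) hadd T.supported_simps hgen M.smult_r_distr S.a_rcos_sum)
      then have "h (frag_of (x \<oplus>\<^bsub>M\<^esub> y, b) - (frag_of (x, b) + frag_of (y, b))) = \<one>\<^bsub>M A_Mod S\<^esub>"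
        using add_left by (intro hdiff1 T.supported_simps) auto
      then show ?case by (simp add: diff_diff_eq)
    next
      case (add_right x b d)
      obtain a where a: "a \<in> carrier A" "b = ?\<phi> a" using rep[OF add_right(2)] by auto
      obtain a' where a': "a' \<in> carrier A" "d = ?\<phi> a'" using rep[OF add_right(3)] by auto
      have bd: "b \<oplus>\<^bsub>?B\<^esub> d = ?\<phi> (a \<oplus>\<^bsub>A\<^esub> a')" using ring_hom_add[OF T.\<phi> a(1) a'(1)] a(2) a'(2) by simp
      have "h (frag_of (x, b \<oplus>\<^bsub>?B\<^esub> d)) = h (frag_of (x, b) + frag_of (x, d))"
        unfolding bd using add_right(1) a(1) a'(1) \<phi>c[OF a(1)] \<phi>c[OF a'(1)]
        by (simp add: a(2) a'(2) hadd T.supported_simps hgen M.smult_l_distr S.a_rcos_sum)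
      then have "h (frag_of (x, b \<oplus>\<^bsub>?B\<^esub> d) - (frag_of (x, b) + frag_of (x, d))) = \<one>\<^bsub>M A_Mod S\<^esub>"
        using add_right by (intro hdiff1 T.supported_simps) auto
      then show ?case by (simp add: diff_diff_eq)
    next
      case (scalar a x b)
      obtain a' where a': "a' \<in> carrier A" "b = ?\<phi> a'" using rep[OF scalar(3)] by auto
      have ab: "?\<phi> a \<otimes>\<^bsub>?B\<^esub> b = ?\<phi> (a' \<otimes>\<^bsub>A\<^esub> a)"
        using ring_hom_mult[OF T.\<phi> scalar(1) a'(1)] a'(2) M.R.m_comm[OF scalar(1) a'(1)] by simp
      have "h (frag_of (a \<odot>\<^bsub>M\<^esub> x, b)) = h (frag_of (x, ?\<phi> a \<otimes>\<^bsub>?B\<^esub> b))"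
        unfolding ab using scalar(1,2) a'(1) by (simp add: a'(2) hgen M.smult_assoc1)
      then show ?case
        using scalar \<phi>c[OF scalar(1)] by (intro hdiff1 T.supported_simps) auto
    qed
    have hrel: "h z = \<one>\<^bsub>M A_Mod S\<^esub>" if "z \<in> T.rel" for z
      using that unfolding T.rel_def
    proof (induction rule: generate.induct)
      case (inv k)
      have k: "T.supported k" by (rule T.tensor_relations_supported[OF inv])
      have "h (0 - k) = \<one>\<^bsub>M A_Mod S\<^esub>"
        by (rule hdiff1[OF T.supported_simps(1) k]) (simp add: hzero trel[OF inv])
      then show ?case using k by (simp add: T.supported_def)
    next
      case (eng k l)
      have "T.supported k" "T.supported l" using T.rel_supported eng(1,2) unfolding T.rel_def by auto
      then show ?case using eng by (simp add: hadd del: add_A_FactGroup)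
    qed (simp_all add: hzero trel)
    show "S = carrier M"
    proof
      show "carrier M \<subseteq> S"
      proof
        fix y assume y: "y \<in> carrier M"
        obtain x where x: "x \<in> S" "?e y - ?e x \<in> T.rel" using cover[OF y] by auto
        have xM: "x \<in> carrier M" by (rule D(5)[OF x(1)])
        have s: "T.supported (?e y)" "T.supported (?e x)" using y xM by (auto intro: T.supported_simps)
        have "h (?e y) = h (?e x)" using hdiff[OF s] hrel[OF x(2)] hc[OF s(2)] by (simp del: add_A_FactGroup)
        then have "S +>\<^bsub>M\<^esub> y = S +>\<^bsub>M\<^esub> x" unfolding one using hgen y xM by simp
        then have "y \<in> S +>\<^bsub>M\<^esub> x" using S.a_rcos_self[OF y] by simp
        then obtain s where "s \<in> S" "y = s \<oplus>\<^bsub>M\<^esub> x" unfolding a_r_coset_def' by blast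
        then show "y \<in> S" using D(3) x(1) by simp
      qed
    qed (rule D(1))
  qed
qed

section \<open>Stalks and fibres\<close>

context sheaf_of_sets
begin

lemma germ_mem_iff:
  "(V, t) \<in> germ T F r x U s \<longleftrightarrow> openin T V \<and> x \<in> V \<and> t \<in> F V \<and>
     (\<exists>W. openin T W \<and> x \<in> W \<and> W \<subseteq> U \<inter> V \<and> r U W s = r V W t)"
  by (simp add: germ_def)

lemma germ_self: "\<lbrakk>openin T U; x \<in> U; s \<in> F U\<rbrakk> \<Longrightarrow> (U, s) \<in> germ T F r x U s"
  unfolding germ_mem_iff by (intro conjI exI[of _ U]) auto

lemma germ_subsetI:
  assumes U: "openin T U" "x \<in> U" "s \<in> F U" and V: "openin T V" "x \<in> V" "t \<in> F V"
    and W: "openin T W" "x \<in> W" "W \<subseteq> U \<inter> V" "r U W s = r V W t"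
  shows "germ T F r x U s \<subseteq> germ T F r x V t"
proof
  fix z assume z: "z \<in> germ T F r x U s"
  obtain V' t' where zz: "z = (V', t')" by (cases z)
  from z obtain W' where V': "openin T V'" "x \<in> V'" "t' \<in> F V'"
    and W': "openin T W'" "x \<in> W'" "W' \<subseteq> U \<inter> V'" "r U W' s = r V' W' t'"
    unfolding zz germ_mem_iff by auto
  let ?W = "W \<inter> W'"
  have op: "openin T ?W" using W(1) W'(1) by auto
  have "r V ?W t = r W ?W (r V W t)" using res_comp[OF V(1) W(1) op _ _ V(3)] W(3) by simp
  also have "\<dots> = r U ?W s" unfolding W(4)[symmetric] using res_comp[OF U(1) W(1) op _ _ U(3)] W(3) by simp
  also have "\<dots> = r W' ?W (r U W' s)" using res_comp[OF U(1) W'(1) op _ _ U(3)] W'(3) by simp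
  also have "\<dots> = r V' ?W t'" unfolding W'(4) using res_comp[OF V'(1) W'(1) op _ _ V'(3)] W'(3) by simp
  finally have "r V ?W t = r V' ?W t'" .
  moreover have "x \<in> ?W" "?W \<subseteq> V \<inter> V'" using W(2,3) W'(2,3) by auto
  ultimately show "z \<in> germ T F r x V t" unfolding zz germ_mem_iff using V' op by (intro conjI exI[of _ ?W]) auto
qed

lemma germ_eqI:
  assumes "openin T U" "x \<in> U" "s \<in> F U" "openin T V" "x \<in> V" "t \<in> F V"
    and W: "openin T W" "x \<in> W" "W \<subseteq> U \<inter> V" "r U W s = r V W t"
  shows "germ T F r x U s = germ T F r x V t"
  using germ_subsetI[OF assms] germ_subsetI[OF assms(4-6,1-3) W(1,2) _ W(4)[symmetric]] W(3) by blast

lemma germ_eqD: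
  assumes "openin T V" "x \<in> V" "t \<in> F V" "germ T F r x U s = germ T F r x V t"
  obtains W where "openin T W" "x \<in> W" "W \<subseteq> U" "W \<subseteq> V" "r U W s = r V W t"
  using germ_self[OF assms(1-3)] unfolding assms(4)[symmetric] germ_mem_iff by auto

lemma germ_restrict:
  assumes "openin T U" "s \<in> F U" "openin T V" "x \<in> V" "V \<subseteq> U"
  shows "germ T F r x V (r U V s) = germ T F r x U s"
  by (rule germ_eqI[of V x _ U _ V])
    (use assms res_closed[OF assms(1,3,5,2)] res_comp[OF assms(1,3,3,5) subset_refl assms(2)] in auto)

lemma germ_in_germs: "\<lbrakk>openin T U; x \<in> U; s \<in> F U\<rbrakk> \<Longrightarrow> germ T F r x U s \<in> germs T F r x"
  by (auto simp: germs_def)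

lemma germs_common_open:
  assumes "G \<in> germs T F r x" "openin T V" "x \<in> V"
  obtains W s where "openin T W" "x \<in> W" "W \<subseteq> V" "s \<in> F W" "G = germ T F r x W s"
proof -
  obtain U s where U: "openin T U" "x \<in> U" "s \<in> F U" "G = germ T F r x U s"
    using assms(1) by (auto simp: germs_def)
  have op: "openin T (U \<inter> V)" using U(1) assms(2) by auto
  show thesis
    by (rule that[of "U \<inter> V" "r U (U \<inter> V) s"])
      (use U assms(3) op res_closed[OF U(1) op _ U(3)] germ_restrict[OF U(1,3) op] in auto)
qed

end

text \<open>An operation on sections that commutes with restriction can be computed on germs with
  representatives over a common open set.\<close>

lemma germ_binop:
  assumes S1: "sheaf_of_sets T F1 r1" and S2: "sheaf_of_sets T F2 r2" and S3: "sheaf_of_sets T F3 r3"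
    and opc: "\<And>W s t. \<lbrakk>openin T W; s \<in> F1 W; t \<in> F2 W\<rbrakk> \<Longrightarrow> f W s t \<in> F3 W"
    and opr: "\<And>W V s t. \<lbrakk>openin T W; openin T V; V \<subseteq> W; s \<in> F1 W; t \<in> F2 W\<rbrakk>
      \<Longrightarrow> r3 W V (f W s t) = f V (r1 W V s) (r2 W V t)"
    and W: "openin T W" "x \<in> W" and s: "s \<in> F1 W" and t: "t \<in> F2 W"
  shows "(\<Union>(U, s')\<in>germ T F1 r1 x W s. \<Union>(V, t')\<in>germ T F2 r2 x W t.
      germ T F3 r3 x (U \<inter> V) (f (U \<inter> V) (r1 U (U \<inter> V) s') (r2 V (U \<inter> V) t')))
    = germ T F3 r3 x W (f W s t)"
proof -
  interpret S1: sheaf_of_sets T F1 r1 by (rule S1)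
  interpret S2: sheaf_of_sets T F2 r2 by (rule S2)
  interpret S3: sheaf_of_sets T F3 r3 by (rule S3)
  have eq: "germ T F3 r3 x (U \<inter> V) (f (U \<inter> V) (r1 U (U \<inter> V) s') (r2 V (U \<inter> V) t'))
      = germ T F3 r3 x W (f W s t)"
    if m: "(U, s') \<in> germ T F1 r1 x W s" "(V, t') \<in> germ T F2 r2 x W t" for U s' V t'
  proof -
    obtain W1 where U: "openin T U" "x \<in> U" "s' \<in> F1 U"
      and W1: "openin T W1" "x \<in> W1" "W1 \<subseteq> W \<inter> U" "r1 W W1 s = r1 U W1 s'"
      using m(1) unfolding S1.germ_mem_iff by auto
    obtain W2 where V: "openin T V" "x \<in> V" "t' \<in> F2 V"
      and W2: "openin T W2" "x \<in> W2" "W2 \<subseteq> W \<inter> V" "r2 W W2 t = r2 V W2 t'"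
      using m(2) unfolding S2.germ_mem_iff by auto
    let ?W = "W1 \<inter> W2" and ?U = "U \<inter> V"
    have op: "openin T ?W" "openin T ?U" "x \<in> ?W" "x \<in> ?U" using W1 W2 U V by auto
    have sub: "?W \<subseteq> W1" "?W \<subseteq> W2" "?W \<subseteq> W" "?W \<subseteq> U" "?W \<subseteq> V" "?W \<subseteq> ?U" "?U \<subseteq> U" "?U \<subseteq> V"
      "W1 \<subseteq> W" "W1 \<subseteq> U" "W2 \<subseteq> W" "W2 \<subseteq> V" using W1(3) W2(3) by auto
    have c: "r1 U ?U s' \<in> F1 ?U" "r2 V ?U t' \<in> F2 ?U"
      using S1.res_closed[OF U(1) op(2) sub(7) U(3)] S2.res_closed[OF V(1) op(2) sub(8) V(3)] by auto
    have s: "r1 W ?W s = r1 ?U ?W (r1 U ?U s')"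
      using S1.res_comp[OF W(1) W1(1) op(1) sub(9,1) s] S1.res_comp[OF U(1) W1(1) op(1) sub(10,1) U(3)]
        S1.res_comp[OF U(1) op(2,1) sub(7,6) U(3)] W1(4) by simp
    have t: "r2 W ?W t = r2 ?U ?W (r2 V ?U t')"
      using S2.res_comp[OF W(1) W2(1) op(1) sub(11,2) t] S2.res_comp[OF V(1) W2(1) op(1) sub(12,2) V(3)]
        S2.res_comp[OF V(1) op(2,1) sub(8,6) V(3)] W2(4) by simp
    show ?thesis
    proof (rule S3.germ_eqI[OF op(2,4) opc[OF op(2) c] W opc[OF W(1) \<open>s \<in> F1 W\<close> \<open>t \<in> F2 W\<close>] op(1,3)])
      show "?W \<subseteq> ?U \<inter> W" using sub by auto
      show "r3 ?U ?W (f ?U (r1 U ?U s') (r2 V ?U t')) = r3 W ?W (f W s t)"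
        unfolding opr[OF op(2,1) sub(6) c] opr[OF W(1) op(1) sub(3) \<open>s \<in> F1 W\<close> \<open>t \<in> F2 W\<close>] s t ..
    qed
  qed
  have ne: "germ T F1 r1 x W s \<noteq> {}" "germ T F2 r2 x W t \<noteq> {}"
    using S1.germ_self[OF W s] S2.germ_self[OF W t] by auto
  have "(\<Union>(U, s')\<in>germ T F1 r1 x W s. \<Union>(V, t')\<in>germ T F2 r2 x W t.
      germ T F3 r3 x (U \<inter> V) (f (U \<inter> V) (r1 U (U \<inter> V) s') (r2 V (U \<inter> V) t')))
    = (\<Union>z\<in>germ T F1 r1 x W s. \<Union>z'\<in>germ T F2 r2 x W t. germ T F3 r3 x W (f W s t))"
    by (intro SUP_cong refl) (simp add: case_prod_beta eq)
  also have "\<dots> = germ T F3 r3 x W (f W s t)" using ne by simp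
  finally show ?thesis .
qed

text \<open>Stated for an arbitrary record \<open>Q\<close> so as to apply to stalks of rings and of modules.\<close>

lemma germs_abelian_group:
  fixes A :: "'x set \<Rightarrow> ('s, 'k) ring_scheme" and Q :: "(('x set \<times> 's) set, 'l) ring_scheme"
  assumes S: "sheaf_of_sets T (\<lambda>U. carrier (A U)) r" and x: "x \<in> topspace T"
    and A: "\<And>U. openin T U \<Longrightarrow> abelian_group (A U)"
    and add: "\<And>U V s t. \<lbrakk>openin T U; openin T V; V \<subseteq> U; s \<in> carrier (A U); t \<in> carrier (A U)\<rbrakk>
      \<Longrightarrow> r U V (s \<oplus>\<^bsub>A U\<^esub> t) = r U V s \<oplus>\<^bsub>A V\<^esub> r U V t"
    and Qc: "carrier Q = germs T (\<lambda>U. carrier (A U)) r x"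
    and Q0: "\<zero>\<^bsub>Q\<^esub> = germ T (\<lambda>U. carrier (A U)) r x (topspace T) \<zero>\<^bsub>A (topspace T)\<^esub>"
    and Qa: "\<And>G H. G \<oplus>\<^bsub>Q\<^esub> H = (\<Union>(U, s)\<in>G. \<Union>(V, t)\<in>H. germ T (\<lambda>U. carrier (A U)) r x (U \<inter> V)
      (r U (U \<inter> V) s \<oplus>\<^bsub>A (U \<inter> V)\<^esub> r V (U \<inter> V) t))"
  shows "abelian_group Q"
    and "\<And>W s t. \<lbrakk>openin T W; x \<in> W; s \<in> carrier (A W); t \<in> carrier (A W)\<rbrakk> \<Longrightarrow>
      germ T (\<lambda>U. carrier (A U)) r x W s \<oplus>\<^bsub>Q\<^esub> germ T (\<lambda>U. carrier (A U)) r x W t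
      = germ T (\<lambda>U. carrier (A U)) r x W (s \<oplus>\<^bsub>A W\<^esub> t)"
proof -
  interpret S: sheaf_of_sets T "\<lambda>U. carrier (A U)" r by (rule S)
  let ?g = "germ T (\<lambda>U. carrier (A U)) r x"
  have ac: "s \<oplus>\<^bsub>A W\<^esub> t \<in> carrier (A W)" if "openin T W" "s \<in> carrier (A W)" "t \<in> carrier (A W)" for W s t
    using abelian_groupE(1)[OF A[OF that(1)]] that(2,3) by simp
  show ga: "?g W s \<oplus>\<^bsub>Q\<^esub> ?g W t = ?g W (s \<oplus>\<^bsub>A W\<^esub> t)"
    if W: "openin T W" "x \<in> W" "s \<in> carrier (A W)" "t \<in> carrier (A W)" for W s t
    unfolding Qa
    by (rule germ_binop[OF S S S, where f = "\<lambda>W s t. s \<oplus>\<^bsub>A W\<^esub> t"]) (use ac add W in auto)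
  have zeroc: "\<zero>\<^bsub>A W\<^esub> \<in> carrier (A W)" if "openin T W" for W using abelian_groupE(2)[OF A[OF that]] .
  have g0: "\<zero>\<^bsub>Q\<^esub> = ?g W \<zero>\<^bsub>A W\<^esub>" if W: "openin T W" "x \<in> W" for W
  proof -
    interpret AW: abelian_group "A W" by (rule A[OF W(1)])
    interpret AT: abelian_group "A (topspace T)" by (rule A) simp
    have sub: "W \<subseteq> topspace T" using W(1) by (rule openin_subset)
    have z: "r (topspace T) W \<zero>\<^bsub>A (topspace T)\<^esub> \<in> carrier (A W)"
      by (rule S.res_closed[OF _ W(1) sub]) auto
    have "r (topspace T) W (\<zero>\<^bsub>A (topspace T)\<^esub> \<oplus>\<^bsub>A (topspace T)\<^esub> \<zero>\<^bsub>A (topspace T)\<^esub>)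
        = r (topspace T) W \<zero>\<^bsub>A (topspace T)\<^esub> \<oplus>\<^bsub>A W\<^esub> r (topspace T) W \<zero>\<^bsub>A (topspace T)\<^esub>"
      by (rule add[OF _ W(1) sub]) auto
    then have "r (topspace T) W \<zero>\<^bsub>A (topspace T)\<^esub> = \<zero>\<^bsub>A W\<^esub>" using z by simp
    then show ?thesis unfolding Q0 using S.germ_restrict[OF openin_topspace AT.zero_closed W sub] by simp
  qed
  show "abelian_group Q"
  proof (rule abelian_groupI)
    fix a b assume a: "a \<in> carrier Q" and b: "b \<in> carrier Q"
    obtain U s where U: "openin T U" "x \<in> U" "s \<in> carrier (A U)" "a = ?g U s"
      by (rule S.germs_common_open[OF a[unfolded Qc] openin_topspace x], rule that)
    obtain V t where V: "openin T V" "x \<in> V" "V \<subseteq> U" "t \<in> carrier (A V)" "b = ?g V t"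
      by (rule S.germs_common_open[OF b[unfolded Qc] U(1,2)], rule that)
    have aV: "r U V s \<in> carrier (A V)" "a = ?g V (r U V s)"
      using S.res_closed[OF U(1) V(1,3) U(3)] S.germ_restrict[OF U(1,3) V(1-3)] U(4) by auto
    interpret AV: abelian_group "A V" by (rule A[OF V(1)])
    show "a \<oplus>\<^bsub>Q\<^esub> b \<in> carrier Q"
      unfolding aV(2) V(5) ga[OF V(1,2) aV(1) V(4)] Qc
      by (rule S.germ_in_germs[OF V(1,2)]) (use aV V in auto)
    show "a \<oplus>\<^bsub>Q\<^esub> b = b \<oplus>\<^bsub>Q\<^esub> a"
      unfolding aV(2) V(5) ga[OF V(1,2) aV(1) V(4)] ga[OF V(1,2) V(4) aV(1)]
      using aV(1) V(4) by (simp add: AV.a_comm)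
    show "\<zero>\<^bsub>Q\<^esub> \<oplus>\<^bsub>Q\<^esub> a = a"
      unfolding aV(2) g0[OF V(1,2)] ga[OF V(1,2) AV.zero_closed aV(1)] using aV(1) by simp
    have m: "\<ominus>\<^bsub>A V\<^esub> r U V s \<in> carrier (A V)" using aV(1) by simp
    show "\<exists>y\<in>carrier Q. y \<oplus>\<^bsub>Q\<^esub> a = \<zero>\<^bsub>Q\<^esub>"
      by (rule bexI[of _ "?g V (\<ominus>\<^bsub>A V\<^esub> r U V s)"])
        (use aV V m S.germ_in_germs[OF V(1,2) m] in
          \<open>auto simp: ga[OF V(1,2) m aV(1)] g0[OF V(1,2)] Qc AV.l_neg\<close>)
    fix c assume c: "c \<in> carrier Q"
    obtain W u where W: "openin T W" "x \<in> W" "W \<subseteq> V" "u \<in> carrier (A W)" "c = ?g W u"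
      by (rule S.germs_common_open[OF c[unfolded Qc] V(1,2)], rule that)
    have WU: "W \<subseteq> U" using W(3) V(3) by auto
    have r: "r U W s \<in> carrier (A W)" "a = ?g W (r U W s)" "r V W t \<in> carrier (A W)" "b = ?g W (r V W t)"
      using S.res_closed[OF U(1) W(1) WU U(3)] S.germ_restrict[OF U(1,3) W(1,2) WU] U(4)
        S.res_closed[OF V(1) W(1,3) V(4)] S.germ_restrict[OF V(1,4) W(1-3)] V(5) by auto
    interpret AW: abelian_group "A W" by (rule A[OF W(1)])
    show "a \<oplus>\<^bsub>Q\<^esub> b \<oplus>\<^bsub>Q\<^esub> c = a \<oplus>\<^bsub>Q\<^esub> (b \<oplus>\<^bsub>Q\<^esub> c)"
      unfolding r(2,4) W(5) using r(1,3) W(4)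
      by (simp add: ga[OF W(1,2)] AW.a_assoc)
  next
    show "\<zero>\<^bsub>Q\<^esub> \<in> carrier Q" unfolding Q0 Qc
      by (rule S.germ_in_germs[OF openin_topspace x]) (rule zeroc, simp)
  qed
qed

context coherent_spec
begin

abbreviation og :: "'a set \<Rightarrow> 'a set set \<Rightarrow> ('a set \<Rightarrow> ('a \<times> 'a) set) \<Rightarrow> ('a set set \<times> ('a set \<Rightarrow> ('a \<times> 'a) set)) set"
  where "og p \<equiv> germ (zariski R) (\<lambda>U. carrier (structure_sections R U)) (\<lambda>U V s. restrict s V) p"

abbreviation mg :: "'a set \<Rightarrow> 'a set set \<Rightarrow> 'm \<Rightarrow> ('a set set \<times> 'm) set"
  where "mg p \<equiv> germ (zariski R) (\<lambda>U. carrier (msec M U)) rs p"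

abbreviation L :: "'a set \<Rightarrow> ('a set set \<times> ('a set \<Rightarrow> ('a \<times> 'a) set)) set ring"
  where "L \<equiv> stalk (Spec R)"

abbreviation Mp :: "'a set \<Rightarrow> (('a set set \<times> ('a set \<Rightarrow> ('a \<times> 'a) set)) set, ('a set set \<times> 'm) set) module"
  where "Mp \<equiv> mstalk (Spec R) M"

text \<open>The canonical map from \<open>R\<close> to the local ring at \<open>p\<close>, followed by the one from global sections to the
  stalk of the module.\<close>

definition \<kappa> :: "'a set \<Rightarrow> 'a \<Rightarrow> ('a set set \<times> ('a set \<Rightarrow> ('a \<times> 'a) set)) set" where
  "\<kappa> p a = og p whole (const_section R whole a)"

definition \<iota> :: "'a set \<Rightarrow> 'm \<Rightarrow> ('a set set \<times> 'm) set" where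
  "\<iota> p y = mg p whole y"

lemma O_sheaf: "sheaf_of_sets (zariski R) (\<lambda>U. carrier (structure_sections R U)) (\<lambda>U V s. restrict s V)"
  using ringed_space.axioms(1)[OF ringed_space_Spec[OF is_cring]] by simp

lemma M_sheaf: "sheaf_of_sets (zariski R) (\<lambda>U. carrier (msec M U)) rs"
  using module_sheaf.axioms(2)[OF sheaf] by simp

lemma restrict_hom: "\<lbrakk>opn U; opn V; V \<subseteq> U\<rbrakk>
    \<Longrightarrow> (\<lambda>s. restrict s V) \<in> ring_hom (structure_sections R U) (structure_sections R V)"
  using ringed_space.res_hom[OF ringed_space_Spec[OF is_cring]] by simp

lemma O_cring: "opn U \<Longrightarrow> cring (structure_sections R U)"
  by (rule sections_cring[OF is_cring])

lemma L_simps: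
  "carrier (L p) = germs (zariski R) (\<lambda>U. carrier (structure_sections R U)) (\<lambda>U V s. restrict s V) p"
  "\<zero>\<^bsub>L p\<^esub> = og p whole \<zero>\<^bsub>structure_sections R whole\<^esub>" "\<one>\<^bsub>L p\<^esub> = og p whole \<one>\<^bsub>structure_sections R whole\<^esub>"
  "G \<oplus>\<^bsub>L p\<^esub> H = (\<Union>(U, s)\<in>G. \<Union>(V, t)\<in>H. og p (U \<inter> V)
     (restrict s (U \<inter> V) \<oplus>\<^bsub>structure_sections R (U \<inter> V)\<^esub> restrict t (U \<inter> V)))"
  "G \<otimes>\<^bsub>L p\<^esub> H = (\<Union>(U, s)\<in>G. \<Union>(V, t)\<in>H. og p (U \<inter> V)
     (restrict s (U \<inter> V) \<otimes>\<^bsub>structure_sections R (U \<inter> V)\<^esub> restrict t (U \<inter> V)))"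
  by (simp_all add: stalk_def Let_def)

lemma Mp_simps:
  "carrier (Mp p) = germs (zariski R) (\<lambda>U. carrier (msec M U)) rs p"
  "\<zero>\<^bsub>Mp p\<^esub> = mg p whole \<zero>\<^bsub>msec M whole\<^esub>"
  "C \<oplus>\<^bsub>Mp p\<^esub> D = (\<Union>(U, s)\<in>C. \<Union>(V, t)\<in>D. mg p (U \<inter> V)
     (rs U (U \<inter> V) s \<oplus>\<^bsub>msec M (U \<inter> V)\<^esub> rs V (U \<inter> V) t))"
  "G \<odot>\<^bsub>Mp p\<^esub> C = (\<Union>(U, a)\<in>G. \<Union>(V, s)\<in>C. mg p (U \<inter> V)
     (restrict a (U \<inter> V) \<odot>\<^bsub>msec M (U \<inter> V)\<^esub> rs V (U \<inter> V) s))"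
  by (simp_all add: mstalk_def Let_def)

lemma L_add:
  assumes p: "p \<in> whole"
  shows "abelian_group (L p)"
    and "\<And>W s t. \<lbrakk>opn W; p \<in> W; s \<in> carrier (structure_sections R W); t \<in> carrier (structure_sections R W)\<rbrakk>
      \<Longrightarrow> og p W s \<oplus>\<^bsub>L p\<^esub> og p W t = og p W (s \<oplus>\<^bsub>structure_sections R W\<^esub> t)"
proof -
  have A: "abelian_group (structure_sections R U)" if "opn U" for U
    using O_cring[OF that] by (simp add: cring_def ring_def)
  have add: "restrict (s \<oplus>\<^bsub>structure_sections R U\<^esub> t) V = restrict s V \<oplus>\<^bsub>structure_sections R V\<^esub> restrict t V"
    if "opn U" "opn V" "V \<subseteq> U" "s \<in> carrier (structure_sections R U)" "t \<in> carrier (structure_sections R U)" for U V s t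
    using ring_hom_add[OF restrict_hom[OF that(1-3)] that(4,5)] .
  note * = germs_abelian_group[OF O_sheaf p A add L_simps(1,2,4)]
  show "abelian_group (L p)" by (rule *(1))
  show "\<And>W s t. \<lbrakk>opn W; p \<in> W; s \<in> carrier (structure_sections R W); t \<in> carrier (structure_sections R W)\<rbrakk>
      \<Longrightarrow> og p W s \<oplus>\<^bsub>L p\<^esub> og p W t = og p W (s \<oplus>\<^bsub>structure_sections R W\<^esub> t)" by (rule *(2))
qed

lemma Mp_add:
  assumes p: "p \<in> whole"
  shows "abelian_group (Mp p)"
    and "\<And>W s t. \<lbrakk>opn W; p \<in> W; s \<in> carrier (msec M W); t \<in> carrier (msec M W)\<rbrakk>
      \<Longrightarrow> mg p W s \<oplus>\<^bsub>Mp p\<^esub> mg p W t = mg p W (s \<oplus>\<^bsub>msec M W\<^esub> t)"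
proof -
  have A: "abelian_group (msec M U)" if "opn U" for U
    using msec_mod[OF that] by (simp add: module_def)
  have add: "rs U V (s \<oplus>\<^bsub>msec M U\<^esub> t) = rs U V s \<oplus>\<^bsub>msec M V\<^esub> rs U V t"
    if "opn U" "opn V" "V \<subseteq> U" "s \<in> carrier (msec M U)" "t \<in> carrier (msec M U)" for U V s t
    using rs_add[OF that(1-3)] that(4,5) by (simp add: sect_carrier sect_add)
  note * = germs_abelian_group[OF M_sheaf p A add Mp_simps(1-3)]
  show "abelian_group (Mp p)" by (rule *(1))
  show "\<And>W s t. \<lbrakk>opn W; p \<in> W; s \<in> carrier (msec M W); t \<in> carrier (msec M W)\<rbrakk>
      \<Longrightarrow> mg p W s \<oplus>\<^bsub>Mp p\<^esub> mg p W t = mg p W (s \<oplus>\<^bsub>msec M W\<^esub> t)" by (rule *(2))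
qed

lemma L_mult:
  assumes W: "opn W" "p \<in> W" "s \<in> carrier (structure_sections R W)" "t \<in> carrier (structure_sections R W)"
  shows "og p W s \<otimes>\<^bsub>L p\<^esub> og p W t = og p W (s \<otimes>\<^bsub>structure_sections R W\<^esub> t)"
  unfolding L_simps
proof (rule germ_binop[OF O_sheaf O_sheaf O_sheaf, where f = "\<lambda>W s t. s \<otimes>\<^bsub>structure_sections R W\<^esub> t", OF _ _ W])
  fix W s t assume "opn W" "s \<in> carrier (structure_sections R W)" "t \<in> carrier (structure_sections R W)"
  then show "s \<otimes>\<^bsub>structure_sections R W\<^esub> t \<in> carrier (structure_sections R W)"
    using O_cring by (simp add: cring_def ring_def monoid.m_closed)
next
  fix W V s t assume "opn W" "opn V" "V \<subseteq> W" "s \<in> carrier (structure_sections R W)" "t \<in> carrier (structure_sections R W)"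
  then show "restrict (s \<otimes>\<^bsub>structure_sections R W\<^esub> t) V = restrict s V \<otimes>\<^bsub>structure_sections R V\<^esub> restrict t V"
    using ring_hom_mult[OF restrict_hom] by metis
qed

lemma Mp_smult:
  assumes W: "opn W" "p \<in> W" "a \<in> carrier (structure_sections R W)" "s \<in> carrier (msec M W)"
  shows "og p W a \<odot>\<^bsub>Mp p\<^esub> mg p W s = mg p W (a \<odot>\<^bsub>msec M W\<^esub> s)"
  unfolding Mp_simps
proof (rule germ_binop[OF O_sheaf M_sheaf M_sheaf, where f = "\<lambda>W a s. a \<odot>\<^bsub>msec M W\<^esub> s", OF _ _ W])
  fix W a s assume "opn W" "a \<in> carrier (structure_sections R W)" "s \<in> carrier (msec M W)"
  then show "a \<odot>\<^bsub>msec M W\<^esub> s \<in> carrier (msec M W)" using module.smult_closed[OF msec_mod] by metis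
next
  fix W V a s assume "opn W" "opn V" "V \<subseteq> W" "a \<in> carrier (structure_sections R W)" "s \<in> carrier (msec M W)"
  then show "rs W V (a \<odot>\<^bsub>msec M W\<^esub> s) = restrict a V \<odot>\<^bsub>msec M V\<^esub> rs W V s"
    using rs_smult_msec by (simp add: sect_carrier)
qed

lemma L_restrict:
  "\<lbrakk>opn U; s \<in> carrier (structure_sections R U); opn V; p \<in> V; V \<subseteq> U\<rbrakk> \<Longrightarrow> og p V (restrict s V) = og p U s"
  by (rule sheaf_of_sets.germ_restrict[OF O_sheaf])

lemma Mp_restrict:
  "\<lbrakk>opn U; s \<in> carrier (msec M U); opn V; p \<in> V; V \<subseteq> U\<rbrakk> \<Longrightarrow> mg p V (rs U V s) = mg p U s"
  by (rule sheaf_of_sets.germ_restrict[OF M_sheaf])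

lemma L_closed: "\<lbrakk>opn U; p \<in> U; s \<in> carrier (structure_sections R U)\<rbrakk> \<Longrightarrow> og p U s \<in> carrier (L p)"
  unfolding L_simps by (rule sheaf_of_sets.germ_in_germs[OF O_sheaf])

lemma Mp_closed: "\<lbrakk>opn U; p \<in> U; s \<in> carrier (msec M U)\<rbrakk> \<Longrightarrow> mg p U s \<in> carrier (Mp p)"
  unfolding Mp_simps by (rule sheaf_of_sets.germ_in_germs[OF M_sheaf])

lemma L_rep:
  assumes "G \<in> carrier (L p)" "opn V" "p \<in> V"
  obtains W s where "opn W" "p \<in> W" "W \<subseteq> V" "s \<in> carrier (structure_sections R W)" "G = og p W s"
  by (rule sheaf_of_sets.germs_common_open[OF O_sheaf assms(1)[unfolded L_simps] assms(2,3)], rule that)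

lemma Mp_rep:
  assumes "C \<in> carrier (Mp p)" "opn V" "p \<in> V"
  obtains W s where "opn W" "p \<in> W" "W \<subseteq> V" "s \<in> carrier (msec M W)" "C = mg p W s"
  by (rule sheaf_of_sets.germs_common_open[OF M_sheaf assms(1)[unfolded Mp_simps] assms(2,3)], rule that)

lemma L_rep2:
  assumes "G \<in> carrier (L p)" "H \<in> carrier (L p)" "opn V" "p \<in> V"
  obtains W s t where "opn W" "p \<in> W" "W \<subseteq> V" "s \<in> carrier (structure_sections R W)" "G = og p W s"
    "t \<in> carrier (structure_sections R W)" "H = og p W t"
proof -
  obtain U s where U: "opn U" "p \<in> U" "U \<subseteq> V" "s \<in> carrier (structure_sections R U)" "G = og p U s"
    by (rule L_rep[OF assms(1,3,4)], rule that)
  obtain W t where W: "opn W" "p \<in> W" "W \<subseteq> U" "t \<in> carrier (structure_sections R W)" "H = og p W t"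
    by (rule L_rep[OF assms(2) U(1,2)], rule that)
  have WV: "W \<subseteq> V" using U(3) W(3) by auto
  show thesis
    by (rule that[OF W(1,2) WV ring_hom_closed[OF restrict_hom[OF U(1) W(1,3)] U(4)] _ W(4,5)])
      (simp add: U(5) L_restrict[OF U(1,4) W(1-3)])
qed

lemma L_one: "opn W \<Longrightarrow> p \<in> W \<Longrightarrow> \<one>\<^bsub>L p\<^esub> = og p W \<one>\<^bsub>structure_sections R W\<^esub>"
proof -
  assume W: "opn W" "p \<in> W"
  note sub = opn_sub_whole[OF W(1)]
  interpret O: cring "structure_sections R whole" by (rule O_cring[OF opn_whole])
  show ?thesis
    unfolding L_simps L_restrict[OF opn_whole O.one_closed W sub, symmetric]
    using ring_hom_one[OF restrict_hom[OF opn_whole W(1) sub]] by simp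
qed

lemma L_cring:
  assumes p: "p \<in> whole"
  shows "cring (L p)"
proof (rule cringI)
  show "abelian_group (L p)" by (rule L_add(1)[OF p])
  show "comm_monoid (L p)"
  proof (rule comm_monoidI)
    interpret O: cring "structure_sections R whole" by (rule O_cring[OF opn_whole])
    show "\<one>\<^bsub>L p\<^esub> \<in> carrier (L p)" unfolding L_simps(3) by (rule L_closed[OF opn_whole p O.one_closed])
    fix G assume G: "G \<in> carrier (L p)"
    obtain U s where U: "opn U" "p \<in> U" "U \<subseteq> whole" "s \<in> carrier (structure_sections R U)" "G = og p U s"
      by (rule L_rep[OF G opn_whole p], rule that)
    interpret U: cring "structure_sections R U" by (rule O_cring[OF U(1)])
    show "\<one>\<^bsub>L p\<^esub> \<otimes>\<^bsub>L p\<^esub> G = G"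
      unfolding L_one[OF U(1,2)] U(5) L_mult[OF U(1,2) U.one_closed U(4)] using U(4) by simp
  next
    fix G H assume GH: "G \<in> carrier (L p)" "H \<in> carrier (L p)"
    obtain W s t where W: "opn W" "p \<in> W" "W \<subseteq> whole" "s \<in> carrier (structure_sections R W)" "G = og p W s"
      "t \<in> carrier (structure_sections R W)" "H = og p W t" by (rule L_rep2[OF GH opn_whole p], rule that)
    interpret W: cring "structure_sections R W" by (rule O_cring[OF W(1)])
    show "G \<otimes>\<^bsub>L p\<^esub> H \<in> carrier (L p)" unfolding W(5,7) L_mult[OF W(1,2,4,6)]
      by (rule L_closed[OF W(1,2) W.m_closed[OF W(4,6)]])
    show "G \<otimes>\<^bsub>L p\<^esub> H = H \<otimes>\<^bsub>L p\<^esub> G"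
      unfolding W(5,7) L_mult[OF W(1,2,4,6)] L_mult[OF W(1,2,6,4)] using W(4,6) by (simp add: W.m_comm)
    fix K assume K: "K \<in> carrier (L p)"
    obtain V u where V: "opn V" "p \<in> V" "V \<subseteq> W" "u \<in> carrier (structure_sections R V)" "K = og p V u"
      by (rule L_rep[OF K W(1,2)], rule that)
    interpret V: cring "structure_sections R V" by (rule O_cring[OF V(1)])
    note c = ring_hom_closed[OF restrict_hom[OF W(1) V(1,3)]]
    show "G \<otimes>\<^bsub>L p\<^esub> H \<otimes>\<^bsub>L p\<^esub> K = G \<otimes>\<^bsub>L p\<^esub> (H \<otimes>\<^bsub>L p\<^esub> K)"
      unfolding W(5,7) V(5) L_restrict[OF W(1,4) V(1-3), symmetric] L_restrict[OF W(1,6) V(1-3), symmetric]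
      using c[OF W(4)] c[OF W(6)] V(4) by (simp add: L_mult[OF V(1,2)] V.m_assoc)
  qed
  fix G H K assume GH: "G \<in> carrier (L p)" "H \<in> carrier (L p)" and K: "K \<in> carrier (L p)"
  obtain W s t where W: "opn W" "p \<in> W" "W \<subseteq> whole" "s \<in> carrier (structure_sections R W)" "G = og p W s"
    "t \<in> carrier (structure_sections R W)" "H = og p W t" by (rule L_rep2[OF GH opn_whole p], rule that)
  obtain V u where V: "opn V" "p \<in> V" "V \<subseteq> W" "u \<in> carrier (structure_sections R V)" "K = og p V u"
    by (rule L_rep[OF K W(1,2)], rule that)
  interpret V: cring "structure_sections R V" by (rule O_cring[OF V(1)])
  note c = ring_hom_closed[OF restrict_hom[OF W(1) V(1,3)]]
  show "(G \<oplus>\<^bsub>L p\<^esub> H) \<otimes>\<^bsub>L p\<^esub> K = G \<otimes>\<^bsub>L p\<^esub> K \<oplus>\<^bsub>L p\<^esub> H \<otimes>\<^bsub>L p\<^esub> K"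
    unfolding W(5,7) V(5) L_restrict[OF W(1,4) V(1-3), symmetric] L_restrict[OF W(1,6) V(1-3), symmetric]
    using c[OF W(4)] c[OF W(6)] V(4) by (simp add: L_mult[OF V(1,2)] L_add(2)[OF p V(1,2)] V.l_distr)
qed

lemma Mp_module:
  assumes p: "p \<in> whole"
  shows "module (L p) (Mp p)"
proof (rule moduleI)
  show "cring (L p)" by (rule L_cring[OF p])
  show "abelian_group (Mp p)" by (rule Mp_add(1)[OF p])
next
  fix G C assume G: "G \<in> carrier (L p)" and C: "C \<in> carrier (Mp p)"
  obtain U a where U: "opn U" "p \<in> U" "U \<subseteq> whole" "a \<in> carrier (structure_sections R U)" "G = og p U a"
    by (rule L_rep[OF G opn_whole p], rule that)
  obtain V s where V: "opn V" "p \<in> V" "V \<subseteq> U" "s \<in> carrier (msec M V)" "C = mg p V s"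
    by (rule Mp_rep[OF C U(1,2)], rule that)
  interpret V: module "structure_sections R V" "msec M V" by (rule msec_mod[OF V(1)])
  note c = ring_hom_closed[OF restrict_hom[OF U(1) V(1,3)] U(4)]
  show "G \<odot>\<^bsub>Mp p\<^esub> C \<in> carrier (Mp p)"
    unfolding U(5) V(5) L_restrict[OF U(1,4) V(1-3), symmetric] Mp_smult[OF V(1,2) c V(4)]
    by (rule Mp_closed[OF V(1,2)]) (use c V(4) in auto)
next
  fix G H C assume GH: "G \<in> carrier (L p)" "H \<in> carrier (L p)" and C: "C \<in> carrier (Mp p)"
  obtain W s t where W: "opn W" "p \<in> W" "W \<subseteq> whole" "s \<in> carrier (structure_sections R W)" "G = og p W s"
    "t \<in> carrier (structure_sections R W)" "H = og p W t" by (rule L_rep2[OF GH opn_whole p], rule that)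
  obtain V u where V: "opn V" "p \<in> V" "V \<subseteq> W" "u \<in> carrier (msec M V)" "C = mg p V u"
    by (rule Mp_rep[OF C W(1,2)], rule that)
  interpret V: module "structure_sections R V" "msec M V" by (rule msec_mod[OF V(1)])
  note c = ring_hom_closed[OF restrict_hom[OF W(1) V(1,3)]]
  note r = L_restrict[OF W(1,4) V(1-3), symmetric] L_restrict[OF W(1,6) V(1-3), symmetric]
  show "(G \<oplus>\<^bsub>L p\<^esub> H) \<odot>\<^bsub>Mp p\<^esub> C = G \<odot>\<^bsub>Mp p\<^esub> C \<oplus>\<^bsub>Mp p\<^esub> H \<odot>\<^bsub>Mp p\<^esub> C"
    unfolding W(5,7) V(5) r using c[OF W(4)] c[OF W(6)] V(4)
    by (simp add: Mp_smult[OF V(1,2)] L_add(2)[OF p V(1,2)] Mp_add(2)[OF p V(1,2)] V.smult_l_distr)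
  show "(G \<otimes>\<^bsub>L p\<^esub> H) \<odot>\<^bsub>Mp p\<^esub> C = G \<odot>\<^bsub>Mp p\<^esub> (H \<odot>\<^bsub>Mp p\<^esub> C)"
    unfolding W(5,7) V(5) r using c[OF W(4)] c[OF W(6)] V(4)
    by (simp add: Mp_smult[OF V(1,2)] L_mult[OF V(1,2)] V.smult_assoc1)
next
  fix G C D assume G: "G \<in> carrier (L p)" and C: "C \<in> carrier (Mp p)" and D: "D \<in> carrier (Mp p)"
  obtain U a where U: "opn U" "p \<in> U" "U \<subseteq> whole" "a \<in> carrier (structure_sections R U)" "G = og p U a"
    by (rule L_rep[OF G opn_whole p], rule that)
  obtain V s where V: "opn V" "p \<in> V" "V \<subseteq> U" "s \<in> carrier (msec M V)" "C = mg p V s"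
    by (rule Mp_rep[OF C U(1,2)], rule that)
  obtain W t where W: "opn W" "p \<in> W" "W \<subseteq> V" "t \<in> carrier (msec M W)" "D = mg p W t"
    by (rule Mp_rep[OF D V(1,2)], rule that)
  have WU: "W \<subseteq> U" using V(3) W(3) by auto
  interpret W: module "structure_sections R W" "msec M W" by (rule msec_mod[OF W(1)])
  have rc: "rs V W s \<in> carrier (msec M W)" using rs_closed[OF V(1) W(1,3)] V(4) by (simp add: sect_carrier)
  show "G \<odot>\<^bsub>Mp p\<^esub> (C \<oplus>\<^bsub>Mp p\<^esub> D) = G \<odot>\<^bsub>Mp p\<^esub> C \<oplus>\<^bsub>Mp p\<^esub> G \<odot>\<^bsub>Mp p\<^esub> D"
    unfolding U(5) V(5) W(5) L_restrict[OF U(1,4) W(1,2) WU, symmetric] Mp_restrict[OF V(1,4) W(1-3), symmetric]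
    using ring_hom_closed[OF restrict_hom[OF U(1) W(1) WU] U(4)] rc W(4)
    by (simp add: Mp_smult[OF W(1,2)] Mp_add(2)[OF p W(1,2)] W.smult_r_distr)
next
  fix C assume C: "C \<in> carrier (Mp p)"
  obtain V s where V: "opn V" "p \<in> V" "V \<subseteq> whole" "s \<in> carrier (msec M V)" "C = mg p V s"
    by (rule Mp_rep[OF C opn_whole p], rule that)
  interpret V: module "structure_sections R V" "msec M V" by (rule msec_mod[OF V(1)])
  show "\<one>\<^bsub>L p\<^esub> \<odot>\<^bsub>Mp p\<^esub> C = C"
    unfolding L_one[OF V(1,2)] V(5) Mp_smult[OF V(1,2) V.R.one_closed V(4)] using V(4) by simp
qed


lemma \<kappa>_open:
  assumes "opn W" "p \<in> W" "a \<in> carrier R"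
  shows "\<kappa> p a = og p W (const_section R W a)"
proof -
  have "restrict (const_section R whole a) W = const_section R W a"
    using opn_sub_whole[OF assms(1)] by (auto simp: const_section_def restrict_def fun_eq_iff)
  then show ?thesis
    unfolding \<kappa>_def L_restrict[OF opn_whole const_section_closed[OF opn_whole assms(3)] assms(1,2)
      opn_sub_whole[OF assms(1)], symmetric] by simp
qed

lemma \<kappa>_hom:
  assumes p: "p \<in> whole"
  shows "\<kappa> p \<in> ring_hom R (L p)"
proof (rule ring_hom_memI)
  note h = const_section_hom[OF opn_whole] and c = const_section_closed[OF opn_whole]
  fix a b assume ab: "a \<in> carrier R" "b \<in> carrier R"
  show "\<kappa> p a \<in> carrier (L p)" unfolding \<kappa>_def by (rule L_closed[OF opn_whole p c[OF ab(1)]])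
  show "\<kappa> p (a \<otimes> b) = \<kappa> p a \<otimes>\<^bsub>L p\<^esub> \<kappa> p b"
    unfolding \<kappa>_def L_mult[OF opn_whole p c[OF ab(1)] c[OF ab(2)]] ring_hom_mult[OF h ab] ..
  show "\<kappa> p (a \<oplus> b) = \<kappa> p a \<oplus>\<^bsub>L p\<^esub> \<kappa> p b"
    unfolding \<kappa>_def L_add(2)[OF p opn_whole p c[OF ab(1)] c[OF ab(2)]] ring_hom_add[OF h ab] ..
next
  show "\<kappa> p \<one> = \<one>\<^bsub>L p\<^esub>"
    unfolding \<kappa>_def L_simps ring_hom_one[OF const_section_hom[OF opn_whole]] ..
qed

text \<open>The next three lemmas extract from the identification of the stalk of the structure sheaf at \<open>p\<close> with the
  localization of \<open>R\<close> what determines its maximal ideal: its elements are fractions, and the elements of \<open>R\<close>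
  that become units are those outside \<open>p\<close>.\<close>

lemma \<kappa>_fraction:
  assumes p: "p \<in> whole" and G: "G \<in> carrier (L p)"
  obtains c \<alpha> where "c \<in> carrier R - p" "\<alpha> \<in> carrier R" "\<kappa> p c \<otimes>\<^bsub>L p\<^esub> G = \<kappa> p \<alpha>"
proof -
  obtain U s where U: "opn U" "p \<in> U" "U \<subseteq> whole" "s \<in> carrier (structure_sections R U)" "G = og p U s"
    by (rule L_rep[OF G opn_whole p], rule that)
  obtain W c \<alpha> where W: "opn W" "p \<in> W" "W \<subseteq> U" "c \<in> carrier R" "\<And>q. q \<in> W \<Longrightarrow> c \<notin> q"
    "\<alpha> \<in> carrier R" "\<And>q. q \<in> W \<Longrightarrow> s q = fraction R q \<alpha> c"
    by (rule section_locally_fraction[OF U(4,2)], rule that)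
  have r: "restrict s W \<in> carrier (structure_sections R W)"
    by (rule sections_restrict[OF is_cring U(1) W(1,3) U(4)])
  have "const_section R W c \<otimes>\<^bsub>structure_sections R W\<^esub> restrict s W = const_section R W \<alpha>"
    by (rule const_mult_fraction[OF W(1) r W(4,5,6)]) (use W(7) in auto)
  then have "\<kappa> p c \<otimes>\<^bsub>L p\<^esub> G = \<kappa> p \<alpha>"
    unfolding \<kappa>_open[OF W(1,2,4)] \<kappa>_open[OF W(1,2,6)] U(5) L_restrict[OF U(1,4) W(1-3), symmetric]
      L_mult[OF W(1,2) const_section_closed[OF W(1,4)] r] by simp
  then show thesis using that W(2,4,5,6) by auto
qed

lemma \<kappa>_unit:
  assumes p: "p \<in> whole" and c: "c \<in> carrier R - p"
  shows "\<kappa> p c \<in> Units (L p)"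
proof -
  let ?W = "basic_open R c"
  have W: "opn ?W" "p \<in> ?W" "c \<in> carrier R"
    using c p open_basic by (auto simp: basic_open_def topspace_zariski)
  interpret W: cring "structure_sections R ?W" by (rule O_cring[OF W(1)])
  interpret L: cring "L p" by (rule L_cring[OF p])
  obtain b where b: "b \<in> carrier (structure_sections R ?W)"
    "b \<otimes>\<^bsub>structure_sections R ?W\<^esub> const_section R ?W c = \<one>\<^bsub>structure_sections R ?W\<^esub>"
    by (rule const_section_unit[OF W(1,3)]) (auto simp: basic_open_def)
  have "og p ?W b \<otimes>\<^bsub>L p\<^esub> \<kappa> p c = \<one>\<^bsub>L p\<^esub>"
    unfolding \<kappa>_open[OF W] L_mult[OF W(1,2) b(1) const_section_closed[OF W(1,3)]] b(2) L_one[OF W(1,2)] ..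
  moreover note bc = L_closed[OF W(1,2) b(1)] and kc = ring_hom_closed[OF \<kappa>_hom[OF p] W(3)]
  ultimately have "og p ?W b \<otimes>\<^bsub>L p\<^esub> \<kappa> p c = \<one>\<^bsub>L p\<^esub>" "\<kappa> p c \<otimes>\<^bsub>L p\<^esub> og p ?W b = \<one>\<^bsub>L p\<^esub>"
    using L.m_comm[OF bc kc] by simp_all
  then show ?thesis unfolding Units_def using bc kc by blast
qed

lemma \<kappa>_nonunit:
  assumes p: "p \<in> whole" and a: "\<alpha> \<in> p"
  shows "\<kappa> p \<alpha> \<notin> Units (L p)"
proof
  assume "\<kappa> p \<alpha> \<in> Units (L p)"
  then obtain G where G: "G \<in> carrier (L p)" "\<kappa> p \<alpha> \<otimes>\<^bsub>L p\<^esub> G = \<one>\<^bsub>L p\<^esub>"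
    by (auto simp: Units_def)
  have pp: "primeideal p R" using p by (simp add: topspace_zariski)
  interpret p: primeideal p R by (rule pp)
  interpret L: cring "L p" by (rule L_cring[OF p])
  note h = \<kappa>_hom[OF p]
  obtain c \<beta> where c: "c \<in> carrier R - p" "\<beta> \<in> carrier R" "\<kappa> p c \<otimes>\<^bsub>L p\<^esub> G = \<kappa> p \<beta>"
    by (rule \<kappa>_fraction[OF p G(1)], rule that)
  have aR: "\<alpha> \<in> carrier R" using a by (rule p.Icarr)
  have k: "\<kappa> p \<alpha> \<in> carrier (L p)" "\<kappa> p c \<in> carrier (L p)"
    using ring_hom_closed[OF h] aR c(1) by auto
  have "\<kappa> p c = \<kappa> p c \<otimes>\<^bsub>L p\<^esub> (\<kappa> p \<alpha> \<otimes>\<^bsub>L p\<^esub> G)" unfolding G(2) using k by simp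
  also have "\<dots> = \<kappa> p \<alpha> \<otimes>\<^bsub>L p\<^esub> (\<kappa> p c \<otimes>\<^bsub>L p\<^esub> G)" using k G(1) by (simp add: L.m_lcomm)
  also have "\<dots> = \<kappa> p (\<alpha> \<otimes> \<beta>)" unfolding c(3) using ring_hom_mult[OF h aR c(2)] by simp
  finally have eq: "og p whole (const_section R whole c) = og p whole (const_section R whole (\<alpha> \<otimes> \<beta>))"
    by (simp add: \<kappa>_def)
  have ab: "\<alpha> \<otimes> \<beta> \<in> carrier R" using aR c(2) by simp
  obtain W where W: "p \<in> W" "restrict (const_section R whole c) W = restrict (const_section R whole (\<alpha> \<otimes> \<beta>)) W"
    by (rule sheaf_of_sets.germ_eqD[OF O_sheaf opn_whole p const_section_closed[OF opn_whole ab] eq], rule that)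
  have "restrict (const_section R whole c) W p = restrict (const_section R whole (\<alpha> \<otimes> \<beta>)) W p"
    using W(2) by simp
  then have "fraction R p c \<one> = fraction R p (\<alpha> \<otimes> \<beta>) \<one>" using W(1) p by (simp add: const_section_def)
  then have "(\<alpha> \<otimes> \<beta>, \<one>) \<in> fraction R p c \<one>" using p.fraction_refl[OF ab p.one_compl] by simp
  from p.fraction_memD(3)[OF this] obtain k where
    k: "k \<in> carrier R - p" "k \<otimes> (\<one> \<otimes> c) = k \<otimes> (\<one> \<otimes> (\<alpha> \<otimes> \<beta>))" by auto
  have "k \<otimes> c = k \<otimes> (\<alpha> \<otimes> \<beta>)" using k c(1) ab by simp
  moreover have "k \<otimes> (\<alpha> \<otimes> \<beta>) \<in> p" using p.I_l_closed[OF p.I_r_closed[OF a c(2)]] k(1) by simp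
  moreover have "k \<otimes> c \<notin> p" using p.compl_closed[OF k(1) c(1)] by simp
  ultimately show False by simp
qed

text \<open>An element \<open>\<alpha> / c\<close> of the localization is a unit if and only if \<open>\<alpha>\<close> lies outside \<open>p\<close>.\<close>

lemma stalk_max_ideal_eq:
  assumes p: "p \<in> whole"
  shows "stalk_max_ideal (Spec R) p
    = {G \<in> carrier (L p). \<exists>c\<in>carrier R - p. \<exists>\<alpha>\<in>p. \<kappa> p c \<otimes>\<^bsub>L p\<^esub> G = \<kappa> p \<alpha>}"
proof -
  interpret L: cring "L p" by (rule L_cring[OF p])
  note h = \<kappa>_hom[OF p]
  have "G \<in> Units (L p) \<longleftrightarrow> \<alpha> \<notin> p"
    if G: "G \<in> carrier (L p)" and c: "c \<in> carrier R - p" and \<alpha>: "\<alpha> \<in> carrier R"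
      and eq: "\<kappa> p c \<otimes>\<^bsub>L p\<^esub> G = \<kappa> p \<alpha>" for G c \<alpha>
  proof
    assume "G \<in> Units (L p)"
    then have "\<kappa> p \<alpha> \<in> Units (L p)" using \<kappa>_unit[OF p c] eq L.Units_m_closed by metis
    then show "\<alpha> \<notin> p" using \<kappa>_nonunit[OF p] by auto
  next
    assume "\<alpha> \<notin> p"
    then have u: "\<kappa> p \<alpha> \<in> Units (L p)" using \<kappa>_unit[OF p] \<alpha> by auto
    have "G = inv\<^bsub>L p\<^esub> \<kappa> p c \<otimes>\<^bsub>L p\<^esub> \<kappa> p \<alpha>"
      unfolding eq[symmetric] using \<kappa>_unit[OF p c] G by (simp add: L.Units_closed flip: L.m_assoc)
    then show "G \<in> Units (L p)" using u \<kappa>_unit[OF p c] by simp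
  qed
  note iff = this
  have pR: "\<alpha> \<in> carrier R" if "\<alpha> \<in> p" for \<alpha>
    using that p ideal.Icarr[OF primeideal.axioms(1)] by (auto simp: topspace_zariski)
  show ?thesis
  proof (intro equalityI subsetI)
    fix G assume "G \<in> stalk_max_ideal (Spec R) p"
    then have G: "G \<in> carrier (L p)" "G \<notin> Units (L p)" by (auto simp: stalk_max_ideal_def)
    obtain c \<alpha> where c: "c \<in> carrier R - p" "\<alpha> \<in> carrier R" "\<kappa> p c \<otimes>\<^bsub>L p\<^esub> G = \<kappa> p \<alpha>"
      by (rule \<kappa>_fraction[OF p G(1)], rule that)
    then show "G \<in> {G \<in> carrier (L p). \<exists>c\<in>carrier R - p. \<exists>\<alpha>\<in>p. \<kappa> p c \<otimes>\<^bsub>L p\<^esub> G = \<kappa> p \<alpha>}"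
      using iff[OF G(1) c] G by auto
  next
    fix G assume "G \<in> {G \<in> carrier (L p). \<exists>c\<in>carrier R - p. \<exists>\<alpha>\<in>p. \<kappa> p c \<otimes>\<^bsub>L p\<^esub> G = \<kappa> p \<alpha>}"
    then obtain c \<alpha> where c: "G \<in> carrier (L p)" "c \<in> carrier R - p" "\<alpha> \<in> p" "\<kappa> p c \<otimes>\<^bsub>L p\<^esub> G = \<kappa> p \<alpha>"
      by auto
    then show "G \<in> stalk_max_ideal (Spec R) p"
      using iff[OF c(1,2) pR[OF c(3)] c(4)] by (simp add: stalk_max_ideal_def)
  qed
qed

lemma stalk_max_ideal_maximal:
  assumes p: "p \<in> whole"
  shows "maximalideal (stalk_max_ideal (Spec R) p) (L p)"
proof -
  interpret L: cring "L p" by (rule L_cring[OF p])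
  interpret p: primeideal p R using p by (simp add: topspace_zariski)
  let ?I = "stalk_max_ideal (Spec R) p"
  note h = \<kappa>_hom[OF p] and I_eq = stalk_max_ideal_eq[OF p]
  note hm = ring_hom_mult[OF h] and ha = ring_hom_add[OF h] and hc = ring_hom_closed[OF h]
  have I_intro: "G \<in> ?I" if "G \<in> carrier (L p)" "c \<in> carrier R - p" "\<alpha> \<in> p" "\<kappa> p c \<otimes>\<^bsub>L p\<^esub> G = \<kappa> p \<alpha>" for G c \<alpha>
    unfolding I_eq using that by auto
  have mult: "G \<otimes>\<^bsub>L p\<^esub> H \<in> ?I" if G: "G \<in> ?I" and H: "H \<in> carrier (L p)" for G H
  proof -
    obtain c \<alpha> where c: "G \<in> carrier (L p)" "c \<in> carrier R - p" "\<alpha> \<in> p" "\<kappa> p c \<otimes>\<^bsub>L p\<^esub> G = \<kappa> p \<alpha>"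
      using G unfolding I_eq by auto
    obtain e \<beta> where e: "e \<in> carrier R - p" "\<beta> \<in> carrier R" "\<kappa> p e \<otimes>\<^bsub>L p\<^esub> H = \<kappa> p \<beta>"
      by (rule \<kappa>_fraction[OF p H], rule that)
    have cc: "c \<in> carrier R" "e \<in> carrier R" "\<alpha> \<in> carrier R" using c e p.Icarr by auto
    have "\<kappa> p (c \<otimes> e) \<otimes>\<^bsub>L p\<^esub> (G \<otimes>\<^bsub>L p\<^esub> H) = (\<kappa> p c \<otimes>\<^bsub>L p\<^esub> G) \<otimes>\<^bsub>L p\<^esub> (\<kappa> p e \<otimes>\<^bsub>L p\<^esub> H)"
      using hc[OF cc(1)] hc[OF cc(2)] c(1) H by (simp add: hm[OF cc(1,2)] L.m_ac)
    also have "\<dots> = \<kappa> p (\<alpha> \<otimes> \<beta>)" unfolding c(4) e(3) hm[OF cc(3) e(2)] ..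
    finally show ?thesis
      by (intro I_intro[OF _ p.compl_closed[OF c(2) e(1)] p.I_r_closed[OF c(3) e(2)]]) (use c(1) H in auto)
  qed
  have ideal: "ideal ?I (L p)"
  proof (rule idealI)
    show "ring (L p)" by (rule L.ring_axioms)
    show "subgroup ?I (add_monoid (L p))"
    proof (rule L.add.subgroupI)
      show "?I \<subseteq> carrier (L p)" unfolding I_eq by auto
      have "\<kappa> p \<one> \<otimes>\<^bsub>L p\<^esub> \<kappa> p \<zero> = \<kappa> p \<zero>" using hm[of \<one> \<zero>] by simp
      then have "\<kappa> p \<zero> \<in> ?I" using p.zero_closed p.one_compl hc[of \<zero>] by (intro I_intro) auto
      then show "?I \<noteq> {}" by auto
    next
      fix G assume G: "G \<in> ?I"
      then have GL: "G \<in> carrier (L p)" unfolding I_eq by auto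
      have "G \<otimes>\<^bsub>L p\<^esub> (\<ominus>\<^bsub>L p\<^esub> \<one>\<^bsub>L p\<^esub>) \<in> ?I" by (rule mult[OF G]) auto
      then show "\<ominus>\<^bsub>L p\<^esub> G \<in> ?I" using GL by (simp add: L.r_minus)
    next
      fix G H assume G: "G \<in> ?I" and H: "H \<in> ?I"
      obtain c \<alpha> where c: "G \<in> carrier (L p)" "c \<in> carrier R - p" "\<alpha> \<in> p" "\<kappa> p c \<otimes>\<^bsub>L p\<^esub> G = \<kappa> p \<alpha>"
        using G unfolding I_eq by auto
      obtain e \<beta> where e: "H \<in> carrier (L p)" "e \<in> carrier R - p" "\<beta> \<in> p" "\<kappa> p e \<otimes>\<^bsub>L p\<^esub> H = \<kappa> p \<beta>"
        using H unfolding I_eq by auto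
      have cc: "c \<in> carrier R" "e \<in> carrier R" "\<alpha> \<in> carrier R" "\<beta> \<in> carrier R" using c e p.Icarr by auto
      have ecc: "e \<otimes> \<alpha> \<in> carrier R" "c \<otimes> \<beta> \<in> carrier R" using cc by auto
      have "\<kappa> p (c \<otimes> e) \<otimes>\<^bsub>L p\<^esub> (G \<oplus>\<^bsub>L p\<^esub> H)
          = \<kappa> p e \<otimes>\<^bsub>L p\<^esub> (\<kappa> p c \<otimes>\<^bsub>L p\<^esub> G) \<oplus>\<^bsub>L p\<^esub> \<kappa> p c \<otimes>\<^bsub>L p\<^esub> (\<kappa> p e \<otimes>\<^bsub>L p\<^esub> H)"
        using hc[OF cc(1)] hc[OF cc(2)] c(1) e(1) by (simp add: hm[OF cc(1,2)] L.m_ac L.r_distr)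
      also have "\<dots> = \<kappa> p (e \<otimes> \<alpha> \<oplus> c \<otimes> \<beta>)"
        unfolding c(4) e(4) ha[OF ecc] hm[OF cc(2,3)] hm[OF cc(1,4)] ..
      finally show "G \<oplus>\<^bsub>L p\<^esub> H \<in> ?I"
        by (intro I_intro[OF _ p.compl_closed[OF c(2) e(2)]
            p.a_closed[OF p.I_l_closed[OF c(3) cc(2)] p.I_l_closed[OF e(3) cc(1)]]]) (use c(1) e(1) in auto)
    qed
    fix G H assume G: "G \<in> ?I" and H: "H \<in> carrier (L p)"
    show "G \<otimes>\<^bsub>L p\<^esub> H \<in> ?I" by (rule mult[OF G H])
    then show "H \<otimes>\<^bsub>L p\<^esub> G \<in> ?I" using G H L.m_comm[of G H] unfolding I_eq by auto
  qed
  show ?thesis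
  proof (rule maximalidealI[OF ideal])
    have "\<one>\<^bsub>L p\<^esub> \<notin> ?I" by (simp add: stalk_max_ideal_def)
    then show "carrier (L p) \<noteq> ?I" using L.one_closed by auto
    fix J assume J: "ideal J (L p)" "?I \<subseteq> J" "J \<subseteq> carrier (L p)"
    show "J = ?I \<or> J = carrier (L p)"
    proof (cases "J \<subseteq> ?I")
      case False
      then obtain G where G: "G \<in> J" "G \<in> Units (L p)" using J(3) by (auto simp: stalk_max_ideal_def)
      then have "\<one>\<^bsub>L p\<^esub> \<in> J" using ideal.I_l_closed[OF J(1) G(1), of "inv\<^bsub>L p\<^esub> G"] by simp
      then show ?thesis using ideal.one_imp_carrier[OF J(1)] by simp
    qed (use J(2) in auto)
  qed
qed

lemma \<iota>_facts:
  assumes p: "p \<in> whole" and y: "y \<in> carrier (sect whole)"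
  shows "\<iota> p y \<in> carrier (Mp p)"
    and "z \<in> carrier (sect whole) \<Longrightarrow> \<iota> p (y \<oplus>\<^bsub>sect whole\<^esub> z) = \<iota> p y \<oplus>\<^bsub>Mp p\<^esub> \<iota> p z"
    and "a \<in> carrier R \<Longrightarrow> \<iota> p (a \<odot>\<^bsub>sect whole\<^esub> y) = \<kappa> p a \<odot>\<^bsub>Mp p\<^esub> \<iota> p y"
    and "\<lbrakk>z \<in> carrier (sect whole); \<iota> p y = \<iota> p z\<rbrakk>
      \<Longrightarrow> \<exists>c\<in>carrier R - p. c \<odot>\<^bsub>sect whole\<^esub> y = c \<odot>\<^bsub>sect whole\<^esub> z"
proof -
  have y': "y \<in> carrier (msec M whole)" using y by (simp add: sect_carrier)
  show "\<iota> p y \<in> carrier (Mp p)" unfolding \<iota>_def by (rule Mp_closed[OF opn_whole p y'])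
  show "\<iota> p (a \<odot>\<^bsub>sect whole\<^esub> y) = \<kappa> p a \<odot>\<^bsub>Mp p\<^esub> \<iota> p y" if "a \<in> carrier R"
    unfolding \<iota>_def \<kappa>_def sect_smult
    by (rule Mp_smult[OF opn_whole p const_section_closed[OF opn_whole that] y', symmetric])
  assume "z \<in> carrier (sect whole)"
  then have z: "z \<in> carrier (sect whole)" "z \<in> carrier (msec M whole)" by (auto simp: sect_carrier)
  show "\<iota> p (y \<oplus>\<^bsub>sect whole\<^esub> z) = \<iota> p y \<oplus>\<^bsub>Mp p\<^esub> \<iota> p z"
    unfolding \<iota>_def sect_add by (rule Mp_add(2)[OF p opn_whole p y' z(2), symmetric])
  assume eq: "\<iota> p y = \<iota> p z"
  obtain W where W: "opn W" "p \<in> W" "W \<subseteq> whole" "W \<subseteq> whole" "rs whole W y = rs whole W z"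
    by (rule sheaf_of_sets.germ_eqD[OF M_sheaf opn_whole p z(2) eq[unfolded \<iota>_def]], rule that)
  show "\<exists>c\<in>carrier R - p. c \<odot>\<^bsub>sect whole\<^esub> y = c \<odot>\<^bsub>sect whole\<^esub> z"
    by (rule agree_near[OF opn_whole y z(1) W(1,3,2,5)])
qed

text \<open>Together with the last of the facts above: the stalk at \<open>p\<close> is the localization at \<open>p\<close> of the module of
  global sections.\<close>

lemma \<iota>_fraction:
  assumes p: "p \<in> whole" and u: "u \<in> carrier (Mp p)"
  obtains h t where "h \<in> carrier R - p" "t \<in> carrier (sect whole)" "\<iota> p t = \<kappa> p h \<odot>\<^bsub>Mp p\<^esub> u"
proof -
  obtain V s where V: "opn V" "p \<in> V" "V \<subseteq> whole" "s \<in> carrier (msec M V)" "u = mg p V s"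
    by (rule Mp_rep[OF u opn_whole p], rule that)
  have s: "s \<in> carrier (sect V)" using V(4) by (simp add: sect_carrier)
  obtain W h t where W: "opn W" "p \<in> W" "W \<subseteq> V" "unit_on W h" "t \<in> carrier (sect whole)"
    "rs whole W t = h \<odot>\<^bsub>sect W\<^esub> rs V W s" by (rule locally_global[OF V(1) s V(2)], rule that)
  have rc: "rs V W s \<in> carrier (msec M W)" using rs_closed[OF V(1) W(1,3) s] by (simp add: sect_carrier)
  have h: "h \<in> carrier R" "h \<in> carrier R - p" using unit_onD[OF W(4)] W(2) by auto
  have t: "t \<in> carrier (msec M whole)" using W(5) by (simp add: sect_carrier)
  have "\<iota> p t = mg p W (rs whole W t)"
    unfolding \<iota>_def by (rule Mp_restrict[OF opn_whole t W(1,2) opn_sub_whole[OF W(1)], symmetric])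
  also have "\<dots> = \<kappa> p h \<odot>\<^bsub>Mp p\<^esub> u"
    unfolding W(6) sect_smult \<kappa>_open[OF W(1,2) h(1)] V(5) Mp_restrict[OF V(1,4) W(1-3), symmetric]
    by (rule Mp_smult[OF W(1,2) const_section_closed[OF W(1) h(1)] rc, symmetric])
  finally show thesis by (rule that[OF h(2) W(5)])
qed

text \<open>Generators of the fibre lift to the stalk, and after multiplication with units to global sections.
  Nakayama's lemma for the module of global sections asks about its saturated submodules \<open>N\<close>
  containing these lifts and all multiples by elements of \<open>p\<close>; such an \<open>N\<close> corresponds to the submodule \<open>S\<close> of the
  stalk of all elements that a unit brings into the image of \<open>N\<close>.\<close>

lemma completed_by_rank:
  assumes p: "p \<in> whole" and rank: "sheaf_rank (Spec R) M p \<le> enat n"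
  shows "module.completed_by R (sect whole) p {} n"
proof -
  interpret G: module R "sect whole" by (rule sect_module[OF opn_whole])
  interpret L: cring "L p" by (rule L_cring[OF p])
  interpret N: module "L p" "Mp p" by (rule Mp_module[OF p])
  have pp: "primeideal p R" using p by (simp add: topspace_zariski)
  interpret p: primeideal p R by (rule pp)
  let ?I = "stalk_max_ideal (Spec R) p"
  interpret I: maximalideal ?I "L p" by (rule stalk_max_ideal_maximal[OF p])
  note h = \<kappa>_hom[OF p] and I_eq = stalk_max_ideal_eq[OF p]
  note hm = ring_hom_mult[OF h] and hc = ring_hom_closed[OF h]
  note \<iota> = \<iota>_facts[OF p]
  let ?K = "residue_field (Spec R) p" and ?F = "fibre (Spec R) M p"
  have K: "?K = L p Quot ?I" by (simp add: residue_field_def)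
  have F: "?F = base_change (L p) (Mp p) (L p Quot ?I) (\<lambda>a. ?I +>\<^bsub>L p\<^esub> a)"
    by (simp add: fibre_def residue_field_def)
  have fieldK: "field ?K" unfolding K by (rule I.quotient_is_field[OF L.is_cring])
  interpret T: module_base_change "L p" "Mp p" "L p Quot ?I" "\<lambda>a. ?I +>\<^bsub>L p\<^esub> a"
    by (intro module_base_change.intro Mp_module[OF p] module_base_change_axioms.intro I.rcos_ring_hom
        I.quotient_is_cring[OF L.is_cring])
  have "module ?K ?F" unfolding K F by (rule T.base_change_module)
  then interpret F: vectorspace ?K ?F by (intro vectorspace.intro fieldK)
  have fd: "F.fin_dim" and dim: "F.dim \<le> n"
    using rank by (auto simp: sheaf_rank_def split: if_splits)
  have "\<exists>k X. finite X \<and> card X = k \<and> X \<subseteq> carrier ?F \<and> F.gen_set X"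
    using fd unfolding F.fin_dim_def by auto
  from LeastI_ex[OF this] obtain X where X: "finite X" "card X = F.dim" "X \<subseteq> carrier ?F" "F.gen_set X"
    unfolding F.dim_def by auto
  obtain Y where Y: "Y \<subseteq> carrier (Mp p)" "finite Y" "card Y \<le> card X"
    and gen: "\<And>S. \<lbrakk>LinearCombinations.submodule (L p) S (Mp p); Y \<subseteq> S;
      \<And>a y. \<lbrakk>a \<in> ?I; y \<in> carrier (Mp p)\<rbrakk> \<Longrightarrow> a \<odot>\<^bsub>Mp p\<^esub> y \<in> S\<rbrakk> \<Longrightarrow> S = carrier (Mp p)"
  proof (rule lift_generators_of_quotient[OF Mp_module[OF p] I.ideal_axioms X(1) X(3)[unfolded F]
        X(4)[unfolded F K]])
    fix Y
    assume Y: "Y \<subseteq> carrier (Mp p)" "finite Y" "card Y \<le> card X"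
      and gen: "\<And>S. \<lbrakk>LinearCombinations.submodule (L p) S (Mp p); Y \<subseteq> S;
        \<And>a y. \<lbrakk>a \<in> ?I; y \<in> carrier (Mp p)\<rbrakk> \<Longrightarrow> a \<odot>\<^bsub>Mp p\<^esub> y \<in> S\<rbrakk> \<Longrightarrow> S = carrier (Mp p)"
    show thesis by (rule that[OF Y gen])
  qed
  have "\<exists>t\<in>carrier (sect whole). \<exists>g\<in>carrier R - p. \<iota> p t = \<kappa> p g \<odot>\<^bsub>Mp p\<^esub> u" if u: "u \<in> Y" for u
  proof -
    have "u \<in> carrier (Mp p)" using u Y(1) by auto
    then obtain g t where "g \<in> carrier R - p" "t \<in> carrier (sect whole)" "\<iota> p t = \<kappa> p g \<odot>\<^bsub>Mp p\<^esub> u"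
      by (rule \<iota>_fraction[OF p])
    then show ?thesis by auto
  qed
  then obtain f where f: "\<And>u. u \<in> Y \<Longrightarrow> f u \<in> carrier (sect whole)"
    "\<And>u. u \<in> Y \<Longrightarrow> \<exists>g\<in>carrier R - p. \<iota> p (f u) = \<kappa> p g \<odot>\<^bsub>Mp p\<^esub> u" by metis
  obtain Z where Z: "finite Z" "Z \<subseteq> carrier (sect whole)" "sp whole Z = carrier (sect whole)"
    by (rule global_sections_finitely_generated, rule that)
  have satZ: "G.sat p (sp whole Z) = carrier (sect whole)"
    unfolding Z(3) using G.subset_sat[OF pp subset_refl] G.sat_carrier by auto
  have fY: "f ` Y \<subseteq> carrier (sect whole)" "finite (f ` Y)" using f(1) Y(2) by auto
  have "G.completed_by p {} (card (f ` Y))"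
  proof (rule G.nakayama[OF pp fY Z(1,2) satZ])
    fix N assume N: "G.submod N" "G.sat p N \<subseteq> N" and fN: "f ` Y \<subseteq> N"
      and pN: "\<And>b y. b \<in> p \<Longrightarrow> y \<in> carrier (sect whole) \<Longrightarrow> b \<odot>\<^bsub>sect whole\<^esub> y \<in> N"
    note D = G.submodD[OF N(1)]
    define S where "S = {u \<in> carrier (Mp p). \<exists>g\<in>carrier R - p. \<exists>y\<in>N. \<kappa> p g \<odot>\<^bsub>Mp p\<^esub> u = \<iota> p y}"
    have S_intro: "u \<in> S" if "u \<in> carrier (Mp p)" "g \<in> carrier R - p" "y \<in> N" "\<kappa> p g \<odot>\<^bsub>Mp p\<^esub> u = \<iota> p y" for u g y
      unfolding S_def using that by auto
    have "N.submod S"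
    proof (rule N.submodI)
      show "S \<subseteq> carrier (Mp p)" by (auto simp: S_def)
      have "\<iota> p (\<zero> \<odot>\<^bsub>sect whole\<^esub> \<zero>\<^bsub>sect whole\<^esub>) = \<kappa> p \<zero> \<odot>\<^bsub>Mp p\<^esub> \<iota> p \<zero>\<^bsub>sect whole\<^esub>"
        by (rule \<iota>(3)) auto
      moreover have "\<kappa> p \<zero> = \<zero>\<^bsub>L p\<^esub>" by (rule ring_hom_zero[OF h ring_axioms L.ring_axioms])
      ultimately have "\<iota> p \<zero>\<^bsub>sect whole\<^esub> = \<zero>\<^bsub>Mp p\<^esub>" using \<iota>(1)[of "\<zero>\<^bsub>sect whole\<^esub>"] by simp
      then show "\<zero>\<^bsub>Mp p\<^esub> \<in> S"
        by (intro S_intro[OF _ p.one_compl D(2)]) (use hc[OF one_closed] in auto)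
    next
      fix u v assume "u \<in> S" "v \<in> S"
      then obtain g y g' y' where u: "u \<in> carrier (Mp p)" "g \<in> carrier R - p" "y \<in> N" "\<kappa> p g \<odot>\<^bsub>Mp p\<^esub> u = \<iota> p y"
        and v: "v \<in> carrier (Mp p)" "g' \<in> carrier R - p" "y' \<in> N" "\<kappa> p g' \<odot>\<^bsub>Mp p\<^esub> v = \<iota> p y'"
        unfolding S_def mem_Collect_eq by (elim conjE bexE)
      have gc: "g \<in> carrier R" "g' \<in> carrier R" using u(2) v(2) by auto
      have yc: "y \<in> carrier (sect whole)" "y' \<in> carrier (sect whole)" using D(5) u(3) v(3) by auto
      have gy: "g' \<odot>\<^bsub>sect whole\<^esub> y \<in> carrier (sect whole)" "g \<odot>\<^bsub>sect whole\<^esub> y' \<in> carrier (sect whole)"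
        using gc yc by auto
      have "\<kappa> p (g \<otimes> g') \<odot>\<^bsub>Mp p\<^esub> (u \<oplus>\<^bsub>Mp p\<^esub> v)
          = \<kappa> p g' \<odot>\<^bsub>Mp p\<^esub> (\<kappa> p g \<odot>\<^bsub>Mp p\<^esub> u) \<oplus>\<^bsub>Mp p\<^esub> \<kappa> p g \<odot>\<^bsub>Mp p\<^esub> (\<kappa> p g' \<odot>\<^bsub>Mp p\<^esub> v)"
        using hc[OF gc(1)] hc[OF gc(2)] u(1) v(1)
        by (simp add: hm[OF gc] N.smult_r_distr L.m_comm[of "\<kappa> p g'"] flip: N.smult_assoc1)
      also have "\<dots> = \<iota> p (g' \<odot>\<^bsub>sect whole\<^esub> y \<oplus>\<^bsub>sect whole\<^esub> g \<odot>\<^bsub>sect whole\<^esub> y')"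
        unfolding u(4) v(4) \<iota>(2)[OF gy] \<iota>(3)[OF yc(1) gc(2)] \<iota>(3)[OF yc(2) gc(1)] ..
      finally show "u \<oplus>\<^bsub>Mp p\<^esub> v \<in> S"
        by (intro S_intro[OF _ p.compl_closed[OF u(2) v(2)] D(3)[OF D(4)[OF gc(2) u(3)] D(4)[OF gc(1) v(3)]]])
          (use u(1) v(1) in auto)
    next
      fix A u assume A: "A \<in> carrier (L p)" and "u \<in> S"
      then obtain g y where u: "u \<in> carrier (Mp p)" "g \<in> carrier R - p" "y \<in> N" "\<kappa> p g \<odot>\<^bsub>Mp p\<^esub> u = \<iota> p y"
        unfolding S_def mem_Collect_eq by (elim conjE bexE)
      obtain c \<alpha> where c: "c \<in> carrier R - p" "\<alpha> \<in> carrier R" "\<kappa> p c \<otimes>\<^bsub>L p\<^esub> A = \<kappa> p \<alpha>"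
        by (rule \<kappa>_fraction[OF p A], rule that)
      have gc: "c \<in> carrier R" "g \<in> carrier R" using u(2) c(1) by auto
      have "\<kappa> p (c \<otimes> g) \<odot>\<^bsub>Mp p\<^esub> (A \<odot>\<^bsub>Mp p\<^esub> u) = (\<kappa> p c \<otimes>\<^bsub>L p\<^esub> A) \<odot>\<^bsub>Mp p\<^esub> (\<kappa> p g \<odot>\<^bsub>Mp p\<^esub> u)"
        using hc[OF gc(1)] hc[OF gc(2)] A u(1) by (simp add: hm[OF gc] L.m_ac flip: N.smult_assoc1)
      also have "\<dots> = \<iota> p (\<alpha> \<odot>\<^bsub>sect whole\<^esub> y)"
        unfolding c(3) u(4) \<iota>(3)[OF D(5)[OF u(3)] c(2)] ..
      finally show "A \<odot>\<^bsub>Mp p\<^esub> u \<in> S"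
        by (intro S_intro[OF _ p.compl_closed[OF c(1) u(2)] D(4)[OF c(2) u(3)]]) (use A u(1) in auto)
    qed
    moreover have "Y \<subseteq> S"
    proof
      fix u assume u: "u \<in> Y"
      obtain g where "g \<in> carrier R - p" "\<iota> p (f u) = \<kappa> p g \<odot>\<^bsub>Mp p\<^esub> u" using f(2)[OF u] by auto
      then show "u \<in> S" using u Y(1) fN by (intro S_intro[of u g "f u"]) auto
    qed
    moreover have "A \<odot>\<^bsub>Mp p\<^esub> u \<in> S" if A: "A \<in> ?I" and u: "u \<in> carrier (Mp p)" for A u
    proof -
      obtain c \<alpha> where c: "A \<in> carrier (L p)" "c \<in> carrier R - p" "\<alpha> \<in> p" "\<kappa> p c \<otimes>\<^bsub>L p\<^esub> A = \<kappa> p \<alpha>"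
        using A unfolding I_eq by auto
      obtain g t where g: "g \<in> carrier R - p" "t \<in> carrier (sect whole)" "\<iota> p t = \<kappa> p g \<odot>\<^bsub>Mp p\<^esub> u"
        by (rule \<iota>_fraction[OF p u], rule that)
      have gc: "c \<in> carrier R" "g \<in> carrier R" "\<alpha> \<in> carrier R" using c(2,3) g(1) p.Icarr by auto
      have "\<kappa> p (c \<otimes> g) \<odot>\<^bsub>Mp p\<^esub> (A \<odot>\<^bsub>Mp p\<^esub> u) = (\<kappa> p c \<otimes>\<^bsub>L p\<^esub> A) \<odot>\<^bsub>Mp p\<^esub> (\<kappa> p g \<odot>\<^bsub>Mp p\<^esub> u)"
        using hc[OF gc(1)] hc[OF gc(2)] c(1) u by (simp add: hm[OF gc(1,2)] L.m_ac flip: N.smult_assoc1)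
      also have "\<dots> = \<iota> p (\<alpha> \<odot>\<^bsub>sect whole\<^esub> t)"
        unfolding c(4) g(3)[symmetric] \<iota>(3)[OF g(2) gc(3)] ..
      finally show ?thesis
        by (intro S_intro[OF _ p.compl_closed[OF c(2) g(1)] pN[OF c(3) g(2)]]) (use c(1) u in auto)
    qed
    ultimately have S_all: "S = carrier (Mp p)" by (rule gen)
    show "N = carrier (sect whole)"
    proof
      show "carrier (sect whole) \<subseteq> N"
      proof
        fix y assume y: "y \<in> carrier (sect whole)"
        have "\<iota> p y \<in> S" unfolding S_all by (rule \<iota>(1)[OF y])
        then obtain g y' where g: "g \<in> carrier R - p" "y' \<in> N" "\<kappa> p g \<odot>\<^bsub>Mp p\<^esub> \<iota> p y = \<iota> p y'"
          unfolding S_def by auto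
        have gc: "g \<in> carrier R" using g(1) by simp
        have "\<iota> p (g \<odot>\<^bsub>sect whole\<^esub> y) = \<iota> p y'" using \<iota>(3)[OF y gc] g(3) by simp
        from \<iota>(4)[OF G.smult_closed[OF gc y] D(5)[OF g(2)] this] obtain c where
          c: "c \<in> carrier R - p" "c \<odot>\<^bsub>sect whole\<^esub> (g \<odot>\<^bsub>sect whole\<^esub> y) = c \<odot>\<^bsub>sect whole\<^esub> y'" by auto
        have cN: "c \<odot>\<^bsub>sect whole\<^esub> y' \<in> N" using D(4)[OF _ g(2)] c(1) by simp
        have "y \<in> G.sat p N"
        proof (rule G.satI[OF y])
          show "(c \<otimes> g) \<odot>\<^bsub>sect whole\<^esub> y \<in> N" using cN c gc y by (simp add: G.smult_assoc1)
          show "c \<otimes> g \<in> carrier R" "c \<otimes> g \<notin> p" using p.compl_closed[OF c(1) g(1)] by auto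
        qed
        then show "y \<in> N" using N(2) by auto
      qed
    qed (rule D(1))
  qed
  then show ?thesis
    by (rule G.completed_by_mono) (use card_image_le[OF Y(2), of f] Y(3) X(2) dim in auto)
qed

end

section \<open>Generation outside a closed set of large codimension\<close>

theorem theorem7p2:
  fixes R :: "('a, 'b) ring_scheme"
    and M :: "('a set, 'a set \<Rightarrow> ('a \<times> 'a) set, 'm) module_sheaf_data"
    and n :: nat
  assumes "cring R" and "noetherian_ring R"
    and "coherent_module (Spec R) M"
    and "\<forall>x\<in>topspace (zariski R). sheaf_rank (Spec R) M x \<le> enat n"
  shows "\<forall>d::nat. \<exists>U. openin (zariski R) U
           \<and> codim (topspace (zariski R) - U) (zariski R) > enat d
           \<and> (\<exists>m. (\<forall>i<d + n. m i \<in> carrier (msec M (topspace (zariski R))))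
                \<and> generates (Spec R) M U (d + n) (\<lambda>i. mres M (topspace (zariski R)) U (m i)))"
proof
  fix d :: nat
  interpret coherent_spec R M
    by (intro coherent_spec.intro noetherian_cring.intro coherent_spec_axioms.intro assms(1-3))
  interpret G: noetherian_module R "sect whole"
    by (intro noetherian_module.intro noetherian_cring_axioms sect_module[OF opn_whole])
  obtain Z where Z: "finite Z" "Z \<subseteq> carrier (sect whole)" "sp whole Z = carrier (sect whole)"
    by (rule global_sections_finitely_generated, rule that)
  obtain F where F: "finite F" "\<And>P. P \<in> F \<Longrightarrow> primeideal P R" "\<And>P. P \<in> F \<Longrightarrow> {\<zero>\<^bsub>R\<^esub>} \<subseteq> P"
    "\<And>p. primeideal p R \<Longrightarrow> {\<zero>\<^bsub>R\<^esub>} \<subseteq> p \<Longrightarrow> \<exists>P\<in>F. P \<subseteq> p"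
    by (rule finitely_many_primes_over[OF zeroideal], rule that)
  have rank: "G.completed_by p {} n" if "primeideal p R" for p
    using completed_by_rank[of p n] assms(4) that by (simp add: topspace_zariski)
  have "\<exists>m. m \<subseteq> carrier (sect whole) \<and> finite m \<and> card m \<le> d + n \<and>
    (\<forall>k. \<forall>P\<in>F. \<forall>q. primeideal q R \<and> P \<subseteq> q \<and> \<not> G.completed_by q m k \<longrightarrow>
       (\<forall>c. c + n \<le> d + n + k + 1 \<longrightarrow> prime_chain R P q c))"
    by (rule G.elements_of_bounded_defect[OF Z rank F(1,2)])
  then obtain m where
    m: "m \<subseteq> carrier (sect whole)" "finite m" "card m \<le> d + n"
    and chains: "\<forall>k. \<forall>P\<in>F. \<forall>q. primeideal q R \<and> P \<subseteq> q \<and> \<not> G.completed_by q m k \<longrightarrow>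
       (\<forall>c. c + n \<le> d + n + k + 1 \<longrightarrow> prime_chain R P q c)" by (elim exE conjE)
  obtain J where J: "ideal J R" "\<And>q. primeideal q R \<Longrightarrow> J \<subseteq> q \<longleftrightarrow> \<not> G.completed_by q m 0"
    by (rule G.incomplete_locus_closed[OF Z m(1), of 0], rule that)
  define U where "U = whole - prime_locus R J"
  have JR: "J \<subseteq> carrier R" using ideal.Icarr[OF J(1)] by auto
  then have cl: "closedin (zariski R) (prime_locus R J)" unfolding closedin_zariski by auto
  then have U: "opn U" unfolding U_def by auto
  have compl: "whole - U = prime_locus R J" using closedin_subset[OF cl] by (auto simp: U_def)
  obtain e where e: "m = e ` {i. i < (card m :: nat)}" "inj_on e {i. i < card m}"
    using ex_bij_betw_nat_finite[OF m(2)] by (auto simp: bij_betw_def atLeast0LessThan lessThan_def)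
  \<comment> \<open>Zero sections fill the list up to length \<open>d + n\<close>.\<close>
  define f where "f i = (if i < card m then e i else \<zero>\<^bsub>sect whole\<^esub>)" for i
  have f: "f i \<in> carrier (sect whole)" for i
    using e(1) m(1) G.M.zero_closed unfolding f_def by (cases "i < card m") auto
  have "m \<subseteq> f ` {..<d + n}"
  proof
    fix x assume "x \<in> m"
    then have "x \<in> e ` {i. i < card m}" using e(1) by simp
    then obtain i where i: "i < card m" "x = e i" by auto
    then show "x \<in> f ` {..<d + n}" using m(3) by (intro image_eqI[of _ _ i]) (auto simp: f_def)
  qed
  note span = G.sat_mono[OF G.span_is_monotone[OF this]]
  have gen: "generates (Spec R) M U (d + n) (\<lambda>i. rs whole U (f i))"
  proof (rule generatesI[OF U f])
    fix q assume q: "q \<in> U"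
    then have "primeideal q R" "G.completed_by q m 0"
      using J(2)[of q] by (auto simp: U_def topspace_zariski prime_locus_def)
    then have "carrier (sect whole) \<subseteq> G.sat q (sp whole m)" unfolding G.completed_by_def by auto
    then show "G.sat q (sp whole (f ` {..<d + n})) = carrier (sect whole)"
      using span[of q] G.sat_carrier by blast
  qed
  have "codim (whole - U) (zariski R) > enat d"
    unfolding compl
  proof (rule codim_greaterI[OF cl F(1,2)])
    show "\<exists>P\<in>F. P \<subseteq> p" if "primeideal p R" for p
      using F(4)[OF that] additive_subgroup.zero_closed[OF ideal.axioms(1)[OF primeideal.axioms(1)[OF that]]]
      by simp
    show "prime_chain R P q (Suc d)" if "P \<in> F" "q \<in> prime_locus R J" "P \<subseteq> q" for P q
      using chains[rule_format, of P q 0 "Suc d"] that J(2)[of q] by (simp add: prime_locus_def)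
  qed
  then show "\<exists>U. opn U \<and> codim (whole - U) (zariski R) > enat d \<and>
      (\<exists>m. (\<forall>i<d + n. m i \<in> carrier (msec M whole)) \<and>
        generates (Spec R) M U (d + n) (\<lambda>i. rs whole U (m i)))"
    using U gen f by (intro exI[of _ U] conjI exI[of _ f]) (auto simp: sect_carrier)
qed

end
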